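(* Let $\{\nu_{nk}:n\in\mathbb{N},1\le k\le k_n\}$ be an infinitesimal array of Borel probability measures on $\mathbb{R}$. Fix a real number $\gamma$ and a finite positive Borel measure $\sigma$ on $\mathbb{R}$, and let $\{c_n\}_{n=1}^\infty$ be a sequence of real numbers. The following statements are equivalent: (1) The sequence $\delta_{c_n}*\nu_{n1}*\nu_{n2}*\cdots*\nu_{nk_n}$ converges weakly to $\nu_*^{\gamma,\sigma}$. (2) The sequence $\delta_{c_n}\boxplus\nu_{n1}\boxplus\nu_{n2}\boxplus\cdots\boxplus\nu_{nk_n}$ converges weakly to $\nu_\boxplus^{\gamma,\sigma}$. (3) The sequence $\delta_{c_n}\uplus\nu_{n1}\uplus\nu_{n2}\uplus\cdots\uplus\nu_{nk_n}$ converges weakly to $\nu_\uplus^{\gamma,\sigma}$. (4) The sequence of measures $$d\sigma_n(t)=\sum_{k=1}^{k_n}\frac{t^2}{1+t^2}\,d\nu_{nk}^\circ(t)$$ converges weakly on $\mathbb{R}$ to $\sigma$, and the sequence of numbers $$\gamma_n=c_n+\sum_{k=1}^{k_n}\left[a_{nk}+\int_{-\infty}^{\infty}\frac{t}{1+t^2}\,d\nu_{nk}^\circ(t)\right]$$ converges to $\gamma$ as $n\to\infty$.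
   Context: $\{k_n\}$ is a sequence of natural numbers; $\delta_c$ is the point mass at $c$. An array $\{\nu_{nk}\}_{n\in\mathbb{N},1\le k\le k_n}$ of probability measures on $\mathbb{R}$ is infinitesimal if $\lim_{n\to\infty}\max_{1\le k\le k_n}\nu_{nk}(\{t\in\mathbb{R}:|t|\ge\varepsilon\})=0$ for every $\varepsilon>0$. Put $a_{nk}=\int_{|t|<1}t\,d\nu_{nk}(t)$ and $d\nu_{nk}^\circ(t)=d\nu_{nk}(t+a_{nk})$, i.e. $\nu_{nk}^\circ(A)=\nu_{nk}(A+a_{nk})$ for Borel $A\subset\mathbb{R}$. For a Borel probability measure $\mu$ on $\mathbb{R}$, let $G_\mu(z)=\int_{-\infty}^\infty\frac{1}{z-t}\,d\mu(t)$, $F_\mu=1/G_\mu$ and $E_\mu(z)=z-F_\mu(z)$ for $z\in\mathbb{C}^+=\{\Im z>0\}$. The measure $\mu$ is determined by $E_\mu$. Additive boolean convolution $\uplus$ is determined by $E_{\mu_1\uplus\mu_2}=E_{\mu_1}+E_{\mu_2}$ on $\mathbb{C}^+$. Additive free convolution $\boxplus$ is the distribution of the sum of freely independent self-adjoint random variables with the given distributions; equivalently, with $\Gamma_{\alpha,\beta}=\{x+iy: y>\beta, |x|<\alpha y\}$, for every $\alpha>0$ there is $\beta>0$ such that $F_\mu$ has a right inverse $F_\mu^{-1}$ on $\Gamma_{\alpha,\beta}$, the Voiculescu transform is $\phi_\mu(z)=F_\mu^{-1}(z)-z$, and $\phi_{\mu\boxplus\nu}=\phi_\mu+\phi_\nu$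 on a truncated cone $\Gamma_{\alpha,\beta}$ where all three functions are defined. $*$ is classical convolution. For $\gamma\in\mathbb{R}$ and a finite positive Borel measure $\sigma$ on $\mathbb{R}$: $\nu_\uplus^{\gamma,\sigma}$ is the probability measure with $E_\nu(z)=\gamma+\int_{-\infty}^\infty\frac{1+tz}{z-t}\,d\sigma(t)$; $\nu_\boxplus^{\gamma,\sigma}$ is the probability measure with $\phi_\nu(z)=\gamma+\int_{-\infty}^\infty\frac{1+tz}{z-t}\,d\sigma(t)$; and $\nu_*^{\gamma,\sigma}$ is the probability measure with Fourier transform $\widehat{\nu}(t)=\int e^{itx}\,d\nu(x)=\exp\left[i\gamma t+\int_{-\infty}^\infty\left(e^{itx}-1-\frac{itx}{1+x^2}\right)\frac{1+x^2}{x^2}\,d\sigma(x)\right]$, $t\in\mathbb{R}$, where the integrand is interpreted as $-t^2/2$ at $x=0$. *)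

theory Defs
  imports "HOL-Probability.Probability"
begin

subsection \<open>Weak convergence of finite Borel measures\<close>

text \<open>
  The library's \<^const>\<open>weak_conv_m\<close> is pointwise convergence of distribution functions at
  continuity points.  That agrees with weak convergence for probability measures (see
  \<open>weakly_converges_iff_weak_conv_m\<close> below), but for finite measures of varying total mass it does
  not prevent mass from escaping to \<open>+\<infinity>\<close>.  Hence the definition by bounded continuous functions.
\<close>

definition weakly_converges :: "(nat \<Rightarrow> real measure) \<Rightarrow> real measure \<Rightarrow> bool" where
  "weakly_converges M_seq M \<longleftrightarrow>
     (\<forall>f :: real \<Rightarrow> real. continuous_on UNIV f \<and> bounded (range f) \<longrightarrow>
        (\<lambda>n. \<integral>x. f x \<partial>M_seq n) \<longlonglongrightarrow> (\<integral>x. f x \<partial>M))"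

lemma weakly_converges_iff_weak_conv_m:
  assumes "\<And>n. real_distribution (M_seq n)" "real_distribution M"
  shows "weakly_converges M_seq M \<longleftrightarrow> weak_conv_m M_seq M"
proof
  assume *: "weakly_converges M_seq M"
  show "weak_conv_m M_seq M"
  proof (rule integral_bdd_continuous_conv_imp_weak_conv[OF assms])
    fix f :: "real \<Rightarrow> real"
    assume "\<And>x. isCont f x" "\<And>x. \<bar>f x\<bar> \<le> 1"
    then have "continuous_on UNIV f" "bounded (range f)"
      by (auto simp: continuous_at_imp_continuous_on intro!: boundedI[of _ 1])
    then show "(\<lambda>n. integral\<^sup>L (M_seq n) f) \<longlonglongrightarrow> integral\<^sup>L M f"
      using * by (auto simp: weakly_converges_def)
  qed
next
  assume *: "weak_conv_m M_seq M"
  show "weakly_converges M_seq M"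
    unfolding weakly_converges_def
  proof (intro allI impI, elim conjE)
    fix f :: "real \<Rightarrow> real"
    assume c: "continuous_on UNIV f" and "bounded (range f)"
    then obtain B where "\<And>x. norm (f x) \<le> B" by (auto simp: bounded_iff)
    moreover have "\<And>x. isCont f x"
      using c by (simp add: continuous_on_eq_continuous_at)
    ultimately show "(\<lambda>n. \<integral>x. f x \<partial>M_seq n) \<longlonglongrightarrow> (\<integral>x. f x \<partial>M)"
      by (intro weak_conv_imp_integral_bdd_continuous_conv[OF assms *])
  qed
qed


subsection \<open>Cauchy transform and Voiculescu transform\<close>

definition cauchy_transform :: "real measure \<Rightarrow> complex \<Rightarrow> complex" where
  "cauchy_transform \<mu> z = (\<integral>t. 1 / (z - complex_of_real t) \<partial>\<mu>)"

definition F_transform :: "real measure \<Rightarrow> complex \<Rightarrow> complex" where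
  "F_transform \<mu> z = 1 / cauchy_transform \<mu> z"

definition E_transform :: "real measure \<Rightarrow> complex \<Rightarrow> complex" where
  "E_transform \<mu> z = z - F_transform \<mu> z"

definition truncated_cone :: "real \<Rightarrow> real \<Rightarrow> complex set" where
  "truncated_cone \<alpha> \<beta> = {z. Im z > \<beta> \<and> \<bar>Re z\<bar> < \<alpha> * Im z}"

text \<open>
  \<open>F_\<mu>\<close> need not be injective on the upper half-plane: for \<open>\<mu> = (\<delta>\<^sub>-\<^sub>1 + \<delta>\<^sub>1)/2\<close> one has
  \<open>F_\<mu>(z) = z - 1/z\<close>, which has two analytic right inverses near infinity, one asymptotic to \<open>z\<close>,
  the other to \<open>-1/z\<close>.  The inverse meant by \<open>F_\<mu>\<^sup>-\<^sup>1\<close> is the one with \<open>g(z) = z (1 + o(1))\<close>; any two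
  such \<open>g\<close> on the same truncated cone are equal.
\<close>

definition is_F_inverse_on ::
  "complex set \<Rightarrow> real measure \<Rightarrow> (complex \<Rightarrow> complex) \<Rightarrow> bool" where
  "is_F_inverse_on \<Gamma> \<mu> g \<longleftrightarrow>
     g holomorphic_on \<Gamma> \<and>
     (\<forall>z\<in>\<Gamma>. Im (g z) > 0 \<and> F_transform \<mu> (g z) = z) \<and>
     ((\<lambda>z. g z / z) \<longlongrightarrow> 1) (inf at_infinity (principal \<Gamma>))"

definition is_voiculescu_transform_on ::
  "complex set \<Rightarrow> real measure \<Rightarrow> (complex \<Rightarrow> complex) \<Rightarrow> bool" where
  "is_voiculescu_transform_on \<Gamma> \<mu> \<phi> \<longleftrightarrow>
     (\<exists>g. is_F_inverse_on \<Gamma> \<mu> g \<and> (\<forall>z\<in>\<Gamma>. \<phi> z = g z - z))"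


subsection \<open>Convolutions\<close>

text \<open>Classical convolution is the library's \<^const>\<open>convolution\<close>, and \<open>\<delta>\<^sub>c\<close> is \<open>return borel c\<close>.\<close>

definition boolean_convolution :: "real measure \<Rightarrow> real measure \<Rightarrow> real measure" where
  "boolean_convolution \<mu> \<nu> = (THE \<rho>. real_distribution \<rho> \<and>
     (\<forall>z. Im z > 0 \<longrightarrow> E_transform \<rho> z = E_transform \<mu> z + E_transform \<nu> z))"

definition free_convolution :: "real measure \<Rightarrow> real measure \<Rightarrow> real measure" where
  "free_convolution \<mu> \<nu> = (THE \<rho>. real_distribution \<rho> \<and>
     (\<exists>\<alpha>>0. \<exists>\<beta>>0. \<exists>\<phi>\<^sub>\<mu> \<phi>\<^sub>\<nu> \<phi>\<^sub>\<rho>.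
        is_voiculescu_transform_on (truncated_cone \<alpha> \<beta>) \<mu> \<phi>\<^sub>\<mu> \<and>
        is_voiculescu_transform_on (truncated_cone \<alpha> \<beta>) \<nu> \<phi>\<^sub>\<nu> \<and>
        is_voiculescu_transform_on (truncated_cone \<alpha> \<beta>) \<rho> \<phi>\<^sub>\<rho> \<and>
        (\<forall>z\<in>truncated_cone \<alpha> \<beta>. \<phi>\<^sub>\<rho> z = \<phi>\<^sub>\<mu> z + \<phi>\<^sub>\<nu> z)))"

text \<open>
  \<open>iterated_convolution cv \<mu> \<nu> m\<close> is \<open>\<mu>\<close> convolved with \<open>\<nu> 1, \<dots>, \<nu> m\<close>, bracketed to the left.
\<close>

definition iterated_convolution ::
  "(real measure \<Rightarrow> real measure \<Rightarrow> real measure) \<Rightarrow> real measure \<Rightarrow> (nat \<Rightarrow> real measure) \<Rightarrow> nat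
     \<Rightarrow> real measure" where
  "iterated_convolution cv \<mu> \<nu> m = foldl cv \<mu> (map \<nu> [1..<Suc m])"


subsection \<open>Infinitely divisible measures\<close>

definition nevanlinna_integral :: "real \<Rightarrow> real measure \<Rightarrow> complex \<Rightarrow> complex" where
  "nevanlinna_integral \<gamma> \<sigma> z = complex_of_real \<gamma> +
     (\<integral>t. (1 + complex_of_real t * z) / (z - complex_of_real t) \<partial>\<sigma>)"

definition levy_khintchine_kernel :: "real \<Rightarrow> real \<Rightarrow> complex" where
  "levy_khintchine_kernel t x =
     (if x = 0 then - (complex_of_real t)\<^sup>2 / 2
      else (exp (\<i> * of_real (t * x)) - 1 - \<i> * of_real (t * x) / of_real (1 + x\<^sup>2))
             * of_real ((1 + x\<^sup>2) / x\<^sup>2))"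

definition boolean_inf_div :: "real \<Rightarrow> real measure \<Rightarrow> real measure" where
  "boolean_inf_div \<gamma> \<sigma> = (THE \<nu>. real_distribution \<nu> \<and>
     (\<forall>z. Im z > 0 \<longrightarrow> E_transform \<nu> z = nevanlinna_integral \<gamma> \<sigma> z))"

definition free_inf_div :: "real \<Rightarrow> real measure \<Rightarrow> real measure" where
  "free_inf_div \<gamma> \<sigma> = (THE \<nu>. real_distribution \<nu> \<and>
     (\<exists>\<alpha>>0. \<exists>\<beta>>0.
        is_voiculescu_transform_on (truncated_cone \<alpha> \<beta>) \<nu> (nevanlinna_integral \<gamma> \<sigma>)))"

definition classical_inf_div :: "real \<Rightarrow> real measure \<Rightarrow> real measure" where
  "classical_inf_div \<gamma> \<sigma> = (THE \<nu>. real_distribution \<nu> \<and>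
     (\<forall>t. char \<nu> t =
        exp (\<i> * of_real (\<gamma> * t) + (\<integral>x. levy_khintchine_kernel t x \<partial>\<sigma>))))"


subsection \<open>Infinitesimal arrays\<close>

text \<open>The \<open>n\<close>-th row of an array \<open>\<nu>\<close> consists of \<open>\<nu> n j\<close> for \<open>j \<in> {1..k n}\<close>.\<close>

definition infinitesimal_array :: "(nat \<Rightarrow> nat) \<Rightarrow> (nat \<Rightarrow> nat \<Rightarrow> real measure) \<Rightarrow> bool" where
  "infinitesimal_array k \<nu> \<longleftrightarrow>
     (\<forall>\<epsilon>>0. (\<lambda>n. Max ((\<lambda>j. measure (\<nu> n j) {t. \<bar>t\<bar> \<ge> \<epsilon>}) ` {1..k n})) \<longlonglongrightarrow> 0)"

definition truncated_mean :: "real measure \<Rightarrow> real" where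
  "truncated_mean \<mu> = (LINT t:{t. \<bar>t\<bar> < 1}|\<mu>. t)"

definition centered :: "real measure \<Rightarrow> real measure" where
  "centered \<mu> = distr \<mu> borel (\<lambda>t. t - truncated_mean \<mu>)"

lemma emeasure_centered:
  assumes "real_distribution \<mu>" "A \<in> sets borel"
  shows "emeasure (centered \<mu>) A = emeasure \<mu> ((\<lambda>t. t + truncated_mean \<mu>) ` A)"
proof -
  interpret real_distribution \<mu> by fact
  have "(\<lambda>t. t - truncated_mean \<mu>) -` A = (\<lambda>t. t + truncated_mean \<mu>) ` A"
    unfolding image_def vimage_def
    by (intro Collect_cong) (auto intro: bexI[of _ "_ - truncated_mean \<mu>"])
  then show ?thesis
    using assms by (simp add: centered_def emeasure_distr)
qed

definition sigma_row :: "(nat \<Rightarrow> real measure) \<Rightarrow> nat \<Rightarrow> real measure" where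
  "sigma_row \<nu> m = measure_of UNIV (sets borel)
     (\<lambda>A. \<Sum>j=1..m. emeasure (density (centered (\<nu> j)) (\<lambda>t. ennreal (t\<^sup>2 / (1 + t\<^sup>2)))) A)"

lemma sets_sigma_row: "sets (sigma_row \<nu> m) = sets borel"
proof -
  have "sigma_sets UNIV (sets (borel :: real measure)) = sets borel"
    using sets.sigma_sets_eq[of "borel :: real measure"] by simp
  then show ?thesis
    by (simp add: sigma_row_def)
qed

lemma emeasure_sigma_row:
  assumes "A \<in> sets borel"
  shows "emeasure (sigma_row \<nu> m) A =
    (\<Sum>j=1..m. emeasure (density (centered (\<nu> j)) (\<lambda>t. ennreal (t\<^sup>2 / (1 + t\<^sup>2)))) A)"
  unfolding sigma_row_def
proof (rule emeasure_measure_of_sigma[OF _ _ _ assms])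
  let ?D = "\<lambda>j. density (centered (\<nu> j)) (\<lambda>t. ennreal (t\<^sup>2 / (1 + t\<^sup>2)))"
  show "sigma_algebra UNIV (sets (borel :: real measure))"
    using sets.sigma_algebra_axioms[of "borel :: real measure"] by simp
  show "positive (sets borel) (\<lambda>A. \<Sum>j=1..m. emeasure (?D j) A)"
    by (simp add: positive_def)
  show "countably_additive (sets borel) (\<lambda>A. \<Sum>j=1..m. emeasure (?D j) A)"
  proof (rule countably_additiveI)
    fix A :: "nat \<Rightarrow> real set"
    assume A: "range A \<subseteq> sets borel" "disjoint_family A"
    have "sets (?D j) = sets borel" for j
      by (simp add: centered_def)
    with A have "(\<Sum>i. emeasure (?D j) (A i)) = emeasure (?D j) (\<Union>i. A i)" for j
      by (intro suminf_emeasure) auto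
    then show "(\<Sum>i. \<Sum>j=1..m. emeasure (?D j) (A i)) = (\<Sum>j=1..m. emeasure (?D j) (\<Union>i. A i))"
      by (simp add: suminf_sum)
  qed
qed

definition gamma_row :: "real \<Rightarrow> (nat \<Rightarrow> real measure) \<Rightarrow> nat \<Rightarrow> real" where
  "gamma_row c \<nu> m =
     c + (\<Sum>j=1..m. truncated_mean (\<nu> j) + (\<integral>t. t / (1 + t\<^sup>2) \<partial>centered (\<nu> j)))"

end

theory Submission
  imports Defs "HOL-Complex_Analysis.Complex_Analysis" "HOL-Real_Asymp.Real_Asymp"
begin

text \<open>
All three limit theorems say the same thing about the same data. Centring each
\<open>\<nu>\<^sub>n\<^sub>k\<close> at its truncated mean \<open>a\<^sub>n\<^sub>k\<close> and putting \<open>t\<^sup>2/(1+t\<^sup>2) d\<nu>\<degree>\<close> (\<^const>\<open>sigma_row\<close>) and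
\<open>\<integral> t/(1+t\<^sup>2) d\<nu>\<degree>\<close> (in \<^const>\<open>gamma_row\<close>) in the role of the Levy-Khintchine measure and drift, the
transform that linearises the convolution of a single entry agrees with the transform of
its Levy data up to \<open>o(1)\<close> times the mass of \<open>t\<^sup>2/(1+t\<^sup>2) d\<nu>\<degree>\<close>, uniformly in the row. Adding up,
the linearising transform of the whole row differs from the transform of
\<open>(\<gamma>\<^sub>n, \<sigma>\<^sub>n)\<close> by a bounded multiple of \<open>e\<^sub>n \<sigma>\<^sub>n(\<real>)\<close> with \<open>e\<^sub>n\<close> tending to 0. So each limit theorem
reduces to the continuity of the correspondence between a pair \<open>(\<gamma>, \<sigma>)\<close> and its transform, in both
directions. The one delicate point is that the drift of a centred entry is itself bounded by
the mass (\<open>levy_drift_bound\<close>); this is what the centring is for.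

For Boolean convolution the transform is \<open>E = z - F\<close>, and \<open>E\<close> of a centred measure is
\<open>z(zG - 1)/(zG)\<close>, while its Levy data have Nevanlinna integral \<open>z(zG - 1)\<close>; the quotient \<open>zG\<close> is
uniformly close to 1 on a truncated cone (\<open>E_transform_levy\<close>). For free convolution the
Voiculescu transform is \<open>E\<close> evaluated at the inverse of \<open>F\<close>, a point at relative distance \<open>O(e\<^sub>n)\<close>,
which gives the same estimate (\<open>voiculescu_levy\<close>). In both cases \<open>nevanlinna_perturbation_forward\<close>
and \<open>nevanlinna_perturbation_backward\<close> conclude: minus the imaginary part of a Nevanlinna integral at
\<open>iy\<close> controls the mass and the tail of its measure, so the measures of the rows are bounded
and tight as soon as the transforms converge, and the transform determines \<open>(\<gamma>, \<sigma>)\<close>.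

For classical convolution one compares characteristic functions: \<open>|exp w - 1 - w| = O(|w|\<^sup>2)\<close> and
a telescoping product give \<open>classical_row_comparison\<close> once the masses are bounded. In the direction
from convergence, boundedness and tightness come from symmetrising (the squared moduli of
the factors) and averaging over a Gaussian frequency (\<open>row_tail\<close>).

The convolutions and limit laws are definite descriptions, so their existence has to
be proved. A holomorphic \<open>E\<close> with \<open>Im E \<le> 0\<close> and \<open>E(z) = o(z)\<close> on cones is the \<open>E\<close>-transform of a
probability measure (\<open>E_transform_exists\<close>, from Herglotz's theorem), which settles the Boolean
case; the free case follows by solving the subordination equations
(\<open>subordination\<close>); the classical infinitely divisible law is obtained as a limit of convolution
powers of Boolean roots (\<open>classical_inf_div_exists\<close>).
\<close>

section \<open>Finite Borel measures and tightness\<close>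

abbreviation (input) "finite_borel \<equiv> finite_borel_measure"

lemma real_distribution_finite_borel: "real_distribution M ==> finite_borel M"
  by (rule real_distribution.finite_borel_measure_M)

lemma finite_borelD:
  assumes "finite_borel M"
  shows "finite_measure M" "sets M = sets borel" "space M = UNIV"
    "\<And>f. f \<in> borel_measurable borel ==> f \<in> borel_measurable M"
proof -
  interpret finite_borel_measure M by fact
  show "finite_measure M" by unfold_locales
  show "sets M = sets borel" by (rule M_is_borel)
  from sets_eq_imp_space_eq[OF this] show "space M = UNIV" by simp
  show "\<And>f. f \<in> borel_measurable borel ==> f \<in> borel_measurable M"
    using M_is_borel measurable_cong_sets by blast
qed

lemma real_distributionI_mass:
  assumes "finite_borel M" "measure M UNIV = 1"
  shows "real_distribution M"
proof -
  interpret finite_borel_measure M by fact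
  have "prob_space M"
    using assms by (intro prob_spaceI) (simp add: emeasure_eq_measure finite_borelD(3))
  then show ?thesis
    using finite_borelD(2,3)[OF assms(1)]
    by (auto simp: real_distribution_def real_distribution_axioms_def)
qed

lemma real_distributionD:
  assumes "real_distribution M"
  shows "prob_space M" "finite_borel M" "sets M = sets borel" "space M = UNIV"
    "measure M UNIV = 1"
proof -
  interpret real_distribution M by fact
  show "prob_space M" by unfold_locales
  show "finite_borel M" using assms by (rule real_distribution_finite_borel)
  show "sets M = sets borel" "space M = UNIV" by auto
  show "measure M UNIV = 1" using prob_space by simp
qed

lemma integrable_bounded_borel:
  fixes f :: "real \<Rightarrow> 'a::{banach, second_countable_topology}"
  assumes "finite_borel M" "f \<in> borel_measurable borel" "\<And>x. norm (f x) \<le> B"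
  shows "integrable M f"
proof -
  interpret finite_borel_measure M by fact
  show ?thesis
    using assms finite_borelD(4) by (intro integrable_const_bound[of _ B]) auto
qed

lemma norm_integral_bound:
  fixes f :: "real \<Rightarrow> 'a::{banach, second_countable_topology}"
  assumes M: "finite_borel M" and f: "f \<in> borel_measurable borel"
    and B: "\<And>x. norm (f x) \<le> B"
  shows "norm (\<integral>x. f x \<partial>M) \<le> B * measure M UNIV"
proof -
  interpret finite_borel_measure M by fact
  have "norm (\<integral>x. f x \<partial>M) \<le> (\<integral>x. norm (f x) \<partial>M)" by simp
  also have "... \<le> (\<integral>x. B \<partial>M)"
    using B integrable_bounded_borel[OF M f B] by (intro integral_mono) auto
  also have "... = B * measure M UNIV" by (simp add: finite_borelD(3)[OF M])
  finally show ?thesis .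
qed

text \<open>Continuous functions with values in \<open>[0,1]\<close> converge to the indicators of open half-lines.\<close>
lemma measure_eqI_continuous:
  assumes M: "finite_borel M" and N: "finite_borel N"
    and eq: "\<And>f::real \<Rightarrow> real. continuous_on UNIV f ==> (\<And>x. 0 \<le> f x) ==> (\<And>x. f x \<le> 1)
              ==> (\<integral>x. f x \<partial>M) = (\<integral>x. f x \<partial>N)"
  shows "M = N"
proof (rule measure_eqI_lessThan)
  interpret M: finite_borel_measure M by fact
  interpret N: finite_borel_measure N by fact
  show "sets M = sets borel" "sets N = sets borel"
    using M N finite_borelD(2) by auto
  fix a :: real
  show "emeasure M {a<..} < \<infinity>" by (simp add: M.emeasure_eq_measure)
  define f where "f n x = min 1 (real n * max 0 (x - a))" for n :: nat and x :: real
  have lim: "(\<lambda>n. f n x) \<longlonglongrightarrow> indicat_real {a<..} x" for x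
  proof (cases "a < x")
    case True
    obtain n0 :: nat where n0: "1 / (x - a) \<le> real n0" using real_arch_simple by blast
    have "f n x = 1" if "n \<ge> n0" for n
    proof -
      have "1 / (x - a) \<le> real n" using n0 that by linarith
      then have "1 \<le> real n * (x - a)" using True by (simp add: field_simps)
      then show ?thesis using True by (simp add: f_def)
    qed
    then have "eventually (\<lambda>n. f n x = 1) sequentially" by (auto simp: eventually_sequentially)
    then show ?thesis using True by (simp add: tendsto_eventually)
  next
    case False then show ?thesis by (simp add: f_def)
  qed
  have conv: "(\<lambda>n. \<integral>x. f n x \<partial>K) \<longlonglongrightarrow> measure K {a<..}" if K: "finite_borel K" for K
  proof -
    interpret K: finite_borel_measure K by fact
    have "(\<lambda>n. \<integral>x. f n x \<partial>K) \<longlonglongrightarrow> (\<integral>x. indicat_real {a<..} x \<partial>K)"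
    proof (rule integral_dominated_convergence[where w="\<lambda>_. 1"])
      show "f i \<in> borel_measurable K" for i
        by (rule finite_borelD(4)[OF K]) (unfold f_def, measurable)
      show "indicat_real {a<..} \<in> borel_measurable K"
        by (rule finite_borelD(4)[OF K]) measurable
    qed (use lim in \<open>auto simp: f_def\<close>)
    then show ?thesis using finite_borelD(2,3)[OF K] by simp
  qed
  have "(\<integral>x. f n x \<partial>M) = (\<integral>x. f n x \<partial>N)" for n
    by (rule eq) (auto simp: f_def intro!: continuous_intros)
  then have "measure M {a<..} = measure N {a<..}"
    using conv[OF M] conv[OF N] by (simp add: LIMSEQ_unique)
  then show "emeasure M {a<..} = emeasure N {a<..}"
    by (simp add: M.emeasure_eq_measure N.emeasure_eq_measure)
qed

lemma weakly_converges_complex: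
  fixes f :: "real \<Rightarrow> complex"
  assumes W: "weakly_converges X M" and X: "\<And>n. finite_borel (X n)" "finite_borel M"
    and c: "continuous_on UNIV f" and b: "\<And>x. norm (f x) \<le> B"
  shows "(\<lambda>n. \<integral>x. f x \<partial>X n) \<longlonglongrightarrow> (\<integral>x. f x \<partial>M)"
proof -
  have m: "f \<in> borel_measurable borel" using c by (rule borel_measurable_continuous_onI)
  have int: "integrable K f" if "finite_borel K" for K
    by (rule integrable_bounded_borel[OF that m b])
  have R: "continuous_on UNIV (\<lambda>x. Re (f x))" "continuous_on UNIV (\<lambda>x. Im (f x))"
    using c by (simp_all add: continuous_on_Re continuous_on_Im)
  have "\<bar>Re (f x)\<bar> \<le> B" "\<bar>Im (f x)\<bar> \<le> B" for x
    using b[of x] abs_Re_le_cmod[of "f x"] abs_Im_le_cmod[of "f x"] by linarith+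
  then have "bounded (range (\<lambda>x. Re (f x)))" "bounded (range (\<lambda>x. Im (f x)))"
    by (auto intro!: boundedI[of _ B])
  with R W have *: "(\<lambda>n. \<integral>x. Re (f x) \<partial>X n) \<longlonglongrightarrow> (\<integral>x. Re (f x) \<partial>M)"
     "(\<lambda>n. \<integral>x. Im (f x) \<partial>X n) \<longlonglongrightarrow> (\<integral>x. Im (f x) \<partial>M)"
    unfolding weakly_converges_def by auto
  have eq: "(\<integral>x. f x \<partial>K) = Complex (\<integral>x. Re (f x) \<partial>K) (\<integral>x. Im (f x) \<partial>K)"
    if "finite_borel K" for K
    using int[OF that] by (simp add: complex_eq_iff)
  show ?thesis unfolding eq[OF X(1)] eq[OF X(2)] using * by (rule tendsto_Complex)
qed

lemma weakly_converges_subseq: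
  assumes "weakly_converges X M" "strict_mono (r :: nat \<Rightarrow> nat)"
  shows "weakly_converges (X \<circ> r) M"
  unfolding weakly_converges_def
proof (intro allI impI)
  fix f :: "real \<Rightarrow> real" assume "continuous_on UNIV f \<and> bounded (range f)"
  then have "(\<lambda>n. \<integral>x. f x \<partial>X n) \<longlonglongrightarrow> (\<integral>x. f x \<partial>M)"
    using assms(1) unfolding weakly_converges_def by auto
  from LIMSEQ_subseq_LIMSEQ[OF this assms(2)]
  show "(\<lambda>n. \<integral>x. f x \<partial>(X \<circ> r) n) \<longlonglongrightarrow> (\<integral>x. f x \<partial>M)" by (simp add: o_def)
qed

lemma weakly_converges_mass:
  assumes "weakly_converges X M" "\<And>n. finite_borel (X n)" "finite_borel M"
  shows "(\<lambda>n. measure (X n) UNIV) \<longlonglongrightarrow> measure M UNIV"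
proof -
  have "(\<lambda>n. \<integral>x. (1::real) \<partial>X n) \<longlonglongrightarrow> (\<integral>x. (1::real) \<partial>M)"
    using assms(1) unfolding weakly_converges_def
    by (drule_tac spec[of _ "\<lambda>_. 1"]) (simp add: image_constant_conv)
  then show ?thesis using finite_borelD(3) assms(2,3) by simp
qed

lemma tendsto_subsubseqI:
  fixes X :: "nat \<Rightarrow> 'a::metric_space"
  assumes "\<And>r :: nat \<Rightarrow> nat. strict_mono r ==>
    \<exists>s. strict_mono (s :: nat \<Rightarrow> nat) \<and> (\<lambda>n. X (r (s n))) \<longlonglongrightarrow> L"
  shows "X \<longlonglongrightarrow> L"
proof (rule ccontr)
  assume "\<not> X \<longlonglongrightarrow> L"
  then obtain e where e: "e > 0" "\<And>N. \<exists>n\<ge>N. dist (X n) L \<ge> e"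
    unfolding lim_sequentially not_all not_ex not_imp not_less by blast
  then have inf: "infinite {n. dist (X n) L \<ge> e}"
    unfolding infinite_nat_iff_unbounded_le by blast
  define r where "r = enumerate {n. dist (X n) L \<ge> e}"
  have r: "strict_mono r" "\<And>n. dist (X (r n)) L \<ge> e"
    using strict_mono_enumerate[OF inf] enumerate_in_set[OF inf] by (auto simp: r_def)
  obtain s where s: "strict_mono s" "(\<lambda>n. X (r (s n))) \<longlonglongrightarrow> L" using assms[OF r(1)] by blast
  then have "eventually (\<lambda>n. dist (X (r (s n))) L < e) sequentially"
    using e(1) by (rule_tac tendstoD) auto
  then obtain n where "dist (X (r (s n))) L < e"
    by (auto simp: eventually_sequentially)
  with r(2)[of "s n"] show False by simp
qed

lemma finite_borel_tail:
  assumes M: "finite_borel M" and e: "e > 0"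
  shows "\<exists>R>0. measure M {x. \<bar>x\<bar> > R} < e"
proof -
  interpret finite_borel_measure M by fact
  have "(\<lambda>n. measure M {x. \<bar>x\<bar> > real n}) \<longlonglongrightarrow> measure M (\<Inter>n. {x. \<bar>x\<bar> > real n})"
  proof (rule finite_Lim_measure_decseq)
    show "range (\<lambda>n. {x. \<bar>x\<bar> > real n}) \<subseteq> sets M"
      unfolding finite_borelD(2)[OF M] by (intro image_subsetI) measurable
    show "decseq (\<lambda>n. {x::real. \<bar>x\<bar> > real n})" by (auto simp: decseq_def)
  qed
  moreover have "(\<Inter>n. {x::real. \<bar>x\<bar> > real n}) = {}"
  proof (rule equals0I)
    fix x :: real assume x: "x \<in> (\<Inter>n. {x. \<bar>x\<bar> > real n})"
    obtain n :: nat where "\<bar>x\<bar> \<le> real n" using real_arch_simple by blast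
    with x show False by (auto simp: not_less[symmetric])
  qed
  ultimately have "(\<lambda>n. measure M {x. \<bar>x\<bar> > real n}) \<longlonglongrightarrow> 0" by simp
  then have "eventually (\<lambda>n. measure M {x. \<bar>x\<bar> > real n} < e) sequentially"
    using e by (rule order_tendstoD)
  then obtain n0 where "\<And>n. n \<ge> n0 ==> measure M {x. \<bar>x\<bar> > real n} < e"
    by (auto simp: eventually_sequentially)
  from this[of "Suc n0"] have "measure M {x. \<bar>x\<bar> > real (Suc n0)} < e" by simp
  then show ?thesis by (intro exI[of _ "real (Suc n0)"] conjI) auto
qed

lemma eventually_le_imp_bounded:
  fixes a :: "nat \<Rightarrow> real"
  assumes "eventually (\<lambda>n. a n \<le> C) sequentially"
  shows "\<exists>B. \<forall>n. a n \<le> B"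
proof -
  obtain N where N: "\<And>n. n \<ge> N ==> a n \<le> C" using assms by (auto simp: eventually_sequentially)
  have "a n \<le> max C (Max (a ` {..N}))" for n
  proof (cases "n \<le> N")
    case True
    then have "a n \<le> Max (a ` {..N})" by (intro Max_ge) auto
    then show ?thesis by simp
  qed (use N[of n] in simp)
  then show ?thesis by blast
qed

definition tight_seq :: "(nat \<Rightarrow> real measure) \<Rightarrow> bool" where
  "tight_seq X \<longleftrightarrow> (\<forall>e>0. \<exists>R>0. eventually (\<lambda>n. measure (X n) {x. \<bar>x\<bar> > R} \<le> e) sequentially)"

lemma tight_seq_uniform:
  assumes X: "\<And>n. finite_borel (X n)" and t: "tight_seq X" and e: "e > 0"
  shows "\<exists>R>0. \<forall>n. measure (X n) {x. \<bar>x\<bar> > R} \<le> e"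
proof -
  obtain R N where R: "R > 0" "\<And>n. n \<ge> N ==> measure (X n) {x. \<bar>x\<bar> > R} \<le> e"
    using t e unfolding tight_seq_def eventually_sequentially by blast
  obtain S where S: "\<And>n. S n > 0 \<and> measure (X n) {x. \<bar>x\<bar> > S n} < e"
    using finite_borel_tail[OF X e] by metis
  define T where "T = Max (insert R (S ` {..<N}))"
  have T: "R \<le> T" "\<And>n. n < N ==> S n \<le> T" by (auto simp: T_def)
  have mono: "measure (X n) {x. \<bar>x\<bar> > T} \<le> measure (X n) {x. \<bar>x\<bar> > u}" if "u \<le> T" for u n
  proof -
    interpret finite_borel_measure "X n" by (rule X)
    show ?thesis using that finite_borelD(2)[OF X] by (intro finite_measure_mono) auto
  qed
  have "measure (X n) {x. \<bar>x\<bar> > T} \<le> e" for n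
  proof (cases "n < N")
    case True then show ?thesis using mono[of "S n" n] T(2) S[of n] by fastforce
  next
    case False then show ?thesis using mono[of R n] T(1) R(2)[of n] by fastforce
  qed
  moreover have "T > 0" using T(1) R(1) by simp
  ultimately show ?thesis by blast
qed

lemma tight_seq_subseq:
  assumes "tight_seq X" "strict_mono (r :: nat \<Rightarrow> nat)"
  shows "tight_seq (X \<circ> r)"
  unfolding tight_seq_def
proof (intro allI impI)
  fix e :: real assume "e > 0"
  then obtain R where "R > 0" "eventually (\<lambda>n. measure (X n) {x. \<bar>x\<bar> > R} \<le> e) sequentially"
    using assms(1) unfolding tight_seq_def by blast
  then show "\<exists>R>0. eventually (\<lambda>n. measure ((X \<circ> r) n) {x. \<bar>x\<bar> > R} \<le> e) sequentially"
    using eventually_subseq[OF assms(2)] by auto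
qed

text \<open>Prohorov's theorem for measures of varying mass: along a subsequence the masses converge, and unless
their limit is 0 the normalised measures are tight probability measures.\<close>
lemma tight_seq_compact:
  assumes X: "\<And>n. finite_borel (X n)" and B: "\<And>n. measure (X n) UNIV \<le> B"
    and t: "tight_seq X"
  shows "\<exists>r M. strict_mono (r :: nat \<Rightarrow> nat) \<and> finite_borel M \<and> weakly_converges (X \<circ> r) M"
proof -
  define m where "m n = measure (X n) UNIV" for n
  have "\<forall>n. m n \<in> {0..B}" using B by (auto simp: m_def)
  then obtain L r where Lr: "strict_mono (r :: nat \<Rightarrow> nat)" "(m \<circ> r) \<longlonglongrightarrow> L" "L \<in> {0..B}"
    using compact_Icc[of 0 B] unfolding compact_def by blast
  show ?thesis
  proof (cases "L = 0")
    case True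
    have N0: "finite_borel (null_measure borel)"
      unfolding finite_borel_measure_def finite_borel_measure_axioms_def
      by (auto intro!: finite_measureI)
    have "weakly_converges (X \<circ> r) (null_measure borel)"
      unfolding weakly_converges_def
    proof (intro allI impI, elim conjE)
      fix f :: "real \<Rightarrow> real" assume c: "continuous_on UNIV f" and b: "bounded (range f)"
      then obtain K where K: "\<And>x. norm (f x) \<le> K" by (auto simp: bounded_iff)
      have m: "f \<in> borel_measurable borel" using c by (rule borel_measurable_continuous_onI)
      have "\<forall>n. norm (\<integral>x. f x \<partial>(X \<circ> r) n) \<le> K * (m \<circ> r) n"
        using norm_integral_bound[OF X m K] by (simp add: m_def)
      moreover have "(\<lambda>n. K * (m \<circ> r) n) \<longlonglongrightarrow> 0"
        using tendsto_mult_left[OF Lr(2), of K] True by simp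
      ultimately have "(\<lambda>n. \<integral>x. f x \<partial>(X \<circ> r) n) \<longlonglongrightarrow> 0"
        by (rule Lim_null_comparison[OF always_eventually])
      then show "(\<lambda>n. \<integral>x. f x \<partial>(X \<circ> r) n) \<longlonglongrightarrow> (\<integral>x. f x \<partial>null_measure borel)" by simp
    qed
    then show ?thesis using Lr(1) N0 by blast
  next
    case False
    then have L: "L > 0" using Lr(3) by auto
    have "eventually (\<lambda>n. (m \<circ> r) n > L / 2) sequentially"
      using order_tendstoD(1)[OF Lr(2), of "L / 2"] L by simp
    then obtain n0 where n0: "\<And>n. n \<ge> n0 ==> m (r n) > L / 2"
      by (auto simp: eventually_sequentially)
    define s where "s n = r (n + n0)" for n
    have s: "strict_mono s" using Lr(1) by (auto simp: s_def strict_mono_def)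
    have ms: "m (s n) > L / 2" "m (s n) > 0" for n
      using n0[of "n + n0"] L by (auto simp: s_def)
    have mlim: "(\<lambda>n. m (s n)) \<longlonglongrightarrow> L"
      using LIMSEQ_ignore_initial_segment[OF Lr(2), of n0] by (simp add: s_def o_def)
    define P where "P n = density (X (s n)) (\<lambda>_. ennreal (1 / m (s n)))" for n
    have emP: "measure (P n) A = measure (X (s n)) A / m (s n)" if "A \<in> sets borel" for A n
    proof -
      interpret finite_borel_measure "X (s n)" by (rule X)
      have "emeasure (P n) A = ennreal (1 / m (s n)) * emeasure (X (s n)) A"
        using that finite_borelD(2)[OF X] unfolding P_def
        by (subst emeasure_density_const) auto
      then show ?thesis
        using ms[of n] by (simp add: measure_def enn2real_mult)
    qed
    have Pd: "real_distribution (P n)" for n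
    proof -
      interpret finite_borel_measure "X (s n)" by (rule X)
      have em: "emeasure (P n) UNIV = 1"
      proof -
        have "emeasure (P n) UNIV = ennreal (1 / m (s n)) * emeasure (X (s n)) UNIV"
          using finite_borelD(2)[OF X] unfolding P_def
          by (subst emeasure_density_const) auto
        also have "... = ennreal (1 / m (s n) * m (s n))"
          using ms(2)[of n] finite_borelD(3)[OF X] emeasure_eq_measure
          by (subst ennreal_mult) (auto simp: m_def)
        also have "1 / m (s n) * m (s n) = 1" using ms(2)[of n] by simp
        finally show ?thesis by simp
      qed
      have "sets (P n) = sets borel" "space (P n) = UNIV"
        using finite_borelD(2,3)[OF X] by (auto simp: P_def)
      then show ?thesis using em
        by (auto simp: real_distribution_def real_distribution_axioms_def intro!: prob_spaceI)
    qed
    have intP: "(\<integral>x. f x \<partial>X (s n)) = m (s n) * (\<integral>x. f x \<partial>P n)"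
      if "f \<in> borel_measurable borel" for f :: "real \<Rightarrow> real" and n
      unfolding P_def using that finite_borelD(4)[OF X] ms(2)[of n]
      by (subst integral_density) auto
    have tP: "tight P"
      unfolding tight_def
    proof (intro conjI allI impI Pd)
      fix e :: real assume e: "e > 0"
      obtain R where R: "R > 0" "\<And>n. measure (X n) {x. \<bar>x\<bar> > R} \<le> e * L / 4"
        using tight_seq_uniform[OF X t, of "e * L / 4"] e L by auto
      have "measure (P n) {-(R+1)<..R} > 1 - e" for n
      proof -
        interpret real_distribution "P n" by (rule Pd)
        have "measure (P n) {x. \<bar>x\<bar> > R} = measure (X (s n)) {x. \<bar>x\<bar> > R} / m (s n)"
          by (rule emP) auto
        also have "... \<le> (e * L / 4) / (L / 2)"
          using R(2) ms[of n] L e by (intro frac_le) (auto intro: less_imp_le)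
        also have "... = e / 2" using L by simp
        finally have 1: "measure (P n) {x. \<bar>x\<bar> > R} < e" using e by simp
        have "1 - measure (P n) {x. \<bar>x\<bar> > R} = measure (P n) (UNIV - {x. \<bar>x\<bar> > R})"
          using prob_compl[of "{x. \<bar>x\<bar> > R}"] by simp
        also have "... \<le> measure (P n) {-(R+1)<..R}"
          by (intro finite_measure_mono) auto
        finally show ?thesis using 1 by simp
      qed
      then show "\<exists>a b. a < b \<and> (\<forall>n. 1 - e < measure (P n) {a<..b})"
        using R(1) by (intro exI[of _ "-(R+1)"] exI[of _ R]) auto
    qed
    obtain q Q where q: "strict_mono (q :: nat \<Rightarrow> nat)" "real_distribution Q" "weak_conv_m (P \<circ> q) Q"
      using tight_imp_convergent_subsubsequence[OF tP, of id] by (auto simp: strict_mono_def)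
    have W: "weakly_converges (P \<circ> q) Q"
      using q Pd by (subst weakly_converges_iff_weak_conv_m) (auto simp: o_def)
    define M where "M = density Q (\<lambda>_. ennreal L)"
    interpret Q: real_distribution Q by fact
    have M: "finite_borel M"
      unfolding finite_borel_measure_def finite_borel_measure_axioms_def
    proof
      have "emeasure M UNIV = ennreal L * emeasure Q UNIV"
        unfolding M_def by (subst emeasure_density_const) auto
      then have "emeasure M UNIV \<noteq> \<infinity>"
        using Q.emeasure_eq_measure by (simp add: ennreal_mult_eq_top_iff)
      then show "finite_measure M"
        by (intro finite_measureI) (auto simp: M_def)
    qed (auto simp: M_def)
    have "weakly_converges (X \<circ> (s \<circ> q)) M"
      unfolding weakly_converges_def
    proof (intro allI impI)
      fix f :: "real \<Rightarrow> real" assume f: "continuous_on UNIV f \<and> bounded (range f)"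
      then have mf: "f \<in> borel_measurable borel" by (auto intro: borel_measurable_continuous_onI)
      have "(\<lambda>n. \<integral>x. f x \<partial>P (q n)) \<longlonglongrightarrow> (\<integral>x. f x \<partial>Q)"
        using W f unfolding weakly_converges_def by auto
      then have "(\<lambda>n. m (s (q n)) * (\<integral>x. f x \<partial>P (q n))) \<longlonglongrightarrow> L * (\<integral>x. f x \<partial>Q)"
        using LIMSEQ_subseq_LIMSEQ[OF mlim q(1)] by (intro tendsto_mult) (auto simp: o_def)
      moreover have "(\<integral>x. f x \<partial>M) = L * (\<integral>x. f x \<partial>Q)"
        unfolding M_def using L mf by (subst integral_density) auto
      ultimately show "(\<lambda>n. \<integral>x. f x \<partial>(X \<circ> (s \<circ> q)) n) \<longlonglongrightarrow> (\<integral>x. f x \<partial>M)"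
        using intP[OF mf] by simp
    qed
    then show ?thesis using s q(1) M strict_mono_o by blast
  qed
qed

lemma weakly_convergesI_tight:
  assumes X: "\<And>n. finite_borel (X n)" and B: "\<And>n. measure (X n) UNIV \<le> B"
    and t: "tight_seq X"
    and lim: "\<And>r N. strict_mono (r :: nat \<Rightarrow> nat) ==> finite_borel N
                ==> weakly_converges (X \<circ> r) N ==> N = M"
  shows "weakly_converges X M"
  unfolding weakly_converges_def
proof (intro allI impI, rule tendsto_subsubseqI)
  fix f :: "real \<Rightarrow> real" and r :: "nat \<Rightarrow> nat"
  assume f: "continuous_on UNIV f \<and> bounded (range f)" and r: "strict_mono r"
  obtain s N where s: "strict_mono (s :: nat \<Rightarrow> nat)" "finite_borel N"
      "weakly_converges ((X \<circ> r) \<circ> s) N"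
    using tight_seq_compact[of "X \<circ> r" B] X B tight_seq_subseq[OF t r] by auto
  have "N = M" using s r by (intro lim[of "r \<circ> s"]) (auto simp: o_assoc intro: strict_mono_o)
  then show "\<exists>s. strict_mono (s :: nat \<Rightarrow> nat) \<and>
      (\<lambda>n. integral\<^sup>L (X (r (s n))) f) \<longlonglongrightarrow> integral\<^sup>L M f"
    using s f unfolding weakly_converges_def by (intro exI[of _ s]) auto
qed

section \<open>Cauchy transforms\<close>

definition uhp :: "complex set" where "uhp = {z. Im z > 0}"

lemma open_uhp [simp]: "open uhp"
  unfolding uhp_def by (rule open_halfspace_Im_gt)

lemma convex_uhp: "convex uhp"
  unfolding uhp_def by (rule convex_halfspace_Im_gt)

lemma connected_uhp [simp]: "connected uhp"
  by (rule convex_connected[OF convex_uhp])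

lemma uhp_iff: "z \<in> uhp \<longleftrightarrow> Im z > 0"
  by (simp add: uhp_def)

lemma uhp_diff_real_nz: "z \<in> uhp ==> z - of_real t \<noteq> 0"
  by (auto simp: uhp_iff complex_eq_iff)

lemma norm_uhp_diff_real: "Im z \<le> cmod (z - of_real t)"
  using abs_Im_le_cmod[of "z - of_real t"] by simp

lemma cauchy_kernel_bound: "z \<in> uhp ==> norm (1 / (z - of_real t)) \<le> 1 / Im z"
  using norm_uhp_diff_real[of z t] by (simp add: uhp_iff norm_divide frac_le)

lemma cauchy_integrable:
  assumes "finite_borel M" "z \<in> uhp"
  shows "integrable M (\<lambda>t. 1 / (z - of_real t))"
  using cauchy_kernel_bound[OF assms(2)] by (intro integrable_bounded_borel[OF assms(1)]) auto

lemma cauchy_kernel2_bound: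
  assumes "w \<in> uhp" "z \<in> uhp"
  shows "norm (1 / ((w - of_real t) * (z - of_real t))) \<le> 1 / (Im w * Im z)"
proof -
  have "norm (1 / (w - of_real t)) * norm (1 / (z - of_real t)) \<le> (1 / Im w) * (1 / Im z)"
    using assms by (intro mult_mono cauchy_kernel_bound) (auto simp: uhp_iff)
  then show ?thesis by (simp add: norm_mult norm_divide)
qed

lemma cauchy_integrable2:
  assumes "finite_borel M" "w \<in> uhp" "z \<in> uhp"
  shows "integrable M (\<lambda>t. 1 / ((w - of_real t) * (z - of_real t)))"
  using cauchy_kernel2_bound[OF assms(2,3)] by (intro integrable_bounded_borel[OF assms(1)]) auto

lemma norm_cauchy_transform:
  assumes "finite_borel M" "z \<in> uhp"
  shows "norm (cauchy_transform M z) \<le> measure M UNIV / Im z"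
  unfolding cauchy_transform_def
  using norm_integral_bound[OF assms(1) _ cauchy_kernel_bound[OF assms(2)]] by simp

lemma cauchy_transform_diff:
  assumes M: "finite_borel M" and w: "w \<in> uhp" and z: "z \<in> uhp"
  shows "cauchy_transform M w - cauchy_transform M z
    = (z - w) * (\<integral>t. 1 / ((w - of_real t) * (z - of_real t)) \<partial>M)"
proof -
  have "cauchy_transform M w - cauchy_transform M z =
      (\<integral>t. 1 / (w - of_real t) - 1 / (z - of_real t) \<partial>M)"
    unfolding cauchy_transform_def
    by (rule Bochner_Integration.integral_diff[symmetric]) (intro cauchy_integrable M w z)+
  also have "... = (\<integral>t. (z - w) * (1 / ((w - of_real t) * (z - of_real t))) \<partial>M)"
    using uhp_diff_real_nz[OF w] uhp_diff_real_nz[OF z]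
    by (intro Bochner_Integration.integral_cong) (auto simp: field_simps)
  finally show ?thesis unfolding integral_mult_right_zero .
qed

lemma cauchy_transform_lipschitz:
  assumes M: "finite_borel M" and w: "w \<in> uhp" and z: "z \<in> uhp"
  shows "norm (cauchy_transform M w - cauchy_transform M z)
    \<le> norm (w - z) * measure M UNIV / (Im w * Im z)"
proof -
  have "norm (\<integral>t. 1 / ((w - of_real t) * (z - of_real t)) \<partial>M)
     \<le> 1 / (Im w * Im z) * measure M UNIV"
    by (rule norm_integral_bound[OF M _ cauchy_kernel2_bound[OF w z]]) auto
  then have "norm (z - w) * norm (\<integral>t. 1 / ((w - of_real t) * (z - of_real t)) \<partial>M)
     \<le> norm (z - w) * (1 / (Im w * Im z) * measure M UNIV)"
    by (intro mult_left_mono) auto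
  then show ?thesis
    unfolding cauchy_transform_diff[OF M w z] norm_mult by (simp add: norm_minus_commute)
qed

lemma cauchy_transform_has_derivative:
  assumes M: "finite_borel M" and z: "z \<in> uhp"
  shows "(cauchy_transform M has_field_derivative
      - (\<integral>t. 1 / ((z - of_real t) * (z - of_real t)) \<partial>M)) (at z)"
proof -
  let ?J = "\<lambda>w. \<integral>t. 1 / ((w - of_real t) * (z - of_real t)) \<partial>M"
  define C where "C = measure M UNIV / (Im z * Im z) * (2 / Im z)"
  have near: "w \<in> uhp \<and> Im w \<ge> Im z / 2" if "dist w z < Im z / 2" for w
    using that z abs_Im_le_cmod[of "w - z"] by (auto simp: dist_norm uhp_iff)
  have bd: "norm (?J w - ?J z) \<le> norm (w - z) * C" if "dist w z < Im z / 2" for w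
  proof -
    have w: "w \<in> uhp" "Im w \<ge> Im z / 2" "Im w > 0" using near[OF that] by (auto simp: uhp_iff)
    have Iz: "Im z > 0" using z by (simp add: uhp_iff)
    have nz: "w - of_real t \<noteq> 0" "z - of_real t \<noteq> 0" for t
      using w z uhp_diff_real_nz by blast+
    have "?J w - ?J z = (\<integral>t. 1 / ((w - of_real t) * (z - of_real t))
         - 1 / ((z - of_real t) * (z - of_real t)) \<partial>M)"
      by (rule Bochner_Integration.integral_diff[symmetric]) (intro cauchy_integrable2 M w z)+
    also have "... = (\<integral>t. (z - w) * (1 / ((w - of_real t) * (z - of_real t)))
        * (1 / (z - of_real t)) \<partial>M)"
    proof (intro Bochner_Integration.integral_cong refl)
      fix t
      show "1 / ((w - of_real t) * (z - of_real t))
         - 1 / ((z - of_real t) * (z - of_real t))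
         = (z - w) * (1 / ((w - of_real t) * (z - of_real t)))
        * (1 / (z - of_real t))"
        using nz[of t] by (simp add: divide_simps)
    qed
    also have "norm ... \<le> norm (w - z) * (1 / (Im w * Im z)) * (1 / Im z) * measure M UNIV"
    proof (rule norm_integral_bound[OF M])
      fix t
      show "norm ((z - w) * (1 / ((w - of_real t) * (z - of_real t)))
        * (1 / (z - of_real t))) \<le> norm (w - z) * (1 / (Im w * Im z)) * (1 / Im z)"
        unfolding norm_mult[of _ "1 / (z - of_real t)"] norm_mult[of "z - w"]
        using w z Iz cauchy_kernel2_bound[OF w(1) z] cauchy_kernel_bound[OF z]
        by (intro mult_mono) (auto simp: norm_minus_commute simp del: norm_divide)
    qed auto
    also have "... \<le> norm (w - z) * (2 / (Im z * Im z)) * (1 / Im z) * measure M UNIV"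
    proof -
      have "1 / (Im w * Im z) \<le> 2 / (Im z * Im z)"
        using w Iz by (simp add: field_simps)
      then show ?thesis using Iz by (intro mult_right_mono mult_left_mono) auto
    qed
    finally show ?thesis by (simp add: C_def mult_ac)
  qed
  have "eventually (\<lambda>w. dist w z < Im z / 2) (at z)"
    using z by (auto simp: uhp_iff eventually_at intro!: exI[of _ "Im z / 2"])
  then have "eventually (\<lambda>w. norm (?J w - ?J z) \<le> norm (w - z) * C) (at z)"
    by (rule eventually_mono) (rule bd)
  moreover have "((\<lambda>w. norm (w - z) * C) \<longlongrightarrow> norm (z - z) * C) (at z)"
    by (intro tendsto_intros)
  then have "((\<lambda>w. norm (w - z) * C) \<longlongrightarrow> 0) (at z)" by simp
  ultimately have "((\<lambda>w. ?J w - ?J z) \<longlongrightarrow> 0) (at z)"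
    by (rule Lim_null_comparison)
  then have "(?J \<longlongrightarrow> ?J z) (at z)" by (simp add: LIM_zero_iff)
  then have lim: "((\<lambda>w. - ?J w) \<longlongrightarrow> - ?J z) (at z)" by (rule tendsto_minus)
  have ev: "eventually (\<lambda>w. - ?J w = (cauchy_transform M w - cauchy_transform M z) / (w - z)) (at z)"
    unfolding eventually_at
  proof (intro exI[of _ "Im z / 2"] conjI ballI impI)
    show "Im z / 2 > 0" using z by (simp add: uhp_iff)
    fix w assume "w \<noteq> z \<and> dist w z < Im z / 2"
    then have "w \<noteq> z" "w \<in> uhp" using near by auto
    then show "- ?J w = (cauchy_transform M w - cauchy_transform M z) / (w - z)"
      by (simp add: cauchy_transform_diff[OF M _ z] divide_simps) (simp add: algebra_simps)
  qed
  show ?thesis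
    unfolding has_field_derivative_iff using Lim_transform_eventually[OF lim ev] .
qed

lemma cauchy_transform_holomorphic:
  assumes M: "finite_borel M"
  shows "cauchy_transform M holomorphic_on uhp"
  using cauchy_transform_has_derivative[OF M]
  by (intro holomorphic_onI) (meson field_differentiable_at_within field_differentiable_def)

lemma Im_cauchy_kernel:
  "Im (1 / (z - of_real t)) = - (Im z / ((Re z - t)^2 + (Im z)^2))"
  by (simp add: Im_divide power2_eq_square)

lemma poisson_kernel_integrable:
  assumes M: "finite_borel M" and z: "z \<in> uhp"
  shows "integrable M (\<lambda>t. Im z / ((Re z - t)^2 + (Im z)^2))"
  using integrable_Im[OF cauchy_integrable[OF M z]] unfolding Im_cauchy_kernel by simp

lemma Im_cauchy_transform:
  assumes M: "finite_borel M" and z: "z \<in> uhp"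
  shows "Im (cauchy_transform M z) = - (\<integral>t. Im z / ((Re z - t)^2 + (Im z)^2) \<partial>M)"
proof -
  have "Im (cauchy_transform M z) = (\<integral>t. Im (1 / (z - of_real t)) \<partial>M)"
    unfolding cauchy_transform_def using integral_Im[OF cauchy_integrable[OF M z]] by simp
  then show ?thesis unfolding Im_cauchy_kernel by simp
qed

lemma weakly_converges_cauchy:
  assumes "weakly_converges X M" "\<And>n. finite_borel (X n)" "finite_borel M" "z \<in> uhp"
  shows "(\<lambda>n. cauchy_transform (X n) z) \<longlonglongrightarrow> cauchy_transform M z"
  unfolding cauchy_transform_def
  by (rule weakly_converges_complex[OF assms(1-3) _ cauchy_kernel_bound[OF assms(4)]])
     (use uhp_diff_real_nz[OF assms(4)] in \<open>intro continuous_intros, auto\<close>)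

section \<open>Stieltjes inversion\<close>

lemma arctan_density_integrable: "integrable lborel (\<lambda>u::real. inverse (1 + u^2))"
  using integrable_inverse_1_plus_square by (simp add: set_integrable_def einterval_def)

lemma arctan_density_integral: "(\<integral>u. inverse (1 + u^2) \<partial>lborel) = pi"
  using LBINT_inverse_1_plus_square
  by (simp add: interval_lebesgue_integral_def set_lebesgue_integral_def einterval_def)

definition cauchy_law :: "real measure" where
  "cauchy_law = density lborel (\<lambda>u. ennreal (inverse (1 + u^2)))"

lemma cauchy_law_mass: "emeasure cauchy_law UNIV = ennreal pi"
proof -
  have "emeasure cauchy_law UNIV = (\<integral>\<^sup>+u. ennreal (inverse (1 + u^2)) \<partial>lborel)"
    unfolding cauchy_law_def by (subst emeasure_density) auto
  also have "... = ennreal (\<integral>u. inverse (1 + u^2) \<partial>lborel)"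
    by (rule nn_integral_eq_integral[OF arctan_density_integrable]) auto
  finally show ?thesis by (simp add: arctan_density_integral)
qed

lemma cauchy_law_finite_borel: "finite_borel cauchy_law"
  unfolding finite_borel_measure_def finite_borel_measure_axioms_def
proof
  have "space cauchy_law = UNIV" by (simp add: cauchy_law_def)
  then show "finite_measure cauchy_law"
    using cauchy_law_mass by (intro finite_measureI) auto
  show "sets cauchy_law = sets borel" by (simp add: cauchy_law_def)
qed

text \<open>\<open>- Im G(x + iy)\<close> is the density of the convolution of \<open>M\<close> with the Cauchy law of scale \<open>y\<close> (up to
normalisation). This is Stieltjes inversion before the limit.\<close>
lemma cauchy_smoothing:
  fixes f :: "real \<Rightarrow> real"
  assumes M: "finite_borel M" and c: "continuous_on UNIV f"
    and f: "\<And>x. 0 \<le> f x" and y: "y > 0"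
  shows "(\<integral>\<^sup>+t. \<integral>\<^sup>+u. ennreal (f (t + y * u)) \<partial>cauchy_law \<partial>M)
    = (\<integral>\<^sup>+x. ennreal (f x) * ennreal (- Im (cauchy_transform M (Complex x y))) \<partial>lborel)"
proof -
  interpret M: finite_borel_measure M by fact
  interpret pair_sigma_finite M lborel ..
  have [measurable]: "f \<in> borel_measurable borel" using c by (rule borel_measurable_continuous_onI)
  have [measurable_cong]: "sets M = sets borel" by (rule finite_borelD(2)[OF M])
  have inner: "(\<integral>\<^sup>+u. ennreal (f (t + y * u)) \<partial>cauchy_law)
     = (\<integral>\<^sup>+x. ennreal (f x * (y / ((x - t)^2 + y^2))) \<partial>lborel)" for t
  proof -
    have "(\<integral>\<^sup>+x. ennreal (f x * (y / ((x - t)^2 + y^2))) \<partial>lborel) =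
       (\<integral>\<^sup>+u. ennreal (f (t + y * u) * (y / ((t + y * u - t)^2 + y^2))) \<partial>lborel) * ennreal \<bar>y\<bar>"
      using y by (subst nn_integral_real_affine[where c=y and t=t]) (auto simp: mult.commute)
    also have "... = (\<integral>\<^sup>+u. ennreal (f (t + y * u) * (y / ((t + y * u - t)^2 + y^2))) * ennreal \<bar>y\<bar> \<partial>lborel)"
      by (rule nn_integral_multc[symmetric]) measurable
    also have "... = (\<integral>\<^sup>+u. ennreal (inverse (1 + u^2)) * ennreal (f (t + y * u)) \<partial>lborel)"
    proof (rule nn_integral_cong)
      fix u :: real
      have pos: "1 + u^2 > 0" by (simp add: add_pos_nonneg)
      have "y / ((t + y * u - t)^2 + y^2) * y = inverse (1 + u^2)"
      proof -
        have e: "(t + y * u - t)^2 + y^2 = (1 + u^2) * (y * y)"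
          by (simp add: power2_eq_square algebra_simps)
        show ?thesis unfolding e using y pos by (simp add: divide_simps)
      qed
      then have "f (t + y * u) * (y / ((t + y * u - t)^2 + y^2)) * y = inverse (1 + u^2) * f (t + y * u)"
        by (metis mult.assoc mult.commute)
      then show "ennreal (f (t + y * u) * (y / ((t + y * u - t)^2 + y^2))) * ennreal \<bar>y\<bar>
        = ennreal (inverse (1 + u^2)) * ennreal (f (t + y * u))"
        using y f pos by (simp add: ennreal_mult'[symmetric] ennreal_mult''[symmetric])
    qed
    also have "... = (\<integral>\<^sup>+u. ennreal (f (t + y * u)) \<partial>cauchy_law)"
      unfolding cauchy_law_def by (subst nn_integral_density) auto
    finally show ?thesis by simp
  qed
  have "(\<integral>\<^sup>+t. \<integral>\<^sup>+u. ennreal (f (t + y * u)) \<partial>cauchy_law \<partial>M)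
    = (\<integral>\<^sup>+t. \<integral>\<^sup>+x. ennreal (f x * (y / ((x - t)^2 + y^2))) \<partial>lborel \<partial>M)"
    by (simp add: inner)
  also have "... = (\<integral>\<^sup>+x. \<integral>\<^sup>+t. ennreal (f x * (y / ((x - t)^2 + y^2))) \<partial>M \<partial>lborel)"
    by (rule Fubini'[symmetric]) measurable
  also have "... = (\<integral>\<^sup>+x. ennreal (f x) * ennreal (- Im (cauchy_transform M (Complex x y))) \<partial>lborel)"
  proof (rule nn_integral_cong)
    fix x :: real
    have z: "Complex x y \<in> uhp" using y by (simp add: uhp_iff)
    have "(\<integral>\<^sup>+t. ennreal (f x * (y / ((x - t)^2 + y^2))) \<partial>M)
        = (\<integral>\<^sup>+t. ennreal (f x) * ennreal (y / ((x - t)^2 + y^2)) \<partial>M)"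
    proof (rule nn_integral_cong)
      fix t
      have "0 \<le> y / ((x - t)^2 + y^2)" using y by simp
      then show "ennreal (f x * (y / ((x - t)^2 + y^2))) = ennreal (f x) * ennreal (y / ((x - t)^2 + y^2))"
        by (rule ennreal_mult[OF f(1)])
    qed
    also have "... = ennreal (f x) * (\<integral>\<^sup>+t. ennreal (y / ((x - t)^2 + y^2)) \<partial>M)"
      by (rule nn_integral_cmult) measurable
    also have "(\<integral>\<^sup>+t. ennreal (y / ((x - t)^2 + y^2)) \<partial>M) = ennreal (\<integral>t. y / ((x - t)^2 + y^2) \<partial>M)"
      using poisson_kernel_integrable[OF M z] y
      by (intro nn_integral_eq_integral) auto
    also have "(\<integral>t. y / ((x - t)^2 + y^2) \<partial>M) = - Im (cauchy_transform M (Complex x y))"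
      using Im_cauchy_transform[OF M z] by simp
    finally show "(\<integral>\<^sup>+t. ennreal (f x * (y / ((x - t)^2 + y^2))) \<partial>M)
       = ennreal (f x) * ennreal (- Im (cauchy_transform M (Complex x y)))" .
  qed
  finally show ?thesis .
qed

lemma cauchy_smoothing_limit:
  fixes f :: "real \<Rightarrow> real"
  assumes M: "finite_borel M" and c: "continuous_on UNIV f"
    and f: "\<And>x. 0 \<le> f x" "\<And>x. f x \<le> 1"
  shows "(\<lambda>n. enn2real (\<integral>\<^sup>+t. \<integral>\<^sup>+u. ennreal (f (t + inverse (Suc n) * u)) \<partial>cauchy_law \<partial>M))
     \<longlonglongrightarrow> pi * (\<integral>t. f t \<partial>M)"
proof -
  interpret M: finite_borel_measure M by fact
  interpret C: finite_borel_measure cauchy_law by (rule cauchy_law_finite_borel)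
  have [measurable]: "f \<in> borel_measurable borel" using c by (rule borel_measurable_continuous_onI)
  have [measurable_cong]: "sets M = sets borel" "sets cauchy_law = sets borel"
    using finite_borelD(2)[OF M] finite_borelD(2)[OF cauchy_law_finite_borel] by auto
  have mass: "measure cauchy_law UNIV = pi"
    using cauchy_law_mass by (simp add: measure_def)
  define J where "J y t = (\<integral>u. f (t + y * u) \<partial>cauchy_law)" for y t
  have nb: "norm (f x) \<le> 1" for x using f[of x] by simp
  have inner: "(\<integral>\<^sup>+u. ennreal (f (t + y * u)) \<partial>cauchy_law) = ennreal (J y t)" for y t
    unfolding J_def using f nb
    by (intro nn_integral_eq_integral integrable_bounded_borel[OF cauchy_law_finite_borel, where B=1]) auto
  have [measurable]: "J y \<in> borel_measurable borel" for y
    unfolding J_def by (rule C.borel_measurable_lebesgue_integral) measurable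
  have Jb: "0 \<le> J y t" "J y t \<le> pi" for y t
  proof -
    show "0 \<le> J y t" unfolding J_def using f by simp
    have "norm (J y t) \<le> 1 * measure cauchy_law UNIV"
      unfolding J_def using nb by (intro norm_integral_bound[OF cauchy_law_finite_borel]) auto
    then show "J y t \<le> pi" by (simp add: mass)
  qed
  have outer: "enn2real (\<integral>\<^sup>+t. \<integral>\<^sup>+u. ennreal (f (t + y * u)) \<partial>cauchy_law \<partial>M) = (\<integral>t. J y t \<partial>M)" for y
  proof -
    have "(\<integral>\<^sup>+t. \<integral>\<^sup>+u. ennreal (f (t + y * u)) \<partial>cauchy_law \<partial>M) = ennreal (\<integral>t. J y t \<partial>M)"
      unfolding inner using Jb
      by (intro nn_integral_eq_integral integrable_bounded_borel[OF M, where B=pi]) auto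
    then show ?thesis using Jb by simp
  qed
  have y0: "(\<lambda>n. inverse (real (Suc n))) \<longlonglongrightarrow> 0" by (rule LIMSEQ_inverse_real_of_nat)
  have lim_inner: "(\<lambda>n. J (inverse (Suc n)) t) \<longlonglongrightarrow> pi * f t" for t
  proof -
    have "(\<lambda>n. J (inverse (Suc n)) t) \<longlonglongrightarrow> (\<integral>u. f t \<partial>cauchy_law)"
      unfolding J_def
    proof (rule integral_dominated_convergence[where w="\<lambda>_. 1"])
      show "AE u in cauchy_law. (\<lambda>n. f (t + inverse (real (Suc n)) * u)) \<longlonglongrightarrow> f t"
      proof (rule AE_I2)
        fix u :: real
        have "(\<lambda>n. t + inverse (real (Suc n)) * u) \<longlonglongrightarrow> t + 0 * u"
          by (intro tendsto_intros y0)
        moreover have "isCont f t" using c by (simp add: continuous_on_eq_continuous_at)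
        ultimately show "(\<lambda>n. f (t + inverse (real (Suc n)) * u)) \<longlonglongrightarrow> f t"
          by (intro isCont_tendsto_compose[of t f]) auto
      qed
    qed (use nb in auto)
    then show ?thesis
      using finite_borelD(3)[OF cauchy_law_finite_borel] by (simp add: mass)
  qed
  have "(\<lambda>n. \<integral>t. J (inverse (Suc n)) t \<partial>M) \<longlonglongrightarrow> (\<integral>t. pi * f t \<partial>M)"
  proof (rule integral_dominated_convergence[where w="\<lambda>_. pi"])
    show "AE t in M. norm (J (inverse (real (Suc n))) t) \<le> pi" for n
      using Jb by (auto intro!: AE_I2 simp del: of_nat_Suc)
  qed (use lim_inner in auto)
  then show ?thesis unfolding outer by simp
qed

lemma cauchy_transform_determines:
  assumes M: "finite_borel M" and N: "finite_borel N"
    and eq: "\<And>z. z \<in> uhp ==> cauchy_transform M z = cauchy_transform N z"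
  shows "M = N"
proof (rule measure_eqI_continuous[OF M N])
  fix f :: "real \<Rightarrow> real"
  assume f: "continuous_on UNIV f" "\<And>x. 0 \<le> f x" "\<And>x. f x \<le> 1"
  have "(\<integral>\<^sup>+t. \<integral>\<^sup>+u. ennreal (f (t + y * u)) \<partial>cauchy_law \<partial>M)
     = (\<integral>\<^sup>+t. \<integral>\<^sup>+u. ennreal (f (t + y * u)) \<partial>cauchy_law \<partial>N)" if "y > 0" for y
    using cauchy_smoothing[OF M f(1,2) that] cauchy_smoothing[OF N f(1,2) that] that
    by (simp add: eq uhp_iff)
  then have "pi * (\<integral>t. f t \<partial>M) = pi * (\<integral>t. f t \<partial>N)"
    using cauchy_smoothing_limit[OF M f] cauchy_smoothing_limit[OF N f]
    by (intro LIMSEQ_unique) auto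
  then show "(\<integral>t. f t \<partial>M) = (\<integral>t. f t \<partial>N)" by simp
qed

lemma cauchy_transform_determines_open:
  assumes M: "finite_borel M" and N: "finite_borel N"
    and U: "open U" "U \<noteq> {}" "U \<subseteq> uhp"
    and eq: "\<And>z. z \<in> U ==> cauchy_transform M z = cauchy_transform N z"
  shows "M = N"
proof (rule cauchy_transform_determines[OF M N])
  fix z assume "z \<in> uhp"
  then show "cauchy_transform M z = cauchy_transform N z"
    using analytic_continuation_open[OF U(1) open_uhp U(2) connected_uhp U(3)
        cauchy_transform_holomorphic[OF M] cauchy_transform_holomorphic[OF N] eq] by blast
qed

section \<open>The reciprocal Cauchy transform of a probability measure\<close>

lemma Im_cauchy_transform_neg:
  assumes M: "real_distribution M" and z: "z \<in> uhp"
  shows "Im (cauchy_transform M z) < 0"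
proof -
  interpret real_distribution M by fact
  let ?p = "\<lambda>t. Im z / ((Re z - t)^2 + (Im z)^2)"
  have fb: "finite_borel M" by (rule real_distributionD(2)[OF M])
  have pos: "?p t > 0" for t
    using z by (auto simp: uhp_iff intro!: divide_pos_pos add_nonneg_pos)
  have int: "integrable M ?p" by (rule poisson_kernel_integrable[OF fb z])
  have "(\<integral>t. ?p t \<partial>M) \<noteq> 0"
  proof
    assume "(\<integral>t. ?p t \<partial>M) = 0"
    then have "AE t in M. ?p t = 0"
      using integral_nonneg_eq_0_iff_AE[OF int] pos by (simp add: less_imp_le)
    then have "AE t in M. False" by (rule AE_mp) (use pos in \<open>force intro!: AE_I2\<close>)
    then show False by simp
  qed
  moreover have "(\<integral>t. ?p t \<partial>M) \<ge> 0" using pos by (simp add: less_imp_le)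
  ultimately show ?thesis using Im_cauchy_transform[OF fb z] by simp
qed

lemma cauchy_transform_nz: "real_distribution M ==> z \<in> uhp ==> cauchy_transform M z \<noteq> 0"
  using Im_cauchy_transform_neg[of M z] by auto

lemma cmod_diff_sq: "(cmod (a - b))^2 = (cmod a)^2 - 2 * Re (a * cnj b) + (cmod b)^2"
  unfolding cmod_power2 by (simp add: power2_eq_square algebra_simps)

lemma norm_expectation_sq:
  fixes f :: "real \<Rightarrow> complex"
  assumes M: "real_distribution M" and f: "f \<in> borel_measurable borel" "\<And>x. norm (f x) \<le> B"
  shows "(cmod (\<integral>x. f x \<partial>M))^2 \<le> (\<integral>x. (cmod (f x))^2 \<partial>M)"
proof -
  interpret real_distribution M by fact
  note fb = real_distributionD(2)[OF M]
  have [measurable]: "f \<in> borel_measurable borel" by fact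
  let ?c = "\<integral>x. f x \<partial>M"
  have i1: "integrable M f" by (rule integrable_bounded_borel[OF fb f])
  have i2: "integrable M (\<lambda>x. (cmod (f x))^2)"
    using f(2) by (intro integrable_bounded_borel[OF fb, where B="B^2"]) (auto intro!: power_mono)
  have "0 \<le> (\<integral>x. (cmod (f x - ?c))^2 \<partial>M)" by simp
  also have "... = (\<integral>x. (cmod (f x))^2 - 2 * Re (f x * cnj ?c) + (cmod ?c)^2 \<partial>M)"
    by (intro Bochner_Integration.integral_cong refl cmod_diff_sq)
  also have "... = (\<integral>x. (cmod (f x))^2 \<partial>M) - 2 * Re (?c * cnj ?c) + (cmod ?c)^2"
  proof -
    have i3: "integrable M (\<lambda>x. f x * cnj ?c)" using i1 by (rule integrable_mult_left)
    have "(\<integral>x. Re (f x * cnj ?c) \<partial>M) = Re (\<integral>x. f x * cnj ?c \<partial>M)"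
      by (rule integral_Re[OF i3])
    also have "... = Re (?c * cnj ?c)" by (simp only: integral_mult_left_zero)
    finally have e: "(\<integral>x. Re (f x * cnj ?c) \<partial>M) = Re (?c * cnj ?c)" .
    have i4: "integrable M (\<lambda>x. 2 * Re (f x * cnj ?c))"
      by (intro integrable_mult_right integrable_Re i3)
    have "(\<integral>x. (cmod (f x))^2 - 2 * Re (f x * cnj ?c) + (cmod ?c)^2 \<partial>M)
      = (\<integral>x. (cmod (f x))^2 - 2 * Re (f x * cnj ?c) \<partial>M) + (\<integral>x. (cmod ?c)^2 \<partial>M)"
      by (intro Bochner_Integration.integral_add Bochner_Integration.integrable_diff i2 i4) simp
    also have "(\<integral>x. (cmod (f x))^2 - 2 * Re (f x * cnj ?c) \<partial>M)
      = (\<integral>x. (cmod (f x))^2 \<partial>M) - (\<integral>x. 2 * Re (f x * cnj ?c) \<partial>M)"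
      by (intro Bochner_Integration.integral_diff i2 i4)
    finally show ?thesis
      unfolding integral_mult_right_zero e by (simp add: real_distributionD(5)[OF M])
  qed
  also have "?c * cnj ?c = of_real ((cmod ?c)^2)" by (simp only: complex_norm_square)
  finally show ?thesis by simp
qed

lemma norm_cauchy_transform_sq:
  assumes M: "real_distribution M" and z: "z \<in> uhp"
  shows "Im z * (cmod (cauchy_transform M z))^2 \<le> - Im (cauchy_transform M z)"
proof -
  note fb = real_distributionD(2)[OF M]
  have Iz: "Im z > 0" using z by (simp add: uhp_iff)
  have "(cmod (cauchy_transform M z))^2 \<le> (\<integral>t. (cmod (1 / (z - of_real t)))^2 \<partial>M)"
    unfolding cauchy_transform_def
    by (rule norm_expectation_sq[OF M _ cauchy_kernel_bound[OF z]]) auto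
  also have "... = (\<integral>t. (Im z / ((Re z - t)^2 + (Im z)^2)) / Im z \<partial>M)"
    using Iz by (intro Bochner_Integration.integral_cong)
      (auto simp: norm_divide power_divide cmod_power2)
  also have "... = - Im (cauchy_transform M z) / Im z"
    using Im_cauchy_transform[OF fb z] by (simp only: integral_divide_zero minus_minus)
  finally show ?thesis using Iz by (simp add: field_simps)
qed

text \<open>By Cauchy-Schwarz, \<open>Im z |G|\<^sup>2 \<le> - Im G\<close>; divide by \<open>|G|\<^sup>2\<close>.\<close>
lemma Im_F_transform_ge:
  assumes M: "real_distribution M" and z: "z \<in> uhp"
  shows "Im z \<le> Im (F_transform M z)"
proof -
  let ?G = "cauchy_transform M z"
  have nz: "cmod ?G > 0" using cauchy_transform_nz[OF M z] by simp
  have "Im (F_transform M z) = - Im ?G / (cmod ?G)^2"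
    by (simp add: F_transform_def Im_divide cmod_power2)
  moreover have "Im z \<le> - Im ?G / (cmod ?G)^2"
    using norm_cauchy_transform_sq[OF M z] nz by (subst pos_le_divide_eq) auto
  ultimately show ?thesis by simp
qed

lemma F_transform_holomorphic:
  assumes M: "real_distribution M"
  shows "F_transform M holomorphic_on uhp"
  unfolding F_transform_def
  by (intro holomorphic_on_divide holomorphic_on_const
      cauchy_transform_holomorphic[OF real_distributionD(2)[OF M]] cauchy_transform_nz[OF M])

lemma F_transform_determines_open:
  assumes M: "real_distribution M" and N: "real_distribution N"
    and U: "open U" "U \<noteq> {}" "U \<subseteq> uhp"
    and eq: "\<And>z. z \<in> U ==> F_transform M z = F_transform N z"
  shows "M = N"
proof (rule cauchy_transform_determines_open[OF real_distributionD(2)[OF M] real_distributionD(2)[OF N] U])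
  fix z assume "z \<in> U"
  then show "cauchy_transform M z = cauchy_transform N z"
    using eq[of z] U cauchy_transform_nz[OF M, of z] cauchy_transform_nz[OF N, of z]
    by (auto simp: F_transform_def divide_simps)
qed

section \<open>Estimates on truncated cones\<close>

abbreviation (input) "tcone \<equiv> truncated_cone"

lemma truncated_cone_uhp: "0 \<le> \<beta> ==> tcone \<alpha> \<beta> \<subseteq> uhp"
  by (auto simp: truncated_cone_def uhp_iff)

lemma truncated_cone_mono: "\<alpha> \<le> \<alpha>' ==> 0 \<le> \<beta>' ==> \<beta>' \<le> \<beta> ==> tcone \<alpha> \<beta> \<subseteq> tcone \<alpha>' \<beta>'"
  unfolding truncated_cone_def by (auto intro: less_le_trans[OF _ mult_right_mono])

lemma cone2_norm:
  assumes "w \<in> tcone 2 \<beta>" "0 \<le> \<beta>"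
  shows "cmod w \<le> 3 * Im w"
  using assms cmod_le[of w] by (auto simp: truncated_cone_def)

text \<open>In a cone \<open>|w|\<close> and the distance of \<open>w\<close> to the real line are comparable, which makes these kernels
bounded, and the second one small unless \<open>|t|\<close> is at least of the order of \<open>\<beta>\<close>.\<close>
lemma cone2_kernel:
  assumes w: "w \<in> tcone 2 \<beta>" and b: "0 < \<beta>"
  shows "cmod (w / (w - of_real t)) \<le> 3"
    "cmod (complex_of_real t / (w - of_real t)) \<le> 4 * min 1 (\<bar>t\<bar> / \<beta>)"
proof -
  have I: "Im w > \<beta>" "Im w > 0" "w \<in> uhp" using w b by (auto simp: truncated_cone_def uhp_iff)
  have nz: "w - of_real t \<noteq> 0" using uhp_diff_real_nz[OF I(3)] .
  have d: "Im w \<le> cmod (w - of_real t)" by (rule norm_uhp_diff_real)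
  have "cmod w \<le> 3 * Im w" using cone2_norm w b by auto
  then have "cmod w \<le> 3 * cmod (w - of_real t)" using d by linarith
  then show 1: "cmod (w / (w - of_real t)) \<le> 3"
    using nz by (simp add: norm_divide divide_simps)
  have "complex_of_real t / (w - of_real t) = w / (w - of_real t) - 1"
    using nz by (simp add: field_simps)
  then have 2: "cmod (complex_of_real t / (w - of_real t)) \<le> 4"
    using norm_triangle_ineq4[of "w / (w - of_real t)" 1] 1 by simp
  have "\<bar>t\<bar> / cmod (w - of_real t) \<le> \<bar>t\<bar> / \<beta>"
    using I d b by (intro divide_left_mono mult_pos_pos) auto
  also have "0 \<le> \<bar>t\<bar> / \<beta>" using b by simp
  then have "\<bar>t\<bar> / \<beta> \<le> 4 * (\<bar>t\<bar> / \<beta>)" by linarith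
  finally have "cmod (complex_of_real t / (w - of_real t)) \<le> 4 * (\<bar>t\<bar> / \<beta>)"
    by (simp add: norm_divide)
  with 2 show "cmod (complex_of_real t / (w - of_real t)) \<le> 4 * min 1 (\<bar>t\<bar> / \<beta>)"
    by (simp add: min_def)
qed

text \<open>A bounded first absolute moment at scale \<open>\<beta>\<close>; unlike a tail probability it is continuous under weak
convergence.\<close>
definition kappa :: "real measure \<Rightarrow> real \<Rightarrow> real" where
  "kappa M \<beta> = (\<integral>t. min 1 (\<bar>t\<bar> / \<beta>) \<partial>M)"

lemma kappa_integrable:
  assumes "finite_borel M" "0 < \<beta>"
  shows "integrable M (\<lambda>t. min 1 (\<bar>t\<bar> / \<beta>))"
  using assms(2) by (intro integrable_bounded_borel[OF assms(1), where B=1]) auto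

lemma kappa_nonneg: "0 < \<beta> ==> 0 \<le> kappa M \<beta>"
  unfolding kappa_def by (rule integral_nonneg_AE) auto

lemma cone_cauchy_transform:
  assumes M: "real_distribution M" and w: "w \<in> tcone 2 \<beta>" and b: "0 < \<beta>"
  shows "cmod (w * cauchy_transform M w - 1) \<le> 4 * kappa M \<beta>"
proof -
  interpret real_distribution M by fact
  note fb = real_distributionD(2)[OF M]
  have u: "w \<in> uhp" using w b truncated_cone_uhp[of \<beta> 2] by auto
  have "w * cauchy_transform M w - 1 = (\<integral>t. w * (1 / (w - of_real t)) - 1 \<partial>M)"
    using cauchy_integrable[OF fb u] by (simp add: cauchy_transform_def real_distributionD(5)[OF M] del: times_divide_eq_right)
  also have "... = (\<integral>t. complex_of_real t / (w - of_real t) \<partial>M)"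
    using uhp_diff_real_nz[OF u] by (intro Bochner_Integration.integral_cong) (auto simp: field_simps)
  also have "cmod ... \<le> (\<integral>t. cmod (complex_of_real t / (w - of_real t)) \<partial>M)"
    by (rule integral_norm_bound)
  also have "... \<le> (\<integral>t. 4 * min 1 (\<bar>t\<bar> / \<beta>) \<partial>M)"
  proof (rule integral_mono)
    show "integrable M (\<lambda>t. cmod (complex_of_real t / (w - of_real t)))"
      using cone2_kernel(2)[OF w b] min.cobounded1[of 1]
      by (intro integrable_bounded_borel[OF fb, where B=4]) (fastforce intro: order_trans)+
    show "integrable M (\<lambda>t. 4 * min 1 (\<bar>t\<bar> / \<beta>))"
      using kappa_integrable[OF fb b] by simp
  qed (rule cone2_kernel(2)[OF w b])
  finally show ?thesis by (simp add: kappa_def)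
qed

lemma cone_cauchy_transform2:
  assumes M: "real_distribution M" and w: "w \<in> tcone 2 \<beta>" and v: "v \<in> tcone 2 \<beta>"
    and b: "0 < \<beta>"
  shows "cmod (w * v * (\<integral>t. 1 / ((w - of_real t) * (v - of_real t)) \<partial>M) - 1)
    \<le> 16 * kappa M \<beta>"
proof -
  interpret real_distribution M by fact
  note fb = real_distributionD(2)[OF M]
  have u: "w \<in> uhp" "v \<in> uhp" using w v b truncated_cone_uhp[of \<beta> 2] by auto
  let ?a = "\<lambda>t. w / (w - of_real t)" and ?b = "\<lambda>t. v / (v - of_real t)"
  have am: "cmod (?a t - 1) \<le> 4 * min 1 (\<bar>t\<bar> / \<beta>)" "cmod (?b t - 1) \<le> 4 * min 1 (\<bar>t\<bar> / \<beta>)" for t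
  proof -
    have "?a t - 1 = complex_of_real t / (w - of_real t)"
      "?b t - 1 = complex_of_real t / (v - of_real t)"
      using uhp_diff_real_nz u by (simp_all add: field_simps)
    then show "cmod (?a t - 1) \<le> 4 * min 1 (\<bar>t\<bar> / \<beta>)" "cmod (?b t - 1) \<le> 4 * min 1 (\<bar>t\<bar> / \<beta>)"
      using cone2_kernel(2)[OF w b] cone2_kernel(2)[OF v b] by auto
  qed
  have ab: "cmod (?a t * ?b t - 1) \<le> 16 * min 1 (\<bar>t\<bar> / \<beta>)" for t
  proof -
    have "?a t * ?b t - 1 = (?a t - 1) * ?b t + (?b t - 1)" by (simp add: algebra_simps)
    also have "cmod ... \<le> cmod (?a t - 1) * cmod (?b t) + cmod (?b t - 1)"
      by (metis norm_mult norm_triangle_ineq)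
    also have "... \<le> (4 * min 1 (\<bar>t\<bar> / \<beta>)) * 3 + 4 * min 1 (\<bar>t\<bar> / \<beta>)"
      using am[of t] cone2_kernel(1)[OF v b] b by (intro add_mono mult_mono) auto
    finally show ?thesis by simp
  qed
  have "w * v * (\<integral>t. 1 / ((w - of_real t) * (v - of_real t)) \<partial>M) - 1
     = (\<integral>t. w * v * (1 / ((w - of_real t) * (v - of_real t))) - 1 \<partial>M)"
    using cauchy_integrable2[OF fb u] by (simp add: real_distributionD(5)[OF M] del: times_divide_eq_right)
  also have "... = (\<integral>t. ?a t * ?b t - 1 \<partial>M)"
    by (intro Bochner_Integration.integral_cong) auto
  also have "cmod ... \<le> (\<integral>t. cmod (?a t * ?b t - 1) \<partial>M)"
    by (rule integral_norm_bound)
  also have "... \<le> (\<integral>t. 16 * min 1 (\<bar>t\<bar> / \<beta>) \<partial>M)"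
  proof (rule integral_mono)
    have "cmod (?a t * ?b t - 1) \<le> 16" for t
      using ab[of t] by (rule order_trans) simp
    then show "integrable M (\<lambda>t. cmod (?a t * ?b t - 1))"
      by (intro integrable_bounded_borel[OF fb, where B=16]) auto
    show "integrable M (\<lambda>t. 16 * min 1 (\<bar>t\<bar> / \<beta>))"
      using kappa_integrable[OF fb b] by simp
  qed (rule ab)
  finally show ?thesis by (simp add: kappa_def)
qed

definition cone_small :: "(complex \<Rightarrow> complex) \<Rightarrow> real \<Rightarrow> real \<Rightarrow> bool" where
  "cone_small E \<beta> \<epsilon> \<longleftrightarrow>
     (\<forall>w\<in>tcone 2 \<beta>. cmod (E w) \<le> \<epsilon> * cmod w) \<and>
     (\<forall>w\<in>tcone 2 \<beta>. \<forall>v\<in>tcone 2 \<beta>. cmod (E w - E v) \<le> \<epsilon> * cmod (w - v))"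

lemma cone_small_mono:
  assumes "cone_small E \<beta> \<epsilon>" "0 \<le> \<beta>" "\<beta> \<le> \<beta>'" "\<epsilon> \<le> \<epsilon>'"
  shows "cone_small E \<beta>' \<epsilon>'"
  unfolding cone_small_def
proof (intro conjI ballI)
  have sub: "tcone 2 \<beta>' \<subseteq> tcone 2 \<beta>" using assms by (intro truncated_cone_mono) auto
  fix w assume w: "w \<in> tcone 2 \<beta>'"
  have "cmod (E w) \<le> \<epsilon> * cmod w" using assms(1) w sub by (auto simp: cone_small_def)
  also have "... \<le> \<epsilon>' * cmod w" using assms(4) by (intro mult_right_mono) auto
  finally show "cmod (E w) \<le> \<epsilon>' * cmod w" .
  fix v assume v: "v \<in> tcone 2 \<beta>'"
  have "cmod (E w - E v) \<le> \<epsilon> * cmod (w - v)" using assms(1) w v sub by (auto simp: cone_small_def)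
  also have "... \<le> \<epsilon>' * cmod (w - v)" using assms(4) by (intro mult_right_mono) auto
  finally show "cmod (E w - E v) \<le> \<epsilon>' * cmod (w - v)" .
qed

text \<open>Difference quotients of \<open>E\<close> are governed by those of \<open>1/G\<close>, and \<open>wvG[w,v]\<close> is close to \<open>-1\<close> by the
preceding two estimates. The Lipschitz form is what the fixed point arguments below need.\<close>
lemma E_transform_cone_small:
  assumes M: "real_distribution M" and b: "0 < \<beta>" and k: "kappa M \<beta> \<le> 1 / 8"
  shows "cone_small (E_transform M) \<beta> (104 * kappa M \<beta>)"
  unfolding cone_small_def
proof (intro conjI ballI)
  note fb = real_distributionD(2)[OF M]
  let ?k = "kappa M \<beta>" and ?G = "cauchy_transform M"
  have k0: "0 \<le> ?k" by (rule kappa_nonneg[OF b])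
  fix w assume w: "w \<in> tcone 2 \<beta>"
  have basic: "x \<in> uhp" "x \<noteq> 0" "cmod (x * ?G x - 1) \<le> 4 * ?k" "cmod (x * ?G x) \<ge> 1 / 2"
     "cmod (x * ?G x) \<le> 3 / 2" "?G x \<noteq> 0" if "x \<in> tcone 2 \<beta>" for x
  proof -
    show u: "x \<in> uhp" using that b truncated_cone_uhp[of \<beta> 2] by auto
    then show "x \<noteq> 0" by (auto simp: uhp_iff)
    show 1: "cmod (x * ?G x - 1) \<le> 4 * ?k" by (rule cone_cauchy_transform[OF M that b])
    show "cmod (x * ?G x) \<ge> 1 / 2"
      using 1 k norm_triangle_ineq2[of 1 "1 - x * ?G x"] by (simp add: norm_minus_commute)
    show "cmod (x * ?G x) \<le> 3 / 2"
      using 1 k norm_triangle_ineq[of 1 "x * ?G x - 1"] by simp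
    show "?G x \<noteq> 0" by (rule cauchy_transform_nz[OF M u])
  qed
  note W = basic[OF w]
  have "E_transform M w = w * ((w * ?G w - 1) / (w * ?G w))"
    using W by (simp add: E_transform_def F_transform_def field_simps)
  also have "cmod ... \<le> cmod w * ((4 * ?k) / (1 / 2))"
    unfolding norm_mult norm_divide using W(3,4) k0
    by (intro mult_left_mono frac_le) (auto simp: norm_mult)
  also have "... \<le> (104 * ?k) * cmod w"
    using k0 by (simp add: mult_right_mono)
  finally show "cmod (E_transform M w) \<le> 104 * ?k * cmod w" .
  fix v assume v: "v \<in> tcone 2 \<beta>"
  note V = basic[OF v]
  let ?J = "\<integral>t. 1 / ((w - of_real t) * (v - of_real t)) \<partial>M"
  have F: "F_transform M w - F_transform M v = (w - v) * (?J / (?G w * ?G v))"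
  proof -
    have "F_transform M w - F_transform M v = (?G v - ?G w) / (?G w * ?G v)"
      using W V by (simp add: F_transform_def field_simps)
    also have "?G v - ?G w = (w - v) * ?J"
      using cauchy_transform_diff[OF fb W(1) V(1)] by (simp add: algebra_simps)
    finally show ?thesis by simp
  qed
  define A where "A = w * v * ?J"
  define B where "B = (w * ?G w) * (v * ?G v)"
  have Bn: "cmod B \<ge> 1 / 4"
    using mult_mono[OF W(4) V(4)] unfolding B_def norm_mult by simp
  have B0: "B \<noteq> 0" using Bn by auto
  have B1: "cmod (B - 1) \<le> 10 * ?k"
  proof -
    have "B - 1 = (w * ?G w - 1) * (v * ?G v) + (v * ?G v - 1)" by (simp add: B_def algebra_simps)
    also have "cmod ... \<le> cmod (w * ?G w - 1) * cmod (v * ?G v) + cmod (v * ?G v - 1)"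
      by (metis norm_mult norm_triangle_ineq)
    also have "... \<le> (4 * ?k) * (3 / 2) + 4 * ?k"
      using W(3) V(3,5) k0 by (intro add_mono mult_mono) auto
    finally show ?thesis by simp
  qed
  have A1: "cmod (A - 1) \<le> 16 * ?k" unfolding A_def by (rule cone_cauchy_transform2[OF M w v b])
  have "cmod (B - A) \<le> cmod (B - 1) + cmod (A - 1)"
    by (metis diff_diff_eq2 diff_add_cancel norm_minus_commute norm_triangle_ineq4 add_diff_cancel_right)
  then have BA: "cmod (B - A) \<le> 26 * ?k" using A1 B1 by simp
  have "?J / (?G w * ?G v) = A / B"
    using W V by (simp add: A_def B_def)
  then have "E_transform M w - E_transform M v = (w - v) * (1 - A / B)"
    using F by (simp add: E_transform_def algebra_simps)
  also have "1 - A / B = (B - A) / B" using B0 by (simp add: field_simps)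
  also have "cmod ((w - v) * ((B - A) / B)) \<le> cmod (w - v) * ((26 * ?k) / (1 / 4))"
    unfolding norm_mult norm_divide using BA Bn k0 by (intro mult_left_mono frac_le) auto
  finally show "cmod (E_transform M w - E_transform M v) \<le> 104 * ?k * cmod (w - v)" by (simp add: mult_ac)
qed

lemma kappa_small:
  assumes M: "finite_borel M" and e: "e > 0"
  shows "\<exists>\<beta>>0. kappa M \<beta> < e"
proof -
  have "(\<lambda>n. kappa M (real (Suc n))) \<longlonglongrightarrow> (\<integral>t. 0 \<partial>M)"
    unfolding kappa_def
  proof (rule integral_dominated_convergence[where w="\<lambda>_. 1"])
    show "(\<lambda>t. min 1 (\<bar>t\<bar> / real (Suc n))) \<in> borel_measurable M" for n
      by (rule finite_borelD(4)[OF M]) measurable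
    interpret finite_borel_measure M by fact
    show "integrable M (\<lambda>_. 1::real)" by simp
    show "AE t in M. (\<lambda>n. min 1 (\<bar>t\<bar> / real (Suc n))) \<longlonglongrightarrow> 0"
    proof (rule AE_I2)
      fix t :: real
      have "(\<lambda>n. min 1 (\<bar>t\<bar> * inverse (real (Suc n)))) \<longlonglongrightarrow> min 1 (\<bar>t\<bar> * 0)"
        by (intro tendsto_intros LIMSEQ_inverse_real_of_nat)
      then show "(\<lambda>n. min 1 (\<bar>t\<bar> / real (Suc n))) \<longlonglongrightarrow> 0" by (simp add: divide_inverse)
    qed
  qed auto
  then have "eventually (\<lambda>n. kappa M (real (Suc n)) < e) sequentially"
    using e by (intro order_tendstoD(2)[of _ 0]) auto
  then obtain n where "kappa M (real (Suc n)) < e" by (auto simp: eventually_sequentially)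
  then show ?thesis by (intro exI[of _ "real (Suc n)"]) auto
qed

lemma weakly_converges_kappa:
  assumes "weakly_converges X M" "0 < \<beta>"
  shows "(\<lambda>n. kappa (X n) \<beta>) \<longlonglongrightarrow> kappa M \<beta>"
proof -
  have "continuous_on UNIV (\<lambda>t::real. min 1 (\<bar>t\<bar> / \<beta>))"
    using assms(2) by (intro continuous_intros) auto
  moreover have "bounded (range (\<lambda>t::real. min 1 (\<bar>t\<bar> / \<beta>)))"
    using assms(2) by (intro boundedI[of _ 1]) auto
  ultimately show ?thesis
    using assms(1) unfolding weakly_converges_def kappa_def by blast
qed

text \<open>On the upper half-plane these are exactly the functions \<open>E_transform M\<close>; see \<open>E_transform_pick_class\<close> and \<open>pick_class_E_transform_ex1\<close>.\<close>
definition pick_class :: "(complex \<Rightarrow> complex) \<Rightarrow> bool" where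
  "pick_class E \<longleftrightarrow> E holomorphic_on uhp \<and> (\<forall>z\<in>uhp. Im (E z) \<le> 0) \<and>
     (\<forall>\<epsilon>>0. \<exists>\<beta>>0. cone_small E \<beta> \<epsilon>)"

lemma E_transform_pick_class:
  assumes M: "real_distribution M"
  shows "pick_class (E_transform M)"
  unfolding pick_class_def
proof (intro conjI ballI allI impI)
  show "E_transform M holomorphic_on uhp"
    unfolding E_transform_def by (intro holomorphic_intros F_transform_holomorphic[OF M])
  show "Im (E_transform M z) \<le> 0" if "z \<in> uhp" for z
    using Im_F_transform_ge[OF M that] by (simp add: E_transform_def)
  fix \<epsilon> :: real assume e: "\<epsilon> > 0"
  obtain \<beta> where b: "\<beta> > 0" "kappa M \<beta> < min (1 / 8) (\<epsilon> / 104)"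
    using kappa_small[OF real_distributionD(2)[OF M], of "min (1 / 8) (\<epsilon> / 104)"] e by auto
  have "cone_small (E_transform M) \<beta> \<epsilon>"
    using b by (intro cone_small_mono[OF E_transform_cone_small[OF M b(1)]]) auto
  then show "\<exists>\<beta>>0. cone_small (E_transform M) \<beta> \<epsilon>" using b(1) by blast
qed

section \<open>Weak convergence from convergence of Cauchy transforms\<close>

lemma tail_kernel_bounds: "y > 0 ==> 0 \<le> t^2 / (t^2 + y^2)" "y > 0 ==> t\<^sup>2 / (t^2 + y^2) \<le> (1::real)"
  by (auto simp: divide_le_eq_1 add_nonneg_pos)

lemma tail_kernel_integrable:
  assumes "finite_borel M" "y > 0"
  shows "integrable M (\<lambda>t. t^2 / (t^2 + y^2))"
  using tail_kernel_bounds[OF assms(2)]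
  by (intro integrable_bounded_borel[OF assms(1), where B=1]) auto

text \<open>The kernel is at least 1/2 for \<open>|t| > y\<close>.\<close>
lemma tight_seqI_kernel:
  assumes X: "\<And>n. finite_borel (X n)"
    and t: "\<And>e. e > 0 ==> \<exists>y>0. eventually (\<lambda>n. (\<integral>t. t^2 / (t^2 + y^2) \<partial>X n) \<le> e) sequentially"
  shows "tight_seq X"
  unfolding tight_seq_def
proof (intro allI impI)
  fix e :: real assume "e > 0"
  then obtain y where y: "y > 0"
     "eventually (\<lambda>n. (\<integral>t. t^2 / (t^2 + y^2) \<partial>X n) \<le> e / 2) sequentially"
    using t[of "e / 2"] by auto
  have "measure (X n) {x. \<bar>x\<bar> > y} \<le> 2 * (\<integral>t. t^2 / (t^2 + y^2) \<partial>X n)" for n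
  proof -
    interpret finite_borel_measure "X n" by (rule X)
    have m: "{x. \<bar>x\<bar> > y} \<in> sets (X n)" using finite_borelD(2)[OF X] by simp
    have "measure (X n) {x. \<bar>x\<bar> > y} = (\<integral>t. indicat_real {x. \<bar>x\<bar> > y} t \<partial>X n)"
      using finite_borelD(3)[OF X] m by simp
    also have "... \<le> (\<integral>t. 2 * (t^2 / (t^2 + y^2)) \<partial>X n)"
    proof (rule integral_mono)
      show "integrable (X n) (indicat_real {x. \<bar>x\<bar> > y})"
        using m by (intro integrable_real_indicator) (simp_all add: emeasure_eq_measure)
      show "integrable (X n) (\<lambda>t. 2 * (t^2 / (t^2 + y^2)))"
        by (intro integrable_mult_right tail_kernel_integrable[OF X y(1)])
      fix x :: real
      show "indicat_real {x. \<bar>x\<bar> > y} x \<le> 2 * (x^2 / (x^2 + y^2))"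
      proof (cases "\<bar>x\<bar> > y")
        case True
        then have "y^2 \<le> x^2" using y(1) by (simp add: abs_le_square_iff[symmetric])
        moreover have "x^2 + y^2 > 0" using y(1) by (simp add: add_nonneg_pos)
        ultimately show ?thesis using True by (simp add: le_divide_eq)
      next
        case False then show ?thesis using tail_kernel_bounds[OF y(1)] by simp
      qed
    qed
    finally show ?thesis unfolding integral_mult_right_zero .
  qed
  then have "eventually (\<lambda>n. measure (X n) {x. \<bar>x\<bar> > y} \<le> e) sequentially"
    using y(2) by (elim eventually_mono) (smt (verit) field_sum_of_halves)
  then show "\<exists>R>0. eventually (\<lambda>n. measure (X n) {x. \<bar>x\<bar> > R} \<le> e) sequentially"
    using y(1) by blast
qed

lemma tail_kernel_tendsto:
  assumes M: "finite_borel M"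
  shows "(\<lambda>n. \<integral>t. t^2 / (t^2 + (real (Suc n))^2) \<partial>M) \<longlonglongrightarrow> 0"
proof -
  have "(\<lambda>n. \<integral>t. t^2 / (t^2 + (real (Suc n))^2) \<partial>M) \<longlonglongrightarrow> (\<integral>t. 0 \<partial>M)"
  proof (rule integral_dominated_convergence[where w="\<lambda>_. 1"])
    show "(\<lambda>t. t^2 / (t^2 + (real (Suc n))^2)) \<in> borel_measurable M" for n
      by (rule finite_borelD(4)[OF M]) measurable
    interpret finite_borel_measure M by fact
    show "integrable M (\<lambda>_. 1::real)" by simp
    show "AE t in M. (\<lambda>n. t^2 / (t^2 + (real (Suc n))^2)) \<longlonglongrightarrow> 0"
    proof (rule AE_I2)
      fix t :: real
      show "(\<lambda>n. t^2 / (t^2 + (real (Suc n))^2)) \<longlonglongrightarrow> 0" by real_asymp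
    qed
    show "AE t in M. norm (t^2 / (t^2 + (real (Suc n))^2)) \<le> 1" for n
      using tail_kernel_bounds[of "real (Suc n)"] by (intro AE_I2) simp
  qed auto
  then show ?thesis by simp
qed

lemma Re_cauchy_transform_imaginary:
  assumes M: "finite_borel M" and y: "y > 0"
  shows "Re (Complex 0 y * cauchy_transform M (Complex 0 y))
    = measure M UNIV - (\<integral>t. t^2 / (t^2 + y^2) \<partial>M)"
proof -
  interpret finite_borel_measure M by fact
  have u: "Complex 0 y \<in> uhp" using y by (simp add: uhp_iff)
  have "Re (Complex 0 y * cauchy_transform M (Complex 0 y)) = - y * Im (cauchy_transform M (Complex 0 y))"
    by simp
  also have "... = y * (\<integral>t. y / (t^2 + y^2) \<partial>M)"
    using Im_cauchy_transform[OF M u] by simp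
  also have "... = (\<integral>t. y * (y / (t^2 + y^2)) \<partial>M)"
    by (rule integral_mult_right_zero[symmetric])
  also have "... = (\<integral>t. 1 - t^2 / (t^2 + y^2) \<partial>M)"
  proof (rule Bochner_Integration.integral_cong[OF refl])
    fix t :: real
    have "t^2 + y^2 \<noteq> 0" using y by (simp add: sum_power2_eq_zero_iff)
    then show "y * (y / (t^2 + y^2)) = 1 - t^2 / (t^2 + y^2)"
      by (simp add: field_simps power2_eq_square)
  qed
  also have "... = measure M UNIV - (\<integral>t. t^2 / (t^2 + y^2) \<partial>M)"
    using tail_kernel_integrable[OF M y] finite_borelD(3)[OF M] by simp
  finally show ?thesis .
qed

lemma open_truncated_cone: "open (tcone \<alpha> \<beta>)"
  unfolding truncated_cone_def
  by (intro open_Collect_conj open_Collect_less continuous_intros)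

lemma truncated_cone_imaginary: "\<alpha> > 0 ==> y > \<beta> ==> y > 0 ==> Complex 0 y \<in> tcone \<alpha> \<beta>"
  by (simp add: truncated_cone_def)

lemma truncated_cone_nonempty: "\<alpha> > 0 ==> tcone \<alpha> \<beta> \<noteq> {}"
  using truncated_cone_imaginary[of \<alpha> \<beta> "max 1 (\<beta> + 1)"] by (auto simp: less_max_iff_disj)

text \<open>Tightness comes for free because the limit is a probability measure:
\<open>Re (iy G(iy))\<close> is the total mass minus the integral of the tail kernel.\<close>
lemma weakly_converges_of_cauchy_cone:
  assumes X: "\<And>n. real_distribution (X n)" and M: "real_distribution M"
    and a: "\<alpha> > 0" and b: "\<beta> \<ge> 0"
    and lim: "\<And>z. z \<in> tcone \<alpha> \<beta> ==> (\<lambda>n. cauchy_transform (X n) z) \<longlonglongrightarrow> cauchy_transform M z"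
  shows "weakly_converges X M"
proof (rule weakly_convergesI_tight)
  note Xf = real_distributionD(2)[OF X] and Mf = real_distributionD(2)[OF M]
  show "finite_borel (X n)" "measure (X n) UNIV \<le> 1" for n
    using Xf real_distributionD(5)[OF X] by auto
  show "tight_seq X"
  proof (rule tight_seqI_kernel[OF Xf])
    fix e :: real assume e: "e > 0"
    have "eventually (\<lambda>n. (\<integral>t. t^2 / (t^2 + (real (Suc n))^2) \<partial>M) < e / 2) sequentially"
      using order_tendstoD(2)[OF tail_kernel_tendsto[OF Mf], of "e / 2"] e by simp
    moreover have "eventually (\<lambda>n. real (Suc n) > \<beta>) sequentially" by real_asymp
    ultimately have "eventually (\<lambda>n. (\<integral>t. t^2 / (t^2 + (real (Suc n))^2) \<partial>M) < e / 2 \<and> real (Suc n) > \<beta>) sequentially"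
      by (rule eventually_conj)
    then obtain m where m: "(\<integral>t. t^2 / (t^2 + (real (Suc m))^2) \<partial>M) < e / 2" "real (Suc m) > \<beta>"
      by (auto simp: eventually_sequentially)
    define y where "y = real (Suc m)"
    have y: "y > 0" "y > \<beta>" "(\<integral>t. t^2 / (t^2 + y^2) \<partial>M) < e / 2" using m by (auto simp: y_def)
    have "(\<lambda>n. Re (Complex 0 y * cauchy_transform (X n) (Complex 0 y)))
       \<longlonglongrightarrow> Re (Complex 0 y * cauchy_transform M (Complex 0 y))"
      using lim[OF truncated_cone_imaginary[OF a y(2,1)]] by (intro tendsto_intros)
    then have "(\<lambda>n. \<integral>t. t^2 / (t^2 + y^2) \<partial>X n) \<longlonglongrightarrow> (\<integral>t. t^2 / (t^2 + y^2) \<partial>M)"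
      unfolding Re_cauchy_transform_imaginary[OF Xf y(1)] Re_cauchy_transform_imaginary[OF Mf y(1)]
        real_distributionD(5)[OF X] real_distributionD(5)[OF M]
      using tendsto_diff[OF tendsto_const[of 1]] by fastforce
    then have "eventually (\<lambda>n. (\<integral>t. t^2 / (t^2 + y^2) \<partial>X n) < e) sequentially"
      using y(3) e by (intro order_tendstoD(2)[of _ "\<integral>t. t^2 / (t^2 + y^2) \<partial>M"]) auto
    then show "\<exists>y>0. eventually (\<lambda>n. (\<integral>t. t^2 / (t^2 + y^2) \<partial>X n) \<le> e) sequentially"
      using y(1) by (intro exI[of _ y] conjI) (auto elim: eventually_mono)
  qed
  fix r :: "nat \<Rightarrow> nat" and N
  assume r: "strict_mono r" and N: "finite_borel N" and W: "weakly_converges (X \<circ> r) N"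
  show "N = M"
  proof (rule cauchy_transform_determines_open[OF N Mf open_truncated_cone truncated_cone_nonempty[OF a]
        truncated_cone_uhp[OF b]])
    fix z assume z: "z \<in> tcone \<alpha> \<beta>"
    then have u: "z \<in> uhp" using truncated_cone_uhp[OF b] by blast
    have "(\<lambda>n. cauchy_transform ((X \<circ> r) n) z) \<longlonglongrightarrow> cauchy_transform N z"
      using Xf by (intro weakly_converges_cauchy[OF W _ N u]) auto
    moreover have "(\<lambda>n. cauchy_transform ((X \<circ> r) n) z) \<longlonglongrightarrow> cauchy_transform M z"
      using LIMSEQ_subseq_LIMSEQ[OF lim[OF z] r] by (simp add: o_def)
    ultimately show "cauchy_transform N z = cauchy_transform M z" by (rule LIMSEQ_unique)
  qed
qed

section \<open>The Herglotz representation\<close>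

definition turn :: "real \<Rightarrow> complex" where "turn x = exp (2 * of_real pi * \<i> * of_real x)"

lemma norm_turn [simp]: "cmod (turn x) = 1"
proof -
  have "turn x = exp (\<i> * of_real (2 * pi * x))" by (simp add: turn_def mult_ac)
  then show ?thesis by (simp only: norm_exp_i_times)
qed

lemma turn_nz [simp]: "turn x \<noteq> 0"
  by (simp add: turn_def)

lemma continuous_turn: "continuous_on A turn"
  unfolding turn_def by (intro continuous_intros)

lemma measurable_turn [measurable]: "turn \<in> borel_measurable borel"
  by (rule borel_measurable_continuous_onI[OF continuous_turn])

lemma turn_diff_bound: "1 - cmod w \<le> cmod (turn x - w)"
  using norm_triangle_ineq2[of "turn x" w] by simp

lemma cauchy_formula_turn:
  assumes f: "f holomorphic_on cball 0 1" and w: "cmod w < 1"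
  shows "((\<lambda>x. f (turn x) * turn x / (turn x - w)) has_integral f w) {0..1}"
proof -
  have "((\<lambda>u. f u / (u - w)) has_contour_integral (2 * of_real pi * \<i> * f w)) (circlepath 0 1)"
    using w by (intro Cauchy_integral_circlepath_simple[OF f]) auto
  then have "((\<lambda>x. f (circlepath 0 1 x) / (circlepath 0 1 x - w)
      * vector_derivative (circlepath 0 1) (at x within {0..1})) has_integral (2 * of_real pi * \<i> * f w)) {0..1}"
    unfolding has_contour_integral_def .
  then have "((\<lambda>x. (2 * of_real pi * \<i>) * (f (turn x) * turn x / (turn x - w)))
      has_integral (2 * of_real pi * \<i> * f w)) {0..1}"
  proof (rule has_integral_eq[rotated])
    fix x :: real assume "x \<in> {0..1}"
    then have "vector_derivative (circlepath 0 1) (at x within {0..1}) = 2 * of_real pi * \<i> * turn x"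
      by (subst vector_derivative_circlepath01) (auto simp: turn_def)
    moreover have "circlepath 0 1 x = turn x" by (simp add: circlepath turn_def)
    ultimately show "f (circlepath 0 1 x) / (circlepath 0 1 x - w)
      * vector_derivative (circlepath 0 1) (at x within {0..1})
      = (2 * of_real pi * \<i>) * (f (turn x) * turn x / (turn x - w))"
      by simp
  qed
  note key = this
  define c where "c = 2 * of_real pi * \<i>"
  have c: "c \<noteq> 0" by (simp add: c_def)
  have "((\<lambda>x. c * (f (turn x) * turn x / (turn x - w))) has_integral (c * f w)) {0..1}"
    using key unfolding c_def .
  then have "((\<lambda>x. inverse c * (c * (f (turn x) * turn x / (turn x - w)))) has_integral (inverse c * (c * f w))) {0..1}"
    by (rule has_integral_mult_right)
  moreover have "inverse c * (c * u) = u" for u using c by simp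
  ultimately show ?thesis by (simp only:)
qed

text \<open>Cauchy's formula for \<open>f\<close> at \<open>w\<close> plus the conjugate of the formula for \<open>f(u)/(1 - cnj w u)\<close> at 0; on
the circle the sum involves \<open>Re f\<close> only.\<close>
lemma herglotz_circle:
  assumes f: "f holomorphic_on cball 0 1" and w: "cmod w < 1"
  shows "((\<lambda>x. of_real (Re (f (turn x))) * (2 * turn x / (turn x - w))) has_integral (f w + cnj (f 0))) {0..1}"
proof -
  have nz: "1 - cnj w * u \<noteq> 0" if "u \<in> cball 0 1" for u
  proof
    assume "1 - cnj w * u = 0"
    then have "cmod (cnj w * u) = 1" by (metis eq_iff_diff_eq_0 norm_one)
    moreover have "cmod (cnj w * u) \<le> cmod w * 1"
      unfolding norm_mult using that by (intro mult_mono) auto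
    ultimately show False using w by simp
  qed
  have "(\<lambda>u. f u / (1 - cnj w * u)) holomorphic_on cball 0 1"
    using nz by (intro holomorphic_intros f) auto
  from cauchy_formula_turn[OF this, of 0]
  have "((\<lambda>x. f (turn x) / (1 - cnj w * turn x)) has_integral f 0) {0..1}" by simp
  then have "((cnj \<circ> (\<lambda>x. f (turn x) / (1 - cnj w * turn x))) has_integral cnj (f 0)) {0..1}"
    by (simp only: has_integral_cnj)
  then have "((\<lambda>x. cnj (f (turn x) / (1 - cnj w * turn x))) has_integral cnj (f 0)) {0..1}"
    by (simp only: o_def)
  moreover have "cnj (f (turn x) / (1 - cnj w * turn x)) = cnj (f (turn x)) * turn x / (turn x - w)" for x
  proof -
    have 1: "cnj (turn x) * turn x = 1"
      using complex_norm_square[of "turn x"] by (simp add: mult.commute)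
    have "turn x - w = (1 - w * cnj (turn x)) * turn x" using 1 by (simp add: algebra_simps)
    then have "cnj (f (turn x)) * turn x / (turn x - w) = cnj (f (turn x)) / (1 - w * cnj (turn x))" by simp
    then show ?thesis by simp
  qed
  ultimately have "((\<lambda>x. cnj (f (turn x)) * turn x / (turn x - w)) has_integral cnj (f 0)) {0..1}" by simp
  from has_integral_add[OF cauchy_formula_turn[OF f w] this]
  show ?thesis
  proof (rule has_integral_eq[rotated])
    fix x
    have "f (turn x) + cnj (f (turn x)) = of_real (2 * Re (f (turn x)))" by (rule complex_add_cnj)
    then have "(f (turn x) + cnj (f (turn x))) * (turn x / (turn x - w))
      = of_real (2 * Re (f (turn x))) * (turn x / (turn x - w))" by simp
    then show "f (turn x) * turn x / (turn x - w) + cnj (f (turn x)) * turn x / (turn x - w)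
      = of_real (Re (f (turn x))) * (2 * turn x / (turn x - w))"
      by (simp add: algebra_simps add_divide_distrib)
  qed
qed

lemma herglotz_circle_measure:
  assumes f: "f holomorphic_on cball 0 1" and pos: "\<And>u. u \<in> cball 0 1 ==> Re (f u) \<ge> 0" and A: "Re (f 0) > 0"
  shows "\<exists>P. real_distribution P \<and> measure P {0..1} = 1 \<and>
    (\<forall>w. cmod w < 1 \<longrightarrow> f w + cnj (f 0) = of_real (Re (f 0)) * (\<integral>x. 2 * turn x / (turn x - w) \<partial>P))"
proof -
  define d where "d x = indicat_real {0..1} x * (Re (f (turn x)) / Re (f 0))" for x
  have fc: "continuous_on UNIV (\<lambda>x. f (turn x))"
    using holomorphic_on_imp_continuous_on[OF f]
    by (intro continuous_on_compose2[OF _ continuous_turn]) auto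
  have [measurable]: "(\<lambda>x. f (turn x)) \<in> borel_measurable borel"
    by (rule borel_measurable_continuous_onI[OF fc])
  have [measurable]: "d \<in> borel_measurable borel" unfolding d_def by measurable
  have d0: "d x \<ge> 0" for x using pos[of "turn x"] A by (auto simp: d_def)
  define P where "P = density lborel (\<lambda>x. ennreal (d x))"
  have leb: "(\<integral>x. d x *\<^sub>R g x \<partial>lborel) = integral {0..1} (\<lambda>x. of_real (Re (f (turn x)) / Re (f 0)) * g x)"
    if g: "continuous_on UNIV g" for g :: "real \<Rightarrow> complex"
  proof -
    have "continuous_on {0..1} (\<lambda>x. of_real (Re (f (turn x)) / Re (f 0)) * g x)"
      using A continuous_on_subset[OF fc] continuous_on_subset[OF g] by (intro continuous_intros) auto
    from borel_integrable_atLeastAtMost'[OF this]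
    have "(LINT x:{0..1}|lborel. of_real (Re (f (turn x)) / Re (f 0)) * g x)
      = integral {0..1} (\<lambda>x. of_real (Re (f (turn x)) / Re (f 0)) * g x)"
      by (rule set_borel_integral_eq_integral(2))
    note A1 = this
    have B1: "(LINT x:{0..1}|lborel. of_real (Re (f (turn x)) / Re (f 0)) * g x) = (\<integral>x. d x *\<^sub>R g x \<partial>lborel)"
      unfolding set_lebesgue_integral_def d_def
      by (intro Bochner_Integration.integral_cong) (auto simp: indicator_def scaleR_conv_of_real)
    show ?thesis by (rule trans[OF B1[symmetric] A1])
  qed
  have intP: "(\<integral>x. g x \<partial>P) = integral {0..1} (\<lambda>x. of_real (Re (f (turn x)) / Re (f 0)) * g x)"
    if g: "continuous_on UNIV g" for g :: "real \<Rightarrow> complex"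
    unfolding P_def leb[OF g, symmetric] using d0 borel_measurable_continuous_onI[OF g]
    by (subst integral_density) auto
  have kern: "(\<integral>x. 2 * turn x / (turn x - w) \<partial>P) = (f w + cnj (f 0)) / of_real (Re (f 0))"
    if w: "cmod w < 1" for w
  proof -
    have "turn x - w \<noteq> 0" for x using turn_diff_bound[of w x] w by auto
    then have "continuous_on UNIV (\<lambda>x. 2 * turn x / (turn x - w))"
      by (intro continuous_intros continuous_turn) auto
    from intP[OF this] have "(\<integral>x. 2 * turn x / (turn x - w) \<partial>P)
       = integral {0..1} (\<lambda>x. of_real (Re (f (turn x)) / Re (f 0)) * (2 * turn x / (turn x - w)))" .
    also have "... = integral {0..1} (\<lambda>x. (of_real (Re (f (turn x))) * (2 * turn x / (turn x - w))) * inverse (of_real (Re (f 0))))"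
      by (intro integral_cong) (simp add: divide_inverse)
    also have "... = (f w + cnj (f 0)) * inverse (of_real (Re (f 0)))"
      by (intro integral_unique has_integral_mult_left herglotz_circle[OF f w])
    finally show ?thesis by (simp add: divide_inverse)
  qed
  have dint: "integrable lborel d"
  proof -
    have "continuous_on {0..1} (\<lambda>x. Re (f (turn x)) / Re (f 0))"
      using A continuous_on_subset[OF fc] by (intro continuous_intros) auto
    from borel_integrable_atLeastAtMost'[OF this] show ?thesis
      unfolding set_integrable_def d_def by simp
  qed
  have em: "emeasure P B = ennreal (\<integral>x. d x * indicat_real B x \<partial>lborel)" if [measurable]: "B \<in> sets borel" for B
  proof -
    have "emeasure P B = (\<integral>\<^sup>+x. ennreal (d x) * indicator B x \<partial>lborel)"
      unfolding P_def by (subst emeasure_density) auto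
    also have "... = (\<integral>\<^sup>+x. ennreal (d x * indicat_real B x) \<partial>lborel)"
      by (intro nn_integral_cong) (auto simp: indicator_def)
    also have "... = ennreal (\<integral>x. d x * indicat_real B x \<partial>lborel)"
      using d0 integrable_real_mult_indicator[OF _ dint, of B]
      by (intro nn_integral_eq_integral) (auto simp: mult.commute)
    finally show ?thesis .
  qed
  have "(\<integral>x. (1::complex) \<partial>P) = 1"
  proof -
    have "(\<integral>x. (1::complex) \<partial>P) = (\<integral>x. 2 * turn x / (turn x - 0) \<partial>P) / 2" by simp
    also have "(\<integral>x. 2 * turn x / (turn x - 0) \<partial>P) = (f 0 + cnj (f 0)) / of_real (Re (f 0))"
      by (rule kern) simp
    also have "f 0 + cnj (f 0) = of_real (2 * Re (f 0))" by (rule complex_add_cnj)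
    finally show ?thesis using A by simp
  qed
  also have "(\<integral>x. (1::complex) \<partial>P) = (\<integral>x. d x *\<^sub>R (1::complex) \<partial>lborel)"
    unfolding P_def using d0 by (subst integral_density) auto
  also have "... = of_real (\<integral>x. d x \<partial>lborel)"
    by (simp add: scaleR_conv_of_real)
  finally have d1: "(\<integral>x. d x \<partial>lborel) = 1" using of_real_eq_1_iff by blast
  have "emeasure P UNIV = 1" using em[of UNIV] d1 by simp
  then have "real_distribution P"
    by (auto simp: real_distribution_def real_distribution_axioms_def P_def intro!: prob_spaceI)
  moreover have "measure P {0..1} = 1"
  proof -
    have "(\<integral>x. d x * indicat_real {0..1} x \<partial>lborel) = (\<integral>x. d x \<partial>lborel)"
      by (intro Bochner_Integration.integral_cong) (auto simp: d_def indicator_def)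
    then show ?thesis using em[of "{0..1}"] d1 by (simp add: measure_def)
  qed
  ultimately show ?thesis using kern A by (intro exI[of _ P]) auto
qed

text \<open>Apply the previous lemma to the dilations \<open>h(r\<^sub>n w)\<close> and pass to a weak limit on the compact circle.\<close>
lemma herglotz:
  assumes h: "h holomorphic_on ball 0 1" and pos: "\<And>u. u \<in> ball 0 1 ==> Re (h u) \<ge> 0" and A: "Re (h 0) > 0"
  shows "\<exists>P. real_distribution P \<and>
    (\<forall>w\<in>ball 0 1. h w + cnj (h 0) = of_real (Re (h 0)) * (\<integral>x. 2 * turn x / (turn x - w) \<partial>P))"
proof -
  define r where "r n = 1 - inverse (real (Suc n))" for n
  have r: "0 \<le> r n" "r n < 1" for n
    by (auto simp: r_def divide_simps)
  have rlim: "r \<longlonglongrightarrow> 1"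
  proof -
    have "(\<lambda>n. 1 - inverse (real (Suc n))) \<longlonglongrightarrow> 1 - 0"
      by (intro tendsto_intros LIMSEQ_inverse_real_of_nat)
    then show ?thesis by (simp add: r_def[abs_def])
  qed
  have inb: "of_real (r n) * u \<in> ball (0::complex) 1" if "u \<in> cball 0 1" for n and u :: complex
  proof -
    have "cmod (of_real (r n) * u) \<le> r n * 1"
      unfolding norm_mult using r[of n] that by (intro mult_mono) auto
    then show ?thesis using r(2)[of n] by simp
  qed
  have "\<exists>P. real_distribution P \<and> measure P {0..1} = 1 \<and>
    (\<forall>w. cmod w < 1 \<longrightarrow> h (of_real (r n) * w) + cnj (h 0) = of_real (Re (h 0)) * (\<integral>x. 2 * turn x / (turn x - w) \<partial>P))" for n
  proof -
    have "(h \<circ> (\<lambda>u. of_real (r n) * u)) holomorphic_on cball 0 1"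
      using inb by (intro holomorphic_on_compose holomorphic_intros holomorphic_on_subset[OF h]) auto
    from herglotz_circle_measure[OF this] show ?thesis using pos inb A by auto
  qed
  then obtain P where P: "\<And>n. real_distribution (P n)" "\<And>n. measure (P n) {0..1} = 1"
    "\<And>n w. cmod w < 1 ==> h (of_real (r n) * w) + cnj (h 0) = of_real (Re (h 0)) * (\<integral>x. 2 * turn x / (turn x - w) \<partial>P n)"
    by metis
  have "tight_seq P"
    unfolding tight_seq_def
  proof (intro allI impI exI[of _ 1] conjI always_eventually)
    fix e :: real and n assume e: "e > 0"
    interpret real_distribution "P n" by (rule P)
    have "measure (P n) {x. \<bar>x\<bar> > 1} \<le> measure (P n) (UNIV - {0..1})"
      by (intro finite_measure_mono) auto
    also have "... = 0" using prob_compl[of "{0..1}"] P(2)[of n] by simp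
    finally show "measure (P n) {x. \<bar>x\<bar> > 1} \<le> e" using e by simp
  qed auto
  from tight_seq_compact[OF real_distributionD(2)[OF P(1)] _ this, of 1]
  obtain s Q where s: "strict_mono (s :: nat \<Rightarrow> nat)" "finite_borel Q" "weakly_converges (P \<circ> s) Q"
    using real_distributionD(5)[OF P(1)] by auto
  have "measure Q UNIV = 1"
    using weakly_converges_mass[OF s(3) _ s(2)] real_distributionD(2,5)[OF P(1)]
    by (simp add: LIMSEQ_const_iff)
  then have Q: "real_distribution Q" by (rule real_distributionI_mass[OF s(2)])
  have "h w + cnj (h 0) = of_real (Re (h 0)) * (\<integral>x. 2 * turn x / (turn x - w) \<partial>Q)" if w: "w \<in> ball 0 1" for w
  proof -
    have nz: "turn x - w \<noteq> 0" for x using turn_diff_bound[of w x] w by auto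
    have "(\<lambda>n. \<integral>x. 2 * turn x / (turn x - w) \<partial>(P \<circ> s) n) \<longlonglongrightarrow> (\<integral>x. 2 * turn x / (turn x - w) \<partial>Q)"
    proof (rule weakly_converges_complex[OF s(3) _ s(2)])
      show "finite_borel ((P \<circ> s) n)" for n using real_distributionD(2)[OF P(1)] by simp
      show "continuous_on UNIV (\<lambda>x. 2 * turn x / (turn x - w))"
        using nz by (intro continuous_intros continuous_turn) auto
      show "norm (2 * turn x / (turn x - w)) \<le> 2 / (1 - cmod w)" for x
        using turn_diff_bound[of w x] w by (auto simp: norm_divide norm_mult intro!: divide_left_mono mult_pos_pos)
    qed
    then have 1: "(\<lambda>n. of_real (Re (h 0)) * (\<integral>x. 2 * turn x / (turn x - w) \<partial>(P \<circ> s) n)) \<longlonglongrightarrow>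
       of_real (Re (h 0)) * (\<integral>x. 2 * turn x / (turn x - w) \<partial>Q)"
      by (intro tendsto_intros)
    have "(\<lambda>n. of_real (r (s n)) * w) \<longlonglongrightarrow> of_real 1 * w"
      using LIMSEQ_subseq_LIMSEQ[OF rlim s(1)] by (intro tendsto_intros) (simp add: o_def)
    moreover have "isCont h w"
      using holomorphic_on_imp_continuous_on[OF h] w by (simp add: continuous_on_eq_continuous_at)
    ultimately have "(\<lambda>n. h (of_real (r (s n)) * w)) \<longlonglongrightarrow> h w"
      by (intro isCont_tendsto_compose[of w h]) auto
    then have "(\<lambda>n. h (of_real (r (s n)) * w) + cnj (h 0)) \<longlonglongrightarrow> h w + cnj (h 0)"
      by (intro tendsto_intros)
    then have 2: "(\<lambda>n. of_real (Re (h 0)) * (\<integral>x. 2 * turn x / (turn x - w) \<partial>(P \<circ> s) n)) \<longlonglongrightarrow> h w + cnj (h 0)"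
      using P(3)[of w] w by simp
    show ?thesis by (rule LIMSEQ_unique[OF 2 1])
  qed
  then show ?thesis using Q by blast
qed

section \<open>Which functions are reciprocal Cauchy transforms\<close>

text \<open>The real point corresponding to the boundary point \<open>turn x\<close> of the disc under the Cayley transform.\<close>
definition turn_pt :: "real \<Rightarrow> real" where
  "turn_pt x = Re (\<i> * (1 + turn x) / (1 - turn x))"

lemma measurable_turn_pt [measurable]: "turn_pt \<in> borel_measurable borel"
  unfolding turn_pt_def by measurable

lemma turn_pt:
  assumes "turn x \<noteq> 1"
  shows "turn x = (of_real (turn_pt x) - \<i>) / (of_real (turn_pt x) + \<i>)"
proof -
  let ?e = "turn x" and ?s = "\<i> * (1 + turn x) / (1 - turn x)"
  have nz: "1 - ?e \<noteq> 0" "?e \<noteq> 0" using assms by auto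
  have ee: "cnj ?e = 1 / ?e"
    using complex_norm_square[of ?e] nz by (simp add: field_simps)
  have "cnj ?s = (- \<i>) * (1 + cnj ?e) / (1 - cnj ?e)" by simp
  also have "... = ?s" unfolding ee using nz by (simp add: divide_simps) (simp add: algebra_simps)
  finally have "?s \<in> \<real>" by (simp add: Reals_cnj_iff)
  then have s: "of_real (turn_pt x) = ?s" by (simp add: turn_pt_def)
  have 1: "?s - \<i> = 2 * \<i> * ?e / (1 - ?e)" "?s + \<i> = 2 * \<i> / (1 - ?e)"
    using nz by (simp_all add: divide_simps) (simp_all add: algebra_simps)
  show ?thesis unfolding s 1 using nz by simp
qed

text \<open>The Poisson kernel of the disc, transported to the half-plane; \<open>turn x = 1\<close> is the point at infinity.\<close>
definition hkernel :: "complex \<Rightarrow> real \<Rightarrow> real" where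
  "hkernel z x = (if turn x = 1 then Im z
     else (1 + (turn_pt x)^2) * (Im z / ((Re z - turn_pt x)^2 + (Im z)^2)))"

lemma herglotz_kernel_half_plane:
  assumes z: "z \<in> uhp" and w: "w = (z - \<i>) / (z + \<i>)"
  shows "Re (2 * turn x / (turn x - w)) - 1 = hkernel z x"
proof -
  let ?e = "turn x"
  have Iz: "Im z > 0" using z by (simp add: uhp_iff)
  have zi: "z + \<i> \<noteq> 0" using Iz by (auto simp: complex_eq_iff)
  show ?thesis
  proof (cases "?e = 1")
    case True
    have 1: "1 - w = 2 * \<i> / (z + \<i>)" unfolding w using zi by (simp add: field_simps)
    have "2 * ?e / (?e - w) = 2 / (2 * \<i> / (z + \<i>))" by (simp only: True 1 mult_1_right)
    then have "2 * ?e / (?e - w) = (z + \<i>) / \<i>" by simp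
    then show ?thesis using True by (simp add: hkernel_def Re_divide)
  next
    case False
    define t where "t = turn_pt x"
    have e: "?e = (of_real t - \<i>) / (of_real t + \<i>)" unfolding t_def by (rule turn_pt[OF False])
    have ti: "of_real t + \<i> \<noteq> 0" by (auto simp: complex_eq_iff)
    have tz: "of_real t - z \<noteq> 0" using Iz by (auto simp: complex_eq_iff)
    have "?e - w = 2 * \<i> * (of_real t - z) / ((of_real t + \<i>) * (z + \<i>))"
      unfolding e w using ti zi by (simp add: divide_simps) (simp add: algebra_simps)
    then have "2 * ?e / (?e - w) = 2 * ((of_real t - \<i>) / (of_real t + \<i>)) / (2 * \<i> * (of_real t - z) / ((of_real t + \<i>) * (z + \<i>)))"
      using e by simp
    also have "... = (of_real t - \<i>) * (z + \<i>) / (\<i> * (of_real t - z))"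
      using ti zi tz by (simp add: divide_simps) (simp add: algebra_simps)
    also have "... = (of_real t - \<i>) * (z + \<i>) * (- \<i>) * cnj (of_real t - z) / of_real ((t - Re z)^2 + (Im z)^2)"
    proof -
      have q: "of_real ((t - Re z)^2 + (Im z)^2) = (of_real t - z) * cnj (of_real t - z)"
        unfolding complex_eq_iff
        by (simp add: power2_eq_square algebra_simps del: of_real_add of_real_power of_real_diff of_real_mult)
      have nz: "cnj (of_real t - z) \<noteq> 0" using tz by (simp only: complex_cnj_zero_iff) auto
      have "(of_real t - \<i>) * (z + \<i>) * (- \<i>) * cnj (of_real t - z) / of_real ((t - Re z)^2 + (Im z)^2)
        = (of_real t - \<i>) * (z + \<i>) * (- \<i>) / (of_real t - z)"
        unfolding q by (rule nonzero_mult_divide_mult_cancel_right[OF nz])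
      also have "... = (of_real t - \<i>) * (z + \<i>) / (\<i> * (of_real t - z))"
        using tz by (simp add: divide_simps) (simp add: algebra_simps)
      finally show ?thesis by simp
    qed
    finally have "Re (2 * ?e / (?e - w)) = Re ((of_real t - \<i>) * (z + \<i>) * (- \<i>) * cnj (of_real t - z)) / ((t - Re z)^2 + (Im z)^2)"
      by (simp only: Re_divide_of_real)
    moreover have "Re ((of_real t - \<i>) * (z + \<i>) * (- \<i>) * cnj (of_real t - z))
      = ((t - Re z)^2 + (Im z)^2) + (1 + t^2) * Im z"
      by (simp add: power2_eq_square algebra_simps)
    moreover have "(t - Re z)^2 + (Im z)^2 > 0" using Iz by (simp add: add_nonneg_pos)
    ultimately have "Re (2 * ?e / (?e - w)) - 1 = (1 + t^2) * Im z / ((t - Re z)^2 + (Im z)^2)"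
      using Iz by (simp add: add_divide_distrib)
    then show ?thesis using False by (simp add: hkernel_def t_def power2_commute)
  qed
qed

lemma pick_herglotz:
  assumes G: "G holomorphic_on uhp" and neg: "\<And>z. z \<in> uhp ==> Im (G z) < 0"
  shows "\<exists>P. real_distribution P \<and> (\<forall>z\<in>uhp. integrable P (hkernel z) \<and> - Im (G z) = - Im (G \<i>) * (\<integral>x. hkernel z x \<partial>P))"
proof -
  define c where "c w = \<i> * (1 + w) / (1 - w)" for w :: complex
  define h where "h w = \<i> * G (c w)" for w
  have cI: "c w \<in> uhp" if "w \<in> ball 0 1" for w
  proof -
    have "w \<noteq> 1" using that by auto
    then have nz: "cmod (1 - w) > 0" by simp
    have cz: "cnj (1 - w) \<noteq> 0" using nz by (simp only: complex_cnj_zero_iff) auto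
    have "c w = \<i> * ((1 + w) * cnj (1 - w)) / of_real ((cmod (1 - w))^2)"
      unfolding c_def complex_norm_square mult.assoc[symmetric]
      by (rule nonzero_mult_divide_mult_cancel_right[OF cz, symmetric])
    then have "Im (c w) = Re ((1 + w) * cnj (1 - w)) / (cmod (1 - w))^2"
      by (simp only: Im_divide_of_real Im_i_times)
    also have "Re ((1 + w) * cnj (1 - w)) = 1 - (cmod w)^2"
      unfolding cmod_power2 by (simp add: power2_eq_square algebra_simps)
    finally have e: "Im (c w) = (1 - (cmod w)^2) / (cmod (1 - w))^2" .
    have "(cmod w)^2 < 1" using that by (simp add: power_less_one_iff)
    then have "Im (c w) > 0" unfolding e using nz by (intro divide_pos_pos) auto
    then show ?thesis by (simp add: uhp_iff)
  qed
  have "c holomorphic_on ball 0 1"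
    unfolding c_def by (intro holomorphic_intros) auto
  then have "(G \<circ> c) holomorphic_on ball 0 1"
    using cI by (intro holomorphic_on_compose holomorphic_on_subset[OF G]) auto
  then have hh: "h holomorphic_on ball 0 1"
    unfolding h_def[abs_def] by (intro holomorphic_intros) (simp add: o_def)
  have Re_h: "Re (h w) = - Im (G (c w))" for w by (simp add: h_def)
  have c0: "c 0 = \<i>" by (simp add: c_def)
  have "\<exists>P. real_distribution P \<and>
    (\<forall>w\<in>ball 0 1. h w + cnj (h 0) = of_real (Re (h 0)) * (\<integral>x. 2 * turn x / (turn x - w) \<partial>P))"
    by (rule herglotz[OF hh]) (use neg cI in \<open>auto simp: Re_h less_imp_le\<close>)
  then obtain P where P: "real_distribution P"
    "\<And>w. w \<in> ball 0 1 ==> h w + cnj (h 0) = of_real (Re (h 0)) * (\<integral>x. 2 * turn x / (turn x - w) \<partial>P)"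
    by blast
  interpret real_distribution P by (rule P)
  have "integrable P (hkernel z) \<and> - Im (G z) = - Im (G \<i>) * (\<integral>x. hkernel z x \<partial>P)" if z: "z \<in> uhp" for z
  proof -
    define w where "w = (z - \<i>) / (z + \<i>)"
    have Iz: "Im z > 0" using z by (simp add: uhp_iff)
    have zi: "z + \<i> \<noteq> 0" using Iz by (auto simp: complex_eq_iff)
    have "(cmod (z - \<i>))^2 < (cmod (z + \<i>))^2"
      using Iz unfolding cmod_power2 by (simp add: power2_eq_square algebra_simps)
    then have "cmod (z - \<i>) < cmod (z + \<i>)" using power2_less_imp_less norm_ge_zero by blast
    then have wb: "w \<in> ball 0 1" using zi by (simp add: w_def norm_divide divide_simps)
    have cw: "c w = z"
    proof -
      have "1 - w = 2 * \<i> / (z + \<i>)" "1 + w = 2 * z / (z + \<i>)"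
        unfolding w_def using zi by (simp_all add: field_simps)
      then show ?thesis unfolding c_def using zi by simp
    qed
    have int: "integrable P (\<lambda>x. 2 * turn x / (turn x - w))"
    proof (rule integrable_bounded_borel[OF real_distributionD(2)[OF P(1)]])
      have "turn x - w \<noteq> 0" for x using turn_diff_bound[of w x] wb by auto
      then show "(\<lambda>x. 2 * turn x / (turn x - w)) \<in> borel_measurable borel" by measurable
      show "norm (2 * turn x / (turn x - w)) \<le> 2 / (1 - cmod w)" for x
        using turn_diff_bound[of w x] wb by (auto simp: norm_divide norm_mult intro!: divide_left_mono mult_pos_pos)
    qed
    have hk: "hkernel z x = Re (2 * turn x / (turn x - w)) - 1" for x
      using herglotz_kernel_half_plane[OF z w_def] by simp
    have ik: "integrable P (hkernel z)"
      unfolding hk[abs_def] by (intro Bochner_Integration.integrable_diff integrable_Re int) simp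
    have "(\<integral>x. hkernel z x \<partial>P) = (\<integral>x. Re (2 * turn x / (turn x - w)) \<partial>P) - (\<integral>x. 1 \<partial>P)"
      unfolding hk by (intro Bochner_Integration.integral_diff integrable_Re int) simp
    also have "... = Re (\<integral>x. 2 * turn x / (turn x - w) \<partial>P) - 1"
      unfolding integral_Re[OF int] by (simp add: real_distributionD(5)[OF P(1)])
    finally have k: "(\<integral>x. hkernel z x \<partial>P) = Re (\<integral>x. 2 * turn x / (turn x - w) \<partial>P) - 1" .
    have "Re (h w) + Re (h 0) = Re (h 0) * Re (\<integral>x. 2 * turn x / (turn x - w) \<partial>P)"
    proof -
      have gen: "a + cnj b = of_real r * I ==> Re a + Re b = r * Re I" for a b r I
        by (auto simp: complex_eq_iff)
      show ?thesis by (rule gen[OF P(2)[OF wb]])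
    qed
    then have "Re (h w) = Re (h 0) * (\<integral>x. hkernel z x \<partial>P)"
      unfolding k by (simp add: algebra_simps)
    then show ?thesis using ik by (simp add: Re_h cw c0)
  qed
  then show ?thesis using P(1) by blast
qed

text \<open>The boundary point 1 of the disc is the point at infinity of the half-plane. By Fatou's lemma
along the imaginary axis, the growth bound forces it to carry no mass and the remaining density to
be integrable.\<close>
lemma pick_no_mass_at_infinity:
  assumes P: "real_distribution P" and A: "A > 0"
    and int: "\<And>z. z \<in> uhp ==> integrable P (hkernel z)"
    and bd: "\<And>y. y > 0 ==> y * (A * (\<integral>x. hkernel (Complex 0 y) x \<partial>P)) \<le> 1"
  shows "AE x in P. turn x \<noteq> 1" "integrable P (\<lambda>x. 1 + (turn_pt x)^2)"
proof -
  interpret real_distribution P by (rule P)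
  define u where "u n x = real (Suc n) * hkernel (Complex 0 (real (Suc n))) x" for n x
  have [measurable]: "u n \<in> borel_measurable borel" for n
    unfolding u_def hkernel_def by measurable
  have up: "Complex 0 (real (Suc n)) \<in> uhp" for n by (simp add: uhp_iff)
  have u0: "u n x \<ge> 0" for n x by (simp add: u_def hkernel_def)
  have ui: "(\<integral>\<^sup>+x. ennreal (u n x) \<partial>P) \<le> ennreal (1 / A)" for n
  proof -
    have "(\<integral>\<^sup>+x. ennreal (u n x) \<partial>P) = ennreal (\<integral>x. u n x \<partial>P)"
      using int[OF up] u0 unfolding u_def by (intro nn_integral_eq_integral) auto
    moreover have "(\<integral>x. u n x \<partial>P) \<le> 1 / A"
      using bd[of "real (Suc n)"] A unfolding u_def integral_mult_right_zero
      by (simp add: field_simps del: of_nat_Suc)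
    ultimately show ?thesis by (simp add: ennreal_leI)
  qed
  define L where "L x = (if turn x = 1 then \<infinity> else ennreal (1 + (turn_pt x)^2))" for x
  have [measurable]: "L \<in> borel_measurable borel" unfolding L_def by measurable
  have lim: "(\<lambda>n. ennreal (u n x)) \<longlonglongrightarrow> L x" for x
  proof (cases "turn x = 1")
    case True
    have "filterlim (\<lambda>n. real (Suc n) * real (Suc n)) at_top sequentially" by real_asymp
    then have "(\<lambda>n. ennreal (real (Suc n) * real (Suc n))) \<longlonglongrightarrow> \<infinity>"
      unfolding infinity_ennreal_def by (rule ennreal_tendsto_top_eq_at_top[THEN iffD2])
    then show ?thesis using True by (simp add: u_def hkernel_def L_def)
  next
    case False
    let ?t = "turn_pt x"
    have "(\<lambda>n. (1 + ?t\<^sup>2) * (real (Suc n) * (real (Suc n) / (?t\<^sup>2 + (real (Suc n))^2)))) \<longlonglongrightarrow> (1 + ?t\<^sup>2) * 1"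
    proof (intro tendsto_intros)
      fix t :: real
      show "(\<lambda>n. real (Suc n) * (real (Suc n) / (t^2 + (real (Suc n))^2))) \<longlonglongrightarrow> 1" by real_asymp
    qed
    then have "(\<lambda>n. u n x) \<longlonglongrightarrow> 1 + ?t\<^sup>2"
      using False by (simp add: u_def hkernel_def mult_ac)
    then have "(\<lambda>n. ennreal (u n x)) \<longlonglongrightarrow> ennreal (1 + ?t\<^sup>2)" by (rule tendsto_ennrealI)
    moreover have "L x = ennreal (1 + ?t\<^sup>2)" by (simp only: L_def False if_False)
    ultimately show ?thesis by (simp only:)
  qed
  have "(\<integral>\<^sup>+x. L x \<partial>P) = (\<integral>\<^sup>+x. liminf (\<lambda>n. ennreal (u n x)) \<partial>P)"
    using lim lim_imp_Liminf[OF trivial_limit_sequentially] by (metis (no_types))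
  also have "... \<le> liminf (\<lambda>n. \<integral>\<^sup>+x. ennreal (u n x) \<partial>P)"
    by (rule nn_integral_liminf) measurable
  also have "... \<le> ennreal (1 / A)"
    using ui by (intro Liminf_le) (auto intro: always_eventually)
  finally have Lint: "(\<integral>\<^sup>+x. L x \<partial>P) \<le> ennreal (1 / A)" .
  then have fin: "(\<integral>\<^sup>+x. L x \<partial>P) \<noteq> \<infinity>" by (auto simp: top_unique)
  have "AE x in P. L x \<noteq> \<infinity>" by (rule nn_integral_PInf_AE[OF _ fin]) measurable
  then show ae: "AE x in P. turn x \<noteq> 1" by (rule AE_mp) (auto simp: L_def intro!: AE_I2)
  have "(\<integral>\<^sup>+x. ennreal (1 + (turn_pt x)^2) \<partial>P) = (\<integral>\<^sup>+x. L x \<partial>P)"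
    using ae by (intro nn_integral_cong_AE) (auto simp: L_def)
  then show "integrable P (\<lambda>x. 1 + (turn_pt x)^2)"
    using fin by (intro integrableI_nonneg) (auto simp: less_top intro!: AE_I2)
qed

lemma real_holomorphic_constant:
  assumes D: "D holomorphic_on uhp" and re: "\<And>z. z \<in> uhp ==> Im (D z) = 0"
  shows "\<exists>c. \<forall>z\<in>uhp. D z = c"
proof (rule ccontr)
  assume "\<not> ?thesis"
  then have nc: "\<not> D constant_on uhp" by (auto simp: constant_on_def)
  have op: "open (D ` uhp)" by (rule open_mapping_thm[OF D open_uhp connected_uhp open_uhp order_refl nc])
  have "D \<i> \<in> D ` uhp" by (auto simp: uhp_iff)
  then obtain e where e: "e > 0" "cball (D \<i>) e \<subseteq> D ` uhp"
    using op open_contains_cball by blast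
  have "D \<i> + \<i> * of_real e \<in> cball (D \<i>) e" using e(1) by (simp add: dist_norm norm_mult)
  then obtain z where "z \<in> uhp" "D z = D \<i> + \<i> * of_real e" using e(2) by force
  then show False using re[of z] re[of \<i>] e(1) by (simp add: uhp_iff)
qed

text \<open>The imaginary parts agree by the Herglotz formula, so \<open>G\<close> and the Cauchy transform differ by a
constant, and both vanish at infinity along the imaginary axis.\<close>
lemma pick_cauchy_transform:
  assumes G: "G holomorphic_on uhp" and neg: "\<And>z. z \<in> uhp ==> Im (G z) < 0"
    and bd: "\<And>z. z \<in> uhp ==> cmod (G z) \<le> 1 / Im z"
  shows "\<exists>M. finite_borel M \<and> (\<forall>z\<in>uhp. cauchy_transform M z = G z)"
proof -
  obtain P where P: "real_distribution P" "\<And>z. z \<in> uhp ==> integrable P (hkernel z)"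
    "\<And>z. z \<in> uhp ==> - Im (G z) = - Im (G \<i>) * (\<integral>x. hkernel z x \<partial>P)"
    using pick_herglotz[OF G neg] by blast
  define A where "A = - Im (G \<i>)"
  have A: "A > 0" using neg[of \<i>] by (simp add: A_def uhp_iff)
  have "y * (A * (\<integral>x. hkernel (Complex 0 y) x \<partial>P)) \<le> 1" if y: "y > 0" for y
  proof -
    have u: "Complex 0 y \<in> uhp" using y by (simp add: uhp_iff)
    have "A * (\<integral>x. hkernel (Complex 0 y) x \<partial>P) = - Im (G (Complex 0 y))"
      using P(3)[OF u] by (simp add: A_def)
    also have "... \<le> 1 / y"
      using bd[OF u] abs_Im_le_cmod[of "G (Complex 0 y)"] by simp
    finally show ?thesis using y by (simp add: field_simps)
  qed
  note ae = pick_no_mass_at_infinity[OF P(1) A P(2) this]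
  interpret real_distribution P by (rule P)
  define d where "d x = A * (1 + (turn_pt x)^2)" for x
  have [measurable]: "d \<in> borel_measurable borel" unfolding d_def by measurable
  have d0: "d x \<ge> 0" for x using A by (simp add: d_def)
  have di: "integrable P d" unfolding d_def using ae(2) by (rule integrable_mult_right)
  define Q where "Q = density P (\<lambda>x. ennreal (d x))"
  define M where "M = distr Q borel turn_pt"
  have Qs: "sets Q = sets borel" by (simp add: Q_def)
  have mQ: "turn_pt \<in> borel_measurable Q"
    using measurable_turn_pt by (simp add: measurable_cong_sets[OF Qs refl])
  have "emeasure Q (space Q) = (\<integral>\<^sup>+x. ennreal (d x) \<partial>P)"
    unfolding Q_def by (subst emeasure_density) (auto intro!: nn_integral_cong)
  also have "... = ennreal (\<integral>x. d x \<partial>P)"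
    using d0 by (intro nn_integral_eq_integral di) auto
  finally have "finite_measure Q" by (intro finite_measureI) auto
  then have "finite_measure M" unfolding M_def
    by (rule finite_measure.finite_measure_distr) (rule mQ)
  then have M: "finite_borel M"
    unfolding finite_borel_measure_def finite_borel_measure_axioms_def by (simp add: M_def)
  have im: "Im (cauchy_transform M z) = Im (G z)" if z: "z \<in> uhp" for z
  proof -
    let ?p = "\<lambda>t. Im z / ((Re z - t)^2 + (Im z)^2)"
    have "(\<integral>t. ?p t \<partial>M) = (\<integral>x. ?p (turn_pt x) \<partial>Q)"
      unfolding M_def by (rule integral_distr[OF mQ]) measurable
    also have "... = (\<integral>x. d x * ?p (turn_pt x) \<partial>P)"
      unfolding Q_def using d0 by (subst integral_density) auto
    also have "... = (\<integral>x. A * hkernel z x \<partial>P)"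
      using ae(1) by (intro integral_cong_AE) (auto simp: d_def hkernel_def mult_ac)
    also have "... = A * (\<integral>x. hkernel z x \<partial>P)" by (rule integral_mult_right_zero)
    also have "... = - Im (G z)" using P(3)[OF z] by (simp add: A_def)
    finally show ?thesis using Im_cauchy_transform[OF M z] by simp
  qed
  have "(\<lambda>z. G z - cauchy_transform M z) holomorphic_on uhp"
    by (intro holomorphic_intros G cauchy_transform_holomorphic[OF M])
  from real_holomorphic_constant[OF this] obtain c where c: "\<And>z. z \<in> uhp ==> G z - cauchy_transform M z = c"
    using im by auto
  have "(\<lambda>n. (1 + measure M UNIV) * inverse (real (Suc n))) \<longlonglongrightarrow> (1 + measure M UNIV) * 0"
    by (intro tendsto_intros LIMSEQ_inverse_real_of_nat)
  moreover have "cmod c \<le> (1 + measure M UNIV) * inverse (real (Suc n))" for n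
  proof -
    have u: "Complex 0 (real (Suc n)) \<in> uhp" by (simp add: uhp_iff)
    have "cmod c \<le> cmod (G (Complex 0 (real (Suc n)))) + cmod (cauchy_transform M (Complex 0 (real (Suc n))))"
      using c[OF u] norm_triangle_ineq4 by metis
    also have "... \<le> 1 / real (Suc n) + measure M UNIV / real (Suc n)"
      using bd[OF u] norm_cauchy_transform[OF M u] by simp
    finally show ?thesis by (simp add: field_simps)
  qed
  ultimately have "cmod c \<le> 0" by (intro LIMSEQ_le_const) auto
  then have "cauchy_transform M z = G z" if "z \<in> uhp" for z using c[OF that] by simp
  then show ?thesis using M by blast
qed

lemma pick_F_transform:
  assumes F: "F holomorphic_on uhp" and Im_F: "\<And>z. z \<in> uhp ==> Im z \<le> Im (F z)"
    and lim: "(\<lambda>n. F (Complex 0 (real (Suc n))) / Complex 0 (real (Suc n))) \<longlonglongrightarrow> 1"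
  shows "\<exists>M. real_distribution M \<and> (\<forall>z\<in>uhp. F_transform M z = F z)"
proof -
  have Fp: "Im (F z) > 0" "F z \<noteq> 0" if "z \<in> uhp" for z
    using Im_F[OF that] that by (auto simp: uhp_iff)
  have "\<exists>M. finite_borel M \<and> (\<forall>z\<in>uhp. cauchy_transform M z = 1 / F z)"
  proof (rule pick_cauchy_transform)
    show "(\<lambda>z. 1 / F z) holomorphic_on uhp" using Fp by (intro holomorphic_intros F) auto
    fix z assume z: "z \<in> uhp"
    show "Im (1 / F z) < 0" using Fp[OF z]
      by (auto simp: Im_divide sum_power2_gt_zero_iff intro!: divide_neg_pos)
    have "Im z \<le> cmod (F z)" using Im_F[OF z] abs_Im_le_cmod[of "F z"] by linarith
    then show "cmod (1 / F z) \<le> 1 / Im z"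
      using z by (simp add: norm_divide uhp_iff frac_le)
  qed
  then obtain M where M: "finite_borel M" "\<And>z. z \<in> uhp ==> cauchy_transform M z = 1 / F z" by blast
  have up: "Complex 0 (real (Suc n)) \<in> uhp" for n by (simp add: uhp_iff)
  have "(\<lambda>n. Re (1 / (F (Complex 0 (real (Suc n))) / Complex 0 (real (Suc n))))) \<longlonglongrightarrow> Re (1 / 1)"
    by (intro tendsto_intros lim) auto
  then have 1: "(\<lambda>n. Re (Complex 0 (real (Suc n)) * cauchy_transform M (Complex 0 (real (Suc n))))) \<longlonglongrightarrow> 1"
    using M(2)[OF up] by simp
  have "(\<lambda>n. measure M UNIV - (\<integral>t. t^2 / (t^2 + (real (Suc n))^2) \<partial>M)) \<longlonglongrightarrow> measure M UNIV - 0"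
    by (intro tendsto_intros tail_kernel_tendsto[OF M(1)])
  then have 2: "(\<lambda>n. Re (Complex 0 (real (Suc n)) * cauchy_transform M (Complex 0 (real (Suc n))))) \<longlonglongrightarrow> measure M UNIV"
    using Re_cauchy_transform_imaginary[OF M(1)] by simp
  have "measure M UNIV = 1" by (rule LIMSEQ_unique[OF 2 1])
  then have "real_distribution M" by (rule real_distributionI_mass[OF M(1)])
  moreover have "F_transform M z = F z" if "z \<in> uhp" for z
    using M(2)[OF that] by (simp add: F_transform_def)
  ultimately show ?thesis by blast
qed

lemma cone_small_lim:
  assumes "\<And>\<epsilon>. \<epsilon> > 0 ==> \<exists>\<beta>>0. \<forall>w\<in>tcone 1 \<beta>. cmod (E w) \<le> \<epsilon> * cmod w"
  shows "(\<lambda>n. (Complex 0 (real (Suc n)) - E (Complex 0 (real (Suc n)))) / Complex 0 (real (Suc n))) \<longlonglongrightarrow> 1"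
proof (rule LIMSEQ_I)
  fix e :: real assume e: "e > 0"
  then obtain \<beta> where b: "\<beta> > 0" "\<And>w. w \<in> tcone 1 \<beta> ==> cmod (E w) \<le> (e / 2) * cmod w"
    using assms[of "e / 2"] by auto
  obtain N :: nat where N: "\<beta> \<le> real N" using real_arch_simple by blast
  have "norm ((Complex 0 (real (Suc n)) - E (Complex 0 (real (Suc n)))) / Complex 0 (real (Suc n)) - 1) < e"
    if "n \<ge> N" for n
  proof -
    let ?z = "Complex 0 (real (Suc n))"
    have z: "?z \<in> tcone 1 \<beta>" using N that by (simp add: truncated_cone_def)
    have nz: "?z \<noteq> 0" by (simp add: complex_eq_iff)
    have "(?z - E ?z) / ?z - 1 = - (E ?z / ?z)" using nz by (simp add: field_simps)
    then have "norm ((?z - E ?z) / ?z - 1) = cmod (E ?z) / cmod ?z" by (simp add: norm_divide)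
    also have "... \<le> e / 2" using b(2)[OF z] nz by (simp add: pos_divide_le_eq)
    finally show ?thesis using e by simp
  qed
  then show "\<exists>N. \<forall>n\<ge>N. norm ((Complex 0 (real (Suc n)) - E (Complex 0 (real (Suc n)))) / Complex 0 (real (Suc n)) - 1) < e"
    by blast
qed

lemma E_transform_exists:
  assumes E: "E holomorphic_on uhp" and Im_E: "\<And>z. z \<in> uhp ==> Im (E z) \<le> 0"
    and small: "\<And>\<epsilon>. \<epsilon> > 0 ==> \<exists>\<beta>>0. \<forall>w\<in>tcone 1 \<beta>. cmod (E w) \<le> \<epsilon> * cmod w"
  shows "\<exists>M. real_distribution M \<and> (\<forall>z\<in>uhp. E_transform M z = E z)"
proof -
  have "\<exists>M. real_distribution M \<and> (\<forall>z\<in>uhp. F_transform M z = z - E z)"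
    using Im_E by (intro pick_F_transform holomorphic_intros E cone_small_lim small) auto
  then show ?thesis by (auto simp: E_transform_def)
qed

lemma E_transform_unique:
  assumes M: "real_distribution M" "real_distribution N"
    and eq: "\<And>z. z \<in> uhp ==> E_transform M z = E_transform N z"
  shows "M = N"
proof (rule F_transform_determines_open[OF M open_uhp _ order_refl])
  show "uhp \<noteq> {}" using uhp_iff[of \<i>] by auto
  show "F_transform M z = F_transform N z" if "z \<in> uhp" for z
    using eq[OF that] by (simp add: E_transform_def)
qed

section \<open>Inverting \<open>z - E(z)\<close> near infinity\<close>

lemma cone_imag_norm: "z \<in> tcone 1 \<beta> ==> 0 \<le> \<beta> ==> cmod z \<le> 2 * Im z"
  using cmod_le[of z] by (auto simp: truncated_cone_def)

lemma near_cone: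
  assumes z: "z \<in> tcone 1 (2 * \<beta>)" and b: "0 < \<beta>" and w: "cmod (w - z) \<le> cmod z / 8"
  shows "w \<in> tcone 2 \<beta>" "cmod w \<le> 9 / 8 * cmod z"
proof -
  have Iz: "Im z > 2 * \<beta>" "\<bar>Re z\<bar> < Im z" using z by (auto simp: truncated_cone_def)
  have n: "cmod z \<le> 2 * Im z" by (rule cone_imag_norm[OF z]) (use b in auto)
  have d: "\<bar>Re w - Re z\<bar> \<le> Im z / 4" "\<bar>Im w - Im z\<bar> \<le> Im z / 4"
    using abs_Re_le_cmod[of "w - z"] abs_Im_le_cmod[of "w - z"] w n by auto
  show "w \<in> tcone 2 \<beta>"
    unfolding truncated_cone_def mem_Collect_eq using d Iz b by (intro conjI; linarith)
  show "cmod w \<le> 9 / 8 * cmod z"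
    using norm_triangle_ineq[of "w - z" z] w by simp
qed

lemma near_cone_half:
  assumes z: "z \<in> tcone (1 / 2) (2 * \<beta>)" and b: "0 < \<beta>" and w: "cmod (w - z) \<le> cmod z / 8"
  shows "w \<in> tcone 1 \<beta>"
proof -
  have Iz: "Im z > 2 * \<beta>" "\<bar>Re z\<bar> < Im z / 2" using z by (auto simp: truncated_cone_def)
  have n: "cmod z \<le> 3 / 2 * Im z" using cmod_le[of z] Iz b by auto
  have d: "\<bar>Re w - Re z\<bar> \<le> 3 / 16 * Im z" "\<bar>Im w - Im z\<bar> \<le> 3 / 16 * Im z"
    using abs_Re_le_cmod[of "w - z"] abs_Im_le_cmod[of "w - z"] w n by auto
  show ?thesis
    unfolding truncated_cone_def mem_Collect_eq using d Iz b by (intro conjI; linarith)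
qed

lemma convex_truncated_cone: "convex (tcone \<alpha> \<beta>)"
proof -
  have e: "tcone \<alpha> \<beta> = {z. Im z > \<beta>} \<inter> ({z. (Complex 1 (- \<alpha>)) \<bullet> z < 0} \<inter> {z. (Complex (- 1) (- \<alpha>)) \<bullet> z < 0})"
    by (auto simp: truncated_cone_def inner_complex_def)
  show ?thesis unfolding e
    by (intro convex_Int convex_halfspace_Im_gt convex_halfspace_lt)
qed

lemma connected_truncated_cone: "connected (tcone \<alpha> \<beta>)"
  by (rule convex_connected[OF convex_truncated_cone])

lemma cone_small_inj:
  assumes "cone_small E \<beta> \<epsilon>" "\<epsilon> < 1" "w \<in> tcone 2 \<beta>" "v \<in> tcone 2 \<beta>"
    "w - E w = v - E v"
  shows "w = v"
proof -
  have "w - v = E w - E v" using assms(5) by algebra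
  then have "cmod (w - v) = cmod (E w - E v)" by simp
  also have "... \<le> \<epsilon> * cmod (w - v)" using assms by (auto simp: cone_small_def)
  finally have "(1 - \<epsilon>) * cmod (w - v) \<le> 0" by (simp add: algebra_simps)
  then show ?thesis using assms(2) by (simp add: mult_le_0_iff)
qed

text \<open>\<open>w \<mapsto> z + E(w)\<close> is a contraction of the disc of radius \<open>|z|/8\<close> about \<open>z\<close>, which lies in the larger cone.\<close>
lemma cone_fixpoint:
  assumes E: "cone_small E \<beta> (1 / 16)" and b: "0 < \<beta>" and z: "z \<in> tcone 1 (2 * \<beta>)"
  shows "\<exists>w. cmod (w - z) \<le> cmod z / 8 \<and> w - E w = z"
proof -
  let ?D = "cball z (cmod z / 8)"
  have D: "w \<in> tcone 2 \<beta>" "cmod w \<le> 9 / 8 * cmod z" if "w \<in> ?D" for w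
    using near_cone[OF z b, of w] that by (auto simp: dist_norm norm_minus_commute)
  have "\<exists>!w\<in>?D. z + E w = w"
  proof (rule Banach_fix[OF compact_imp_complete[OF compact_cball], where c="1/2"])
    show "?D \<noteq> {}" by simp
    show "(\<lambda>w. z + E w) ` ?D \<subseteq> ?D"
    proof (intro image_subsetI)
      fix w assume w: "w \<in> ?D"
      have "cmod (E w) \<le> 1 / 16 * cmod w" using E D[OF w] by (auto simp: cone_small_def)
      also have "... \<le> cmod z / 8" using D(2)[OF w] norm_ge_zero[of z] by linarith
      finally show "z + E w \<in> ?D" by (simp add: dist_norm)
    qed
    fix w v assume "w \<in> ?D" "v \<in> ?D"
    then have "cmod (E w - E v) \<le> 1 / 16 * cmod (w - v)"
      using E D(1) by (simp add: cone_small_def)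
    moreover have "dist (z + E w) (z + E v) = cmod (E w - E v)" "dist w v = cmod (w - v)"
      by (simp_all add: dist_norm)
    ultimately show "dist (z + E w) (z + E v) \<le> 1 / 2 * dist w v"
      using norm_ge_zero[of "w - v"] by linarith
  qed auto
  then obtain w where "w \<in> ?D" "z + E w = w" by blast
  then show ?thesis by (intro exI[of _ w]) (auto simp: dist_norm norm_minus_commute algebra_simps)
qed

lemma cone_inverse:
  assumes E: "cone_small E \<beta> (1 / 16)" and b: "0 < \<beta>" and h: "E holomorphic_on tcone 2 \<beta>"
  shows "\<exists>g. g holomorphic_on tcone 1 (2 * \<beta>) \<and>
    (\<forall>z\<in>tcone 1 (2 * \<beta>). cmod (g z - z) \<le> cmod z / 8 \<and> g z - E (g z) = z)"
proof -
  let ?C = "tcone 2 \<beta>" and ?F = "\<lambda>w. w - E w"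
  have inj: "inj_on ?F ?C"
    by (rule inj_onI) (rule cone_small_inj[OF E], auto)
  have "?F holomorphic_on ?C" by (intro holomorphic_intros h)
  then obtain g where g: "g holomorphic_on (?F ` ?C)" "\<And>z. z \<in> ?C ==> g (?F z) = z"
    by (rule holomorphic_has_inverse[OF _ open_truncated_cone inj]) metis
  have *: "z \<in> ?F ` ?C \<and> cmod (g z - z) \<le> cmod z / 8 \<and> g z - E (g z) = z"
    if z: "z \<in> tcone 1 (2 * \<beta>)" for z
  proof -
    obtain w where w: "cmod (w - z) \<le> cmod z / 8" "w - E w = z" using cone_fixpoint[OF E b z] by blast
    have wC: "w \<in> ?C" using near_cone[OF z b w(1)] by simp
    have "g z = w" using g(2)[OF wC] w(2) by simp
    moreover have "z \<in> ?F ` ?C" using w(2) wC by (intro image_eqI[where x=w]) auto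
    ultimately show ?thesis using w by simp
  qed
  have "tcone 1 (2 * \<beta>) \<subseteq> ?F ` ?C" using * by blast
  from holomorphic_on_subset[OF g(1) this] show ?thesis using * by blast
qed

section \<open>A fixed point equation in the upper half-plane\<close>

text \<open>The reciprocals \<open>1/h\<^sub>k\<close> form a normal family, since \<open>|1/h\<^sub>k(z)| \<le> 1/Im z\<close>. Hence convergence on a
small set propagates to the whole half-plane.\<close>
lemma uhp_normal_limit:
  fixes h :: "nat \<Rightarrow> complex \<Rightarrow> complex"
  assumes h: "\<And>k. h k holomorphic_on uhp" and Im_h: "\<And>k z. z \<in> uhp ==> Im z \<le> Im (h k z)"
    and U: "U \<noteq> {}" "U \<subseteq> uhp" and lim: "\<And>z. z \<in> U ==> (\<lambda>k. h k z) \<longlonglongrightarrow> p z"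
  shows "\<exists>H. H holomorphic_on uhp \<and> (\<forall>z\<in>uhp. Im z \<le> Im (H z)) \<and> (\<forall>z\<in>U. H z = p z)"
proof -
  have hnz: "h k z \<noteq> 0" if "z \<in> uhp" for k z
    using Im_h[OF that, of k] that by (auto simp: uhp_iff)
  define f where "f k z = 1 / h k z" for k z
  have fh: "f k holomorphic_on uhp" for k
    unfolding f_def using hnz by (intro holomorphic_intros h) auto
  have fb: "cmod (f k z) \<le> 1 / Im z" if "z \<in> uhp" for k z
  proof -
    have "Im z \<le> cmod (h k z)" using Im_h[OF that, of k] abs_Im_le_cmod[of "h k z"] by linarith
    then show ?thesis using that by (simp add: f_def norm_divide uhp_iff frac_le)
  qed
  obtain g r where g: "g holomorphic_on uhp" "strict_mono (r :: nat \<Rightarrow> nat)"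
      "\<And>x. x \<in> uhp ==> (\<lambda>n. f (r n) x) \<longlonglongrightarrow> g x"
      "\<And>K. compact K ==> K \<subseteq> uhp ==> uniform_limit K (f \<circ> r) g sequentially"
  proof (rule Montel[OF open_uhp, of "range f" f])
    show "\<And>h. h \<in> range f ==> h holomorphic_on uhp" using fh by auto
    fix K assume K: "compact K" "K \<subseteq> uhp"
    have "continuous_on K (\<lambda>z. 1 / Im z)"
      using K(2) by (intro continuous_intros) (auto simp: uhp_iff)
    then have "bounded ((\<lambda>z. 1 / Im z) ` K)" using K(1) compact_continuous_image compact_imp_bounded by blast
    then obtain B where B: "\<And>z. z \<in> K ==> norm (1 / Im z) \<le> B" by (auto simp: bounded_iff)
    have "norm (f k z) \<le> B" if "z \<in> K" for k z
      using fb[of z k] B[OF that] K(2) that by (fastforce simp: uhp_iff)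
    then show "\<exists>B. \<forall>h\<in>range f. \<forall>z\<in>K. norm (h z) \<le> B" by blast
  qed auto
  have gp: "p z \<noteq> 0 \<and> g z = 1 / p z" if z: "z \<in> U" for z
  proof -
    have zu: "z \<in> uhp" using z U by auto
    have l: "(\<lambda>k. h k z) \<longlonglongrightarrow> p z" by (rule lim[OF z])
    have "(\<lambda>k. Im (h k z)) \<longlonglongrightarrow> Im (p z)" using l by (intro tendsto_intros)
    then have "Im z \<le> Im (p z)" using Im_h[OF zu] by (intro LIMSEQ_le_const) auto
    then have nz: "p z \<noteq> 0" using zu by (auto simp: uhp_iff)
    have "(\<lambda>k. f k z) \<longlonglongrightarrow> 1 / p z" unfolding f_def by (intro tendsto_intros l nz)
    then have "(\<lambda>k. f (r k) z) \<longlonglongrightarrow> 1 / p z" using LIMSEQ_subseq_LIMSEQ[OF _ g(2)] by (fastforce simp: o_def)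
    then show ?thesis using g(3)[OF zu] LIMSEQ_unique nz by blast
  qed
  obtain u where u: "u \<in> U" using U by auto
  have gnz: "g z \<noteq> 0" if z: "z \<in> uhp" for z
  proof (cases "g constant_on uhp")
    case True
    then obtain c where "\<And>x. x \<in> uhp ==> g x = c" by (auto simp: constant_on_def)
    then have "g z = g u" using z u U by auto
    then show ?thesis using gp[OF u] by simp
  next
    case False
    show ?thesis
    proof (rule Hurwitz_no_zeros[OF open_uhp connected_uhp _ g(1) g(4) False _ z])
      show "(f \<circ> r) n holomorphic_on uhp" for n using fh by simp
      show "(f \<circ> r) n z \<noteq> 0" if "z \<in> uhp" for n z using hnz[OF that] by (simp add: f_def)
    qed
  qed
  define H where "H z = 1 / g z" for z
  have "H holomorphic_on uhp" unfolding H_def[abs_def] using gnz by (intro holomorphic_intros g(1)) auto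
  moreover have "Im z \<le> Im (H z)" if z: "z \<in> uhp" for z
  proof -
    have "(\<lambda>k. Im (1 / f (r k) z)) \<longlonglongrightarrow> Im (1 / g z)"
      by (intro tendsto_intros g(3)[OF z] gnz[OF z])
    then show ?thesis using Im_h[OF z] by (intro LIMSEQ_le_const) (auto simp: f_def H_def)
  qed
  moreover have "H z = p z" if "z \<in> U" for z using gp[OF that] by (simp add: H_def)
  ultimately show ?thesis by blast
qed

text \<open>Near infinity \<open>\<omega>\<^sub>1\<close> is the fixed point of the contraction \<open>w \<mapsto> z - E\<^sub>2(z - E\<^sub>1(w))\<close>. The iterates
started at \<open>z\<close> are defined on the whole half-plane and never decrease the imaginary part, so
their limit extends there by normality.\<close>
lemma subordination:
  assumes E1: "pick_class E1" and E2: "pick_class E2"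
    and s1: "cone_small E1 \<beta> (1 / 16)" and s2: "cone_small E2 \<beta> (1 / 16)" and b: "0 < \<beta>"
  shows "\<exists>\<omega>1 \<omega>2. \<omega>1 holomorphic_on uhp \<and> \<omega>2 holomorphic_on uhp \<and>
    (\<forall>z\<in>uhp. Im z \<le> Im (\<omega>1 z) \<and> Im z \<le> Im (\<omega>2 z)) \<and>
    (\<forall>z\<in>tcone 1 (2 * \<beta>). cmod (\<omega>1 z - z) \<le> cmod z / 8 \<and> cmod (\<omega>2 z - z) \<le> cmod z / 8 \<and>
       \<omega>1 z = z - E2 (\<omega>2 z) \<and> \<omega>2 z = z - E1 (\<omega>1 z))"
proof -
  let ?C = "tcone 1 (2 * \<beta>)"
  have hol: "E1 holomorphic_on uhp" "E2 holomorphic_on uhp"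
    and Im_E: "\<And>z. z \<in> uhp ==> Im (E1 z) \<le> 0" "\<And>z. z \<in> uhp ==> Im (E2 z) \<le> 0"
    using E1 E2 by (auto simp: pick_class_def)
  define T where "T z w = z - E2 (z - E1 w)" for z w
  define h where "h k z = (T z ^^ k) z" for k z
  have h0: "h 0 z = z" and hS: "h (Suc k) z = z - E2 (z - E1 (h k z))" for k z
    by (auto simp: h_def T_def)
  have hk: "h k holomorphic_on uhp \<and> (\<forall>z\<in>uhp. Im z \<le> Im (h k z))" for k
  proof (induction k)
    case 0
    have "h 0 = (\<lambda>z. z)" by (rule ext) (rule h0)
    then show ?case by simp
  next
    case (Suc k)
    have u1: "h k z \<in> uhp" if "z \<in> uhp" for z using Suc that by (fastforce simp: uhp_iff)
    have "(E1 \<circ> h k) holomorphic_on uhp"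
      using Suc u1 by (intro holomorphic_on_compose holomorphic_on_subset[OF hol(1)]) auto
    then have a: "(\<lambda>z. z - E1 (h k z)) holomorphic_on uhp" by (intro holomorphic_intros) (simp add: o_def)
    have u2: "z - E1 (h k z) \<in> uhp" if "z \<in> uhp" for z
      using Im_E(1)[OF u1[OF that]] that by (simp add: uhp_iff)
    have "(E2 \<circ> (\<lambda>z. z - E1 (h k z))) holomorphic_on uhp"
      using u2 by (intro holomorphic_on_compose a holomorphic_on_subset[OF hol(2)]) auto
    then have "(\<lambda>z. z - E2 (z - E1 (h k z))) holomorphic_on uhp"
      by (intro holomorphic_intros) (simp add: o_def)
    moreover have "h (Suc k) = (\<lambda>z. z - E2 (z - E1 (h k z)))" by (rule ext) (rule hS)
    moreover have "Im z \<le> Im (z - E2 (z - E1 (h k z)))" if "z \<in> uhp" for z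
      using Im_E(2)[OF u2[OF that]] by simp
    ultimately show ?case by simp
  qed
  have fix_pt: "\<exists>p. cmod (p - z) \<le> cmod z / 8 \<and> T z p = p \<and> (\<lambda>k. h k z) \<longlonglongrightarrow> p" if z: "z \<in> ?C" for z
  proof -
    let ?D = "cball z (cmod z / 8)"
    have D: "w \<in> tcone 2 \<beta>" "cmod w \<le> 9 / 8 * cmod z" if "w \<in> ?D" for w
      using near_cone[OF z b, of w] that by (auto simp: dist_norm norm_minus_commute)
    have step: "z - E w \<in> ?D" if "cone_small E \<beta> (1 / 16)" "w \<in> ?D" for E w
    proof -
      have "cmod (E w) \<le> 1 / 16 * cmod w" using that(1) D[OF that(2)] by (auto simp: cone_small_def)
      also have "... \<le> cmod z / 8" using D(2)[OF that(2)] norm_ge_zero[of z] by linarith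
      finally show ?thesis by (simp add: dist_norm)
    qed
    have TD: "T z w \<in> ?D" if "w \<in> ?D" for w
      unfolding T_def by (intro step s1 s2 that)
    have TL: "dist (T z w) (T z v) \<le> 1 / 2 * dist w v" if "w \<in> ?D" "v \<in> ?D" for w v
    proof -
      have "cmod (E2 (z - E1 w) - E2 (z - E1 v)) \<le> 1 / 16 * cmod ((z - E1 w) - (z - E1 v))"
        using s2 D(1)[OF step[OF s1 that(1)]] D(1)[OF step[OF s1 that(2)]] unfolding cone_small_def by blast
      also have "cmod ((z - E1 w) - (z - E1 v)) = cmod (E1 w - E1 v)" by (simp add: norm_minus_commute)
      also have "cmod (E1 w - E1 v) \<le> 1 / 16 * cmod (w - v)"
        using s1 D(1)[OF that(1)] D(1)[OF that(2)] unfolding cone_small_def by blast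
      finally have "cmod (E2 (z - E1 w) - E2 (z - E1 v)) \<le> 1 / 2 * cmod (w - v)"
        using norm_ge_zero[of "w - v"] by linarith
      then show ?thesis by (simp add: T_def dist_norm norm_minus_commute)
    qed
    have "\<exists>!p\<in>?D. T z p = p"
      by (rule Banach_fix[OF compact_imp_complete[OF compact_cball], where c="1/2"])
         (use TD TL in \<open>simp_all add: image_subset_iff del: mem_cball\<close>)
    then obtain p where p: "p \<in> ?D" "T z p = p" by blast
    have hS': "h (Suc k) z = T z (h k z)" for k by (simp add: h_def)
    have hD: "h k z \<in> ?D" for k
    proof (induction k)
      case (Suc k) then show ?case unfolding hS' by (rule TD)
    qed (simp add: h0)
    have dk: "dist (h k z) p \<le> (1 / 2) ^ k * dist z p" for k
    proof (induction k)
      case (Suc k)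
      have "dist (h (Suc k) z) p = dist (T z (h k z)) (T z p)" using p hS' by simp
      also have "... \<le> 1 / 2 * dist (h k z) p" by (rule TL[OF hD p(1)])
      also have "... \<le> 1 / 2 * ((1 / 2) ^ k * dist z p)" using Suc by (intro mult_left_mono) auto
      finally show ?case by simp
    qed (simp add: h0)
    have "\<forall>k. norm (h k z - p) \<le> (1 / 2) ^ k * dist z p" using dk by (simp add: dist_norm)
    moreover have "(\<lambda>k. (1 / 2) ^ k * dist z p) \<longlonglongrightarrow> 0"
      by (intro tendsto_mult_left_zero LIMSEQ_power_zero) auto
    ultimately have "(\<lambda>k. h k z - p) \<longlonglongrightarrow> 0"
      by (rule Lim_null_comparison[OF always_eventually])
    then have "(\<lambda>k. h k z) \<longlonglongrightarrow> p" by (rule LIM_zero_cancel)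
    moreover have "cmod (p - z) \<le> cmod z / 8" using p(1) by (simp add: dist_norm norm_minus_commute)
    ultimately show ?thesis using p(2) by blast
  qed
  from bchoice[OF ballI[OF fix_pt]]
  obtain p where p0: "\<forall>z\<in>?C. cmod (p z - z) \<le> cmod z / 8 \<and> T z (p z) = p z \<and> (\<lambda>k. h k z) \<longlonglongrightarrow> p z" ..
  have p: "cmod (p z - z) \<le> cmod z / 8" "T z (p z) = p z" "(\<lambda>k. h k z) \<longlonglongrightarrow> p z"
    if "z \<in> ?C" for z
    by (rule conjunct1[OF bspec[OF p0 that]], rule conjunct1[OF conjunct2[OF bspec[OF p0 that]]],
        rule conjunct2[OF conjunct2[OF bspec[OF p0 that]]])
  have CU: "?C \<subseteq> uhp" using b by (intro truncated_cone_uhp) auto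
  have Cn: "?C \<noteq> {}" by (rule truncated_cone_nonempty) simp
  have "\<exists>H. H holomorphic_on uhp \<and> (\<forall>z\<in>uhp. Im z \<le> Im (H z)) \<and> (\<forall>z\<in>?C. H z = p z)"
  proof (rule uhp_normal_limit)
    show "h k holomorphic_on uhp" for k using hk by simp
    show "Im z \<le> Im (h k z)" if "z \<in> uhp" for k z using hk[of k] that by simp
  qed (use Cn CU p(3) in simp_all)
  then obtain \<omega> where \<omega>: "\<omega> holomorphic_on uhp" "\<And>z. z \<in> uhp ==> Im z \<le> Im (\<omega> z)" "\<And>z. z \<in> ?C ==> \<omega> z = p z"
    by blast
  have \<omega>u: "\<omega> z \<in> uhp" if "z \<in> uhp" for z using \<omega>(2)[OF that] that by (simp add: uhp_iff)
  define \<omega>' where "\<omega>' z = z - E1 (\<omega> z)" for z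
  have "(E1 \<circ> \<omega>) holomorphic_on uhp"
    using \<omega>u by (intro holomorphic_on_compose \<omega>(1) holomorphic_on_subset[OF hol(1)]) auto
  then have h': "\<omega>' holomorphic_on uhp" unfolding \<omega>'_def[abs_def] by (intro holomorphic_intros) (simp add: o_def)
  have i': "Im z \<le> Im (\<omega>' z)" if "z \<in> uhp" for z using Im_E(1)[OF \<omega>u[OF that]] by (simp add: \<omega>'_def)
  have c': "cmod (\<omega> z - z) \<le> cmod z / 8 \<and> cmod (\<omega>' z - z) \<le> cmod z / 8 \<and>
       \<omega> z = z - E2 (\<omega>' z) \<and> \<omega>' z = z - E1 (\<omega> z)" if z: "z \<in> ?C" for z
  proof -
    have 1: "cmod (\<omega> z - z) \<le> cmod z / 8" using p(1)[OF z] \<omega>(3)[OF z] by simp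
    have 2: "\<omega> z = z - E2 (\<omega>' z)" using p(2)[OF z] \<omega>(3)[OF z] by (simp add: T_def \<omega>'_def)
    have "cmod (E1 (\<omega> z)) \<le> 1 / 16 * cmod (\<omega> z)"
      using s1 near_cone(1)[OF z b 1] by (auto simp: cone_small_def)
    also have "... \<le> cmod z / 8" using near_cone(2)[OF z b 1] norm_ge_zero[of z] by linarith
    finally have 4: "cmod (\<omega>' z - z) \<le> cmod z / 8" by (simp add: \<omega>'_def)
    show ?thesis by (intro conjI 1 2 4 \<omega>'_def)
  qed
  show ?thesis
    by (intro exI[of _ \<omega>] exI[of _ \<omega>'] conjI ballI \<omega>(1,2) h' i' c'[THEN conjunct1]
      c'[THEN conjunct2, THEN conjunct1] c'[THEN conjunct2, THEN conjunct2, THEN conjunct1]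
      c'[THEN conjunct2, THEN conjunct2, THEN conjunct2])
qed

section \<open>Nevanlinna integrals\<close>

abbreviation (input) "nevanlinna \<equiv> nevanlinna_integral"

lemma nevanlinna_kernel_eq:
  "z \<in> uhp ==> (1 + complex_of_real t * z) / (z - of_real t)
     = - z + (1 + z^2) * (1 / (z - of_real t))"
  using uhp_diff_real_nz[of z t] by (simp add: field_simps power2_eq_square)

lemma nevanlinna_kernel_bound:
  assumes "z \<in> uhp"
  shows "cmod ((1 + complex_of_real t * z) / (z - of_real t)) \<le> cmod z + cmod (1 + z^2) / Im z"
proof -
  have "cmod (- z + (1 + z^2) * (1 / (z - of_real t)))
     \<le> cmod (- z) + cmod (1 + z^2) * cmod (1 / (z - of_real t))"
    by (metis norm_mult norm_triangle_ineq)
  also have "... \<le> cmod z + cmod (1 + z^2) * (1 / Im z)"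
    using cauchy_kernel_bound[OF assms, of t] by (intro add_mono mult_left_mono) (auto simp del: norm_divide)
  finally show ?thesis unfolding nevanlinna_kernel_eq[OF assms] by simp
qed

lemma nevanlinna_kernel_measurable [measurable]:
  "(\<lambda>t. (1 + complex_of_real t * z) / (z - of_real t)) \<in> borel_measurable borel"
  by measurable

lemma nevanlinna_kernel_continuous:
  "z \<in> uhp ==> continuous_on UNIV (\<lambda>t. (1 + complex_of_real t * z) / (z - of_real t))"
  using uhp_diff_real_nz by (intro continuous_intros) auto

lemma nevanlinna_kernel_integrable:
  assumes "finite_borel \<sigma>" "z \<in> uhp"
  shows "integrable \<sigma> (\<lambda>t. (1 + complex_of_real t * z) / (z - of_real t))"
  by (rule integrable_bounded_borel[OF assms(1) _ nevanlinna_kernel_bound[OF assms(2)]]) measurable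

lemma nevanlinna_integral_eq:
  assumes s: "finite_borel \<sigma>" and z: "z \<in> uhp"
  shows "nevanlinna \<gamma> \<sigma> z = complex_of_real \<gamma> - z * of_real (measure \<sigma> UNIV)
     + (1 + z^2) * cauchy_transform \<sigma> z"
proof -
  interpret finite_borel_measure \<sigma> by fact
  have "(\<integral>t. (1 + complex_of_real t * z) / (z - of_real t) \<partial>\<sigma>)
     = (\<integral>t. - z + (1 + z^2) * (1 / (z - of_real t)) \<partial>\<sigma>)"
    by (simp only: nevanlinna_kernel_eq[OF z])
  also have "... = (\<integral>t. - z \<partial>\<sigma>) + (\<integral>t. (1 + z^2) * (1 / (z - of_real t)) \<partial>\<sigma>)"
    by (intro Bochner_Integration.integral_add integrable_mult_right cauchy_integrable[OF s z]) simp
  also have "(\<integral>t. (1 + z^2) * (1 / (z - of_real t)) \<partial>\<sigma>) = (1 + z^2) * cauchy_transform \<sigma> z"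
    unfolding cauchy_transform_def by (rule integral_mult_right_zero)
  also have "(\<integral>t. - z \<partial>\<sigma>) = - z * of_real (measure \<sigma> UNIV)"
    using finite_borelD(3)[OF s] by (simp add: scaleR_conv_of_real)
  finally show ?thesis unfolding nevanlinna_integral_def by simp
qed

lemma nevanlinna_integral_holomorphic:
  assumes s: "finite_borel \<sigma>"
  shows "nevanlinna \<gamma> \<sigma> holomorphic_on uhp"
proof -
  have "(\<lambda>z. complex_of_real \<gamma> - z * of_real (measure \<sigma> UNIV) + (1 + z^2) * cauchy_transform \<sigma> z) holomorphic_on uhp"
    by (intro holomorphic_intros cauchy_transform_holomorphic[OF s])
  then show ?thesis
    by (rule holomorphic_transform) (rule nevanlinna_integral_eq[OF s, symmetric])
qed

lemma Im_nevanlinna_kernel: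
  assumes z: "z \<in> uhp"
  shows "Im ((1 + complex_of_real t * z) / (z - of_real t))
    = - (Im z * (1 + t^2) / ((Re z - t)^2 + (Im z)^2))"
proof -
  have "Im ((1 + complex_of_real t * z) / (z - of_real t)) =
     (t * Im z * (Re z - t) - (1 + t * Re z) * Im z) / ((Re z - t)^2 + (Im z)^2)"
    by (simp add: Im_divide)
  also have "t * Im z * (Re z - t) - (1 + t * Re z) * Im z = - (Im z * (1 + t^2))"
    by (simp add: algebra_simps power2_eq_square)
  finally show ?thesis by simp
qed

lemma Im_nevanlinna_integral:
  assumes s: "finite_borel \<sigma>" and z: "z \<in> uhp"
  shows "Im (nevanlinna \<gamma> \<sigma> z) = - (\<integral>t. Im z * (1 + t^2) / ((Re z - t)^2 + (Im z)^2) \<partial>\<sigma>)"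
    and "integrable \<sigma> (\<lambda>t. Im z * (1 + t^2) / ((Re z - t)^2 + (Im z)^2))"
proof -
  note i = nevanlinna_kernel_integrable[OF s z]
  have "Im (nevanlinna \<gamma> \<sigma> z) = (\<integral>t. Im ((1 + complex_of_real t * z) / (z - of_real t)) \<partial>\<sigma>)"
    unfolding nevanlinna_integral_def integral_Im[OF i] by simp
  then show "Im (nevanlinna \<gamma> \<sigma> z) = - (\<integral>t. Im z * (1 + t^2) / ((Re z - t)^2 + (Im z)^2) \<partial>\<sigma>)"
    unfolding Im_nevanlinna_kernel[OF z] by simp
  show "integrable \<sigma> (\<lambda>t. Im z * (1 + t^2) / ((Re z - t)^2 + (Im z)^2))"
    using integrable_Im[OF i] unfolding Im_nevanlinna_kernel[OF z] by simp
qed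

lemma Im_nevanlinna_integral_le:
  assumes s: "finite_borel \<sigma>" and z: "z \<in> uhp"
  shows "Im (nevanlinna \<gamma> \<sigma> z) \<le> 0"
proof -
  have "(\<integral>t. Im z * (1 + t^2) / ((Re z - t)^2 + (Im z)^2) \<partial>\<sigma>) \<ge> 0"
    using z by (intro integral_nonneg_AE AE_I2) (auto simp: uhp_iff)
  then show ?thesis unfolding Im_nevanlinna_integral(1)[OF s z] by simp
qed

lemma nevanlinna_cone_kernels:
  assumes w: "w \<in> tcone 2 \<beta>" and v: "v \<in> tcone 2 \<beta>" and b: "0 < \<beta>"
  shows "cmod ((1 + complex_of_real t * w) / (w - of_real t)) \<le> (1 / \<beta>^2 + 4 * min 1 (\<bar>t\<bar> / \<beta>)) * cmod w"
    "cmod ((1 + of_real (t^2)) / ((w - of_real t) * (v - of_real t)))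
       \<le> 1 / \<beta>^2 + 16 * min 1 (\<bar>t\<bar> / \<beta>)"
proof -
  let ?m = "min 1 (\<bar>t\<bar> / \<beta>)"
  have u: "w \<in> uhp" "v \<in> uhp" "Im w > \<beta>" "Im v > \<beta>"
    using w v b truncated_cone_uhp[of \<beta> 2] by (auto simp: truncated_cone_def)
  have i: "cmod (1 / (x - of_real t)) \<le> 1 / \<beta>" if "x \<in> uhp" "Im x > \<beta>" for x
  proof -
    have "1 / Im x \<le> 1 / \<beta>" using that b by (intro divide_left_mono) auto
    then show ?thesis using cauchy_kernel_bound[OF that(1), of t] by linarith
  qed
  have k: "cmod (complex_of_real t / (x - of_real t)) \<le> 4 * ?m" if "x \<in> tcone 2 \<beta>" for x
    by (rule cone2_kernel(2)[OF that b])
  have m: "0 \<le> ?m" "?m \<le> 1" using b by auto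
  have "(1 + complex_of_real t * w) / (w - of_real t)
    = 1 / (w - of_real t) + (complex_of_real t / (w - of_real t)) * w"
    by (simp add: add_divide_distrib)
  also have "cmod ... \<le> cmod (1 / (w - of_real t)) + cmod (complex_of_real t / (w - of_real t)) * cmod w"
    by (metis norm_mult norm_triangle_ineq)
  also have "... \<le> 1 / \<beta> + (4 * ?m) * cmod w"
    by (intro add_mono mult_right_mono i u k w norm_ge_zero)
  also have "1 / \<beta> \<le> 1 / \<beta>^2 * cmod w"
  proof -
    have "\<beta> \<le> cmod w" using u(3) abs_Im_le_cmod[of w] by linarith
    then show ?thesis using b by (simp add: field_simps power2_eq_square)
  qed
  finally show "cmod ((1 + complex_of_real t * w) / (w - of_real t)) \<le> (1 / \<beta>^2 + 4 * ?m) * cmod w"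
    by (simp add: algebra_simps)
  have "(1 + of_real (t^2)) / ((w - of_real t) * (v - of_real t))
     = (1 / (w - of_real t)) * (1 / (v - of_real t))
       + (complex_of_real t / (w - of_real t)) * (complex_of_real t / (v - of_real t))"
    by (simp add: add_divide_distrib power2_eq_square)
  also have "cmod ... \<le> cmod (1 / (w - of_real t)) * cmod (1 / (v - of_real t))
      + cmod (complex_of_real t / (w - of_real t)) * cmod (complex_of_real t / (v - of_real t))"
    by (metis norm_mult norm_triangle_ineq)
  also have "... \<le> (1 / \<beta>) * (1 / \<beta>) + (4 * ?m) * (4 * ?m)"
    using b m by (intro add_mono mult_mono i u k w v norm_ge_zero) auto
  also have "(4 * ?m) * (4 * ?m) \<le> 16 * ?m"
    using mult_left_mono[OF m(2) m(1)] by simp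
  finally show "cmod ((1 + of_real (t^2)) / ((w - of_real t) * (v - of_real t)))
       \<le> 1 / \<beta>^2 + 16 * ?m"
    by (simp add: power2_eq_square)
qed

lemma kappa_bound_integral:
  fixes f :: "real \<Rightarrow> complex"
  assumes s: "finite_borel \<sigma>" and b: "0 < \<beta>" and f: "f \<in> borel_measurable borel"
    and bd: "\<And>t. cmod (f t) \<le> a + c * min 1 (\<bar>t\<bar> / \<beta>)" and c: "c \<ge> 0"
  shows "cmod (\<integral>t. f t \<partial>\<sigma>) \<le> a * measure \<sigma> UNIV + c * kappa \<sigma> \<beta>"
proof -
  interpret finite_borel_measure \<sigma> by fact
  note [simp] = finite_borelD(3)[OF s]
  have "cmod (f t) \<le> a + c" for t
  proof -
    have "c * min 1 (\<bar>t\<bar> / \<beta>) \<le> c * 1" using c by (intro mult_left_mono) auto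
    then show ?thesis using bd[of t] by linarith
  qed
  then have i: "integrable \<sigma> f" by (rule integrable_bounded_borel[OF s f])
  have "cmod (\<integral>t. f t \<partial>\<sigma>) \<le> (\<integral>t. cmod (f t) \<partial>\<sigma>)" by (rule integral_norm_bound)
  also have "... \<le> (\<integral>t. a + c * min 1 (\<bar>t\<bar> / \<beta>) \<partial>\<sigma>)"
    by (intro integral_mono integrable_norm i bd Bochner_Integration.integrable_add integrable_mult_right
        kappa_integrable[OF s b]) simp
  also have "... = (\<integral>t. a \<partial>\<sigma>) + (\<integral>t. c * min 1 (\<bar>t\<bar> / \<beta>) \<partial>\<sigma>)"
    by (intro Bochner_Integration.integral_add integrable_mult_right kappa_integrable[OF s b]) simp
  also have "... = a * measure \<sigma> UNIV + c * kappa \<sigma> \<beta>"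
    unfolding kappa_def integral_mult_right_zero by simp
  finally show ?thesis .
qed

lemma nevanlinna_integral_diff:
  assumes s: "finite_borel \<sigma>" and w: "w \<in> uhp" and v: "v \<in> uhp"
  shows "nevanlinna \<gamma> \<sigma> w - nevanlinna \<gamma> \<sigma> v
    = (v - w) * (\<integral>t. (1 + of_real (t^2)) / ((w - of_real t) * (v - of_real t)) \<partial>\<sigma>)"
proof -
  have "nevanlinna \<gamma> \<sigma> w - nevanlinna \<gamma> \<sigma> v
    = (\<integral>t. (1 + complex_of_real t * w) / (w - of_real t)
        - (1 + complex_of_real t * v) / (v - of_real t) \<partial>\<sigma>)"
    unfolding nevanlinna_integral_def
    using Bochner_Integration.integral_diff[OF nevanlinna_kernel_integrable[OF s w] nevanlinna_kernel_integrable[OF s v]]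
    by simp
  also have "... = (\<integral>t. (v - w) * ((1 + of_real (t^2)) / ((w - of_real t) * (v - of_real t))) \<partial>\<sigma>)"
  proof (rule Bochner_Integration.integral_cong[OF refl])
    fix t
    have "w - of_real t \<noteq> 0" "v - of_real t \<noteq> 0" using uhp_diff_real_nz w v by auto
    then show "(1 + complex_of_real t * w) / (w - of_real t)
        - (1 + complex_of_real t * v) / (v - of_real t)
      = (v - w) * ((1 + of_real (t^2)) / ((w - of_real t) * (v - of_real t)))"
      by (simp add: divide_simps) (simp add: algebra_simps power2_eq_square)
  qed
  finally show ?thesis unfolding integral_mult_right_zero .
qed

text \<open>The bound is explicit in \<open>\<gamma>\<close>, the mass and \<open>kappa\<close>, each of which is continuous under weak convergence;
so it holds uniformly along convergent data.\<close>
lemma nevanlinna_cone_small: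
  assumes s: "finite_borel \<sigma>" and b: "0 < \<beta>"
  shows "cone_small (nevanlinna \<gamma> \<sigma>) \<beta> (\<bar>\<gamma>\<bar> / \<beta> + measure \<sigma> UNIV / \<beta>^2 + 16 * kappa \<sigma> \<beta>)"
  unfolding cone_small_def
proof (intro conjI ballI)
  let ?K = "kappa \<sigma> \<beta>" and ?M = "measure \<sigma> UNIV"
  have k0: "0 \<le> ?K" by (rule kappa_nonneg[OF b])
  fix w assume w: "w \<in> tcone 2 \<beta>"
  have u: "w \<in> uhp" using w b truncated_cone_uhp[of \<beta> 2] by auto
  have bw: "\<beta> \<le> cmod w" using w abs_Im_le_cmod[of w] by (auto simp: truncated_cone_def)
  have "cmod (\<integral>t. (1 + complex_of_real t * w) / (w - of_real t) \<partial>\<sigma>)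
      \<le> (1 / \<beta>^2 * cmod w) * ?M + (4 * cmod w) * ?K"
  proof (rule kappa_bound_integral[OF s b])
    show "cmod ((1 + complex_of_real t * w) / (w - of_real t)) \<le> 1 / \<beta>^2 * cmod w + 4 * cmod w * min 1 (\<bar>t\<bar> / \<beta>)" for t
      using nevanlinna_cone_kernels(1)[OF w w b, of t] by (simp add: algebra_simps)
  qed auto
  moreover have "\<bar>\<gamma>\<bar> \<le> \<bar>\<gamma>\<bar> / \<beta> * cmod w"
    using mult_left_mono[OF bw, of "\<bar>\<gamma>\<bar>"] b by (simp add: field_simps)
  moreover have "(4 * cmod w) * ?K \<le> (16 * cmod w) * ?K" using k0 by (intro mult_right_mono) auto
  moreover have "cmod (nevanlinna \<gamma> \<sigma> w) \<le> cmod (complex_of_real \<gamma>)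
     + cmod (\<integral>t. (1 + complex_of_real t * w) / (w - of_real t) \<partial>\<sigma>)"
    unfolding nevanlinna_integral_def by (rule norm_triangle_ineq)
  ultimately show "cmod (nevanlinna \<gamma> \<sigma> w) \<le> (\<bar>\<gamma>\<bar> / \<beta> + ?M / \<beta>^2 + 16 * ?K) * cmod w"
    by (simp add: algebra_simps)
  fix v assume v: "v \<in> tcone 2 \<beta>"
  have uv: "v \<in> uhp" using v b truncated_cone_uhp[of \<beta> 2] by auto
  have "cmod (\<integral>t. (1 + of_real (t^2)) / ((w - of_real t) * (v - of_real t)) \<partial>\<sigma>)
      \<le> (1 / \<beta>^2) * ?M + 16 * ?K"
    by (rule kappa_bound_integral[OF s b]) (measurable, rule nevanlinna_cone_kernels(2)[OF w v b], simp)
  also have "... \<le> \<bar>\<gamma>\<bar> / \<beta> + ?M / \<beta>^2 + 16 * ?K" using b by simp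
  finally have "cmod (v - w) * cmod (\<integral>t. (1 + of_real (t^2)) / ((w - of_real t) * (v - of_real t)) \<partial>\<sigma>)
     \<le> cmod (v - w) * (\<bar>\<gamma>\<bar> / \<beta> + ?M / \<beta>^2 + 16 * ?K)"
    by (intro mult_left_mono) auto
  then show "cmod (nevanlinna \<gamma> \<sigma> w - nevanlinna \<gamma> \<sigma> v)
     \<le> (\<bar>\<gamma>\<bar> / \<beta> + ?M / \<beta>^2 + 16 * ?K) * cmod (w - v)"
    unfolding nevanlinna_integral_diff[OF s u uv] norm_mult by (simp only: norm_minus_commute mult.commute)
qed

lemma kappa_mono:
  assumes s: "finite_borel \<sigma>" and b: "0 < \<beta>" "\<beta> \<le> \<beta>'"
  shows "kappa \<sigma> \<beta>' \<le> kappa \<sigma> \<beta>"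
  unfolding kappa_def
proof (rule integral_mono)
  show "integrable \<sigma> (\<lambda>t. min 1 (\<bar>t\<bar> / \<beta>'))" using b by (intro kappa_integrable[OF s]) auto
  show "integrable \<sigma> (\<lambda>t. min 1 (\<bar>t\<bar> / \<beta>))" by (rule kappa_integrable[OF s b(1)])
  show "min 1 (\<bar>t\<bar> / \<beta>') \<le> min 1 (\<bar>t\<bar> / \<beta>)" for t
    using b by (intro min.mono divide_left_mono) auto
qed

lemma nevanlinna_const_small:
  assumes s: "finite_borel \<sigma>" and e: "e > 0"
  shows "\<exists>\<beta>\<ge>1. \<bar>\<gamma>\<bar> / \<beta> + measure \<sigma> UNIV / \<beta>^2 + 16 * kappa \<sigma> \<beta> \<le> e"
proof -
  obtain \<beta>0 where b0: "\<beta>0 > 0" "kappa \<sigma> \<beta>0 < e / 48"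
    using kappa_small[OF s, of "e / 48"] e by auto
  define \<beta> where "\<beta> = max \<beta>0 (max 1 (max (3 * \<bar>\<gamma>\<bar> / e) (3 * measure \<sigma> UNIV / e)))"
  have b: "\<beta> \<ge> \<beta>0" "\<beta> \<ge> 1" "\<beta> \<ge> 3 * \<bar>\<gamma>\<bar> / e" "\<beta> \<ge> 3 * measure \<sigma> UNIV / e" by (auto simp: \<beta>_def)
  have bp: "\<beta> > 0" using b(2) by linarith
  have "\<bar>\<gamma>\<bar> / \<beta> \<le> e / 3" using b(3) bp e by (simp add: field_simps)
  moreover have "measure \<sigma> UNIV / \<beta>^2 \<le> e / 3"
  proof -
    have "measure \<sigma> UNIV / \<beta>^2 \<le> measure \<sigma> UNIV / \<beta>"
      using b(2) bp by (intro divide_left_mono) (auto simp: power2_eq_square)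
    also have "... \<le> e / 3" using b(4) bp e by (simp add: field_simps)
    finally show ?thesis .
  qed
  moreover have "16 * kappa \<sigma> \<beta> \<le> e / 3" using kappa_mono[OF s b0(1) b(1)] b0(2) by simp
  ultimately have "\<bar>\<gamma>\<bar> / \<beta> + measure \<sigma> UNIV / \<beta>^2 + 16 * kappa \<sigma> \<beta> \<le> e" by linarith
  then show ?thesis using b(2) by blast
qed

lemma nevanlinna_small:
  assumes s: "finite_borel \<sigma>" and e: "e > 0"
  shows "\<exists>\<beta>>0. cone_small (nevanlinna \<gamma> \<sigma>) \<beta> e"
proof -
  obtain \<beta> where b: "\<beta> \<ge> 1" "\<bar>\<gamma>\<bar> / \<beta> + measure \<sigma> UNIV / \<beta>^2 + 16 * kappa \<sigma> \<beta> \<le> e"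
    using nevanlinna_const_small[OF s e] by blast
  have bp: "\<beta> > 0" using b(1) by linarith
  have "cone_small (nevanlinna \<gamma> \<sigma>) \<beta> e"
    by (rule cone_small_mono[OF nevanlinna_cone_small[OF s bp] _ order_refl b(2)]) (use bp in simp)
  then show ?thesis using bp by blast
qed

lemma nevanlinna_pick_class:
  "finite_borel \<sigma> ==> pick_class (nevanlinna \<gamma> \<sigma>)"
  unfolding pick_class_def
  using nevanlinna_integral_holomorphic Im_nevanlinna_integral_le nevanlinna_small by blast

lemma nevanlinna_unique:
  assumes s: "finite_borel \<sigma>" "finite_borel \<tau>"
    and U: "open U" "U \<noteq> {}" "U \<subseteq> uhp"
    and eq: "\<And>z. z \<in> U ==> nevanlinna \<gamma> \<sigma> z = nevanlinna \<delta> \<tau> z"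
  shows "\<gamma> = \<delta>" "\<sigma> = \<tau>"
proof -
  have all: "nevanlinna \<gamma> \<sigma> z = nevanlinna \<delta> \<tau> z" if "z \<in> uhp" for z
    using analytic_continuation_open[OF U(1) open_uhp U(2) connected_uhp U(3)
        nevanlinna_integral_holomorphic[OF s(1)] nevanlinna_integral_holomorphic[OF s(2)] eq that] .
  have i: "\<i> \<in> uhp" by (simp add: uhp_iff)
  have "complex_of_real \<gamma> - \<i> * of_real (measure \<sigma> UNIV) = complex_of_real \<delta> - \<i> * of_real (measure \<tau> UNIV)"
    using all[OF i] unfolding nevanlinna_integral_eq[OF s(1) i] nevanlinna_integral_eq[OF s(2) i] by simp
  then have e: "\<gamma> = \<delta>" "measure \<sigma> UNIV = measure \<tau> UNIV" by (auto simp: complex_eq_iff)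
  show "\<gamma> = \<delta>" by (rule e)
  show "\<sigma> = \<tau>"
  proof (rule cauchy_transform_determines_open[OF s, of "uhp - {\<i>}"])
    show "open (uhp - {\<i>})" by (rule open_delete) simp
    have "2 * \<i> \<in> uhp - {\<i>}" by (simp add: uhp_iff)
    then show "uhp - {\<i>} \<noteq> {}" by blast
    fix z assume z: "z \<in> uhp - {\<i>}"
    have "1 + z^2 = (z - \<i>) * (z + \<i>)" by (simp add: power2_eq_square algebra_simps)
    moreover have "z + \<i> \<noteq> 0" using z by (auto simp: uhp_iff complex_eq_iff)
    ultimately have "1 + z^2 \<noteq> 0" using z by auto
    then show "cauchy_transform \<sigma> z = cauchy_transform \<tau> z"
      using all[of z] z nevanlinna_integral_eq[OF s(1), of z] nevanlinna_integral_eq[OF s(2), of z] e by simp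
  qed auto
qed

lemma nevanlinna_converges:
  assumes W: "weakly_converges X \<sigma>" and X: "\<And>n. finite_borel (X n)" "finite_borel \<sigma>"
    and g: "g \<longlonglongrightarrow> \<gamma>" and z: "z \<in> uhp"
  shows "(\<lambda>n. nevanlinna (g n) (X n) z) \<longlonglongrightarrow> nevanlinna \<gamma> \<sigma> z"
  unfolding nevanlinna_integral_def
  by (intro tendsto_add tendsto_of_real g
      weakly_converges_complex[OF W X nevanlinna_kernel_continuous[OF z] nevanlinna_kernel_bound[OF z]])

text \<open>Evaluated at \<open>iy\<close>, minus the imaginary part dominates \<open>y\<close> times the integral of the tail kernel,
so convergence gives tightness, and uniqueness identifies every limit point.\<close>
lemma nevanlinna_converges_imp:
  assumes X: "\<And>n. finite_borel (X n)" and s: "finite_borel \<sigma>"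
    and B: "\<And>n. measure (X n) UNIV \<le> B" and a: "\<alpha> > 0" and b: "\<beta> \<ge> 0"
    and lim: "\<And>z. z \<in> tcone \<alpha> \<beta> ==>
       (\<lambda>n. nevanlinna (g n) (X n) z) \<longlonglongrightarrow> nevanlinna \<gamma> \<sigma> z"
  shows "weakly_converges X \<sigma>" "g \<longlonglongrightarrow> \<gamma>"
proof -
  have tight: "tight_seq X"
  proof (rule tight_seqI_kernel[OF X])
    fix e :: real assume e: "e > 0"
    obtain \<beta>' where b': "\<beta>' > 0" "cone_small (nevanlinna \<gamma> \<sigma>) \<beta>' (e / 2)"
      using nevanlinna_small[OF s, of "e / 2"] e by auto
    define y where "y = max \<beta> \<beta>' + 1"
    have y: "y > \<beta>" "y > \<beta>'" "y > 0" using b b' by (auto simp: y_def)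
    let ?z = "Complex 0 y"
    have u: "?z \<in> uhp" using y by (simp add: uhp_iff)
    have cz: "cmod ?z = y" using y by (simp add: cmod_def)
    have "cmod (nevanlinna \<gamma> \<sigma> ?z) \<le> e / 2 * cmod ?z"
      using b'(2) truncated_cone_imaginary[of 2 \<beta>' y] y unfolding cone_small_def by auto
    then have "- Im (nevanlinna \<gamma> \<sigma> ?z) \<le> e / 2 * y"
      using abs_Im_le_cmod[of "nevanlinna \<gamma> \<sigma> ?z"] cz by simp
    also have "... < e * y" using e y by simp
    finally have "- Im (nevanlinna \<gamma> \<sigma> ?z) < e * y" .
    moreover have "(\<lambda>n. - Im (nevanlinna (g n) (X n) ?z)) \<longlonglongrightarrow> - Im (nevanlinna \<gamma> \<sigma> ?z)"
      by (intro tendsto_intros lim truncated_cone_imaginary a y)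
    ultimately have ev: "eventually (\<lambda>n. - Im (nevanlinna (g n) (X n) ?z) < e * y) sequentially"
      using order_tendstoD(2) by blast
    have "(\<integral>t. t^2 / (t^2 + y^2) \<partial>X n) \<le> e" if "- Im (nevanlinna (g n) (X n) ?z) < e * y" for n
    proof -
      have "(\<integral>t. y * (t^2 / (t^2 + y^2)) \<partial>X n) \<le> (\<integral>t. Im ?z * (1 + t^2) / ((Re ?z - t)^2 + (Im ?z)^2) \<partial>X n)"
      proof (rule integral_mono)
        show "integrable (X n) (\<lambda>t. y * (t^2 / (t^2 + y^2)))"
          by (intro integrable_mult_right tail_kernel_integrable[OF X y(3)])
        show "integrable (X n) (\<lambda>t. Im ?z * (1 + t^2) / ((Re ?z - t)^2 + (Im ?z)^2))"
          by (rule Im_nevanlinna_integral(2)[OF X u])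
        show "y * (t^2 / (t^2 + y^2)) \<le> Im ?z * (1 + t^2) / ((Re ?z - t)^2 + (Im ?z)^2)" for t
          using y by (simp add: divide_right_mono)
      qed
      also have "... < e * y" using that Im_nevanlinna_integral(1)[OF X u] by simp
      finally show ?thesis unfolding integral_mult_right_zero using y by (simp add: mult.commute)
    qed
    then have "eventually (\<lambda>n. (\<integral>t. t^2 / (t^2 + y^2) \<partial>X n) \<le> e) sequentially"
      by (rule eventually_mono[OF ev])
    then show "\<exists>y>0. eventually (\<lambda>n. (\<integral>t. t^2 / (t^2 + y^2) \<partial>X n) \<le> e) sequentially"
      by (intro exI[of _ y] conjI y(3))
  qed
  define z0 where "z0 = Complex 0 (\<beta> + 1)"
  have z0: "z0 \<in> tcone \<alpha> \<beta>" unfolding z0_def using b by (intro truncated_cone_imaginary a) auto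
  have sub: "tcone \<alpha> \<beta> \<subseteq> uhp" by (rule truncated_cone_uhp[OF b])
  have u0: "z0 \<in> uhp" using z0 sub by blast
  define I where "I n = (\<integral>t. (1 + complex_of_real t * z0) / (z0 - complex_of_real t) \<partial>X n)" for n
  have gI: "g n = Re (nevanlinna (g n) (X n) z0 - I n)" for n
    by (simp add: nevanlinna_integral_def I_def)
  have "bounded (range g)"
  proof -
    have "Bseq (\<lambda>n. nevanlinna (g n) (X n) z0)"
      using lim[OF z0] by (intro convergent_imp_Bseq) (auto simp: convergent_def)
    then obtain K where K: "\<And>n. cmod (nevanlinna (g n) (X n) z0) \<le> K" by (auto simp: Bseq_def)
    let ?C = "cmod z0 + cmod (1 + z0^2) / Im z0"
    have C0: "0 \<le> ?C" using u0 by (simp add: uhp_iff)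
    have "norm (g n) \<le> K + ?C * B" for n
    proof -
      have "cmod (I n) \<le> ?C * measure (X n) UNIV" unfolding I_def
        by (rule norm_integral_bound[OF X _ nevanlinna_kernel_bound[OF u0]]) measurable
      also have "... \<le> ?C * B" by (intro mult_left_mono B C0)
      finally have "cmod (I n) \<le> ?C * B" .
      then have "cmod (nevanlinna (g n) (X n) z0 - I n) \<le> K + ?C * B"
        using norm_triangle_ineq4[of "nevanlinna (g n) (X n) z0" "I n"] K[of n] by linarith
      then show ?thesis
        using abs_Re_le_cmod[of "nevanlinna (g n) (X n) z0 - I n"] gI[of n] by simp
    qed
    then show ?thesis by (intro boundedI[of _ "K + ?C * B"]) auto
  qed
  then obtain R where R0: "\<And>n. norm (g n) \<le> R" by (auto simp: bounded_iff)
  have R: "g n \<in> {-R..R}" for n using R0[of n] by auto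
  show W: "weakly_converges X \<sigma>"
  proof (rule weakly_convergesI_tight[OF X B tight])
    fix r :: "nat \<Rightarrow> nat" and N
    assume r: "strict_mono r" and N: "finite_borel N" and WN: "weakly_converges (X \<circ> r) N"
    have "\<forall>n. (g \<circ> r) n \<in> {-R..R}" using R by simp
    then obtain \<delta> q where q: "strict_mono (q :: nat \<Rightarrow> nat)" "((g \<circ> r) \<circ> q) \<longlonglongrightarrow> \<delta>"
      using compact_Icc[of "-R" R] unfolding compact_def by blast
    show "N = \<sigma>"
    proof (rule nevanlinna_unique(2)[OF N s open_truncated_cone truncated_cone_nonempty[OF a] sub])
      fix z assume z: "z \<in> tcone \<alpha> \<beta>"
      have "(\<lambda>n. nevanlinna (((g \<circ> r) \<circ> q) n) (((X \<circ> r) \<circ> q) n) z) \<longlonglongrightarrow> nevanlinna \<delta> N z"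
        using sub z X by (intro nevanlinna_converges[OF weakly_converges_subseq[OF WN q(1)] _ N q(2)]) auto
      moreover have "(\<lambda>n. nevanlinna (((g \<circ> r) \<circ> q) n) (((X \<circ> r) \<circ> q) n) z) \<longlonglongrightarrow> nevanlinna \<gamma> \<sigma> z"
        using LIMSEQ_subseq_LIMSEQ[OF lim[OF z] strict_mono_o[OF r q(1)]] by (simp add: o_def)
      ultimately show "nevanlinna \<delta> N z = nevanlinna \<gamma> \<sigma> z" by (rule LIMSEQ_unique)
    qed
  qed
  have "I \<longlonglongrightarrow> (\<integral>t. (1 + complex_of_real t * z0) / (z0 - complex_of_real t) \<partial>\<sigma>)"
    unfolding I_def
    by (rule weakly_converges_complex[OF W X s nevanlinna_kernel_continuous[OF u0] nevanlinna_kernel_bound[OF u0]])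
  then have "(\<lambda>n. Re (nevanlinna (g n) (X n) z0 - I n)) \<longlonglongrightarrow>
      Re (nevanlinna \<gamma> \<sigma> z0 - (\<integral>t. (1 + complex_of_real t * z0) / (z0 - complex_of_real t) \<partial>\<sigma>))"
    by (intro tendsto_intros lim z0)
  then show "g \<longlonglongrightarrow> \<gamma>" unfolding gI[symmetric] by (simp add: nevanlinna_integral_def)
qed

section \<open>Boolean convolution\<close>

lemma pick_class_cone1:
  assumes "pick_class E" "\<epsilon> > 0"
  shows "\<exists>\<beta>>0. \<forall>w\<in>tcone 1 \<beta>. cmod (E w) \<le> \<epsilon> * cmod w"
proof -
  obtain \<beta> where b: "\<beta> > 0" "cone_small E \<beta> \<epsilon>" using assms by (auto simp: pick_class_def)
  have "tcone 1 \<beta> \<subseteq> tcone 2 \<beta>" using b by (intro truncated_cone_mono) auto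
  then show ?thesis using b unfolding cone_small_def by (intro exI[of _ \<beta>]) blast
qed

lemma pick_class_add:
  assumes "pick_class E" "pick_class E'"
  shows "pick_class (\<lambda>z. E z + E' z)"
  unfolding pick_class_def
proof (intro conjI ballI allI impI)
  show "(\<lambda>z. E z + E' z) holomorphic_on uhp"
    using assms by (intro holomorphic_intros) (auto simp: pick_class_def)
  show "Im (E z + E' z) \<le> 0" if "z \<in> uhp" for z
    using assms that by (simp add: pick_class_def add_nonpos_nonpos)
  fix \<epsilon> :: real assume e: "\<epsilon> > 0"
  obtain \<beta> where b: "\<beta> > 0" "cone_small E \<beta> (\<epsilon> / 2)" using assms e by (meson pick_class_def half_gt_zero)
  obtain \<beta>' where b': "\<beta>' > 0" "cone_small E' \<beta>' (\<epsilon> / 2)" using assms e by (meson pick_class_def half_gt_zero)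
  let ?b = "max \<beta> \<beta>'"
  have c: "cone_small E ?b (\<epsilon> / 2)" "cone_small E' ?b (\<epsilon> / 2)"
    using b b' by (auto intro: cone_small_mono)
  have "cone_small (\<lambda>z. E z + E' z) ?b \<epsilon>"
    unfolding cone_small_def
  proof (intro conjI ballI)
    fix w assume w: "w \<in> tcone 2 ?b"
    have "cmod (E w) \<le> \<epsilon> / 2 * cmod w" "cmod (E' w) \<le> \<epsilon> / 2 * cmod w"
      using c w unfolding cone_small_def by auto
    then show "cmod (E w + E' w) \<le> \<epsilon> * cmod w" using norm_triangle_ineq[of "E w" "E' w"] by linarith
    fix v assume v: "v \<in> tcone 2 ?b"
    have "cmod (E w - E v) \<le> \<epsilon> / 2 * cmod (w - v)" "cmod (E' w - E' v) \<le> \<epsilon> / 2 * cmod (w - v)"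
      using c w v unfolding cone_small_def by auto
    then show "cmod (E w + E' w - (E v + E' v)) \<le> \<epsilon> * cmod (w - v)"
      using norm_diff_triangle_ineq[of "E w" "E' w" "E v" "E' v"] by linarith
  qed
  then show "\<exists>\<beta>>0. cone_small (\<lambda>z. E z + E' z) \<beta> \<epsilon>" using b(1) by (intro exI[of _ ?b]) auto
qed

lemma pick_class_E_transform_ex1:
  assumes "pick_class E"
  shows "\<exists>!M. real_distribution M \<and> (\<forall>z. Im z > 0 \<longrightarrow> E_transform M z = E z)"
proof (rule ex_ex1I)
  show "\<exists>M. real_distribution M \<and> (\<forall>z. Im z > 0 \<longrightarrow> E_transform M z = E z)"
    using E_transform_exists[OF _ _ pick_class_cone1[OF assms]] assms
    unfolding pick_class_def by (auto simp: uhp_iff)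
  show "M = N" if "real_distribution M \<and> (\<forall>z. Im z > 0 \<longrightarrow> E_transform M z = E z)"
    "real_distribution N \<and> (\<forall>z. Im z > 0 \<longrightarrow> E_transform N z = E z)" for M N
    using that by (intro E_transform_unique) (auto simp: uhp_iff)
qed

lemma boolean_convolution:
  assumes "real_distribution \<mu>" "real_distribution \<nu>"
  shows "real_distribution (boolean_convolution \<mu> \<nu>)"
    "z \<in> uhp ==> E_transform (boolean_convolution \<mu> \<nu>) z = E_transform \<mu> z + E_transform \<nu> z"
  using theI'[OF pick_class_E_transform_ex1[OF pick_class_add[OF
      E_transform_pick_class[OF assms(1)] E_transform_pick_class[OF assms(2)]]]]
  unfolding boolean_convolution_def by (auto simp: uhp_iff)

lemma boolean_inf_div:
  assumes "finite_borel \<sigma>"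
  shows "real_distribution (boolean_inf_div \<gamma> \<sigma>)"
    "z \<in> uhp ==> E_transform (boolean_inf_div \<gamma> \<sigma>) z = nevanlinna \<gamma> \<sigma> z"
  using theI'[OF pick_class_E_transform_ex1[OF nevanlinna_pick_class[OF assms]]]
  unfolding boolean_inf_div_def by (auto simp: uhp_iff)

lemma real_distribution_return: "real_distribution (return borel (c::real))"
  by (auto simp: real_distribution_def real_distribution_axioms_def intro!: prob_space_return)

lemma F_transform_return: "F_transform (return borel c) z = z - of_real c"
  by (simp add: F_transform_def cauchy_transform_def integral_return)

lemma E_transform_return: "E_transform (return borel c) z = of_real c"
  by (simp add: E_transform_def F_transform_return)

lemma iterated_convolution_0: "iterated_convolution cv \<mu> \<nu> 0 = \<mu>"
  by (simp add: iterated_convolution_def)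

lemma iterated_convolution_Suc:
  "iterated_convolution cv \<mu> \<nu> (Suc m) = cv (iterated_convolution cv \<mu> \<nu> m) (\<nu> (Suc m))"
  by (simp add: iterated_convolution_def)

lemma iterated_boolean_convolution:
  assumes "\<And>j. 1 \<le> j ==> j \<le> m ==> real_distribution (\<nu> j)"
  shows "real_distribution (iterated_convolution boolean_convolution (return borel c) \<nu> m) \<and>
    (\<forall>z\<in>uhp. E_transform (iterated_convolution boolean_convolution (return borel c) \<nu> m) z
       = of_real c + (\<Sum>j=1..m. E_transform (\<nu> j) z))"
  using assms
proof (induction m)
  case 0
  then show ?case by (simp add: iterated_convolution_0 real_distribution_return E_transform_return)
next
  case (Suc m)
  then have IH: "real_distribution (iterated_convolution boolean_convolution (return borel c) \<nu> m)"
    "\<And>z. z \<in> uhp ==> E_transform (iterated_convolution boolean_convolution (return borel c) \<nu> m) z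
       = of_real c + (\<Sum>j=1..m. E_transform (\<nu> j) z)"
    by auto
  have "real_distribution (\<nu> (Suc m))" using Suc.prems by simp
  from boolean_convolution[OF IH(1) this] IH(2) show ?case
    by (simp add: iterated_convolution_Suc)
qed

lemma weakly_converges_E_transform:
  assumes X: "\<And>n. real_distribution (X n)" and M: "real_distribution M"
    and W: "weakly_converges X M" and z: "z \<in> uhp"
  shows "(\<lambda>n. E_transform (X n) z) \<longlonglongrightarrow> E_transform M z"
  unfolding E_transform_def F_transform_def
  by (intro tendsto_intros weakly_converges_cauchy[OF W real_distributionD(2)[OF X] real_distributionD(2)[OF M] z]
      cauchy_transform_nz[OF M z])

lemma weakly_converges_of_E_cone:
  assumes X: "\<And>n. real_distribution (X n)" and M: "real_distribution M"
    and a: "\<alpha> > 0" and b: "\<beta> \<ge> 0"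
    and E: "\<And>z. z \<in> tcone \<alpha> \<beta> ==> (\<lambda>n. E_transform (X n) z) \<longlonglongrightarrow> E_transform M z"
  shows "weakly_converges X M"
proof (rule weakly_converges_of_cauchy_cone[OF X M a b])
  fix z assume zc: "z \<in> tcone \<alpha> \<beta>"
  then have z: "z \<in> uhp" using truncated_cone_uhp[OF b] by auto
  have Fnz: "F_transform N z \<noteq> 0" if "real_distribution N" for N
    using cauchy_transform_nz[OF that z] by (simp add: F_transform_def)
  have "(\<lambda>n. 1 / (z - E_transform (X n) z)) \<longlonglongrightarrow> 1 / (z - E_transform M z)"
    using Fnz[OF M] E[OF zc] by (intro tendsto_intros) (auto simp: E_transform_def)
  moreover have "1 / (z - E_transform N z) = cauchy_transform N z" for N
    by (simp add: E_transform_def F_transform_def)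
  ultimately show "(\<lambda>n. cauchy_transform (X n) z) \<longlonglongrightarrow> cauchy_transform M z" by simp
qed

section \<open>Germs of inverses at infinity\<close>

abbreviation (input) "voiculescu_on \<equiv> is_voiculescu_transform_on"

lemma dist_ratio_one: "z \<noteq> 0 ==> dist (a / z) (1::complex) = cmod (a - z) / cmod z"
proof -
  assume z: "z \<noteq> 0"
  then have "a / z - 1 = (a - z) / z" by (simp add: field_simps)
  then show ?thesis by (simp add: dist_norm norm_divide)
qed

lemma tendsto_ratio_coneI:
  assumes a: "\<alpha> \<le> 1" and b: "0 \<le> \<beta>"
    and g: "\<And>e. e > 0 ==> \<exists>B. \<forall>z\<in>tcone \<alpha> \<beta>. Im z > B \<longrightarrow> cmod (g z - z) \<le> e * cmod z"
  shows "((\<lambda>z. g z / z) \<longlongrightarrow> 1) (inf at_infinity (principal (tcone \<alpha> \<beta>)))"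
proof (rule tendstoI)
  fix e :: real assume e: "e > 0"
  obtain B where B: "\<And>z. z \<in> tcone \<alpha> \<beta> ==> Im z > B ==> cmod (g z - z) \<le> e / 2 * cmod z"
    using g[of "e / 2"] e by auto
  have "dist (g z / z) 1 < e" if z: "z \<in> tcone \<alpha> \<beta>" and n: "cmod z \<ge> 2 * \<bar>B\<bar> + 1" for z
  proof -
    have "z \<in> tcone 1 0" using z truncated_cone_mono[of \<alpha> 1 0 \<beta>] a b by auto
    then have "cmod z \<le> 2 * Im z" by (rule cone_imag_norm) simp
    then have "Im z > B" using n by linarith
    then have 1: "cmod (g z - z) \<le> e / 2 * cmod z" by (rule B[OF z])
    have nz: "z \<noteq> 0" using n by auto
    have "dist (g z / z) 1 = cmod (g z - z) / cmod z"
      by (rule dist_ratio_one) (use nz in simp)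
    also have "... \<le> e / 2" using 1 nz by (simp add: pos_divide_le_eq)
    finally show ?thesis using e by simp
  qed
  then show "\<forall>\<^sub>F z in inf at_infinity (principal (tcone \<alpha> \<beta>)). dist (g z / z) 1 < e"
    unfolding eventually_inf_principal eventually_at_infinity
    by (intro exI[of _ "2 * \<bar>B\<bar> + 1"]) blast
qed

lemma tendsto_ratio_coneD:
  assumes "((\<lambda>z. g z / z) \<longlongrightarrow> 1) (inf at_infinity (principal (tcone \<alpha> \<beta>)))" and e: "e > 0"
  shows "\<exists>B\<ge>b. \<forall>z\<in>tcone \<alpha> \<beta>. Im z > B \<longrightarrow> cmod (g z - z) \<le> e * cmod z"
proof -
  have "\<forall>\<^sub>F z in inf at_infinity (principal (tcone \<alpha> \<beta>)). dist (g z / z) 1 < e"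
    by (rule tendstoD[OF assms])
  then obtain C where C: "\<And>z. cmod z \<ge> C ==> z \<in> tcone \<alpha> \<beta> ==> dist (g z / z) 1 < e"
    unfolding eventually_inf_principal eventually_at_infinity by blast
  show ?thesis
  proof (intro exI[of _ "max b (max C 0)"] conjI ballI impI)
    fix z assume z: "z \<in> tcone \<alpha> \<beta>" "Im z > max b (max C 0)"
    have n: "cmod z \<ge> Im z" using abs_Im_le_cmod[of z] by linarith
    then have nz: "z \<noteq> 0" "cmod z \<ge> C" using z(2) by auto
    have "dist (g z / z) 1 = cmod (g z - z) / cmod z"
      by (rule dist_ratio_one) (use nz in simp)
    then have "cmod (g z - z) / cmod z \<le> e" using C[OF nz(2) z(1)] by simp
    then show "cmod (g z - z) \<le> e * cmod z" using nz by (simp add: pos_divide_le_eq)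
  qed auto
qed

lemma F_inverse_restrict:
  assumes "is_F_inverse_on \<Gamma> \<mu> g" "\<Gamma>' \<subseteq> \<Gamma>"
  shows "is_F_inverse_on \<Gamma>' \<mu> g"
proof -
  have "inf at_infinity (principal \<Gamma>') \<le> inf at_infinity (principal \<Gamma>)"
    using assms(2) by (intro inf_mono) auto
  then show ?thesis
    using assms unfolding is_F_inverse_on_def by (blast intro: holomorphic_on_subset tendsto_mono)
qed

lemma F_inverse_cong:
  assumes "is_F_inverse_on \<Gamma> \<mu> g" "\<And>z. z \<in> \<Gamma> ==> g z = h z"
  shows "is_F_inverse_on \<Gamma> \<mu> h"
  unfolding is_F_inverse_on_def
proof (intro conjI ballI)
  show "h holomorphic_on \<Gamma>"
    using assms holomorphic_transform unfolding is_F_inverse_on_def by blast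
  show "Im (h z) > 0" "F_transform \<mu> (h z) = z" if "z \<in> \<Gamma>" for z
    using assms that unfolding is_F_inverse_on_def by force+
  have "eventually (\<lambda>z. g z / z = h z / z) (inf at_infinity (principal \<Gamma>))"
    unfolding eventually_inf_principal using assms(2) by (intro always_eventually) auto
  then show "((\<lambda>z. h z / z) \<longlongrightarrow> 1) (inf at_infinity (principal \<Gamma>))"
    using assms(1) unfolding is_F_inverse_on_def by (blast intro: Lim_transform_eventually)
qed

lemma voiculescu_iff: "voiculescu_on \<Gamma> \<mu> \<phi> \<longleftrightarrow> is_F_inverse_on \<Gamma> \<mu> (\<lambda>z. z + \<phi> z)"
proof
  assume "voiculescu_on \<Gamma> \<mu> \<phi>"
  then obtain g where "is_F_inverse_on \<Gamma> \<mu> g" "\<forall>z\<in>\<Gamma>. \<phi> z = g z - z"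
    by (auto simp: is_voiculescu_transform_on_def)
  then show "is_F_inverse_on \<Gamma> \<mu> (\<lambda>z. z + \<phi> z)" by (elim F_inverse_cong) simp
next
  assume "is_F_inverse_on \<Gamma> \<mu> (\<lambda>z. z + \<phi> z)"
  then show "voiculescu_on \<Gamma> \<mu> \<phi>"
    unfolding is_voiculescu_transform_on_def by (intro exI[of _ "\<lambda>z. z + \<phi> z"]) auto
qed

lemma F_inverse_near:
  assumes g: "is_F_inverse_on (tcone \<alpha> \<beta>) \<mu> g" and a: "0 < \<alpha>" and b: "0 < \<beta>" and c: "0 < \<beta>0"
  shows "\<exists>B\<ge>max \<beta> b. \<forall>z\<in>tcone (min \<alpha> 1) B. cmod (g z - z) \<le> cmod z / 8 \<and> g z \<in> tcone 2 \<beta>0"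
proof -
  have lim: "((\<lambda>z. g z / z) \<longlongrightarrow> 1) (inf at_infinity (principal (tcone \<alpha> \<beta>)))"
    using g by (simp add: is_F_inverse_on_def)
  obtain B where B: "B \<ge> max \<beta> (max b (2 * \<beta>0))"
     "\<And>z. z \<in> tcone \<alpha> \<beta> ==> Im z > B ==> cmod (g z - z) \<le> (1 / 8) * cmod z"
    using tendsto_ratio_coneD[OF lim, of "1 / 8" "max \<beta> (max b (2 * \<beta>0))"] by auto
  have "cmod (g z - z) \<le> cmod z / 8 \<and> g z \<in> tcone 2 \<beta>0" if z: "z \<in> tcone (min \<alpha> 1) B" for z
  proof -
    have "tcone (min \<alpha> 1) B \<subseteq> tcone \<alpha> \<beta>" using B(1) b by (intro truncated_cone_mono) auto
    then have 1: "cmod (g z - z) \<le> cmod z / 8" using B(2)[of z] z by (auto simp: truncated_cone_def)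
    have "tcone (min \<alpha> 1) B \<subseteq> tcone 1 (2 * \<beta>0)" using B(1) c by (intro truncated_cone_mono) auto
    then have "z \<in> tcone 1 (2 * \<beta>0)" using z by blast
    from near_cone(1)[OF this c 1] 1 show ?thesis by simp
  qed
  then show ?thesis using B(1) by (intro exI[of _ B]) auto
qed

lemma E_small_base:
  assumes "real_distribution \<mu>"
  shows "\<exists>\<beta>>0. cone_small (E_transform \<mu>) \<beta> (1 / 32)"
  using E_transform_pick_class[OF assms] unfolding pick_class_def by simp

text \<open>Both inverses end up in a region where \<open>z - E(z)\<close> is injective.\<close>
lemma F_inverse_germ_unique:
  assumes m: "real_distribution \<mu>" and g: "is_F_inverse_on (tcone \<alpha> \<beta>) \<mu> g" "0 < \<alpha>" "0 < \<beta>"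
    and h: "is_F_inverse_on (tcone \<alpha>' \<beta>') \<mu> h" "0 < \<alpha>'" "0 < \<beta>'"
  shows "\<exists>a>0. \<exists>b>0. \<forall>z\<in>tcone a b. g z = h z"
proof -
  obtain \<beta>0 where s: "\<beta>0 > 0" "cone_small (E_transform \<mu>) \<beta>0 (1 / 32)" using E_small_base[OF m] by blast
  obtain B where B: "B \<ge> \<beta>" "\<And>z. z \<in> tcone (min \<alpha> 1) B ==> g z \<in> tcone 2 \<beta>0"
    using F_inverse_near[OF g s(1), of 0] by auto
  obtain C where C: "C \<ge> \<beta>'" "\<And>z. z \<in> tcone (min \<alpha>' 1) C ==> h z \<in> tcone 2 \<beta>0"
    using F_inverse_near[OF h s(1), of 0] by auto
  define a where "a = min (min \<alpha> 1) (min \<alpha>' 1)"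
  define b where "b = max B C"
  have ab: "a > 0" "b > 0" using g h B(1) C(1) by (auto simp: a_def b_def)
  have le1: "a \<le> min \<alpha> 1" "a \<le> min \<alpha>' 1" "B \<le> b" "C \<le> b"
    unfolding a_def b_def by (rule min.cobounded1 min.cobounded2 max.cobounded1 max.cobounded2)+
  then have le: "a \<le> min \<alpha> 1" "a \<le> min \<alpha>' 1" "a \<le> \<alpha>" "a \<le> \<alpha>'" "B \<le> b" "C \<le> b" by simp_all
  have "g z = h z" if z: "z \<in> tcone a b" for z
  proof -
    have "tcone a b \<subseteq> tcone (min \<alpha> 1) B" "tcone a b \<subseteq> tcone (min \<alpha>' 1) C"
       "tcone a b \<subseteq> tcone \<alpha> \<beta>" "tcone a b \<subseteq> tcone \<alpha>' \<beta>'"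
      using le B(1) C(1) g(2,3) h(2,3) by (intro truncated_cone_mono; linarith)+
    note zs = this[THEN subsetD, OF z]
    have Fg: "F_transform \<mu> (g z) = z" using g(1) zs(3) unfolding is_F_inverse_on_def by blast
    have Fh: "F_transform \<mu> (h z) = z" using h(1) zs(4) unfolding is_F_inverse_on_def by blast
    show ?thesis
    proof (rule cone_small_inj[OF s(2) _ B(2)[OF zs(1)] C(2)[OF zs(2)]])
      show "g z - E_transform \<mu> (g z) = h z - E_transform \<mu> (h z)"
        unfolding E_transform_def Fg Fh by simp
    qed simp
  qed
  then show ?thesis using ab by blast
qed

lemma F_inverse_determines:
  assumes m: "real_distribution \<mu>" "real_distribution \<rho>" and a: "0 < \<alpha>" and b: "0 < \<beta>"
    and g: "is_F_inverse_on (tcone \<alpha> \<beta>) \<mu> g" and h: "is_F_inverse_on (tcone \<alpha> \<beta>) \<rho> g"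
  shows "\<mu> = \<rho>"
proof (rule F_transform_determines_open[OF m, of "g ` tcone \<alpha> \<beta>"])
  have inj: "inj_on g (tcone \<alpha> \<beta>)"
    using g unfolding is_F_inverse_on_def by (intro inj_on_inverseI[of _ "F_transform \<mu>"]) auto
  have hol: "g holomorphic_on tcone \<alpha> \<beta>" using g by (simp add: is_F_inverse_on_def)
  show "open (g ` tcone \<alpha> \<beta>)" by (rule open_mapping_thm3[OF hol open_truncated_cone inj])
  show "g ` tcone \<alpha> \<beta> \<noteq> {}" using truncated_cone_nonempty[OF a] by simp
  show "g ` tcone \<alpha> \<beta> \<subseteq> uhp" using g by (auto simp: is_F_inverse_on_def uhp_iff)
  show "F_transform \<mu> w = F_transform \<rho> w" if "w \<in> g ` tcone \<alpha> \<beta>" for w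
    using that g h by (auto simp: is_F_inverse_on_def)
qed

lemma F_inverse_exists:
  assumes m: "real_distribution \<mu>" and b: "0 < \<beta>" and s: "cone_small (E_transform \<mu>) \<beta> (1 / 16)"
  shows "\<exists>g. is_F_inverse_on (tcone 1 (2 * \<beta>)) \<mu> g \<and>
     (\<forall>z\<in>tcone 1 (2 * \<beta>). cmod (g z - z) \<le> cmod z / 8)"
proof -
  let ?\<Gamma> = "tcone 1 (2 * \<beta>)"
  note P = E_transform_pick_class[OF m]
  have "E_transform \<mu> holomorphic_on tcone 2 \<beta>"
    using P truncated_cone_uhp[of \<beta> 2] b by (auto simp: pick_class_def intro: holomorphic_on_subset)
  from cone_inverse[OF s b this] obtain g where g: "g holomorphic_on ?\<Gamma>"
    "\<And>z. z \<in> ?\<Gamma> ==> cmod (g z - z) \<le> cmod z / 8" "\<And>z. z \<in> ?\<Gamma> ==> g z - E_transform \<mu> (g z) = z"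
    by blast
  have "((\<lambda>z. g z / z) \<longlongrightarrow> 1) (inf at_infinity (principal ?\<Gamma>))"
  proof (rule tendsto_ratio_coneI)
    fix e :: real assume e: "e > 0"
    obtain \<beta>1 where b1: "\<beta>1 > 0" "cone_small (E_transform \<mu>) \<beta>1 (e / 2)"
      using P e unfolding pick_class_def by (meson half_gt_zero)
    have "cmod (g z - z) \<le> e * cmod z" if z: "z \<in> ?\<Gamma>" and I: "Im z > 2 * \<beta>1" for z
    proof -
      have "z \<in> tcone 1 (2 * \<beta>1)" using z I by (simp add: truncated_cone_def)
      from near_cone[OF this b1(1) g(2)[OF z]]
      have n: "g z \<in> tcone 2 \<beta>1" "cmod (g z) \<le> 9 / 8 * cmod z" .
      have "g z - z = E_transform \<mu> (g z)" using g(3)[OF z] by (simp add: algebra_simps)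
      then have "cmod (g z - z) \<le> e / 2 * cmod (g z)" using b1(2) n(1) by (simp add: cone_small_def)
      also have "... \<le> e / 2 * (9 / 8 * cmod z)" using n(2) e by (intro mult_left_mono) auto
      also have "... \<le> e * cmod z" using e by (simp add: mult_right_mono)
      finally show ?thesis .
    qed
    then show "\<exists>B. \<forall>z\<in>?\<Gamma>. Im z > B \<longrightarrow> cmod (g z - z) \<le> e * cmod z" by blast
  qed (use b in auto)
  moreover have "Im (g z) > 0 \<and> F_transform \<mu> (g z) = z" if z: "z \<in> ?\<Gamma>" for z
  proof -
    have "g z \<in> tcone 2 \<beta>" by (rule near_cone(1)[OF z b g(2)[OF z]])
    then show ?thesis using g(3)[OF z] b by (simp add: truncated_cone_def E_transform_def)
  qed
  ultimately have "is_F_inverse_on ?\<Gamma> \<mu> g" using g(1) by (simp add: is_F_inverse_on_def)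
  then show ?thesis using g(2) by blast
qed

definition voiculescu_germ :: "real measure \<Rightarrow> (complex \<Rightarrow> complex) \<Rightarrow> bool" where
  "voiculescu_germ \<mu> \<phi> \<longleftrightarrow> (\<exists>\<alpha>>0. \<exists>\<beta>>0. voiculescu_on (tcone \<alpha> \<beta>) \<mu> \<phi>)"

lemma voiculescu_restrict:
  "voiculescu_on \<Gamma> \<mu> \<phi> ==> \<Gamma>' \<subseteq> \<Gamma> ==> voiculescu_on \<Gamma>' \<mu> \<phi>"
  unfolding voiculescu_iff by (rule F_inverse_restrict)

lemma voiculescu_cong:
  "voiculescu_on \<Gamma> \<mu> \<phi> ==> (\<And>z. z \<in> \<Gamma> ==> \<phi> z = \<psi> z) ==> voiculescu_on \<Gamma> \<mu> \<psi>"
  unfolding voiculescu_iff by (erule F_inverse_cong) simp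

lemma voiculescu_germ_unique:
  assumes "real_distribution \<mu>" "voiculescu_germ \<mu> \<phi>" "voiculescu_germ \<mu> \<psi>"
  shows "\<exists>a>0. \<exists>b>0. \<forall>z\<in>tcone a b. \<phi> z = \<psi> z"
proof -
  obtain \<alpha> \<beta> \<alpha>' \<beta>' where "\<alpha> > 0" "\<beta> > 0" "\<alpha>' > 0" "\<beta>' > 0"
    "is_F_inverse_on (tcone \<alpha> \<beta>) \<mu> (\<lambda>z. z + \<phi> z)" "is_F_inverse_on (tcone \<alpha>' \<beta>') \<mu> (\<lambda>z. z + \<psi> z)"
    using assms(2,3) unfolding voiculescu_germ_def voiculescu_iff by blast
  from F_inverse_germ_unique[OF assms(1) this(5,1,2,6,3,4)] show ?thesis by simp
qed

lemma cone_common: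
  assumes "0 < a" "0 < b" "0 < a'" "0 < b'"
  shows "\<exists>a''>0. \<exists>b''>0. tcone a'' b'' \<subseteq> tcone a b \<and> tcone a'' b'' \<subseteq> tcone a' b'"
  using assms by (intro exI[of _ "min a a'"] exI[of _ "max b b'"] conjI truncated_cone_mono) auto

lemma voiculescu_germ_determines:
  assumes m: "real_distribution \<mu>" "real_distribution \<rho>" and g: "voiculescu_germ \<mu> \<phi>" "voiculescu_germ \<rho> \<psi>"
    and eq: "\<exists>a>0. \<exists>b>0. \<forall>z\<in>tcone a b. \<phi> z = \<psi> z"
  shows "\<mu> = \<rho>"
proof -
  obtain a1 b1 where 1: "0 < a1" "0 < b1" "voiculescu_on (tcone a1 b1) \<mu> \<phi>"
    using g(1) by (auto simp: voiculescu_germ_def)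
  obtain a2 b2 where 2: "0 < a2" "0 < b2" "voiculescu_on (tcone a2 b2) \<rho> \<psi>"
    using g(2) by (auto simp: voiculescu_germ_def)
  obtain a3 b3 where 3: "0 < a3" "0 < b3" "\<And>z. z \<in> tcone a3 b3 ==> \<phi> z = \<psi> z"
    using eq by blast
  obtain a4 b4 where 4: "0 < a4" "0 < b4" "tcone a4 b4 \<subseteq> tcone a1 b1" "tcone a4 b4 \<subseteq> tcone a2 b2"
    using cone_common[OF 1(1,2) 2(1,2)] by blast
  obtain a5 b5 where 5: "0 < a5" "0 < b5" "tcone a5 b5 \<subseteq> tcone a4 b4" "tcone a5 b5 \<subseteq> tcone a3 b3"
    using cone_common[OF 4(1,2) 3(1,2)] by blast
  have "voiculescu_on (tcone a5 b5) \<mu> \<phi>"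
    by (rule voiculescu_restrict[OF 1(3)]) (use 4 5 in blast)
  then have "voiculescu_on (tcone a5 b5) \<mu> \<psi>"
    by (rule voiculescu_cong) (use 3(3) 5(4) in blast)
  moreover have "voiculescu_on (tcone a5 b5) \<rho> \<psi>"
    by (rule voiculescu_restrict[OF 2(3)]) (use 4 5 in blast)
  ultimately show ?thesis
    unfolding voiculescu_iff by (rule F_inverse_determines[OF m 5(1,2)])
qed

lemma voiculescu_germ_exists:
  assumes m: "real_distribution \<mu>"
  shows "\<exists>\<phi>. voiculescu_germ \<mu> \<phi>"
proof -
  obtain \<beta> where b: "\<beta> > 0" "cone_small (E_transform \<mu>) \<beta> (1 / 32)" using E_small_base[OF m] by blast
  have "cone_small (E_transform \<mu>) \<beta> (1 / 16)" by (rule cone_small_mono[OF b(2)]) (use b in auto)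
  from F_inverse_exists[OF m b(1) this]
  obtain g where "is_F_inverse_on (tcone 1 (2 * \<beta>)) \<mu> g" by blast
  then have "voiculescu_on (tcone 1 (2 * \<beta>)) \<mu> (\<lambda>z. g z - z)"
    unfolding voiculescu_iff by simp
  then show ?thesis unfolding voiculescu_germ_def using b(1)
    by (intro exI[of _ "\<lambda>z. g z - z"] exI[of _ 1] exI[of _ "2 * \<beta>"] conjI) auto
qed

section \<open>Existence of free convolutions\<close>

lemma pick_class_two:
  assumes "pick_class E1" "pick_class E2" "e > 0"
  shows "\<exists>\<beta>\<ge>b. \<beta> > 0 \<and> cone_small E1 \<beta> e \<and> cone_small E2 \<beta> e"
proof -
  obtain \<beta>1 \<beta>2 where b: "\<beta>1 > 0" "cone_small E1 \<beta>1 e" "\<beta>2 > 0" "cone_small E2 \<beta>2 e"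
    using assms unfolding pick_class_def by meson
  show ?thesis
    by (intro exI[of _ "max b (max \<beta>1 \<beta>2)"] conjI cone_small_mono[OF b(2)] cone_small_mono[OF b(4)])
      (use b in auto)
qed

lemma fixpoint_pair_unique:
  assumes s: "cone_small E1 \<beta> (1 / 16)" "cone_small E2 \<beta> (1 / 16)"
    and C: "u \<in> tcone 2 \<beta>" "v \<in> tcone 2 \<beta>" "u' \<in> tcone 2 \<beta>" "v' \<in> tcone 2 \<beta>"
    and e: "u = w - E2 v" "v = w - E1 u" "u' = w - E2 v'" "v' = w - E1 u'"
  shows "u = u'" "v = v'"
proof -
  have 1: "u - u' = E2 v' - E2 v" using e(1,3) by algebra
  have 2: "v - v' = E1 u' - E1 u" using e(2,4) by algebra
  have 3: "cmod (u - u') \<le> 1 / 16 * cmod (v' - v)"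
    unfolding 1 using s(2) C unfolding cone_small_def by blast
  have 4: "cmod (v - v') \<le> 1 / 16 * cmod (u' - u)"
    unfolding 2 using s(1) C unfolding cone_small_def by blast
  have 5: "cmod (u' - u) = cmod (u - u')" "cmod (v' - v) = cmod (v - v')" by (rule norm_minus_commute)+
  have 6: "cmod (u - u') \<le> 0" "cmod (v - v') \<le> 0" using 3 4 unfolding 5 by linarith+
  then show "u = u'" "v = v'" by simp_all
qed

text \<open>\<open>F\<^sub>\<rho> = F\<^sub>\<mu> \<circ> \<omega>\<^sub>1\<close> with the subordination function \<open>\<omega>\<^sub>1\<close>. To see that \<open>k = F\<^sub>\<mu>\<^sup>-\<^sup>1 + F\<^sub>\<nu>\<^sup>-\<^sup>1 - z\<close> inverts it,
note that \<open>(F\<^sub>\<mu>\<^sup>-\<^sup>1(z), F\<^sub>\<nu>\<^sup>-\<^sup>1(z))\<close> solves the subordination equations at \<open>k(z)\<close>, whose solution is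
unique in the cone.\<close>
lemma free_convolution_exists:
  assumes m: "real_distribution \<mu>" and n: "real_distribution \<nu>"
  shows "\<exists>\<rho>. real_distribution \<rho> \<and>
     (\<exists>\<alpha>>0. \<exists>\<beta>>0. \<exists>\<phi>\<^sub>\<mu> \<phi>\<^sub>\<nu> \<phi>\<^sub>\<rho>.
        voiculescu_on (tcone \<alpha> \<beta>) \<mu> \<phi>\<^sub>\<mu> \<and>
        voiculescu_on (tcone \<alpha> \<beta>) \<nu> \<phi>\<^sub>\<nu> \<and>
        voiculescu_on (tcone \<alpha> \<beta>) \<rho> \<phi>\<^sub>\<rho> \<and>
        (\<forall>z\<in>tcone \<alpha> \<beta>. \<phi>\<^sub>\<rho> z = \<phi>\<^sub>\<mu> z + \<phi>\<^sub>\<nu> z))"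
proof -
  let ?E1 = "E_transform \<mu>" and ?E2 = "E_transform \<nu>"
  note P1 = E_transform_pick_class[OF m] and P2 = E_transform_pick_class[OF n]
  obtain \<beta> where b: "\<beta> > 0" "cone_small ?E1 \<beta> (1 / 32)" "cone_small ?E2 \<beta> (1 / 32)"
    using pick_class_two[OF P1 P2, of "1 / 32" 0] by auto
  have s: "cone_small ?E1 \<beta> (1 / 16)" "cone_small ?E2 \<beta> (1 / 16)"
    by (rule cone_small_mono[OF b(2)] cone_small_mono[OF b(3)]; use b(1) in simp)+
  obtain \<omega>1 \<omega>2 where w: "\<omega>1 holomorphic_on uhp" "\<omega>2 holomorphic_on uhp"
    "\<And>z. z \<in> uhp ==> Im z \<le> Im (\<omega>1 z)"
    "\<And>z. z \<in> tcone 1 (2 * \<beta>) ==> cmod (\<omega>1 z - z) \<le> cmod z / 8"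
    "\<And>z. z \<in> tcone 1 (2 * \<beta>) ==> cmod (\<omega>2 z - z) \<le> cmod z / 8"
    "\<And>z. z \<in> tcone 1 (2 * \<beta>) ==> \<omega>1 z = z - ?E2 (\<omega>2 z)"
    "\<And>z. z \<in> tcone 1 (2 * \<beta>) ==> \<omega>2 z = z - ?E1 (\<omega>1 z)"
    using subordination[OF P1 P2 s b(1)] by metis
  have w1u: "\<omega>1 z \<in> uhp" if "z \<in> uhp" for z using w(3)[OF that] that by (simp add: uhp_iff)
  have "\<exists>\<rho>. real_distribution \<rho> \<and> (\<forall>z\<in>uhp. E_transform \<rho> z = z - F_transform \<mu> (\<omega>1 z))"
  proof (rule E_transform_exists)
    have "(F_transform \<mu> \<circ> \<omega>1) holomorphic_on uhp"
      using w1u by (intro holomorphic_on_compose w(1) holomorphic_on_subset[OF F_transform_holomorphic[OF m]]) auto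
    then show "(\<lambda>z. z - F_transform \<mu> (\<omega>1 z)) holomorphic_on uhp" by (intro holomorphic_intros) (simp add: o_def)
    show "Im (z - F_transform \<mu> (\<omega>1 z)) \<le> 0" if "z \<in> uhp" for z
      using Im_F_transform_ge[OF m w1u[OF that]] w(3)[OF that] by simp
    fix e :: real assume e: "e > 0"
    obtain \<beta>' where b': "\<beta>' \<ge> \<beta>" "\<beta>' > 0" "cone_small ?E1 \<beta>' (e / 4)" "cone_small ?E2 \<beta>' (e / 4)"
      using pick_class_two[OF P1 P2, of "e / 4" \<beta>] e by auto
    have "cmod (z - F_transform \<mu> (\<omega>1 z)) \<le> e * cmod z" if z: "z \<in> tcone 1 (2 * \<beta>')" for z
    proof -
      have z0: "z \<in> tcone 1 (2 * \<beta>)"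
        using z truncated_cone_mono[of 1 1 "2 * \<beta>" "2 * \<beta>'"] b b' by auto
      note c1 = near_cone[OF z b'(2) w(4)[OF z0]] and c2 = near_cone[OF z b'(2) w(5)[OF z0]]
      have "z - F_transform \<mu> (\<omega>1 z) = ?E2 (\<omega>2 z) + ?E1 (\<omega>1 z)"
        using w(6)[OF z0] by (simp add: E_transform_def algebra_simps)
      also have "cmod ... \<le> cmod (?E2 (\<omega>2 z)) + cmod (?E1 (\<omega>1 z))" by (rule norm_triangle_ineq)
      also have "... \<le> e / 4 * cmod (\<omega>2 z) + e / 4 * cmod (\<omega>1 z)"
        using b'(3,4) c1(1) c2(1) by (intro add_mono) (auto simp: cone_small_def)
      also have "... \<le> e / 4 * (9 / 8 * cmod z) + e / 4 * (9 / 8 * cmod z)"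
        using c1(2) c2(2) e by (intro add_mono mult_left_mono) auto
      also have "... \<le> e * cmod z" using e by (simp add: mult_right_mono)
      finally show ?thesis .
    qed
    then show "\<exists>\<beta>>0. \<forall>z\<in>tcone 1 \<beta>. cmod (z - F_transform \<mu> (\<omega>1 z)) \<le> e * cmod z"
      using b'(2) by (intro exI[of _ "2 * \<beta>'"]) auto
  qed
  then obtain \<rho> where r: "real_distribution \<rho>" "\<And>z. z \<in> uhp ==> F_transform \<rho> z = F_transform \<mu> (\<omega>1 z)"
    by (auto simp: E_transform_def)
  let ?G = "tcone 1 (2 * \<beta>)" and ?H = "tcone (1 / 2) (2 * (2 * \<beta>))"
  obtain g where g: "is_F_inverse_on ?G \<mu> g" "\<And>z. z \<in> ?G ==> cmod (g z - z) \<le> cmod z / 8"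
    using F_inverse_exists[OF m b(1) s(1)] by blast
  obtain h where h: "is_F_inverse_on ?G \<nu> h" "\<And>z. z \<in> ?G ==> cmod (h z - z) \<le> cmod z / 8"
    using F_inverse_exists[OF n b(1) s(2)] by blast
  have HG: "?H \<subseteq> ?G" using b by (intro truncated_cone_mono) auto
  have g': "is_F_inverse_on ?H \<mu> g" and h': "is_F_inverse_on ?H \<nu> h"
    using F_inverse_restrict[OF g(1) HG] F_inverse_restrict[OF h(1) HG] .
  define k where "k z = g z + h z - z" for z
  have small16: "cmod (f z - z) \<le> cmod z / 16"
    if "cone_small (E_transform \<tau>) \<beta> (1 / 32)" "F_transform \<tau> (f z) = z" "cmod (f z - z) \<le> cmod z / 8" "z \<in> ?G" for \<tau> f z
  proof -
    note c = near_cone[OF that(4) b(1) that(3)]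
    have "f z - z = E_transform \<tau> (f z)" using that(2) by (simp add: E_transform_def)
    then have "cmod (f z - z) \<le> 1 / 32 * cmod (f z)" using that(1) c(1) by (simp add: cone_small_def)
    then show ?thesis using c(2) norm_ge_zero[of z] by linarith
  qed
  have kp: "Im (k z) > 0 \<and> F_transform \<rho> (k z) = z" if z: "z \<in> ?H" for z
  proof -
    have zG: "z \<in> ?G" using HG z by blast
    have Fg: "F_transform \<mu> (g z) = z" "F_transform \<nu> (h z) = z"
      using g(1) h(1) zG by (auto simp: is_F_inverse_on_def)
    have "cmod (k z - z) = cmod ((g z - z) + (h z - z))" by (simp add: k_def algebra_simps)
    also have "... \<le> cmod (g z - z) + cmod (h z - z)" by (rule norm_triangle_ineq)
    also have "... \<le> cmod z / 16 + cmod z / 16"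
      by (intro add_mono small16[where f=g, OF b(2) Fg(1) g(2)[OF zG] zG] small16[where f=h, OF b(3) Fg(2) h(2)[OF zG] zG])
    finally have kz: "cmod (k z - z) \<le> cmod z / 8" by simp
    have kG: "k z \<in> ?G" using near_cone_half[OF z _ kz] b by simp
    have ku: "k z \<in> uhp" using kG b truncated_cone_uhp[of "2 * \<beta>" 1] by auto
    have "\<omega>1 (k z) = g z"
    proof (rule fixpoint_pair_unique(1)[OF s])
      show "\<omega>1 (k z) \<in> tcone 2 \<beta>" by (rule near_cone(1)[OF kG b(1) w(4)[OF kG]])
      show "\<omega>2 (k z) \<in> tcone 2 \<beta>" by (rule near_cone(1)[OF kG b(1) w(5)[OF kG]])
      show "g z \<in> tcone 2 \<beta>" by (rule near_cone(1)[OF zG b(1) g(2)[OF zG]])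
      show "h z \<in> tcone 2 \<beta>" by (rule near_cone(1)[OF zG b(1) h(2)[OF zG]])
      show "\<omega>1 (k z) = k z - ?E2 (\<omega>2 (k z))" by (rule w(6)[OF kG])
      show "\<omega>2 (k z) = k z - ?E1 (\<omega>1 (k z))" by (rule w(7)[OF kG])
      show "g z = k z - ?E2 (h z)" "h z = k z - ?E1 (g z)" using Fg by (simp_all add: k_def E_transform_def)
    qed
    then show ?thesis using r(2)[OF ku] Fg(1) ku by (simp add: uhp_iff)
  qed
  have "((\<lambda>z. k z / z) \<longlongrightarrow> 1) (inf at_infinity (principal ?H))"
  proof (rule tendsto_ratio_coneI)
    fix e :: real assume e: "e > 0"
    have "((\<lambda>z. g z / z) \<longlongrightarrow> 1) (inf at_infinity (principal ?H))" using g' by (simp add: is_F_inverse_on_def)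
    then have "\<exists>B\<ge>0. \<forall>z\<in>?H. Im z > B \<longrightarrow> cmod (g z - z) \<le> e / 2 * cmod z"
      by (rule tendsto_ratio_coneD) (use e in simp)
    then obtain B1 where B1: "\<And>z. z \<in> ?H ==> Im z > B1 ==> cmod (g z - z) \<le> e / 2 * cmod z"
      by blast
    have "((\<lambda>z. h z / z) \<longlongrightarrow> 1) (inf at_infinity (principal ?H))" using h' by (simp add: is_F_inverse_on_def)
    then have "\<exists>B\<ge>0. \<forall>z\<in>?H. Im z > B \<longrightarrow> cmod (h z - z) \<le> e / 2 * cmod z"
      by (rule tendsto_ratio_coneD) (use e in simp)
    then obtain B2 where B2: "\<And>z. z \<in> ?H ==> Im z > B2 ==> cmod (h z - z) \<le> e / 2 * cmod z"
      by blast
    have "cmod (k z - z) \<le> e * cmod z" if "z \<in> ?H" "Im z > max B1 B2" for z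
    proof -
      have "cmod (k z - z) = cmod ((g z - z) + (h z - z))" by (simp add: k_def algebra_simps)
      also have "... \<le> cmod (g z - z) + cmod (h z - z)" by (rule norm_triangle_ineq)
      finally show ?thesis using B1[OF that(1)] B2[OF that(1)] that(2) by simp
    qed
    then show "\<exists>B. \<forall>z\<in>?H. Im z > B \<longrightarrow> cmod (k z - z) \<le> e * cmod z" by blast
  qed (use b in auto)
  moreover have "k holomorphic_on ?H"
    unfolding k_def[abs_def] using g' h' by (intro holomorphic_intros) (auto simp: is_F_inverse_on_def)
  ultimately have k': "is_F_inverse_on ?H \<rho> k" using kp by (simp add: is_F_inverse_on_def)
  have V: "voiculescu_on ?H \<mu> (\<lambda>z. g z - z)" "voiculescu_on ?H \<nu> (\<lambda>z. h z - z)"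
     "voiculescu_on ?H \<rho> (\<lambda>z. k z - z)"
    unfolding voiculescu_iff using g' h' k' by simp_all
  have "\<forall>z\<in>?H. k z - z = (g z - z) + (h z - z)" by (simp add: k_def)
  then show ?thesis using r(1) V b(1)
    by (intro exI[of _ \<rho>] conjI exI[of _ "1/2"] exI[of _ "2 * (2 * \<beta>)"] exI[of _ "\<lambda>z. g z - z"]
        exI[of _ "\<lambda>z. h z - z"] exI[of _ "\<lambda>z. k z - z"]) auto
qed

lemma free_convolution:
  assumes m: "real_distribution \<mu>" and n: "real_distribution \<nu>"
  shows "real_distribution (free_convolution \<mu> \<nu>)"
    "voiculescu_germ \<mu> \<phi> ==> voiculescu_germ \<nu> \<psi> ==> voiculescu_germ (free_convolution \<mu> \<nu>) (\<lambda>z. \<phi> z + \<psi> z)"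
proof -
  let ?Q = "\<lambda>\<rho>. real_distribution \<rho> \<and>
     (\<exists>\<alpha>>0. \<exists>\<beta>>0. \<exists>\<phi>\<^sub>\<mu> \<phi>\<^sub>\<nu> \<phi>\<^sub>\<rho>.
        voiculescu_on (tcone \<alpha> \<beta>) \<mu> \<phi>\<^sub>\<mu> \<and>
        voiculescu_on (tcone \<alpha> \<beta>) \<nu> \<phi>\<^sub>\<nu> \<and>
        voiculescu_on (tcone \<alpha> \<beta>) \<rho> \<phi>\<^sub>\<rho> \<and>
        (\<forall>z\<in>tcone \<alpha> \<beta>. \<phi>\<^sub>\<rho> z = \<phi>\<^sub>\<mu> z + \<phi>\<^sub>\<nu> z))"
  have sum: "voiculescu_germ \<rho> (\<lambda>z. \<phi> z + \<psi> z)"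
    if Q: "?Q \<rho>" and f: "voiculescu_germ \<mu> \<phi>" and p: "voiculescu_germ \<nu> \<psi>" for \<rho> \<phi> \<psi>
  proof -
    obtain \<alpha> \<beta> \<phi>1 \<phi>2 \<phi>3 where c: "\<alpha> > 0" "\<beta> > 0" "voiculescu_on (tcone \<alpha> \<beta>) \<mu> \<phi>1"
      "voiculescu_on (tcone \<alpha> \<beta>) \<nu> \<phi>2"
      "voiculescu_on (tcone \<alpha> \<beta>) \<rho> \<phi>3"
      "\<And>z. z \<in> tcone \<alpha> \<beta> ==> \<phi>3 z = \<phi>1 z + \<phi>2 z"
      using Q by blast
    have "voiculescu_germ \<mu> \<phi>1" "voiculescu_germ \<nu> \<phi>2" using c unfolding voiculescu_germ_def by blast+
    then obtain a1 b1 a2 b2 where e: "a1 > 0" "b1 > 0" "\<And>z. z \<in> tcone a1 b1 ==> \<phi>1 z = \<phi> z"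
      "a2 > 0" "b2 > 0" "\<And>z. z \<in> tcone a2 b2 ==> \<phi>2 z = \<psi> z"
      using voiculescu_germ_unique[OF m _ f] voiculescu_germ_unique[OF n _ p] by metis
    obtain a3 b3 where 3: "0 < a3" "0 < b3" "tcone a3 b3 \<subseteq> tcone a1 b1" "tcone a3 b3 \<subseteq> tcone a2 b2"
      using cone_common[OF e(1,2,4,5)] by blast
    obtain a4 b4 where 4: "0 < a4" "0 < b4" "tcone a4 b4 \<subseteq> tcone a3 b3" "tcone a4 b4 \<subseteq> tcone \<alpha> \<beta>"
      using cone_common[OF 3(1,2) c(1,2)] by blast
    have "voiculescu_on (tcone a4 b4) \<rho> (\<lambda>z. \<phi> z + \<psi> z)"
    proof (rule voiculescu_cong[OF voiculescu_restrict[OF c(5) 4(4)]])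
      fix z assume z: "z \<in> tcone a4 b4"
      have z': "z \<in> tcone a1 b1" "z \<in> tcone a2 b2" "z \<in> tcone \<alpha> \<beta>"
        using z 3 4 by blast+
      show "\<phi>3 z = \<phi> z + \<psi> z" using c(6)[OF z'(3)] e(3)[OF z'(1)] e(6)[OF z'(2)] by simp
    qed
    then show ?thesis using 4(1,2) unfolding voiculescu_germ_def by blast
  qed
  have "\<exists>!\<rho>. ?Q \<rho>"
  proof (rule ex_ex1I)
    show "\<exists>\<rho>. ?Q \<rho>" by (rule free_convolution_exists[OF m n])
    fix \<rho> \<rho>' assume Q: "?Q \<rho>" "?Q \<rho>'"
    obtain \<phi> \<psi> where f: "voiculescu_germ \<mu> \<phi>" "voiculescu_germ \<nu> \<psi>"
      using voiculescu_germ_exists[OF m] voiculescu_germ_exists[OF n] by blast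
    show "\<rho> = \<rho>'"
      by (rule voiculescu_germ_determines[OF _ _ sum[OF Q(1) f] sum[OF Q(2) f]])
         (use Q in \<open>auto intro!: exI[of _ 1]\<close>)
  qed
  from theI'[OF this] have T: "?Q (free_convolution \<mu> \<nu>)" unfolding free_convolution_def .
  then show "real_distribution (free_convolution \<mu> \<nu>)" by (rule conjunct1)
  show "voiculescu_germ \<mu> \<phi> ==> voiculescu_germ \<nu> \<psi> ==> voiculescu_germ (free_convolution \<mu> \<nu>) (\<lambda>z. \<phi> z + \<psi> z)"
    by (rule sum[OF T])
qed

section \<open>Freely infinitely divisible measures\<close>

text \<open>Subordination with \<open>E\<^sub>1 = E\<^sub>2 = N\<close>: by uniqueness of the fixed point the two components agree, so
\<open>\<omega>\<^sub>1 = z - N(\<omega>\<^sub>1)\<close> inverts \<open>z + N(z)\<close> and extends to the half-plane as an \<open>F\<close>-transform.\<close>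
lemma free_inf_div_exists:
  assumes s: "finite_borel \<sigma>"
  shows "\<exists>M. real_distribution M \<and>
    (\<exists>\<beta>>0. voiculescu_on (tcone (1 / 2) \<beta>) M (nevanlinna \<gamma> \<sigma>))"
proof -
  let ?N = "nevanlinna \<gamma> \<sigma>"
  note P = nevanlinna_pick_class[OF s, of \<gamma>]
  obtain \<beta> where b: "\<beta> > 0" "cone_small ?N \<beta> (1 / 16)"
    using nevanlinna_small[OF s, of "1 / 16"] by auto
  obtain \<omega>1 \<omega>2 where w: "\<omega>1 holomorphic_on uhp"
    "\<And>z. z \<in> uhp ==> Im z \<le> Im (\<omega>1 z)"
    "\<And>z. z \<in> tcone 1 (2 * \<beta>) ==> cmod (\<omega>1 z - z) \<le> cmod z / 8"
    "\<And>z. z \<in> tcone 1 (2 * \<beta>) ==> cmod (\<omega>2 z - z) \<le> cmod z / 8"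
    "\<And>z. z \<in> tcone 1 (2 * \<beta>) ==> \<omega>1 z = z - ?N (\<omega>2 z)"
    "\<And>z. z \<in> tcone 1 (2 * \<beta>) ==> \<omega>2 z = z - ?N (\<omega>1 z)"
    using subordination[OF P P b(2,2,1)] by metis
  have fixed: "\<omega>1 z = z - ?N (\<omega>1 z)" if z: "z \<in> tcone 1 (2 * \<beta>)" for z
  proof -
    have "\<omega>1 z = \<omega>2 z"
      by (rule fixpoint_pair_unique(1)[OF b(2,2) near_cone(1)[OF z b(1) w(3)[OF z]]
          near_cone(1)[OF z b(1) w(4)[OF z]] near_cone(1)[OF z b(1) w(4)[OF z]]
          near_cone(1)[OF z b(1) w(3)[OF z]] w(5)[OF z] w(6)[OF z] w(6)[OF z] w(5)[OF z]])
    then show ?thesis using w(6)[OF z] by simp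
  qed
  have "\<exists>M. real_distribution M \<and> (\<forall>z\<in>uhp. E_transform M z = z - \<omega>1 z)"
  proof (rule E_transform_exists)
    show "(\<lambda>z. z - \<omega>1 z) holomorphic_on uhp" by (intro holomorphic_intros w(1))
    show "Im (z - \<omega>1 z) \<le> 0" if "z \<in> uhp" for z using w(2)[OF that] by simp
    fix e :: real assume e: "e > 0"
    obtain \<beta>' where b': "\<beta>' \<ge> \<beta>" "\<beta>' > 0" "cone_small ?N \<beta>' (e / 2)"
      using pick_class_two[OF P P, of "e / 2" \<beta>] e by auto
    have "cmod (z - \<omega>1 z) \<le> e * cmod z" if z: "z \<in> tcone 1 (2 * \<beta>')" for z
    proof -
      have z0: "z \<in> tcone 1 (2 * \<beta>)"
        using z truncated_cone_mono[of 1 1 "2 * \<beta>" "2 * \<beta>'"] b b' by auto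
      note c = near_cone[OF z b'(2) w(3)[OF z0]]
      have "z - \<omega>1 z = ?N (\<omega>1 z)" using fixed[OF z0] by (simp add: algebra_simps)
      then have "cmod (z - \<omega>1 z) \<le> e / 2 * cmod (\<omega>1 z)" using b'(3) c(1) by (simp add: cone_small_def)
      also have "... \<le> e / 2 * (9 / 8 * cmod z)" using c(2) e by (intro mult_left_mono) auto
      also have "... \<le> e * cmod z" using e by (simp add: mult_right_mono)
      finally show ?thesis .
    qed
    then show "\<exists>\<beta>>0. \<forall>z\<in>tcone 1 \<beta>. cmod (z - \<omega>1 z) \<le> e * cmod z"
      using b'(2) by (intro exI[of _ "2 * \<beta>'"]) auto
  qed
  then obtain M where M: "real_distribution M" "\<And>z. z \<in> uhp ==> F_transform M z = \<omega>1 z"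
    by (auto simp: E_transform_def)
  let ?H = "tcone (1 / 2) (2 * (2 * \<beta>))"
  have HC: "?H \<subseteq> tcone 2 \<beta>" using b by (intro truncated_cone_mono) auto
  have Hu: "?H \<subseteq> uhp" using b by (intro truncated_cone_uhp) auto
  have inv: "Im (z + ?N z) > 0 \<and> F_transform M (z + ?N z) = z" if z: "z \<in> ?H" for z
  proof -
    let ?w = "z + ?N z"
    have zC: "z \<in> tcone 2 \<beta>" using z HC by blast
    have "cmod (?w - z) \<le> 1 / 16 * cmod z" using b(2) zC by (simp add: cone_small_def)
    then have "cmod (?w - z) \<le> cmod z / 8" using norm_ge_zero[of z] by linarith
    from near_cone_half[OF z _ this] b have wG: "?w \<in> tcone 1 (2 * \<beta>)" by simp
    have wu: "?w \<in> uhp" using wG b truncated_cone_uhp[of "2 * \<beta>" 1] by auto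
    have cN: "cone_small (\<lambda>z. - ?N z) \<beta> (1 / 16)"
      using b(2) unfolding cone_small_def by (simp add: norm_minus_commute)
    have "\<omega>1 ?w = z"
    proof (rule cone_small_inj[OF cN _ near_cone(1)[OF wG b(1) w(3)[OF wG]] zC])
      show "\<omega>1 ?w - - ?N (\<omega>1 ?w) = z - - ?N z" using fixed[OF wG] by (simp add: algebra_simps)
    qed simp
    then show ?thesis using M(2)[OF wu] wu by (simp add: uhp_iff)
  qed
  have "((\<lambda>z. (z + ?N z) / z) \<longlongrightarrow> 1) (inf at_infinity (principal ?H))"
  proof (rule tendsto_ratio_coneI)
    fix e :: real assume e: "e > 0"
    obtain \<beta>' where b': "\<beta>' > 0" "cone_small ?N \<beta>' e" using nevanlinna_small[OF s e] by blast
    have "cmod (z + ?N z - z) \<le> e * cmod z" if z: "z \<in> ?H" and I: "Im z > \<beta>'" for z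
    proof -
      have "z \<in> tcone 2 \<beta>'" using z I b by (auto simp: truncated_cone_def)
      then show ?thesis using b'(2) by (simp add: cone_small_def)
    qed
    then show "\<exists>B. \<forall>z\<in>?H. Im z > B \<longrightarrow> cmod (z + ?N z - z) \<le> e * cmod z" by blast
  qed (use b in auto)
  moreover have "(\<lambda>z. z + ?N z) holomorphic_on ?H"
    by (intro holomorphic_intros holomorphic_on_subset[OF nevanlinna_integral_holomorphic[OF s] Hu])
  ultimately have "voiculescu_on ?H M ?N"
    unfolding voiculescu_iff is_F_inverse_on_def using inv by simp
  then show ?thesis using M(1) b(1) by (intro exI[of _ M] conjI exI[of _ "2 * (2 * \<beta>)"]) auto
qed

lemma free_inf_div:
  assumes s: "finite_borel \<sigma>"
  shows "real_distribution (free_inf_div \<gamma> \<sigma>)"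
    "\<exists>\<beta>>0. voiculescu_on (tcone (1 / 2) \<beta>) (free_inf_div \<gamma> \<sigma>) (nevanlinna \<gamma> \<sigma>)"
proof -
  let ?N = "nevanlinna \<gamma> \<sigma>"
  obtain M \<beta> where M: "real_distribution M" "\<beta> > 0" "voiculescu_on (tcone (1 / 2) \<beta>) M ?N"
    using free_inf_div_exists[OF s] by blast
  have Mg: "voiculescu_germ M ?N"
    unfolding voiculescu_germ_def using M by (intro exI[of _ "1/2"] conjI exI[of _ \<beta>]) auto
  have "free_inf_div \<gamma> \<sigma> = M"
    unfolding free_inf_div_def
  proof (rule the_equality)
    show "real_distribution M \<and> (\<exists>\<alpha>>0. \<exists>\<beta>>0. voiculescu_on (tcone \<alpha> \<beta>) M ?N)"
      using M(1) Mg unfolding voiculescu_germ_def by blast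
    fix M' assume M': "real_distribution M' \<and> (\<exists>\<alpha>>0. \<exists>\<beta>>0. voiculescu_on (tcone \<alpha> \<beta>) M' ?N)"
    have g': "real_distribution M'" "voiculescu_germ M' ?N" using M' by (auto simp: voiculescu_germ_def)
    show "M' = M"
      by (rule voiculescu_germ_determines[OF g'(1) M(1) g'(2) Mg]) (intro exI[of _ 1] conjI, auto)
  qed
  then show "real_distribution (free_inf_div \<gamma> \<sigma>)"
    "\<exists>\<beta>>0. voiculescu_on (tcone (1 / 2) \<beta>) (free_inf_div \<gamma> \<sigma>) ?N"
    using M by blast+
qed

lemma voiculescu_germ_return: "voiculescu_germ (return borel c) (\<lambda>_. of_real c)"
proof -
  have "((\<lambda>z. (z + of_real c) / z) \<longlongrightarrow> 1) (inf at_infinity (principal (tcone 1 1)))"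
  proof (rule tendsto_ratio_coneI)
    fix e :: real assume e: "e > 0"
    have "cmod (z + of_real c - z) \<le> e * cmod z" if "Im z > \<bar>c\<bar> / e" for z
    proof -
      have "\<bar>c\<bar> \<le> e * Im z" using that e by (simp add: field_simps)
      also have "... \<le> e * cmod z" using e abs_Im_le_cmod[of z] by (intro mult_left_mono) auto
      finally show ?thesis by simp
    qed
    then show "\<exists>B. \<forall>z\<in>tcone 1 1. Im z > B \<longrightarrow> cmod (z + of_real c - z) \<le> e * cmod z" by blast
  qed auto
  moreover have "(\<lambda>z. z + complex_of_real c) holomorphic_on tcone 1 1" by (intro holomorphic_intros)
  ultimately have "voiculescu_on (tcone 1 1) (return borel c) (\<lambda>_. of_real c)"
    unfolding voiculescu_iff is_F_inverse_on_def
    by (auto simp: F_transform_return truncated_cone_def)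
  then show ?thesis unfolding voiculescu_germ_def by (intro exI[of _ 1] conjI) auto
qed

lemma iterated_free_convolution:
  assumes "\<And>j. 1 \<le> j ==> j \<le> m ==> real_distribution (\<nu> j)"
  shows "real_distribution (iterated_convolution free_convolution (return borel c) \<nu> m)"
    and "(\<And>j. 1 \<le> j ==> j \<le> m ==> voiculescu_germ (\<nu> j) (\<phi> j)) ==>
      voiculescu_germ (iterated_convolution free_convolution (return borel c) \<nu> m)
         (\<lambda>z. of_real c + (\<Sum>j=1..m. \<phi> j z))"
proof -
  have *: "real_distribution (iterated_convolution free_convolution (return borel c) \<nu> i)" if "i \<le> m" for i
    using that
  proof (induction i)
    case 0 then show ?case by (simp add: iterated_convolution_0 real_distribution_return)
  next
    case (Suc i)
    then show ?case unfolding iterated_convolution_Suc by (intro free_convolution(1) assms) auto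
  qed
  then show "real_distribution (iterated_convolution free_convolution (return borel c) \<nu> m)" by simp
  assume g: "\<And>j. 1 \<le> j ==> j \<le> m ==> voiculescu_germ (\<nu> j) (\<phi> j)"
  have "voiculescu_germ (iterated_convolution free_convolution (return borel c) \<nu> i)
         (\<lambda>z. of_real c + (\<Sum>j=1..i. \<phi> j z))" if "i \<le> m" for i
    using that
  proof (induction i)
    case 0 then show ?case by (simp add: iterated_convolution_0 voiculescu_germ_return)
  next
    case (Suc i)
    have "real_distribution (\<nu> (Suc i))" "voiculescu_germ (\<nu> (Suc i)) (\<phi> (Suc i))"
      using Suc.prems by (auto intro: assms g)
    from free_convolution(2)[OF *[of i] this(1) Suc.IH this(2)] Suc.prems
    show ?case by (simp add: iterated_convolution_Suc add.assoc)
  qed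
  then show "voiculescu_germ (iterated_convolution free_convolution (return borel c) \<nu> m)
         (\<lambda>z. of_real c + (\<Sum>j=1..m. \<phi> j z))" by simp
qed

section \<open>Weak convergence and Voiculescu transforms\<close>

lemma near_cone_quarter:
  assumes z: "z \<in> tcone (1 / 4) (2 * \<beta>)" and b: "0 < \<beta>" and w: "cmod (w - z) \<le> cmod z / 16"
  shows "w \<in> tcone (1 / 2) \<beta>"
proof -
  have Iz: "Im z > 2 * \<beta>" "\<bar>Re z\<bar> < Im z / 4" using z by (auto simp: truncated_cone_def)
  have n: "cmod z \<le> 5 / 4 * Im z" using cmod_le[of z] Iz b by auto
  have d: "\<bar>Re w - Re z\<bar> \<le> 5 / 64 * Im z" "\<bar>Im w - Im z\<bar> \<le> 5 / 64 * Im z"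
    using abs_Re_le_cmod[of "w - z"] abs_Im_le_cmod[of "w - z"] w n by auto
  show ?thesis
    unfolding truncated_cone_def mem_Collect_eq using d Iz b by (intro conjI; linarith)
qed

text \<open>Let \<open>w = z + \<phi>(z)\<close>. Then \<open>G\<^sub>n(z + \<theta>\<^sub>n(z)) = 1/z = G\<^sub>M(w)\<close>, and the \<open>G\<^sub>n\<close> are uniformly Lipschitz near \<open>w\<close>, so
\<open>G\<^sub>n(w)\<close> converges to \<open>G\<^sub>M(w)\<close>; and such \<open>w\<close> fill a cone.\<close>
lemma weakly_converges_of_F_inverses:
  assumes X: "\<And>n. real_distribution (X n)" and M: "real_distribution M" and b: "0 < \<beta>"
    and V: "voiculescu_on (tcone (1 / 2) \<beta>) M \<phi>"
    and lim: "\<And>z. z \<in> tcone (1 / 2) \<beta> ==> (\<lambda>n. \<theta> n z) \<longlonglongrightarrow> \<phi> z"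
    and inv: "\<And>z. z \<in> tcone (1 / 2) \<beta> ==>
       eventually (\<lambda>n. Im (z + \<theta> n z) > 0 \<and> F_transform (X n) (z + \<theta> n z) = z) sequentially"
  shows "weakly_converges X M"
proof -
  obtain \<beta>0 where b0: "\<beta>0 > 0" "cone_small (E_transform M) \<beta>0 (1 / 32)" using E_small_base[OF M] by blast
  obtain B where B: "B \<ge> max \<beta> \<beta>0"
    "\<And>z. z \<in> tcone (min (1 / 2) 1) B ==> z + \<phi> z \<in> tcone 2 \<beta>0"
    using F_inverse_near[OF V[unfolded voiculescu_iff] _ b b0(1), of \<beta>0] by auto
  have Bp: "B > 0" "B \<ge> \<beta>" "B \<ge> \<beta>0" using B(1) b by auto
  show ?thesis
  proof (rule weakly_converges_of_cauchy_cone[OF X M, of "1 / 4" "2 * B"])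
    fix w assume w: "w \<in> tcone (1 / 4) (2 * B)"
    have wu: "w \<in> uhp" using w truncated_cone_uhp[of "2 * B" "1 / 4"] Bp by auto
    have w2: "w \<in> tcone 2 \<beta>0"
      using w truncated_cone_mono[of "1 / 4" 2 \<beta>0 "2 * B"] Bp b0(1) by auto
    define z where "z = F_transform M w"
    have "cmod (z - w) = cmod (E_transform M w)" by (simp add: z_def E_transform_def norm_minus_commute)
    also have "... \<le> 1 / 32 * cmod w" using b0(2) w2 by (simp add: cone_small_def)
    finally have "cmod (z - w) \<le> cmod w / 16" using norm_ge_zero[of w] by linarith
    from near_cone_quarter[OF w Bp(1) this] have zB: "z \<in> tcone (1 / 2) B" .
    then have z\<beta>: "z \<in> tcone (1 / 2) \<beta>"
      using truncated_cone_mono[of "1 / 2" "1 / 2" \<beta> B] b Bp by auto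
    have "z + \<phi> z = w"
    proof (rule cone_small_inj[OF b0(2) _ _ w2])
      show "z + \<phi> z \<in> tcone 2 \<beta>0" by (rule B(2)) (use zB in simp)
      have "F_transform M (z + \<phi> z) = z" using V z\<beta> by (simp add: voiculescu_iff is_F_inverse_on_def)
      then show "z + \<phi> z - E_transform M (z + \<phi> z) = w - E_transform M w"
        by (simp add: E_transform_def z_def)
    qed simp
    then have lw: "(\<lambda>n. z + \<theta> n z) \<longlonglongrightarrow> w" using tendsto_add[OF tendsto_const lim[OF z\<beta>], of z] by simp
    have Mw: "cauchy_transform M w = 1 / z" by (simp add: z_def F_transform_def)
    have "(\<lambda>n. cmod (z + \<theta> n z - w) / (Im (z + \<theta> n z) * Im w)) \<longlonglongrightarrow> cmod (w - w) / (Im w * Im w)"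
      using wu by (intro tendsto_intros lw) (auto simp: uhp_iff)
    then have "(\<lambda>n. cmod (z + \<theta> n z - w) / (Im (z + \<theta> n z) * Im w)) \<longlonglongrightarrow> 0" by simp
    moreover have "eventually (\<lambda>n. norm (1 / z - cauchy_transform (X n) w)
        \<le> cmod (z + \<theta> n z - w) / (Im (z + \<theta> n z) * Im w)) sequentially"
      using inv[OF z\<beta>]
    proof eventually_elim
      case (elim n)
      then have u: "z + \<theta> n z \<in> uhp" by (simp add: uhp_iff)
      have "1 / z = 1 / F_transform (X n) (z + \<theta> n z)" using elim by simp
      also have "... = cauchy_transform (X n) (z + \<theta> n z)" by (simp add: F_transform_def)
      finally have "1 / z = cauchy_transform (X n) (z + \<theta> n z)" .
      then show ?case
        using cauchy_transform_lipschitz[OF real_distributionD(2)[OF X] u wu, of n]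
        by (simp add: real_distributionD(5)[OF X])
    qed
    ultimately have "(\<lambda>n. 1 / z - cauchy_transform (X n) w) \<longlonglongrightarrow> 0"
      by (rule Lim_null_comparison[rotated])
    then have "(\<lambda>n. 1 / z - (1 / z - cauchy_transform (X n) w)) \<longlonglongrightarrow> 1 / z - 0"
      by (intro tendsto_diff tendsto_const)
    then show "(\<lambda>n. cauchy_transform (X n) w) \<longlonglongrightarrow> cauchy_transform M w" by (simp add: Mw)
  qed (use Bp in auto)
qed

text \<open>Since \<open>kappa\<close> converges, the inverses of all but finitely many \<open>F\<^sub>n\<close> live on one common cone.\<close>
lemma F_inverses_of_weakly_converges:
  assumes X: "\<And>n. real_distribution (X n)" and M: "real_distribution M" and b: "0 < \<beta>"
    and V: "voiculescu_on (tcone (1 / 2) \<beta>) M \<phi>"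
    and W: "weakly_converges X M"
  shows "\<exists>B\<ge>max \<beta> b0. \<exists>N. \<exists>g. (\<forall>n\<ge>N. is_F_inverse_on (tcone 1 B) (X n) (g n)) \<and>
    (\<forall>z\<in>tcone (1 / 2) B. (\<lambda>n. g n z - z) \<longlonglongrightarrow> \<phi> z)"
proof -
  \<comment> \<open>\<open>1664 = 104 * 16\<close>, so that the \<open>E\<close>-transforms become Lipschitz with constant \<open>1 / 16\<close>.\<close>
  obtain \<beta>0 where b0: "\<beta>0 > 0" "kappa M \<beta>0 < 1 / 1664"
    using kappa_small[OF real_distributionD(2)[OF M], of "1 / 1664"] by auto
  have "eventually (\<lambda>n. kappa (X n) \<beta>0 < 1 / 1664) sequentially"
    using order_tendstoD(2)[OF weakly_converges_kappa[OF W b0(1)] b0(2)] .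
  then obtain N where N: "\<And>n. n \<ge> N ==> kappa (X n) \<beta>0 < 1 / 1664" by (auto simp: eventually_sequentially)
  have sm: "cone_small (E_transform (X n)) \<beta>0 (1 / 16)" if "n \<ge> N" for n
    using N[OF that] b0(1) by (intro cone_small_mono[OF E_transform_cone_small[OF X b0(1)]]) auto
  have "\<forall>n. \<exists>g. n \<ge> N \<longrightarrow> is_F_inverse_on (tcone 1 (2 * \<beta>0)) (X n) g \<and>
     (\<forall>z\<in>tcone 1 (2 * \<beta>0). cmod (g z - z) \<le> cmod z / 8)"
    using F_inverse_exists[OF X b0(1) sm] by blast
  from choice[OF this] obtain g where g: "\<forall>n. n \<ge> N \<longrightarrow> is_F_inverse_on (tcone 1 (2 * \<beta>0)) (X n) (g n) \<and>
     (\<forall>z\<in>tcone 1 (2 * \<beta>0). cmod (g n z - z) \<le> cmod z / 8)" ..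
  obtain B where B: "B \<ge> max \<beta> (max b0 (2 * \<beta>0))"
    "\<And>z. z \<in> tcone (min (1 / 2) 1) B ==> z + \<phi> z \<in> tcone 2 \<beta>0"
    using F_inverse_near[OF V[unfolded voiculescu_iff] _ b b0(1), of "max b0 (2 * \<beta>0)"] by auto
  have Bp: "B \<ge> \<beta>" "B \<ge> b0" "B \<ge> 2 * \<beta>0" using B(1) by auto
  have C1: "tcone 1 B \<subseteq> tcone 1 (2 * \<beta>0)" using Bp b0 by (intro truncated_cone_mono) auto
  have "(\<lambda>n. g n z - z) \<longlonglongrightarrow> \<phi> z" if z: "z \<in> tcone (1 / 2) B" for z
  proof -
    have z1: "z \<in> tcone 1 (2 * \<beta>0)"
      using z truncated_cone_mono[of "1 / 2" 1 "2 * \<beta>0" B] Bp b0 by auto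
    have z2: "z \<in> tcone (1 / 2) \<beta>"
      using z truncated_cone_mono[of "1 / 2" "1 / 2" \<beta> B] Bp b by auto
    define u where "u = z + \<phi> z"
    have uC: "u \<in> tcone 2 \<beta>0" unfolding u_def by (rule B(2)) (use z in simp)
    have uu: "u \<in> uhp" using uC b0(1) truncated_cone_uhp[of \<beta>0 2] by auto
    have Fu: "F_transform M u = z" using V z2 by (simp add: voiculescu_iff is_F_inverse_on_def u_def)
    have "(\<lambda>n. 2 * cmod (E_transform M u - E_transform (X n) u)) \<longlonglongrightarrow> 2 * cmod (E_transform M u - E_transform M u)"
      by (intro tendsto_intros weakly_converges_E_transform[OF X M W uu])
    then have l0: "(\<lambda>n. 2 * cmod (E_transform M u - E_transform (X n) u)) \<longlonglongrightarrow> 0" by simp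
    have "eventually (\<lambda>n. norm (g n z - u) \<le> 2 * cmod (E_transform M u - E_transform (X n) u)) sequentially"
      unfolding eventually_sequentially
    proof (intro exI[of _ N] allI impI)
      fix n assume n: "n \<ge> N"
      have gn: "is_F_inverse_on (tcone 1 (2 * \<beta>0)) (X n) (g n)" "cmod (g n z - z) \<le> cmod z / 8"
        using g n z1 by blast+
      have gC: "g n z \<in> tcone 2 \<beta>0" by (rule near_cone(1)[OF z1 b0(1) gn(2)])
      have Fg: "F_transform (X n) (g n z) = z" using gn(1) z1 by (simp add: is_F_inverse_on_def)
      have "g n z - u = (E_transform (X n) (g n z) - E_transform (X n) u) - (E_transform M u - E_transform (X n) u)"
        using Fg Fu by (simp add: E_transform_def)
      then have "cmod (g n z - u) \<le> cmod (E_transform (X n) (g n z) - E_transform (X n) u)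
          + cmod (E_transform M u - E_transform (X n) u)"
        by (metis norm_triangle_ineq4)
      also have "cmod (E_transform (X n) (g n z) - E_transform (X n) u) \<le> 1 / 16 * cmod (g n z - u)"
        using sm[OF n] gC uC unfolding cone_small_def by blast
      finally show "norm (g n z - u) \<le> 2 * cmod (E_transform M u - E_transform (X n) u)"
        using norm_ge_zero[of "g n z - u"] norm_ge_zero[of "E_transform M u - E_transform (X n) u"] by linarith
    qed
    then have "(\<lambda>n. g n z - u) \<longlonglongrightarrow> 0" using l0 by (rule Lim_null_comparison)
    then have "(\<lambda>n. g n z) \<longlonglongrightarrow> u" by (rule LIM_zero_cancel)
    then have "(\<lambda>n. g n z - z) \<longlonglongrightarrow> u - z" by (intro tendsto_diff tendsto_const)
    then show ?thesis by (simp add: u_def)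
  qed
  moreover have "is_F_inverse_on (tcone 1 B) (X n) (g n)" if "n \<ge> N" for n
    using g that by (intro F_inverse_restrict[OF _ C1]) blast
  ultimately show ?thesis using Bp by (intro exI[of _ B] conjI exI[of _ N] exI[of _ g]) auto
qed

section \<open>A single centred measure\<close>

text \<open>\<open>kappa \<mu> 1\<close> is the single number through which infinitesimality enters all estimates.\<close>
lemma truncated_mean_kappa:
  assumes m: "real_distribution \<mu>"
  shows "\<bar>truncated_mean \<mu>\<bar> \<le> kappa \<mu> 1"
proof -
  note fb = real_distributionD(2)[OF m]
  have "norm (\<integral>t. indicat_real {t. \<bar>t\<bar> < 1} t *\<^sub>R t \<partial>\<mu>) \<le> (\<integral>t. norm (indicat_real {t. \<bar>t\<bar> < 1} t *\<^sub>R t) \<partial>\<mu>)"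
    by (rule integral_norm_bound)
  also have "... \<le> (\<integral>t. min 1 (\<bar>t\<bar> / 1) \<partial>\<mu>)"
  proof (rule integral_mono)
    show "integrable \<mu> (\<lambda>t. norm (indicat_real {t. \<bar>t\<bar> < 1} t *\<^sub>R t))"
      by (intro integrable_bounded_borel[OF fb, where B=1]) (auto simp: indicator_def)
    show "integrable \<mu> (\<lambda>t. min 1 (\<bar>t\<bar> / 1))" by (rule kappa_integrable[OF fb]) simp
  qed (auto simp: indicator_def)
  finally show ?thesis unfolding truncated_mean_def set_lebesgue_integral_def kappa_def by simp
qed

lemma shift_measurable: "real_distribution \<mu> ==> (\<lambda>t. t - a) \<in> borel_measurable \<mu>"
  by (rule finite_borelD(4)[OF real_distributionD(2)]) auto

lemma real_distribution_centered:
  assumes m: "real_distribution \<mu>"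
  shows "real_distribution (centered \<mu>)"
  using prob_space.prob_space_distr[OF real_distributionD(1)[OF m] shift_measurable[OF m]]
  by (auto simp: centered_def real_distribution_def real_distribution_axioms_def)

lemma integral_centered:
  fixes f :: "real \<Rightarrow> 'a::{banach, second_countable_topology}"
  assumes m: "real_distribution \<mu>" and f: "f \<in> borel_measurable borel"
  shows "(\<integral>s. f s \<partial>centered \<mu>) = (\<integral>t. f (t - truncated_mean \<mu>) \<partial>\<mu>)"
  unfolding centered_def by (rule integral_distr[OF shift_measurable[OF m] f])

lemma kappa_centered:
  assumes m: "real_distribution \<mu>"
  shows "kappa (centered \<mu>) 1 \<le> 2 * kappa \<mu> 1"
proof -
  interpret real_distribution \<mu> by fact
  note fb = real_distributionD(2)[OF m]
  let ?a = "truncated_mean \<mu>"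
  have "kappa (centered \<mu>) 1 = (\<integral>t. min 1 (\<bar>t - ?a\<bar> / 1) \<partial>\<mu>)"
    unfolding kappa_def by (rule integral_centered[OF m]) measurable
  also have "... \<le> (\<integral>t. min 1 (\<bar>t\<bar> / 1) + \<bar>?a\<bar> \<partial>\<mu>)"
  proof (rule integral_mono)
    show "integrable \<mu> (\<lambda>t. min 1 (\<bar>t - ?a\<bar> / 1))"
      by (intro integrable_bounded_borel[OF fb, where B=1]) auto
    show "integrable \<mu> (\<lambda>t. min 1 (\<bar>t\<bar> / 1) + \<bar>?a\<bar>)"
      by (intro Bochner_Integration.integrable_add kappa_integrable[OF fb]) auto
  qed auto
  also have "... = kappa \<mu> 1 + \<bar>?a\<bar>"
    using kappa_integrable[OF fb, of 1] by (simp add: kappa_def real_distributionD(5)[OF m])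
  finally show ?thesis using truncated_mean_kappa[OF m] by simp
qed

definition levy_part :: "real measure \<Rightarrow> real measure" where
  "levy_part \<mu> = density (centered \<mu>) (\<lambda>t. ennreal (t^2 / (1 + t^2)))"

definition levy_mass :: "real measure \<Rightarrow> real" where
  "levy_mass \<mu> = (\<integral>t. t^2 / (1 + t^2) \<partial>centered \<mu>)"

definition levy_drift :: "real measure \<Rightarrow> real" where
  "levy_drift \<mu> = (\<integral>t. t / (1 + t^2) \<partial>centered \<mu>)"

lemma sq_ratio_bounds: "0 \<le> t^2 / (1 + t^2)" "t^2 / (1 + t^2) \<le> (1::real)" "t^2 / (1 + t^2) \<le> min 1 \<bar>t\<bar>"
proof -
  have p: "1 + t^2 > 0" by (simp add: add_pos_nonneg)
  show "0 \<le> t^2 / (1 + t^2)" by simp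
  show 1: "t^2 / (1 + t^2) \<le> 1" using p by simp
  have "\<bar>t\<bar> * \<bar>t\<bar> \<le> \<bar>t\<bar> * (1 + t^2)"
  proof (rule mult_left_mono)
    show "\<bar>t\<bar> \<le> 1 + t^2" using sum_squares_bound[of "\<bar>t\<bar>" 1] by (simp add: power2_eq_square)
  qed simp
  then have "t^2 / (1 + t^2) \<le> \<bar>t\<bar>" using p by (simp add: pos_divide_le_eq power2_eq_square)
  with 1 show "t^2 / (1 + t^2) \<le> min 1 \<bar>t\<bar>" by simp
qed

lemma sq_ratio_integrable:
  assumes "finite_borel M"
  shows "integrable M (\<lambda>t. t^2 / (1 + t^2))"
  using sq_ratio_bounds(1,2) by (intro integrable_bounded_borel[OF assms, where B=1]) auto

lemma abs_drift_le: "\<bar>t / (1 + t^2)\<bar> \<le> (1::real)"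
proof -
  have p: "1 + t^2 > 0" by (simp add: add_pos_nonneg)
  have "\<bar>t\<bar> \<le> 1 + t^2" using sum_squares_bound[of "\<bar>t\<bar>" 1] by (simp add: power2_eq_square)
  moreover have "\<bar>t / (1 + t^2)\<bar> = \<bar>t\<bar> / (1 + t^2)" using p by (simp add: abs_divide)
  ultimately show ?thesis using p by (simp only: divide_le_eq_1_pos)
qed

lemma drift_integrable:
  assumes "finite_borel M"
  shows "integrable M (\<lambda>t. t / (1 + t^2))"
proof (rule integrable_bounded_borel[OF assms])
  show "norm (t / (1 + t^2)) \<le> 1" for t :: real unfolding real_norm_def by (rule abs_drift_le)
qed measurable

lemma levy_mass_nonneg: "0 \<le> levy_mass \<mu>"
  unfolding levy_mass_def by (rule integral_nonneg_AE) auto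

lemma levy_mass_kappa:
  assumes m: "real_distribution \<mu>"
  shows "levy_mass \<mu> \<le> 2 * kappa \<mu> 1"
proof -
  note fb = real_distributionD(2)[OF real_distribution_centered[OF m]]
  have "levy_mass \<mu> \<le> kappa (centered \<mu>) 1"
    unfolding levy_mass_def kappa_def
    by (intro integral_mono sq_ratio_integrable[OF fb] kappa_integrable[OF fb]) (use sq_ratio_bounds(3) in auto)
  then show ?thesis using kappa_centered[OF m] by simp
qed

text \<open>On the set \<open>A\<close> where \<open>|s + a| < 1\<close> the drift integrand is \<open>s\<close> up to \<open>2 s\<^sup>2/(1+s\<^sup>2)\<close>, and by the choice of \<open>a\<close>
the integral of \<open>s\<close> over \<open>A\<close> is only \<open>a\<close> times the mass off \<open>A\<close>. Off \<open>A\<close> one has \<open>|s| \<ge> 1/2\<close>, so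
that mass is at most five times the Levy mass.\<close>
lemma levy_drift_bound:
  assumes m: "real_distribution \<mu>" and a: "\<bar>truncated_mean \<mu>\<bar> \<le> 1 / 2"
  shows "\<bar>levy_drift \<mu>\<bar> \<le> 6 * levy_mass \<mu>"
proof -
  let ?a = "truncated_mean \<mu>" and ?M = "centered \<mu>"
  interpret real_distribution \<mu> by fact
  note C = real_distribution_centered[OF m]
  note fb = real_distributionD(2)[OF m] and fc = real_distributionD(2)[OF C]
  interpret C: real_distribution ?M by (rule C)
  define A where "A = {s::real. \<bar>s + ?a\<bar> < 1}"
  have [measurable]: "A \<in> sets borel" unfolding A_def by measurable
  let ?p = "\<lambda>s::real. s^2 / (1 + s^2)"
  have pos: "1 + s^2 > 0" for s :: real by (simp add: add_pos_nonneg)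
  have ip: "integrable ?M ?p" by (rule sq_ratio_integrable[OF fc])
  have iu: "integrable ?M (\<lambda>s. indicat_real A s * s)"
    using a by (intro integrable_bounded_borel[OF fc, where B=2]) (auto simp: A_def indicator_def)
  have ir: "integrable ?M (\<lambda>s. s / (1 + s^2) - indicat_real A s * s)"
  proof -
    have "integrable ?M (\<lambda>s. s / (1 + s^2))" by (rule drift_integrable[OF fc])
    then show ?thesis using iu by (rule Bochner_Integration.integrable_diff)
  qed
  have r: "\<bar>s / (1 + s^2) - indicat_real A s * s\<bar> \<le> 2 * ?p s" for s
  proof (cases "s \<in> A")
    case True
    then have s: "\<bar>s\<bar> \<le> 3 / 2" using a by (auto simp: A_def)
    have "s / (1 + s^2) - s = - (s * ?p s)" using pos[of s] by (simp add: field_simps power2_eq_square)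
    then have "\<bar>s / (1 + s^2) - s\<bar> = \<bar>s\<bar> * ?p s" using pos[of s] by (simp add: abs_mult)
    also have "... \<le> 2 * ?p s" using s sq_ratio_bounds(1)[of s] by (intro mult_right_mono) auto
    finally show ?thesis using True by simp
  next
    case False
    then have s: "\<bar>s\<bar> \<ge> 1 / 2" using a by (auto simp: A_def)
    have "\<bar>s\<bar> \<le> 2 * (\<bar>s\<bar> * \<bar>s\<bar>)" using mult_right_mono[OF s, of "\<bar>s\<bar>"] by simp
    then have "\<bar>s\<bar> / (1 + s^2) \<le> 2 * s^2 / (1 + s^2)"
      using pos[of s] by (intro divide_right_mono) (auto simp: power2_eq_square)
    moreover have "\<bar>s / (1 + s^2)\<bar> = \<bar>s\<bar> / (1 + s^2)" using pos[of s] by (simp add: abs_divide)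
    ultimately show ?thesis using False by simp
  qed
  have o: "indicat_real (- A) s \<le> 5 * ?p s" for s
  proof (cases "s \<in> A")
    case False
    then have "\<bar>s\<bar> \<ge> 1 / 2" using a by (auto simp: A_def)
    then have "(1 / 2)^2 \<le> \<bar>s\<bar>\<^sup>2" by (intro power_mono) auto
    then have "1 + s^2 \<le> 5 * s^2" by (simp add: power2_eq_square)
    then show ?thesis using False pos[of s] by (simp add: pos_le_divide_eq)
  qed (use sq_ratio_bounds(1)[of s] in simp)
  have u: "(\<integral>s. indicat_real A s * s \<partial>?M) = ?a * measure ?M (- A)"
  proof -
    have iA: "integrable \<mu> (\<lambda>t. indicat_real {t. \<bar>t\<bar> < 1} t * t)"
      by (intro integrable_bounded_borel[OF fb, where B=1]) (auto simp: indicator_def)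
    have iB: "integrable \<mu> (\<lambda>t. indicat_real {t. \<bar>t\<bar> < 1} t * ?a)"
      by (intro integrable_bounded_borel[OF fb, where B="\<bar>?a\<bar>"]) (auto simp: indicator_def)
    have "(\<integral>s. indicat_real A s * s \<partial>?M) = (\<integral>t. indicat_real A (t - ?a) * (t - ?a) \<partial>\<mu>)"
      by (rule integral_centered[OF m]) measurable
    also have "... = (\<integral>t. indicat_real {t. \<bar>t\<bar> < 1} t * t - indicat_real {t. \<bar>t\<bar> < 1} t * ?a \<partial>\<mu>)"
      by (intro Bochner_Integration.integral_cong) (auto simp: A_def indicator_def)
    also have "... = (\<integral>t. indicat_real {t. \<bar>t\<bar> < 1} t * t \<partial>\<mu>) - (\<integral>t. indicat_real {t. \<bar>t\<bar> < 1} t * ?a \<partial>\<mu>)"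
      by (rule Bochner_Integration.integral_diff[OF iA iB])
    also have "(\<integral>t. indicat_real {t. \<bar>t\<bar> < 1} t * t \<partial>\<mu>) = ?a"
      unfolding truncated_mean_def set_lebesgue_integral_def by simp
    also have "(\<integral>t. indicat_real {t. \<bar>t\<bar> < 1} t * ?a \<partial>\<mu>) = (\<integral>s. indicat_real A s * ?a \<partial>?M)"
      by (subst integral_centered[OF m]) (auto intro!: Bochner_Integration.integral_cong simp: A_def indicator_def)
    also have "... = measure ?M A * ?a" by simp
    also have "?a - measure ?M A * ?a = ?a * (1 - measure ?M A)" by (simp add: algebra_simps)
    also have "1 - measure ?M A = measure ?M (- A)"
      using C.prob_compl[of A] by (simp add: Compl_eq_Diff_UNIV)
    finally show ?thesis .
  qed
  have "measure ?M (- A) = (\<integral>s. indicat_real (- A) s \<partial>?M)" by simp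
  also have "... \<le> (\<integral>s. 5 * ?p s \<partial>?M)"
    by (intro integral_mono o integrable_mult_right ip integrable_bounded_borel[OF fc, where B=1]) auto
  also have "... = 5 * levy_mass \<mu>" unfolding levy_mass_def by (rule integral_mult_right_zero)
  finally have mA: "measure ?M (- A) \<le> 5 * levy_mass \<mu>" .
  have "\<bar>\<integral>s. (s / (1 + s^2) - indicat_real A s * s) \<partial>?M\<bar> \<le> (\<integral>s. \<bar>s / (1 + s^2) - indicat_real A s * s\<bar> \<partial>?M)"
    by (rule integral_abs_bound)
  also have "... \<le> (\<integral>s. 2 * ?p s \<partial>?M)"
    using r ir by (intro integral_mono integrable_mult_right ip) auto
  also have "... = 2 * levy_mass \<mu>" unfolding levy_mass_def by (rule integral_mult_right_zero)
  finally have rI: "\<bar>\<integral>s. (s / (1 + s^2) - indicat_real A s * s) \<partial>?M\<bar> \<le> 2 * levy_mass \<mu>" .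
  have "levy_drift \<mu> = (\<integral>s. (s / (1 + s^2) - indicat_real A s * s) + indicat_real A s * s \<partial>?M)"
    unfolding levy_drift_def by simp
  also have "... = (\<integral>s. (s / (1 + s^2) - indicat_real A s * s) \<partial>?M) + ?a * measure ?M (- A)"
    unfolding u[symmetric] by (rule Bochner_Integration.integral_add[OF ir iu])
  finally have "levy_drift \<mu> = (\<integral>s. (s / (1 + s^2) - indicat_real A s * s) \<partial>?M) + ?a * measure ?M (- A)" .
  moreover have "\<bar>?a * measure ?M (- A)\<bar> = \<bar>?a\<bar> * measure ?M (- A)" by (simp add: abs_mult)
  ultimately have "\<bar>levy_drift \<mu>\<bar> \<le> 2 * levy_mass \<mu> + \<bar>?a\<bar> * measure ?M (- A)"
    using rI by linarith
  also have "\<bar>?a\<bar> * measure ?M (- A) \<le> 1 / 2 * (5 * levy_mass \<mu>)"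
    using a mA by (intro mult_mono) auto
  finally show ?thesis using levy_mass_nonneg[of \<mu>] by linarith
qed

lemma emeasure_levy_part:
  assumes m: "real_distribution \<mu>"
  shows "finite_borel (levy_part \<mu>)" "measure (levy_part \<mu>) UNIV = levy_mass \<mu>"
proof -
  note fc = real_distributionD(2)[OF real_distribution_centered[OF m]]
  have meas: "(\<lambda>t. ennreal (t^2 / (1 + t^2))) \<in> borel_measurable (centered \<mu>)"
    by (rule finite_borelD(4)[OF fc]) measurable
  have em: "emeasure (levy_part \<mu>) UNIV = ennreal (levy_mass \<mu>)"
  proof -
    have "emeasure (levy_part \<mu>) UNIV = (\<integral>\<^sup>+t. ennreal (t^2 / (1 + t^2)) \<partial>centered \<mu>)"
      unfolding levy_part_def using finite_borelD(2)[OF fc]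
      by (subst emeasure_density[OF meas]) auto
    also have "... = ennreal (levy_mass \<mu>)"
      unfolding levy_mass_def by (intro nn_integral_eq_integral sq_ratio_integrable[OF fc]) auto
    finally show ?thesis .
  qed
  have "space (levy_part \<mu>) = UNIV" "sets (levy_part \<mu>) = sets borel"
    using finite_borelD(2,3)[OF fc] by (auto simp: levy_part_def)
  then show "finite_borel (levy_part \<mu>)"
    unfolding finite_borel_measure_def finite_borel_measure_axioms_def
    using em by (auto intro!: finite_measureI)
  show "measure (levy_part \<mu>) UNIV = levy_mass \<mu>"
    using em levy_mass_nonneg by (simp add: measure_def)
qed

lemma integral_levy_part:
  fixes f :: "real \<Rightarrow> 'a::{banach, second_countable_topology}"
  assumes m: "real_distribution \<mu>" and f: "f \<in> borel_measurable borel"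
  shows "(\<integral>t. f t \<partial>levy_part \<mu>) = (\<integral>t. (t^2 / (1 + t^2)) *\<^sub>R f t \<partial>centered \<mu>)"
proof -
  note fc = real_distributionD(2)[OF real_distribution_centered[OF m]]
  have 1: "f \<in> borel_measurable (centered \<mu>)" by (rule finite_borelD(4)[OF fc f])
  have 2: "(\<lambda>t. t^2 / (1 + t^2)) \<in> borel_measurable (centered \<mu>)"
    by (rule finite_borelD(4)[OF fc]) measurable
  have 3: "AE t in centered \<mu>. 0 \<le> t^2 / (1 + t^2)" by (intro AE_I2 sq_ratio_bounds(1))
  show ?thesis unfolding levy_part_def by (rule integral_density[OF 1 2 3])
qed

definition levy_nevanlinna :: "real measure \<Rightarrow> complex \<Rightarrow> complex" where
  "levy_nevanlinna \<mu> = nevanlinna (levy_drift \<mu>) (levy_part \<mu>)"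

text \<open>The drift completes the kernel: \<open>t/(1+t\<^sup>2) + t\<^sup>2/(1+t\<^sup>2) (1+tz)/(z-t) = tz/(z-t)\<close>.\<close>
lemma levy_nevanlinna_eq:
  assumes m: "real_distribution \<mu>" and z: "z \<in> uhp"
  shows "levy_nevanlinna \<mu> z = z * (z * cauchy_transform (centered \<mu>) z - 1)"
proof -
  note C = real_distribution_centered[OF m]
  note fc = real_distributionD(2)[OF C]
  let ?k = "\<lambda>t. (1 + complex_of_real t * z) / (z - of_real t)"
  have kb: "norm ((t^2 / (1 + t^2)) *\<^sub>R ?k t) \<le> cmod z + cmod (1 + z^2) / Im z" for t
  proof -
    have "norm ((t^2 / (1 + t^2)) *\<^sub>R ?k t) \<le> 1 * cmod (?k t)"
      unfolding norm_scaleR using sq_ratio_bounds(1,2)[of t] by (intro mult_right_mono) auto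
    then show ?thesis using nevanlinna_kernel_bound[OF z, of t] by simp
  qed
  have ik: "integrable (centered \<mu>) (\<lambda>t. (t^2 / (1 + t^2)) *\<^sub>R ?k t)"
    by (rule integrable_bounded_borel[OF fc _ kb]) measurable
  have id: "integrable (centered \<mu>) (\<lambda>t. t / (1 + t^2))" by (rule drift_integrable[OF fc])
  have "levy_nevanlinna \<mu> z = (\<integral>t. complex_of_real (t / (1 + t^2)) \<partial>centered \<mu>)
      + (\<integral>t. (t^2 / (1 + t^2)) *\<^sub>R ?k t \<partial>centered \<mu>)"
    unfolding levy_nevanlinna_def nevanlinna_integral_def levy_drift_def
      integral_levy_part[OF m nevanlinna_kernel_measurable]
    by (simp only: integral_complex_of_real)
  also have "... = (\<integral>t. complex_of_real (t / (1 + t^2)) + (t^2 / (1 + t^2)) *\<^sub>R ?k t \<partial>centered \<mu>)"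
    by (rule Bochner_Integration.integral_add[symmetric, OF integrable_of_real[OF id] ik])
  also have "... = (\<integral>t. z * (z * (1 / (z - of_real t)) - 1) \<partial>centered \<mu>)"
  proof (rule Bochner_Integration.integral_cong[OF refl])
    fix t
    have nz: "z - of_real t \<noteq> 0" by (rule uhp_diff_real_nz[OF z])
    have "1 + t^2 > 0" by (simp add: add_pos_nonneg)
    then have "complex_of_real (1 + t^2) \<noteq> 0" by (metis less_irrefl of_real_eq_0_iff)
    then have d: "1 + (complex_of_real t)^2 \<noteq> 0" by simp
    have "complex_of_real (t / (1 + t^2)) + (t^2 / (1 + t^2)) *\<^sub>R ?k t
      = complex_of_real t / (1 + (complex_of_real t)^2)
        + (complex_of_real t)^2 / (1 + (complex_of_real t)^2) * ?k t"
      by (simp add: scaleR_conv_of_real)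
    also have "... = z * (z * (1 / (z - of_real t)) - 1)"
      using nz d by (simp add: divide_simps) (simp add: algebra_simps power2_eq_square)
    finally show "complex_of_real (t / (1 + t^2)) + (t^2 / (1 + t^2)) *\<^sub>R ?k t
      = z * (z * (1 / (z - of_real t)) - 1)" .
  qed
  also have "... = z * (\<integral>t. z * (1 / (z - of_real t)) - 1 \<partial>centered \<mu>)"
    by (rule integral_mult_right_zero)
  also have "(\<integral>t. z * (1 / (z - of_real t)) - 1 \<partial>centered \<mu>)
     = (\<integral>t. z * (1 / (z - of_real t)) \<partial>centered \<mu>) - (\<integral>t. 1 \<partial>centered \<mu>)"
    by (intro Bochner_Integration.integral_diff integrable_mult_right cauchy_integrable[OF fc z]
        integrable_bounded_borel[OF fc, where B=1]) auto
  also have "(\<integral>t. z * (1 / (z - of_real t)) \<partial>centered \<mu>) = z * cauchy_transform (centered \<mu>) z"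
    unfolding cauchy_transform_def by (rule integral_mult_right_zero)
  also have "(\<integral>t. (1::complex) \<partial>centered \<mu>) = 1"
    using real_distributionD(4,5)[OF C] by simp
  finally show ?thesis .
qed

lemma kappa_le_mass:
  assumes "finite_borel M" "0 < \<beta>"
  shows "kappa M \<beta> \<le> measure M UNIV"
proof -
  interpret finite_borel_measure M by fact
  have "kappa M \<beta> \<le> (\<integral>t. 1 \<partial>M)"
    unfolding kappa_def by (intro integral_mono kappa_integrable assms) auto
  then show ?thesis using finite_borelD(3)[OF assms(1)] by simp
qed

lemma levy_nevanlinna_small:
  assumes m: "real_distribution \<mu>" and a: "\<bar>truncated_mean \<mu>\<bar> \<le> 1 / 2"
  shows "cone_small (levy_nevanlinna \<mu>) (1 / 2) (32 * levy_mass \<mu>)"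
proof -
  note L = emeasure_levy_part[OF m]
  have "\<bar>levy_drift \<mu>\<bar> / (1 / 2) + measure (levy_part \<mu>) UNIV / (1 / 2)^2 + 16 * kappa (levy_part \<mu>) (1 / 2)
     \<le> 32 * levy_mass \<mu>"
    using levy_drift_bound[OF m a] kappa_le_mass[OF L(1), of "1 / 2"] L(2) by (simp add: power2_eq_square)
  then show ?thesis
    unfolding levy_nevanlinna_def by (intro cone_small_mono[OF nevanlinna_cone_small[OF L(1), where \<beta>="1 / 2"]]) auto
qed

lemma kappa_half:
  assumes "finite_borel M"
  shows "kappa M (1 / 2) \<le> 2 * kappa M 1"
proof -
  have "kappa M (1 / 2) \<le> (\<integral>t. 2 * min 1 (\<bar>t\<bar> / 1) \<partial>M)"
    unfolding kappa_def by (intro integral_mono integrable_mult_right kappa_integrable assms) auto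
  then show ?thesis unfolding kappa_def integral_mult_right_zero .
qed

lemma cauchy_transform_centered:
  assumes m: "real_distribution \<mu>"
  shows "cauchy_transform (centered \<mu>) w = cauchy_transform \<mu> (w + of_real (truncated_mean \<mu>))"
  unfolding cauchy_transform_def
  by (subst integral_centered[OF m]) (auto simp: algebra_simps)

lemma E_transform_centered:
  assumes m: "real_distribution \<mu>"
  shows "E_transform \<mu> z = of_real (truncated_mean \<mu>) + E_transform (centered \<mu>) (z - of_real (truncated_mean \<mu>))"
  by (simp add: E_transform_def F_transform_def cauchy_transform_centered[OF m])

text \<open>With \<open>q = wG(w)\<close> one has \<open>E = w(q-1)/q\<close>, while the Levy data give \<open>w(q-1)\<close>.\<close>
lemma centered_estimates:
  assumes m: "real_distribution \<mu>" and k: "kappa \<mu> 1 \<le> 1 / 32" and w: "w \<in> tcone 2 (1 / 2)"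
  shows "cmod (E_transform (centered \<mu>) w) \<le> 32 * kappa \<mu> 1 * cmod w"
    "cmod (E_transform (centered \<mu>) w - levy_nevanlinna \<mu> w) \<le> 1024 * kappa \<mu> 1 * levy_mass \<mu> * cmod w"
proof -
  let ?C = "centered \<mu>" and ?k = "kappa \<mu> 1" and ?m = "levy_mass \<mu>"
  note C = real_distribution_centered[OF m]
  have k0: "0 \<le> ?k" by (rule kappa_nonneg) simp
  have wu: "w \<in> uhp" using w truncated_cone_uhp[of "1/2" 2] by auto
  have w0: "w \<noteq> 0" using wu by (auto simp: uhp_iff)
  have a: "\<bar>truncated_mean \<mu>\<bar> \<le> 1 / 2" using truncated_mean_kappa[OF m] k by simp
  define q where "q = w * cauchy_transform ?C w"
  have "cmod (q - 1) \<le> 4 * kappa ?C (1 / 2)"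
    unfolding q_def by (rule cone_cauchy_transform[OF C w]) simp
  also have "... \<le> 16 * ?k" using kappa_half[OF real_distributionD(2)[OF C]] kappa_centered[OF m] by simp
  finally have q1: "cmod (q - 1) \<le> 16 * ?k" .
  then have q2: "cmod q \<ge> 1 / 2"
    using k norm_triangle_ineq2[of 1 "1 - q"] by (simp add: norm_minus_commute)
  then have q0: "q \<noteq> 0" by auto
  have ratio: "cmod ((q - 1) / q) \<le> 32 * ?k"
  proof -
    have "cmod (q - 1) / cmod q \<le> (16 * ?k) / (1 / 2)" using q1 q2 k0 by (intro frac_le) auto
    then show ?thesis by (simp add: norm_divide)
  qed
  have cz: "cauchy_transform ?C w \<noteq> 0" using q0 by (auto simp: q_def)
  have E1: "E_transform ?C w = w * ((q - 1) / q)"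
    using w0 cz by (simp add: E_transform_def F_transform_def q_def field_simps)
  show "cmod (E_transform ?C w) \<le> 32 * ?k * cmod w"
    unfolding E1 norm_mult using mult_left_mono[OF ratio, of "cmod w"] by (simp add: mult_ac)
  have g: "levy_nevanlinna \<mu> w = w * (q - 1)" unfolding q_def by (rule levy_nevanlinna_eq[OF m wu])
  have "E_transform ?C w - levy_nevanlinna \<mu> w = - (levy_nevanlinna \<mu> w * ((q - 1) / q))"
    unfolding E1 g using q0 by (simp add: field_simps)
  then have "cmod (E_transform ?C w - levy_nevanlinna \<mu> w) = cmod (levy_nevanlinna \<mu> w) * cmod ((q - 1) / q)"
    by (simp only: norm_minus_cancel norm_mult)
  also have "... \<le> (32 * ?m * cmod w) * (32 * ?k)"
    using levy_nevanlinna_small[OF m a] w ratio k0 levy_mass_nonneg[of \<mu>]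
    by (intro mult_mono) (auto simp: cone_small_def)
  finally show "cmod (E_transform ?C w - levy_nevanlinna \<mu> w) \<le> 1024 * ?k * ?m * cmod w"
    by (simp add: mult_ac)
qed

lemma E_transform_levy:
  assumes m: "real_distribution \<mu>" and k: "kappa \<mu> 1 \<le> 1 / 32" and z: "z \<in> tcone 1 1"
  shows "cmod (E_transform \<mu> z - (of_real (truncated_mean \<mu>) + levy_nevanlinna \<mu> z))
    \<le> 3000 * kappa \<mu> 1 * levy_mass \<mu> * cmod z"
proof -
  let ?a = "truncated_mean \<mu>" and ?k = "kappa \<mu> 1" and ?m = "levy_mass \<mu>"
  have k0: "0 \<le> ?k" by (rule kappa_nonneg) simp
  have ak: "\<bar>?a\<bar> \<le> ?k" by (rule truncated_mean_kappa[OF m])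
  then have a2: "\<bar>?a\<bar> \<le> 1 / 2" using k by linarith
  have z1: "cmod z \<ge> 1" using z abs_Im_le_cmod[of z] by (auto simp: truncated_cone_def)
  have z': "z \<in> tcone 1 (2 * (1 / 2))" using z by simp
  have "cmod (z - of_real ?a - z) \<le> cmod z / 8" using ak k z1 by simp
  note w = near_cone[OF z' _ this, simplified]
  have zc: "z \<in> tcone 2 (1 / 2)" using near_cone(1)[OF z', of z] by simp
  have mk: "0 \<le> ?m" by (rule levy_mass_nonneg)
  have 1: "cmod (E_transform (centered \<mu>) (z - of_real ?a) - levy_nevanlinna \<mu> (z - of_real ?a))
      \<le> 1024 * ?k * ?m * (9 / 8 * cmod z)"
    using w k0 mk by (intro order_trans[OF centered_estimates(2)[OF m k w(1)]] mult_left_mono) auto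
  have "cmod (levy_nevanlinna \<mu> (z - of_real ?a) - levy_nevanlinna \<mu> z) \<le> 32 * ?m * cmod (z - of_real ?a - z)"
    using levy_nevanlinna_small[OF m a2] w(1) zc unfolding cone_small_def by blast
  also have "... \<le> 32 * ?m * (?k * cmod z)"
  proof (intro mult_left_mono)
    have "?k * 1 \<le> ?k * cmod z" using z1 k0 by (intro mult_left_mono) auto
    then show "cmod (z - of_real ?a - z) \<le> ?k * cmod z" using ak by simp
  qed (use mk in auto)
  finally have 2: "cmod (levy_nevanlinna \<mu> (z - of_real ?a) - levy_nevanlinna \<mu> z) \<le> 32 * ?m * (?k * cmod z)" .
  have dec: "E_transform \<mu> z - (of_real ?a + levy_nevanlinna \<mu> z)
     = (E_transform (centered \<mu>) (z - of_real ?a) - levy_nevanlinna \<mu> (z - of_real ?a))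
       + (levy_nevanlinna \<mu> (z - of_real ?a) - levy_nevanlinna \<mu> z)"
    using E_transform_centered[OF m, of z] by algebra
  have "cmod (E_transform \<mu> z - (of_real ?a + levy_nevanlinna \<mu> z))
     \<le> 1024 * ?k * ?m * (9 / 8 * cmod z) + 32 * ?m * (?k * cmod z)"
    unfolding dec by (rule norm_triangle_mono[OF 1 2])
  also have "... = 1184 * (?k * ?m * cmod z)" by (simp add: algebra_simps)
  also have "... \<le> 3000 * (?k * ?m * cmod z)" using k0 mk by (intro mult_right_mono) auto
  finally show ?thesis by (simp add: mult_ac)
qed

text \<open>\<open>u - z = E(u)\<close>, so only the passage from \<open>u\<close> to \<open>z\<close> is new compared with \<open>E_transform_levy\<close>; the Levy data
are Lipschitz with a constant proportional to the Levy mass.\<close>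
lemma voiculescu_levy:
  assumes m: "real_distribution \<mu>" and k: "kappa \<mu> 1 \<le> 1 / 32" and z: "z \<in> tcone 1 1"
    and u: "F_transform \<mu> u = z" "cmod (u - z) \<le> cmod z / 16"
  shows "cmod (u - z - (of_real (truncated_mean \<mu>) + levy_nevanlinna \<mu> z))
    \<le> 3000 * kappa \<mu> 1 * levy_mass \<mu> * cmod z"
proof -
  let ?a = "truncated_mean \<mu>" and ?k = "kappa \<mu> 1" and ?m = "levy_mass \<mu>"
  have k0: "0 \<le> ?k" by (rule kappa_nonneg) simp
  have ak: "\<bar>?a\<bar> \<le> ?k" by (rule truncated_mean_kappa[OF m])
  then have a2: "\<bar>?a\<bar> \<le> 1 / 2" using k by linarith
  have z1: "cmod z \<ge> 1" using z abs_Im_le_cmod[of z] by (auto simp: truncated_cone_def)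
  have z': "z \<in> tcone 1 (2 * (1 / 2))" using z by simp
  define w where "w = u - of_real ?a"
  have "cmod (w - z) \<le> cmod (u - z) + cmod (complex_of_real ?a)"
  proof -
    have "w - z = (u - z) - complex_of_real ?a" by (simp add: w_def)
    then show ?thesis by (simp only: norm_triangle_ineq4)
  qed
  then have "cmod (w - z) \<le> cmod z / 8" using u(2) ak k z1 by simp
  note w = near_cone[OF z' _ this, simplified]
  have zc: "z \<in> tcone 2 (1 / 2)" using near_cone(1)[OF z', of z] by simp
  have mk: "0 \<le> ?m" by (rule levy_mass_nonneg)
  have e: "u - z = of_real ?a + E_transform (centered \<mu>) w"
    using u(1) E_transform_centered[OF m, of u] by (simp add: E_transform_def w_def)
  have 1: "cmod (E_transform (centered \<mu>) w - levy_nevanlinna \<mu> w) \<le> 1024 * ?k * ?m * (9 / 8 * cmod z)"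
    using w k0 mk by (intro order_trans[OF centered_estimates(2)[OF m k w(1)]] mult_left_mono) auto
  have "w - z = E_transform (centered \<mu>) w" using e by (simp add: w_def algebra_simps)
  then have "cmod (w - z) \<le> 32 * ?k * cmod w" using centered_estimates(1)[OF m k w(1)] by simp
  also have "... \<le> 32 * ?k * (9 / 8 * cmod z)" using w(2) k0 by (intro mult_left_mono) auto
  finally have wz: "cmod (w - z) \<le> 36 * ?k * cmod z" by (simp add: mult_ac)
  have "cmod (levy_nevanlinna \<mu> w - levy_nevanlinna \<mu> z) \<le> 32 * ?m * cmod (w - z)"
    using levy_nevanlinna_small[OF m a2] w(1) zc unfolding cone_small_def by blast
  also have "... \<le> 32 * ?m * (36 * ?k * cmod z)" using wz mk by (intro mult_left_mono) auto
  finally have 2: "cmod (levy_nevanlinna \<mu> w - levy_nevanlinna \<mu> z) \<le> 32 * ?m * (36 * ?k * cmod z)" .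
  have dec: "u - z - (of_real ?a + levy_nevanlinna \<mu> z)
     = (E_transform (centered \<mu>) w - levy_nevanlinna \<mu> w) + (levy_nevanlinna \<mu> w - levy_nevanlinna \<mu> z)"
    unfolding e by simp
  have "cmod (u - z - (of_real ?a + levy_nevanlinna \<mu> z))
     \<le> 1024 * ?k * ?m * (9 / 8 * cmod z) + 32 * ?m * (36 * ?k * cmod z)"
    unfolding dec by (rule norm_triangle_mono[OF 1 2])
  also have "... = 2304 * (?k * ?m * cmod z)" by (simp add: algebra_simps)
  also have "... \<le> 3000 * (?k * ?m * cmod z)" using k0 mk by (intro mult_right_mono) auto
  finally show ?thesis by (simp add: mult_ac)
qed

section \<open>Rows of an array\<close>

lemma nn_integral_sigma_row:
  assumes m: "\<And>j. 1 \<le> j ==> j \<le> m ==> real_distribution (\<nu> j)" and f: "f \<in> borel_measurable borel"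
  shows "(\<integral>\<^sup>+t. f t \<partial>sigma_row \<nu> m) = (\<Sum>j=1..m. \<integral>\<^sup>+t. f t \<partial>levy_part (\<nu> j))"
  using f
proof (induction rule: borel_measurable_induct)
  have [measurable_cong]: "sets (sigma_row \<nu> m) = sets borel" by (rule sets_sigma_row)
  have L [measurable_cong]: "j \<in> {1..m} ==> sets (levy_part (\<nu> j)) = sets borel" for j
    using emeasure_levy_part(1)[OF m] finite_borelD(2) by simp
  have mb: "w \<in> borel_measurable M" if "w \<in> borel_measurable borel" "sets M = sets borel"
    for w :: "real \<Rightarrow> ennreal" and M :: "real measure"
    using that(1) measurable_cong_sets[OF that(2) refl] by blast
  {
    case (cong f g)
    then have "f = g" by (intro ext) (auto simp: space_borel)
    then show ?case using cong by simp
  next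
    case (set A)
    then show ?case
      using L by (simp add: emeasure_sigma_row levy_part_def sets_sigma_row)
  next
    case (mult u c)
    have e: "(\<integral>\<^sup>+t. c * u t \<partial>M) = c * (\<integral>\<^sup>+t. u t \<partial>M)" if "sets M = sets borel" for M :: "real measure"
      by (rule nn_integral_cmult[OF mb[OF mult(2) that]])
    have IH: "(\<integral>\<^sup>+t. u t \<partial>sigma_row \<nu> m) = (\<Sum>j=1..m. \<integral>\<^sup>+t. u t \<partial>levy_part (\<nu> j))" by fact
    show ?case unfolding e[OF sets_sigma_row] IH sum_distrib_left
      by (intro sum.cong refl e[symmetric] L)
  next
    case (add u v)
    have um: "u \<in> borel_measurable borel" "v \<in> borel_measurable borel" by fact+
    have e: "(\<integral>\<^sup>+t. v t + u t \<partial>M) = (\<integral>\<^sup>+t. v t \<partial>M) + (\<integral>\<^sup>+t. u t \<partial>M)"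
      if "sets M = sets borel" for M :: "real measure"
      by (rule nn_integral_add[OF mb[OF um(2) that] mb[OF um(1) that]])
    have IH: "(\<integral>\<^sup>+t. u t \<partial>sigma_row \<nu> m) = (\<Sum>j=1..m. \<integral>\<^sup>+t. u t \<partial>levy_part (\<nu> j))"
      "(\<integral>\<^sup>+t. v t \<partial>sigma_row \<nu> m) = (\<Sum>j=1..m. \<integral>\<^sup>+t. v t \<partial>levy_part (\<nu> j))" by fact+
    show ?case unfolding e[OF sets_sigma_row] IH sum.distrib[symmetric]
      by (intro sum.cong refl e[symmetric] L)
  next
    case (seq U)
    have iU: "incseq U" by fact
    have mU: "U i \<in> borel_measurable borel" for i by fact
    have IH: "(\<integral>\<^sup>+t. U i t \<partial>sigma_row \<nu> m) = (\<Sum>j=1..m. \<integral>\<^sup>+t. U i t \<partial>levy_part (\<nu> j))" for i by fact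
    have inc: "incseq (\<lambda>i. \<integral>\<^sup>+t. U i t \<partial>M)" for M
      using iU by (auto simp: incseq_def le_fun_def intro!: nn_integral_mono)
    have lim: "(\<lambda>i. \<integral>\<^sup>+t. U i t \<partial>M) \<longlonglongrightarrow> (\<integral>\<^sup>+t. (SUP i. U i) t \<partial>M)" if "sets M = sets borel" for M :: "real measure"
    proof -
      have "U i \<in> borel_measurable M" for i
        by (rule mb[OF mU that])
      then have mono: "(\<integral>\<^sup>+t. (SUP i. U i t) \<partial>M) = (SUP i. \<integral>\<^sup>+t. U i t \<partial>M)"
        by (rule nn_integral_monotone_convergence_SUP[OF iU])
      have "(SUP i. U i) t = (SUP i. U i t)" for t by (simp add: image_comp)
      then have "(\<integral>\<^sup>+t. (SUP i. U i) t \<partial>M) = (SUP i. \<integral>\<^sup>+t. U i t \<partial>M)"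
        unfolding mono[symmetric] by (intro nn_integral_cong)
      then show ?thesis using LIMSEQ_SUP[OF inc] by simp
    qed
    have "(\<lambda>i. \<Sum>j=1..m. \<integral>\<^sup>+t. U i t \<partial>levy_part (\<nu> j)) \<longlonglongrightarrow> (\<Sum>j=1..m. \<integral>\<^sup>+t. (SUP i. U i) t \<partial>levy_part (\<nu> j))"
      by (intro tendsto_sum lim L)
    then have "(\<lambda>i. \<integral>\<^sup>+t. U i t \<partial>sigma_row \<nu> m) \<longlonglongrightarrow> (\<Sum>j=1..m. \<integral>\<^sup>+t. (SUP i. U i) t \<partial>levy_part (\<nu> j))"
      unfolding IH .
    from LIMSEQ_unique[OF lim[OF sets_sigma_row] this] show ?case .
  }
qed

lemma sigma_row_finite:
  assumes m: "\<And>j. 1 \<le> j ==> j \<le> m ==> real_distribution (\<nu> j)"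
  shows "finite_borel (sigma_row \<nu> m)"
    "measure (sigma_row \<nu> m) UNIV = (\<Sum>j=1..m. levy_mass (\<nu> j))"
proof -
  have sp: "space (sigma_row \<nu> m) = UNIV" using sets_eq_imp_space_eq[OF sets_sigma_row] by simp
  have "emeasure (levy_part (\<nu> j)) UNIV = ennreal (levy_mass (\<nu> j))" if "j \<in> {1..m}" for j
  proof -
    have r: "real_distribution (\<nu> j)" using m that by simp
    interpret finite_borel_measure "levy_part (\<nu> j)" by (rule emeasure_levy_part(1)[OF r])
    show ?thesis unfolding emeasure_eq_measure emeasure_levy_part(2)[OF r] ..
  qed
  then have "emeasure (sigma_row \<nu> m) UNIV = (\<Sum>j=1..m. ennreal (levy_mass (\<nu> j)))"
    by (simp add: emeasure_sigma_row levy_part_def)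
  also have "... = ennreal (\<Sum>j=1..m. levy_mass (\<nu> j))"
    by (rule sum_ennreal) (rule levy_mass_nonneg)
  finally have em: "emeasure (sigma_row \<nu> m) UNIV = ennreal (\<Sum>j=1..m. levy_mass (\<nu> j))" .
  show "finite_borel (sigma_row \<nu> m)"
    unfolding finite_borel_measure_def finite_borel_measure_axioms_def
    using em sp sets_sigma_row by (auto intro!: finite_measureI)
  show "measure (sigma_row \<nu> m) UNIV = (\<Sum>j=1..m. levy_mass (\<nu> j))"
    using em by (simp add: measure_def sum_nonneg levy_mass_nonneg)
qed

lemma integral_sigma_row_real:
  fixes f :: "real \<Rightarrow> real"
  assumes m: "\<And>j. 1 \<le> j ==> j \<le> m ==> real_distribution (\<nu> j)"
    and f: "f \<in> borel_measurable borel" "\<And>t. \<bar>f t\<bar> \<le> B"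
  shows "(\<integral>t. f t \<partial>sigma_row \<nu> m) = (\<Sum>j=1..m. \<integral>t. f t \<partial>levy_part (\<nu> j))"
proof -
  let ?h = "\<lambda>t. f t + B"
  have h0: "0 \<le> ?h t" "norm (?h t) \<le> 2 * B" for t using f(2)[of t] by auto
  have hm: "?h \<in> borel_measurable borel" using f(1) by measurable
  have nn: "(\<integral>\<^sup>+t. ennreal (?h t) \<partial>M) = ennreal (\<integral>t. ?h t \<partial>M)" "(\<integral>t. ?h t \<partial>M) = (\<integral>t. f t \<partial>M) + B * measure M UNIV"
    if M: "finite_borel M" for M
  proof -
    interpret finite_borel_measure M by fact
    show "(\<integral>\<^sup>+t. ennreal (?h t) \<partial>M) = ennreal (\<integral>t. ?h t \<partial>M)"
      by (intro nn_integral_eq_integral integrable_bounded_borel[OF M hm h0(2)] AE_I2 h0(1))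
    have fi: "integrable M f" using f by (intro integrable_bounded_borel[OF M]) auto
    then show "(\<integral>t. ?h t \<partial>M) = (\<integral>t. f t \<partial>M) + B * measure M UNIV"
      using finite_borelD(3)[OF M] by simp
  qed
  note S = sigma_row_finite[OF m]
  have L: "finite_borel (levy_part (\<nu> j))" "measure (levy_part (\<nu> j)) UNIV = levy_mass (\<nu> j)"
    if "j \<in> {1..m}" for j using emeasure_levy_part[OF m] that by auto
  have "ennreal (\<integral>t. ?h t \<partial>sigma_row \<nu> m) = (\<integral>\<^sup>+t. ennreal (?h t) \<partial>sigma_row \<nu> m)"
    using nn(1)[OF S(1)] by simp
  also have "... = (\<Sum>j=1..m. \<integral>\<^sup>+t. ennreal (?h t) \<partial>levy_part (\<nu> j))"
    using hm by (intro nn_integral_sigma_row m) auto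
  also have "... = (\<Sum>j=1..m. ennreal (\<integral>t. ?h t \<partial>levy_part (\<nu> j)))"
    by (intro sum.cong refl nn(1) L)
  also have "... = ennreal (\<Sum>j=1..m. \<integral>t. ?h t \<partial>levy_part (\<nu> j))"
    by (rule sum_ennreal) (intro integral_nonneg_AE AE_I2 h0)
  finally have "(\<integral>t. ?h t \<partial>sigma_row \<nu> m) = (\<Sum>j=1..m. \<integral>t. ?h t \<partial>levy_part (\<nu> j))"
    by (subst (asm) ennreal_inj) (intro integral_nonneg_AE AE_I2 h0 sum_nonneg)+
  also have "... = (\<Sum>j=1..m. (\<integral>t. f t \<partial>levy_part (\<nu> j)) + B * levy_mass (\<nu> j))"
    using nn(2)[OF L(1)] L(2) by (intro sum.cong) auto
  also have "... = (\<Sum>j=1..m. \<integral>t. f t \<partial>levy_part (\<nu> j)) + B * (\<Sum>j=1..m. levy_mass (\<nu> j))"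
    by (simp add: sum.distrib sum_distrib_left)
  finally show ?thesis using nn(2)[OF S(1)] S(2) by simp
qed

lemma integral_sigma_row:
  fixes f :: "real \<Rightarrow> complex"
  assumes m: "\<And>j. 1 \<le> j ==> j \<le> m ==> real_distribution (\<nu> j)"
    and f: "f \<in> borel_measurable borel" "\<And>t. cmod (f t) \<le> B"
  shows "(\<integral>t. f t \<partial>sigma_row \<nu> m) = (\<Sum>j=1..m. \<integral>t. f t \<partial>levy_part (\<nu> j))"
proof -
  have fi: "integrable M f" if "finite_borel M" for M
    by (rule integrable_bounded_borel[OF that f])
  have bd: "\<bar>Re (f t)\<bar> \<le> B" "\<bar>Im (f t)\<bar> \<le> B" for t
    using abs_Re_le_cmod[of "f t"] abs_Im_le_cmod[of "f t"] f(2)[of t] by linarith+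
  have rm: "(\<lambda>t. Re (f t)) \<in> borel_measurable borel" "(\<lambda>t. Im (f t)) \<in> borel_measurable borel"
    using f(1) by measurable
  have L: "finite_borel (levy_part (\<nu> j))" if "j \<in> {1..m}" for j
    using emeasure_levy_part[OF m] that by auto
  note S = sigma_row_finite(1)[OF m]
  have "Re (\<integral>t. f t \<partial>sigma_row \<nu> m) = (\<integral>t. Re (f t) \<partial>sigma_row \<nu> m)"
    by (rule integral_Re[OF fi[OF S], symmetric])
  also have "... = (\<Sum>j=1..m. \<integral>t. Re (f t) \<partial>levy_part (\<nu> j))"
    by (rule integral_sigma_row_real[OF m rm(1) bd(1)])
  also have "... = (\<Sum>j=1..m. Re (\<integral>t. f t \<partial>levy_part (\<nu> j)))"
    by (intro sum.cong refl integral_Re fi L)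
  finally have R: "Re (\<integral>t. f t \<partial>sigma_row \<nu> m) = (\<Sum>j=1..m. Re (\<integral>t. f t \<partial>levy_part (\<nu> j)))" .
  have "Im (\<integral>t. f t \<partial>sigma_row \<nu> m) = (\<integral>t. Im (f t) \<partial>sigma_row \<nu> m)"
    by (rule integral_Im[OF fi[OF S], symmetric])
  also have "... = (\<Sum>j=1..m. \<integral>t. Im (f t) \<partial>levy_part (\<nu> j))"
    by (rule integral_sigma_row_real[OF m rm(2) bd(2)])
  also have "... = (\<Sum>j=1..m. Im (\<integral>t. f t \<partial>levy_part (\<nu> j)))"
    by (intro sum.cong refl integral_Im fi L)
  finally have I: "Im (\<integral>t. f t \<partial>sigma_row \<nu> m) = (\<Sum>j=1..m. Im (\<integral>t. f t \<partial>levy_part (\<nu> j)))" .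
  show ?thesis using R I by (simp only: complex_eq_iff Re_sum Im_sum)
qed

lemma nevanlinna_row:
  assumes m: "\<And>j. 1 \<le> j ==> j \<le> m ==> real_distribution (\<nu> j)" and z: "z \<in> uhp"
  shows "nevanlinna (gamma_row c \<nu> m) (sigma_row \<nu> m) z
    = of_real c + (\<Sum>j=1..m. of_real (truncated_mean (\<nu> j)) + levy_nevanlinna (\<nu> j) z)"
proof -
  have "(\<integral>t. (1 + complex_of_real t * z) / (z - of_real t) \<partial>sigma_row \<nu> m)
    = (\<Sum>j=1..m. \<integral>t. (1 + complex_of_real t * z) / (z - of_real t) \<partial>levy_part (\<nu> j))"
    by (rule integral_sigma_row[OF m nevanlinna_kernel_measurable nevanlinna_kernel_bound[OF z]])
  then show ?thesis
    unfolding nevanlinna_integral_def levy_nevanlinna_def gamma_row_def levy_drift_def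
    by (simp add: sum.distrib)
qed

section \<open>Comparison with the Nevanlinna integrals of the rows\<close>

lemma infinitesimal_kappa:
  assumes inf: "infinitesimal_array k \<nu>" and k: "\<And>n. 1 \<le> k n"
    and m: "\<And>n j. 1 \<le> j ==> j \<le> k n ==> real_distribution (\<nu> n j)"
  shows "\<exists>e. e \<longlonglongrightarrow> 0 \<and> (\<forall>n j. 1 \<le> j \<longrightarrow> j \<le> k n \<longrightarrow> kappa (\<nu> n j) 1 \<le> e n)"
proof -
  define e where "e n = Max ((\<lambda>j. kappa (\<nu> n j) 1) ` {1..k n})" for n
  have le: "kappa (\<nu> n j) 1 \<le> e n" if "1 \<le> j" "j \<le> k n" for n j
    unfolding e_def using that by (intro Max_ge) auto
  have "e \<longlonglongrightarrow> 0"
  proof (rule LIMSEQ_I)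
    fix r :: real assume r: "r > 0"
    define M where "M n = Max ((\<lambda>j. measure (\<nu> n j) {t. \<bar>t\<bar> \<ge> r / 3}) ` {1..k n})" for n
    have "M \<longlonglongrightarrow> 0" unfolding M_def[abs_def]
      by (rule inf[unfolded infinitesimal_array_def, rule_format]) (use r in simp)
    then have "eventually (\<lambda>n. M n < r / 3) sequentially" using r by (intro order_tendstoD(2)[of _ 0]) auto
    then obtain N where N: "\<And>n. n \<ge> N ==> M n < r / 3" by (auto simp: eventually_sequentially)
    have "norm (e n - 0) < r" if n: "n \<ge> N" for n
    proof -
      have kap: "kappa (\<nu> n j) 1 \<le> 2 * r / 3 \<and> 0 \<le> kappa (\<nu> n j) 1" if j: "j \<in> {1..k n}" for j
      proof -
        have rd: "real_distribution (\<nu> n j)" using m j by simp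
        interpret real_distribution "\<nu> n j" by (rule rd)
        note fb = real_distributionD(2)[OF rd]
        have "kappa (\<nu> n j) 1 \<le> (\<integral>t. r / 3 + indicat_real {t. \<bar>t\<bar> \<ge> r / 3} t \<partial>\<nu> n j)"
          unfolding kappa_def
        proof (intro integral_mono kappa_integrable[OF fb])
          show "integrable (\<nu> n j) (\<lambda>t. r / 3 + indicat_real {t. \<bar>t\<bar> \<ge> r / 3} t)"
            using r by (intro integrable_bounded_borel[OF fb, where B="r / 3 + 1"]) (auto simp: indicator_def)
          show "min 1 (\<bar>t\<bar> / 1) \<le> r / 3 + indicat_real {t. \<bar>t\<bar> \<ge> r / 3} t" for t
            using r by (auto simp: indicator_def)
        qed simp
        also have "... = r / 3 + measure (\<nu> n j) {t. \<bar>t\<bar> \<ge> r / 3}"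
          by (subst Bochner_Integration.integral_add) (auto simp: real_distributionD(5)[OF rd] emeasure_eq_measure)
        also have "measure (\<nu> n j) {t. \<bar>t\<bar> \<ge> r / 3} \<le> M n"
          unfolding M_def using j by (intro Max_ge) auto
        finally have "kappa (\<nu> n j) 1 \<le> 2 * r / 3" using N[OF n] by simp
        then show ?thesis using kappa_nonneg[of 1 "\<nu> n j"] by simp
      qed
      have ne: "{1..k n} \<noteq> {}" using k[of n] by auto
      have "e n \<le> 2 * r / 3" unfolding e_def using kap ne by (subst Max_le_iff) auto
      moreover have "0 \<le> e n" using le[of 1 n] kap[of 1] k[of n] by fastforce
      ultimately show ?thesis using r by simp
    qed
    then show "\<exists>N. \<forall>n\<ge>N. norm (e n - 0) < r" by blast
  qed
  then show ?thesis using le by blast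
qed

text \<open>The function \<open>\<theta>\<close> stands for the linearising transform of a row, Boolean or free.\<close>
lemma nevanlinna_perturbation_forward:
  assumes X: "\<And>n. finite_borel (X n)" and s: "finite_borel \<sigma>"
    and e: "e \<longlonglongrightarrow> 0"
    and cmp: "eventually (\<lambda>n. cmod (\<theta> n z - nevanlinna (g n) (X n) z)
        \<le> e n * measure (X n) UNIV * cmod z) sequentially"
    and W: "weakly_converges X \<sigma>" and g: "g \<longlonglongrightarrow> \<gamma>" and z: "z \<in> uhp"
  shows "(\<lambda>n. \<theta> n z) \<longlonglongrightarrow> nevanlinna \<gamma> \<sigma> z"
proof -
  have "(\<lambda>n. e n * measure (X n) UNIV * cmod z) \<longlonglongrightarrow> 0 * measure \<sigma> UNIV * cmod z"
    by (intro tendsto_intros e weakly_converges_mass[OF W X s])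
  then have "(\<lambda>n. e n * measure (X n) UNIV * cmod z) \<longlonglongrightarrow> 0" by simp
  with cmp have "(\<lambda>n. \<theta> n z - nevanlinna (g n) (X n) z) \<longlonglongrightarrow> 0" by (rule Lim_null_comparison)
  from tendsto_add[OF this nevanlinna_converges[OF W X s g z]] show ?thesis by simp
qed

text \<open>The error is proportional to the mass, so the mass has to be bounded first: at a point \<open>iy\<close> the
Nevanlinna integral has size at least mass\<open>/y\<close>, and for small \<open>e\<^sub>n\<close> the error is at most half of that.\<close>
lemma nevanlinna_perturbation_backward:
  assumes X: "\<And>n. finite_borel (X n)" and s: "finite_borel \<sigma>"
    and e: "e \<longlonglongrightarrow> 0" and a: "\<alpha> > 0" and b: "\<beta> \<ge> 1"
    and cmp: "eventually (\<lambda>n. \<forall>z\<in>tcone \<alpha> \<beta>. cmod (\<theta> n z - nevanlinna (g n) (X n) z)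
        \<le> e n * measure (X n) UNIV * cmod z) sequentially"
    and lim: "\<And>z. z \<in> tcone \<alpha> \<beta> ==> (\<lambda>n. \<theta> n z) \<longlonglongrightarrow> nevanlinna \<gamma> \<sigma> z"
  shows "weakly_converges X \<sigma>" "g \<longlonglongrightarrow> \<gamma>"
proof -
  define y where "y = \<beta> + 1"
  have y: "y > \<beta>" "y \<ge> 1" "y > 0" using b by (auto simp: y_def)
  let ?z = "Complex 0 y"
  have zc: "?z \<in> tcone \<alpha> \<beta>" by (rule truncated_cone_imaginary[OF a y(1,3)])
  have zu: "?z \<in> uhp" using y by (simp add: uhp_iff)
  have nz: "cmod ?z = y" using y by (simp add: cmod_def)
  have low: "measure (X n) UNIV / y \<le> - Im (nevanlinna (g n) (X n) ?z)" for n
  proof -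
    interpret finite_borel_measure "X n" by (rule X)
    have "measure (X n) UNIV / y = (\<integral>t. 1 / y \<partial>X n)" using finite_borelD(3)[OF X] by simp
    also have "... \<le> (\<integral>t. Im ?z * (1 + t^2) / ((Re ?z - t)^2 + (Im ?z)^2) \<partial>X n)"
    proof (intro integral_mono Im_nevanlinna_integral(2)[OF X zu])
      fix t :: real
      have p: "t^2 + y^2 > 0" using y by (simp add: add_nonneg_pos)
      have "1 * t^2 \<le> y^2 * t^2" using y by (intro mult_right_mono) auto
      then have "t^2 + y^2 \<le> y * (y * (1 + t^2))" by (simp add: power2_eq_square algebra_simps)
      then have "1 / y \<le> y * (1 + t^2) / (t^2 + y^2)" using p y by (simp add: field_simps)
      then show "1 / y \<le> Im ?z * (1 + t^2) / ((Re ?z - t)^2 + (Im ?z)^2)" by simp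
    qed simp
    finally show ?thesis using Im_nevanlinna_integral(1)[OF X zu] by simp
  qed
  define K where "K = cmod (nevanlinna \<gamma> \<sigma> ?z) + 1"
  have "(\<lambda>n. cmod (\<theta> n ?z)) \<longlonglongrightarrow> cmod (nevanlinna \<gamma> \<sigma> ?z)" by (intro tendsto_intros lim zc)
  then have ev1: "eventually (\<lambda>n. cmod (\<theta> n ?z) < K) sequentially"
    by (rule order_tendstoD(2)) (simp add: K_def)
  have ev2: "eventually (\<lambda>n. e n < 1 / (2 * y * y)) sequentially"
    by (rule order_tendstoD(2)[OF e]) (use y in simp)
  have "eventually (\<lambda>n. measure (X n) UNIV \<le> 2 * y * K) sequentially"
    using cmp ev1 ev2
  proof eventually_elim
    case (elim n)
    let ?m = "measure (X n) UNIV"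
    define q where "q = ?m / y"
    have "?m / y \<le> - Im (nevanlinna (g n) (X n) ?z)" by (rule low)
    also have "... \<le> cmod (\<theta> n ?z) + cmod (\<theta> n ?z - nevanlinna (g n) (X n) ?z)"
      using abs_Im_le_cmod[of "nevanlinna (g n) (X n) ?z"]
        norm_triangle_ineq4[of "\<theta> n ?z" "\<theta> n ?z - nevanlinna (g n) (X n) ?z"] by simp
    finally have 1: "?m / y \<le> cmod (\<theta> n ?z) + cmod (\<theta> n ?z - nevanlinna (g n) (X n) ?z)" .
    have 2: "cmod (\<theta> n ?z - nevanlinna (g n) (X n) ?z) \<le> e n * ?m * y"
      using elim(1)[rule_format, OF zc] unfolding nz .
    have "e n * ?m * y \<le> 1 / (2 * y * y) * ?m * y"
      using elim(3) y by (intro mult_right_mono) auto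
    also have "... = q / 2" using y by (simp add: q_def)
    finally have "q \<le> 2 * K" using 1 2 elim(2) unfolding q_def[symmetric] by linarith
    then have "?m / y \<le> 2 * K" by (simp add: q_def)
    then show ?case using y by (simp add: field_simps)
  qed
  from eventually_le_imp_bounded[OF this] obtain B where B: "\<And>n. measure (X n) UNIV \<le> B" by blast
  have lim': "(\<lambda>n. nevanlinna (g n) (X n) z) \<longlonglongrightarrow> nevanlinna \<gamma> \<sigma> z" if z: "z \<in> tcone \<alpha> \<beta>" for z
  proof -
    have "eventually (\<lambda>n. norm (\<theta> n z - nevanlinna (g n) (X n) z) \<le> \<bar>e n\<bar> * B * cmod z) sequentially"
      using cmp
    proof eventually_elim
      case (elim n)
      have "e n * measure (X n) UNIV * cmod z \<le> \<bar>e n\<bar> * B * cmod z"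
        by (intro mult_right_mono mult_mono B) auto
      then show ?case using elim[rule_format, OF z] by linarith
    qed
    moreover have "(\<lambda>n. \<bar>e n\<bar> * B * cmod z) \<longlonglongrightarrow> \<bar>0\<bar> * B * cmod z" by (intro tendsto_intros e)
    then have "(\<lambda>n. \<bar>e n\<bar> * B * cmod z) \<longlonglongrightarrow> 0" by simp
    ultimately have "(\<lambda>n. \<theta> n z - nevanlinna (g n) (X n) z) \<longlonglongrightarrow> 0" by (rule Lim_null_comparison)
    from tendsto_diff[OF lim[OF z] this] show ?thesis by simp
  qed
  have b0: "\<beta> \<ge> 0" using b by simp
  show "weakly_converges X \<sigma>" "g \<longlonglongrightarrow> \<gamma>"
    using nevanlinna_converges_imp[OF X s B a b0 lim'] by auto
qed

section \<open>The Boolean limit theorem\<close>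

text \<open>Infinitesimality in quantitative form; the sequence \<open>e\<close> comes from \<open>infinitesimal_kappa\<close>.\<close>
locale infinitesimal_rows =
  fixes k :: "nat \<Rightarrow> nat" and \<nu> :: "nat \<Rightarrow> nat \<Rightarrow> real measure" and \<gamma> :: real and \<sigma> :: "real measure"
    and c :: "nat \<Rightarrow> real" and e :: "nat \<Rightarrow> real"
  assumes m: "\<And>n j. 1 \<le> j ==> j \<le> k n ==> real_distribution (\<nu> n j)"
    and s: "finite_borel \<sigma>"
    and e: "e \<longlonglongrightarrow> 0" and ke: "\<And>n j. 1 \<le> j ==> j \<le> k n ==> kappa (\<nu> n j) 1 \<le> e n"
begin

abbreviation (input) "row_measure n \<equiv> sigma_row (\<nu> n) (k n)"
abbreviation (input) "row_drift n \<equiv> gamma_row (c n) (\<nu> n) (k n)"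
abbreviation (input) "row_mass n \<equiv> measure (row_measure n) UNIV"

text \<open>Since the error of each entry is proportional to its Levy mass, the errors add up to the mass of
the row.\<close>
lemma row_comparison:
  assumes z: "z \<in> tcone 1 1"
    and t: "\<And>j. 1 \<le> j ==> j \<le> k n ==> cmod (t j - (of_real (truncated_mean (\<nu> n j)) + levy_nevanlinna (\<nu> n j) z))
        \<le> 3000 * kappa (\<nu> n j) 1 * levy_mass (\<nu> n j) * cmod z"
  shows "cmod (of_real (c n) + (\<Sum>j=1..k n. t j)
      - nevanlinna (row_drift n) (row_measure n) z)
    \<le> 3000 * e n * row_mass n * cmod z"
proof -
  have zu: "z \<in> uhp" using z truncated_cone_uhp[of 1 1] by auto
  have N: "nevanlinna (row_drift n) (row_measure n) z
      = of_real (c n) + (\<Sum>j=1..k n. of_real (truncated_mean (\<nu> n j)) + levy_nevanlinna (\<nu> n j) z)"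
    by (rule nevanlinna_row[OF _ zu]) (rule m)
  have mass: "row_mass n = (\<Sum>j=1..k n. levy_mass (\<nu> n j))"
    by (rule sigma_row_finite(2)) (rule m)
  have "of_real (c n) + (\<Sum>j=1..k n. t j) - nevanlinna (row_drift n) (row_measure n) z
    = (\<Sum>j=1..k n. t j - (of_real (truncated_mean (\<nu> n j)) + levy_nevanlinna (\<nu> n j) z))"
    unfolding N by (simp add: sum_subtractf)
  also have "cmod ... \<le> (\<Sum>j=1..k n. 3000 * e n * cmod z * levy_mass (\<nu> n j))"
  proof (rule sum_norm_le)
    fix j assume "j \<in> {1..k n}"
    then have j: "1 \<le> j" "j \<le> k n" by auto
    have "cmod (t j - (of_real (truncated_mean (\<nu> n j)) + levy_nevanlinna (\<nu> n j) z))
        \<le> 3000 * kappa (\<nu> n j) 1 * levy_mass (\<nu> n j) * cmod z" by (rule t[OF j])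
    also have "... \<le> 3000 * e n * levy_mass (\<nu> n j) * cmod z"
      using ke[OF j] levy_mass_nonneg by (intro mult_right_mono) auto
    finally show "cmod (t j - (of_real (truncated_mean (\<nu> n j)) + levy_nevanlinna (\<nu> n j) z))
      \<le> 3000 * e n * cmod z * levy_mass (\<nu> n j)" by (simp add: mult_ac)
  qed
  also have "... = 3000 * e n * cmod z * row_mass n"
    unfolding mass by (simp add: sum_distrib_left)
  finally show ?thesis by (simp add: mult_ac)
qed

lemma row_finite: "finite_borel (row_measure n)"
  by (rule sigma_row_finite(1)) (rule m)

lemma e3000: "(\<lambda>n. 3000 * e n) \<longlonglongrightarrow> 0"
  using tendsto_mult_left[OF e, of 3000] by simp

lemma e_small: "r > 0 ==> eventually (\<lambda>n. e n < r) sequentially"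
  using order_tendstoD(2)[OF e] by blast

lemma boolean_limit_theorem:
  "weakly_converges (\<lambda>n. iterated_convolution boolean_convolution (return borel (c n)) (\<nu> n) (k n)) (boolean_inf_div \<gamma> \<sigma>)
   \<longleftrightarrow> weakly_converges row_measure \<sigma> \<and> row_drift \<longlonglongrightarrow> \<gamma>"
proof -
  let ?X = "\<lambda>n. iterated_convolution boolean_convolution (return borel (c n)) (\<nu> n) (k n)"
  let ?g = "\<lambda>n. row_drift n" and ?s = "\<lambda>n. row_measure n"
  have X: "real_distribution (?X n)" for n using iterated_boolean_convolution[of "k n" "\<nu> n" "c n"] m by blast
  have EX: "E_transform (?X n) z = of_real (c n) + (\<Sum>j=1..k n. E_transform (\<nu> n j) z)" if "z \<in> uhp" for n z
    using iterated_boolean_convolution[of "k n" "\<nu> n" "c n"] m that by blast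
  note M = boolean_inf_div[OF s, where \<gamma>=\<gamma>]
  have cu: "tcone 1 1 \<subseteq> uhp" by (rule truncated_cone_uhp) simp
  have cmp: "eventually (\<lambda>n. \<forall>z\<in>tcone 1 1. cmod (E_transform (?X n) z - nevanlinna (?g n) (?s n) z)
        \<le> (3000 * e n) * measure (?s n) UNIV * cmod z) sequentially"
    using e_small[of "1 / 32"]
  proof (rule eventually_mono)
    fix n assume en: "e n < 1 / 32"
    show "\<forall>z\<in>tcone 1 1. cmod (E_transform (?X n) z - nevanlinna (?g n) (?s n) z)
        \<le> (3000 * e n) * measure (?s n) UNIV * cmod z"
    proof
      fix z assume z: "z \<in> tcone 1 1"
      then have zu: "z \<in> uhp" using cu by blast
      have "cmod (E_transform (\<nu> n j) z - (of_real (truncated_mean (\<nu> n j)) + levy_nevanlinna (\<nu> n j) z))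
          \<le> 3000 * kappa (\<nu> n j) 1 * levy_mass (\<nu> n j) * cmod z" if "1 \<le> j" "j \<le> k n" for j
        using ke[OF that] en by (intro E_transform_levy[OF m[OF that] _ z]) simp
      from row_comparison[OF z this]
      show "cmod (E_transform (?X n) z - nevanlinna (?g n) (?s n) z)
        \<le> (3000 * e n) * measure (?s n) UNIV * cmod z"
        unfolding EX[OF zu] .
    qed
  qed simp
  show ?thesis
  proof
    assume W: "weakly_converges ?X (boolean_inf_div \<gamma> \<sigma>)"
    have lim: "(\<lambda>n. E_transform (?X n) z) \<longlonglongrightarrow> nevanlinna \<gamma> \<sigma> z" if "z \<in> tcone 1 1" for z
    proof -
      have "z \<in> uhp" using that cu by blast
      from weakly_converges_E_transform[OF X M(1) W this] show ?thesis unfolding M(2)[OF \<open>z \<in> uhp\<close>] .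
    qed
    show "weakly_converges ?s \<sigma> \<and> ?g \<longlonglongrightarrow> \<gamma>"
      using nevanlinna_perturbation_backward[OF row_finite s e3000 zero_less_one order_refl cmp lim] by auto
  next
    assume *: "weakly_converges ?s \<sigma> \<and> ?g \<longlonglongrightarrow> \<gamma>"
    show "weakly_converges ?X (boolean_inf_div \<gamma> \<sigma>)"
    proof (rule weakly_converges_of_E_cone[OF X M(1), of 1 1])
      fix z assume z: "z \<in> tcone 1 1"
      then have zu: "z \<in> uhp" using cu by blast
      have "eventually (\<lambda>n. cmod (E_transform (?X n) z - nevanlinna (?g n) (?s n) z)
        \<le> (3000 * e n) * measure (?s n) UNIV * cmod z) sequentially"
        by (rule eventually_mono[OF cmp]) (use z in blast)
      from nevanlinna_perturbation_forward[where X="?s" and g="?g" and \<theta>="\<lambda>n z. E_transform (?X n) z",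
          OF row_finite s e3000 this conjunct1[OF *] conjunct2[OF *] zu]
      show "(\<lambda>n. E_transform (?X n) z) \<longlonglongrightarrow> E_transform (boolean_inf_div \<gamma> \<sigma>) z"
        unfolding M(2)[OF zu] .
    qed auto
  qed
qed

end

section \<open>The free limit theorem\<close>

context infinitesimal_rows
begin

text \<open>All inverses of a row exist on the same cone because \<open>kappa\<close> is uniformly small in the row.\<close>
lemma row_voiculescu:
  assumes en: "e n < 1 / 10000" and j: "1 \<le> j" "j \<le> k n"
  shows "\<exists>\<phi>. voiculescu_on (tcone 1 1) (\<nu> n j) \<phi> \<and>
    (\<forall>z\<in>tcone 1 1. cmod (\<phi> z - (of_real (truncated_mean (\<nu> n j)) + levy_nevanlinna (\<nu> n j) z))
        \<le> 3000 * kappa (\<nu> n j) 1 * levy_mass (\<nu> n j) * cmod z)"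
proof -
  let ?\<mu> = "\<nu> n j"
  have m': "real_distribution ?\<mu>" by (rule m[OF j])
  have k1: "kappa ?\<mu> 1 < 1 / 10000" using ke[OF j] en by linarith
  \<comment> \<open>\<open>104 / 5000 < 1 / 32\<close>, where 104 is the constant in \<open>E_transform_cone_small\<close>.\<close>
  have k2: "kappa ?\<mu> (1 / 2) \<le> 1 / 5000"
    using kappa_half[OF real_distributionD(2)[OF m']] k1 by linarith
  have sm: "cone_small (E_transform ?\<mu>) (1 / 2) (1 / 32)"
    by (rule cone_small_mono[OF E_transform_cone_small[OF m', of "1 / 2"]]) (use k2 in auto)
  then have "cone_small (E_transform ?\<mu>) (1 / 2) (1 / 16)" by (rule cone_small_mono) auto
  from F_inverse_exists[OF m' _ this] obtain g where g: "is_F_inverse_on (tcone 1 1) ?\<mu> g"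
    "\<And>z. z \<in> tcone 1 1 ==> cmod (g z - z) \<le> cmod z / 8" by auto
  have "cmod (g z - z - (of_real (truncated_mean ?\<mu>) + levy_nevanlinna ?\<mu> z))
        \<le> 3000 * kappa ?\<mu> 1 * levy_mass ?\<mu> * cmod z" if z: "z \<in> tcone 1 1" for z
  proof (rule voiculescu_levy[OF m' _ z])
    show "kappa ?\<mu> 1 \<le> 1 / 32" using k1 by simp
    show F: "F_transform ?\<mu> (g z) = z" using g(1) z by (simp add: is_F_inverse_on_def)
    have z': "z \<in> tcone 1 (2 * (1 / 2))" using z by simp
    note c = near_cone[OF z' _ g(2)[OF z], simplified]
    have "g z - z = E_transform ?\<mu> (g z)" using F by (simp add: E_transform_def)
    then have "cmod (g z - z) \<le> 1 / 32 * cmod (g z)" using sm c(1) by (simp add: cone_small_def)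
    then show "cmod (g z - z) \<le> cmod z / 16" using c(2) norm_ge_zero[of z] by linarith
  qed
  moreover have "voiculescu_on (tcone 1 1) ?\<mu> (\<lambda>z. g z - z)"
    using g(1) by (simp add: voiculescu_iff)
  ultimately show ?thesis by (intro exI[of _ "\<lambda>z. g z - z"]) blast
qed

abbreviation (input) "free_row n \<equiv> iterated_convolution free_convolution (return borel (c n)) (\<nu> n) (k n)"

text \<open>The Voiculescu transform of the convolution is the sum of those of the entries only as a germ at
infinity, but the sum is holomorphic on a fixed cone.\<close>
lemma free_row_transform:
  assumes en: "e n < 1 / 10000"
  shows "\<exists>\<theta>. voiculescu_germ (free_row n) \<theta> \<and> \<theta> holomorphic_on tcone 1 1 \<and>
    (\<forall>z\<in>tcone 1 1. cmod (\<theta> z - nevanlinna (row_drift n) (row_measure n) z)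
        \<le> 3000 * e n * row_mass n * cmod z)"
proof -
  have "\<forall>j\<in>{1..k n}. \<exists>\<phi>. voiculescu_on (tcone 1 1) (\<nu> n j) \<phi> \<and>
    (\<forall>z\<in>tcone 1 1. cmod (\<phi> z - (of_real (truncated_mean (\<nu> n j)) + levy_nevanlinna (\<nu> n j) z))
        \<le> 3000 * kappa (\<nu> n j) 1 * levy_mass (\<nu> n j) * cmod z)"
    using row_voiculescu[OF en] by simp
  from bchoice[OF this] obtain \<phi> where \<phi>:
    "\<forall>j\<in>{1..k n}. voiculescu_on (tcone 1 1) (\<nu> n j) (\<phi> j) \<and>
    (\<forall>z\<in>tcone 1 1. cmod (\<phi> j z - (of_real (truncated_mean (\<nu> n j)) + levy_nevanlinna (\<nu> n j) z))
        \<le> 3000 * kappa (\<nu> n j) 1 * levy_mass (\<nu> n j) * cmod z)" ..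
  have V: "voiculescu_on (tcone 1 1) (\<nu> n j) (\<phi> j)" if "1 \<le> j" "j \<le> k n" for j
    using \<phi> that by simp
  have Vg: "voiculescu_germ (\<nu> n j) (\<phi> j)" if "1 \<le> j" "j \<le> k n" for j
    unfolding voiculescu_germ_def by (intro exI[of _ 1] conjI V that) auto
  have hol: "\<phi> j holomorphic_on tcone 1 1" if j: "j \<in> {1..k n}" for j
  proof -
    have "(\<lambda>z. z + \<phi> j z) holomorphic_on tcone 1 1"
      using V[of j] j by (simp add: voiculescu_iff is_F_inverse_on_def)
    from holomorphic_on_diff[OF this holomorphic_on_ident] show ?thesis by simp
  qed
  let ?\<theta> = "\<lambda>z. of_real (c n) + (\<Sum>j=1..k n. \<phi> j z)"
  have "voiculescu_germ (free_row n) ?\<theta>"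
    by (rule iterated_free_convolution(2)[OF m Vg])
  moreover have "?\<theta> holomorphic_on tcone 1 1"
    by (intro holomorphic_intros hol)
  moreover have "cmod (?\<theta> z - nevanlinna (row_drift n) (row_measure n) z)
        \<le> 3000 * e n * row_mass n * cmod z" if z: "z \<in> tcone 1 1" for z
    by (rule row_comparison[OF z]) (use \<phi> z in simp)
  ultimately show ?thesis by blast
qed

text \<open>Both directions use analytic continuation to replace the cone of the germ, which may
depend on \<open>n\<close>, by a fixed one: in the first from the inverses given by weak convergence,
in the second for the identity \<open>F(z + \<theta>\<^sub>n(z)) = z\<close>.\<close>
lemma free_limit_theorem:
  "weakly_converges free_row (free_inf_div \<gamma> \<sigma>)
   \<longleftrightarrow> weakly_converges row_measure \<sigma> \<and> row_drift \<longlonglongrightarrow> \<gamma>"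
proof -
  let ?g = "\<lambda>n. row_drift n" and ?s = "\<lambda>n. row_measure n"
  let ?N = "nevanlinna \<gamma> \<sigma>" and ?C = "tcone 1 1"
  have X: "real_distribution (free_row n)" for n by (rule iterated_free_convolution(1)) (rule m)
  have M: "real_distribution (free_inf_div \<gamma> \<sigma>)" by (rule free_inf_div(1)[OF s])
  obtain \<beta> where b: "\<beta> > 0" "voiculescu_on (tcone (1 / 2) \<beta>) (free_inf_div \<gamma> \<sigma>) ?N"
    using free_inf_div(2)[OF s] by blast
  have "eventually (\<lambda>n. e n < 1 / 10000) sequentially" by (rule e_small) simp
  then obtain n0 where n0: "\<And>n. n \<ge> n0 ==> e n < 1 / 10000" by (auto simp: eventually_sequentially)
  have "\<forall>n\<in>{n0..}. \<exists>\<theta>. voiculescu_germ (free_row n) \<theta> \<and> \<theta> holomorphic_on ?C \<and>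
    (\<forall>z\<in>?C. cmod (\<theta> z - nevanlinna (?g n) (?s n) z) \<le> 3000 * e n * measure (?s n) UNIV * cmod z)"
    using free_row_transform n0 by simp
  from bchoice[OF this] obtain \<theta> where \<theta>:
    "\<forall>n\<in>{n0..}. voiculescu_germ (free_row n) (\<theta> n) \<and> \<theta> n holomorphic_on ?C \<and>
    (\<forall>z\<in>?C. cmod (\<theta> n z - nevanlinna (?g n) (?s n) z) \<le> 3000 * e n * measure (?s n) UNIV * cmod z)" ..
  have \<theta>1: "voiculescu_germ (free_row n) (\<theta> n)" "\<theta> n holomorphic_on ?C" if "n \<ge> n0" for n
    using \<theta> that by simp_all
  have \<theta>2: "cmod (\<theta> n z - nevanlinna (?g n) (?s n) z) \<le> 3000 * e n * measure (?s n) UNIV * cmod z"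
    if "n \<ge> n0" "z \<in> ?C" for n z
    using \<theta> that by simp
  show ?thesis
  proof
    assume W: "weakly_converges free_row (free_inf_div \<gamma> \<sigma>)"
    from F_inverses_of_weakly_converges[OF X M b W, of 1]
    obtain B N g where B: "B \<ge> max \<beta> 1" "\<forall>n\<ge>N. is_F_inverse_on (tcone 1 B) (free_row n) (g n)"
      "\<forall>z\<in>tcone (1 / 2) B. (\<lambda>n. g n z - z) \<longlonglongrightarrow> ?N z"
      by blast
    have B1: "B \<ge> 1" "B > 0" using B(1) by auto
    have CB: "tcone 1 B \<subseteq> ?C" using B1 by (intro truncated_cone_mono) auto
    have HB: "tcone (1 / 2) B \<subseteq> tcone 1 B" using B1 by (intro truncated_cone_mono) auto
    have eq: "g n z - z = \<theta> n z" if n: "n \<ge> max n0 N" and z: "z \<in> tcone 1 B" for n z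
    proof -
      have gi: "is_F_inverse_on (tcone 1 B) (free_row n) (g n)" using B(2) n by simp
      have gv: "voiculescu_germ (free_row n) (\<lambda>z. g n z - z)"
        unfolding voiculescu_germ_def voiculescu_iff using gi B1
        by (intro exI[of _ 1] conjI exI[of _ B]) auto
      have \<theta>n: "voiculescu_germ (free_row n) (\<theta> n)" "\<theta> n holomorphic_on ?C" using \<theta>1 n by simp_all
      obtain a b where ab: "a > 0" "b > 0" "\<forall>z\<in>tcone a b. g n z - z = \<theta> n z"
        using voiculescu_germ_unique[OF X gv \<theta>n(1)] by blast
      obtain a' b' where ab': "a' > 0" "tcone a' b' \<subseteq> tcone a b" "tcone a' b' \<subseteq> tcone 1 B"
        using cone_common[OF ab(1,2) zero_less_one B1(2)] by blast
      have hg: "(\<lambda>z. g n z - z) holomorphic_on tcone 1 B"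
        using gi by (intro holomorphic_intros) (simp add: is_F_inverse_on_def)
      have h\<theta>: "\<theta> n holomorphic_on tcone 1 B" by (rule holomorphic_on_subset[OF \<theta>n(2) CB])
      have eq': "g n x - x = \<theta> n x" if "x \<in> tcone a' b'" for x using that ab ab' by blast
      show ?thesis
        by (rule analytic_continuation_open[OF open_truncated_cone open_truncated_cone truncated_cone_nonempty[OF ab'(1)]
            connected_truncated_cone ab'(3) hg h\<theta> eq' z])
    qed
    have lim: "(\<lambda>n. \<theta> n z) \<longlonglongrightarrow> ?N z" if z: "z \<in> tcone (1 / 2) B" for z
    proof -
      have "eventually (\<lambda>n. g n z - z = \<theta> n z) sequentially"
        unfolding eventually_sequentially using eq HB z by blast
      then show ?thesis using B(3) z by (blast intro: Lim_transform_eventually)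
    qed
    have half: "(1 / 2 :: real) > 0" by simp
    have cmp: "eventually (\<lambda>n. \<forall>z\<in>tcone (1 / 2) B. cmod (\<theta> n z - nevanlinna (?g n) (?s n) z)
        \<le> (3000 * e n) * measure (?s n) UNIV * cmod z) sequentially"
      unfolding eventually_sequentially using \<theta>2 HB CB by (intro exI[of _ n0]) blast
    show "weakly_converges ?s \<sigma> \<and> ?g \<longlonglongrightarrow> \<gamma>"
      using nevanlinna_perturbation_backward[where X="?s" and g="?g" and \<theta>=\<theta>,
          OF row_finite s e3000 half B1(1) cmp lim] by blast
  next
    assume *: "weakly_converges ?s \<sigma> \<and> ?g \<longlonglongrightarrow> \<gamma>"
    note W = conjunct1[OF *] and G = conjunct2[OF *]
    obtain \<beta>1 where b1: "\<beta>1 \<ge> 1" "\<bar>\<gamma>\<bar> / \<beta>1 + measure \<sigma> UNIV / \<beta>1\<^sup>2 + 16 * kappa \<sigma> \<beta>1 \<le> 1 / 64"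
      using nevanlinna_const_small[OF s, of "1 / 64"] by auto
    have bp: "\<beta>1 > 0" using b1 by linarith
    have mass: "(\<lambda>n. measure (?s n) UNIV) \<longlonglongrightarrow> measure \<sigma> UNIV"
      by (rule weakly_converges_mass[OF W row_finite s])
    have kap: "(\<lambda>n. kappa (?s n) \<beta>1) \<longlonglongrightarrow> kappa \<sigma> \<beta>1" by (rule weakly_converges_kappa[OF W bp])
    have "(\<lambda>n. \<bar>?g n\<bar> / \<beta>1 + measure (?s n) UNIV / \<beta>1\<^sup>2 + 16 * kappa (?s n) \<beta>1)
       \<longlonglongrightarrow> \<bar>\<gamma>\<bar> / \<beta>1 + measure \<sigma> UNIV / \<beta>1\<^sup>2 + 16 * kappa \<sigma> \<beta>1"
      using bp by (intro tendsto_intros G mass kap) auto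
    then have ev1: "eventually (\<lambda>n. \<bar>?g n\<bar> / \<beta>1 + measure (?s n) UNIV / \<beta>1\<^sup>2 + 16 * kappa (?s n) \<beta>1 < 1 / 32) sequentially"
      by (rule order_tendstoD(2)) (use b1(2) in linarith)
    have "(\<lambda>n. 3000 * e n * measure (?s n) UNIV) \<longlonglongrightarrow> 0 * measure \<sigma> UNIV"
      by (intro tendsto_mult e3000 mass)
    then have ev2: "eventually (\<lambda>n. 3000 * e n * measure (?s n) UNIV < 1 / 32) sequentially"
      by (rule order_tendstoD(2)) simp
    have C1: "tcone 1 \<beta>1 \<subseteq> ?C" "tcone 1 \<beta>1 \<subseteq> tcone 2 \<beta>1"
      by (rule truncated_cone_mono; use b1 in simp)+
    have inv: "eventually (\<lambda>n. \<forall>z\<in>tcone 1 \<beta>1. Im (z + \<theta> n z) > 0 \<and> F_transform (free_row n) (z + \<theta> n z) = z) sequentially"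
      using ev1 ev2 eventually_ge_at_top[of n0]
    proof eventually_elim
      case (elim n)
      have sm: "cone_small (nevanlinna (?g n) (?s n)) \<beta>1 (1 / 32)"
        by (rule cone_small_mono[OF nevanlinna_cone_small[OF row_finite bp] _ order_refl])
           (use bp elim(1) in auto)
      have u: "z + \<theta> n z \<in> uhp" if z: "z \<in> tcone 1 \<beta>1" for z
      proof -
        have "cmod (\<theta> n z - nevanlinna (?g n) (?s n) z) \<le> 3000 * e n * measure (?s n) UNIV * cmod z"
          using \<theta>2[OF elim(3)] z C1(1) by blast
        also have "... \<le> 1 / 32 * cmod z" using elim(2) by (intro mult_right_mono) auto
        finally have 1: "cmod (\<theta> n z - nevanlinna (?g n) (?s n) z) \<le> 1 / 32 * cmod z" .
        have 2: "cmod (nevanlinna (?g n) (?s n) z) \<le> 1 / 32 * cmod z"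
          using sm z C1(2) unfolding cone_small_def by blast
        have "cmod (\<theta> n z) \<le> cmod (\<theta> n z - nevanlinna (?g n) (?s n) z) + cmod (nevanlinna (?g n) (?s n) z)"
          using norm_triangle_ineq[of "\<theta> n z - nevanlinna (?g n) (?s n) z"] by (metis diff_add_cancel)
        then have "cmod (\<theta> n z) \<le> cmod z / 8" using 1 2 norm_ge_zero[of z] by linarith
        then have "cmod (z + \<theta> n z - z) \<le> cmod z / 8" by simp
        from near_cone(1)[of z "\<beta>1 / 2", OF _ _ this] have "z + \<theta> n z \<in> tcone 2 (\<beta>1 / 2)"
          using z bp by simp
        then show ?thesis using truncated_cone_uhp[of "\<beta>1 / 2" 2] bp by auto
      qed
      have \<theta>n: "voiculescu_germ (free_row n) (\<theta> n)" "\<theta> n holomorphic_on ?C" using \<theta>1[OF elim(3)] .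
      obtain a b where ab: "a > 0" "b > 0" "is_F_inverse_on (tcone a b) (free_row n) (\<lambda>z. z + \<theta> n z)"
        using \<theta>n(1) unfolding voiculescu_germ_def voiculescu_iff by blast
      obtain a' b' where ab': "a' > 0" "tcone a' b' \<subseteq> tcone a b" "tcone a' b' \<subseteq> tcone 1 \<beta>1"
        using cone_common[OF ab(1,2) zero_less_one bp] by blast
      have hw: "(\<lambda>z. z + \<theta> n z) holomorphic_on tcone 1 \<beta>1"
        by (intro holomorphic_intros holomorphic_on_subset[OF \<theta>n(2) C1(1)])
      have "(F_transform (free_row n) \<circ> (\<lambda>z. z + \<theta> n z)) holomorphic_on tcone 1 \<beta>1"
        using u by (intro holomorphic_on_compose hw holomorphic_on_subset[OF F_transform_holomorphic[OF X]]) auto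
      then have hF: "(\<lambda>z. F_transform (free_row n) (z + \<theta> n z)) holomorphic_on tcone 1 \<beta>1" by (simp add: o_def)
      have hid: "(\<lambda>z. z) holomorphic_on tcone 1 \<beta>1" by (intro holomorphic_intros)
      have eq': "F_transform (free_row n) (x + \<theta> n x) = x" if "x \<in> tcone a' b'" for x
      proof -
        have "x \<in> tcone a b" using that ab'(2) by blast
        then show ?thesis using ab(3) by (simp add: is_F_inverse_on_def)
      qed
      show ?case
      proof (intro ballI conjI)
        fix z assume z: "z \<in> tcone 1 \<beta>1"
        show "Im (z + \<theta> n z) > 0" using u[OF z] by (simp add: uhp_iff)
        show "F_transform (free_row n) (z + \<theta> n z) = z"
          by (rule analytic_continuation_open[OF open_truncated_cone open_truncated_cone truncated_cone_nonempty[OF ab'(1)]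
              connected_truncated_cone ab'(3) hF hid eq' z])
      qed
    qed
    define \<beta>' where "\<beta>' = max \<beta> \<beta>1"
    have b': "\<beta>' > 0" "\<beta>' \<ge> \<beta>" "\<beta>' \<ge> \<beta>1" using bp by (auto simp: \<beta>'_def)
    have H1: "tcone (1 / 2) \<beta>' \<subseteq> tcone 1 \<beta>1" using b' bp by (intro truncated_cone_mono) auto
    have H2: "tcone (1 / 2) \<beta>' \<subseteq> tcone (1 / 2) \<beta>" using b' b(1) by (intro truncated_cone_mono) auto
    show "weakly_converges free_row (free_inf_div \<gamma> \<sigma>)"
    proof (rule weakly_converges_of_F_inverses[OF X M b'(1) voiculescu_restrict[OF b(2) H2]])
      fix z assume z: "z \<in> tcone (1 / 2) \<beta>'"
      have zC: "z \<in> ?C" "z \<in> tcone 1 \<beta>1" using z H1 C1 by blast+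
      have zu: "z \<in> uhp" using zC(1) truncated_cone_uhp[of 1 1] by auto
      have cmp: "eventually (\<lambda>n. cmod (\<theta> n z - nevanlinna (?g n) (?s n) z)
        \<le> (3000 * e n) * measure (?s n) UNIV * cmod z) sequentially"
        unfolding eventually_sequentially using \<theta>2 zC(1) by (intro exI[of _ n0]) blast
      show "(\<lambda>n. \<theta> n z) \<longlonglongrightarrow> ?N z"
        by (rule nevanlinna_perturbation_forward[where X="?s" and g="?g" and \<theta>=\<theta>, OF row_finite s e3000 cmp W G zu])
      show "eventually (\<lambda>n. Im (z + \<theta> n z) > 0 \<and> F_transform (free_row n) (z + \<theta> n z) = z) sequentially"
        by (rule eventually_mono[OF inv]) (use zC(2) in blast)
    qed
  qed
qed

end

section \<open>Characteristic functions of convolutions\<close>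

lemma norm_iexp [simp]: "cmod (iexp x) = 1"
  by simp

lemma iexp_measurable: "(\<lambda>x. iexp (t * x)) \<in> borel_measurable borel"
  by (intro borel_measurable_continuous_onI continuous_intros)

lemma convolution_real_distribution:
  assumes "real_distribution \<mu>" "real_distribution \<nu>"
  shows "real_distribution (convolution \<mu> \<nu>)"
    "char (convolution \<mu> \<nu>) t = char \<mu> t * char \<nu> t"
proof -
  interpret M: real_distribution \<mu> by fact
  interpret N: real_distribution \<nu> by fact
  interpret P: pair_prob_space \<mu> \<nu> ..
  have add: "(\<lambda>(x, y). x + y) \<in> borel_measurable (\<mu> \<Otimes>\<^sub>M \<nu>)"
    by measurable
  show "real_distribution (convolution \<mu> \<nu>)"
    unfolding convolution_def real_distribution_def real_distribution_axioms_def
    using P.prob_space_distr[OF add] by simp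
  have b: "(\<lambda>p. iexp (t * (case p of (x, y) \<Rightarrow> x + y))) \<in> borel_measurable (\<mu> \<Otimes>\<^sub>M \<nu>)"
    by (rule measurable_compose[OF add iexp_measurable])
  have int: "integrable (\<mu> \<Otimes>\<^sub>M \<nu>) (\<lambda>p. iexp (t * (case p of (x, y) \<Rightarrow> x + y)))"
    by (rule P.integrable_const_bound[of _ 1, OF _ b]) simp
  have "char (convolution \<mu> \<nu>) t = (\<integral>p. iexp (t * (case p of (x, y) \<Rightarrow> x + y)) \<partial>(\<mu> \<Otimes>\<^sub>M \<nu>))"
    unfolding char_def convolution_def by (rule integral_distr[OF add iexp_measurable])
  also have "... = (\<integral>x. \<integral>y. iexp (t * (case (x, y) of (x, y) \<Rightarrow> x + y)) \<partial>\<nu> \<partial>\<mu>)"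
    by (rule P.integral_fst'[OF int, symmetric])
  also have "... = (\<integral>x. \<integral>y. iexp (t * x) * iexp (t * y) \<partial>\<nu> \<partial>\<mu>)"
    by (simp add: distrib_left exp_add)
  also have "... = char \<mu> t * char \<nu> t"
    by (simp add: char_def)
  finally show "char (convolution \<mu> \<nu>) t = char \<mu> t * char \<nu> t" .
qed

lemma char_return: "char (return borel c) t = iexp (t * c)"
  unfolding char_def by (rule integral_return) (auto simp: iexp_measurable)

lemma iterated_classical_convolution:
  assumes "\<And>j. 1 \<le> j ==> j \<le> m ==> real_distribution (\<nu> j)"
  shows "real_distribution (iterated_convolution convolution (return borel c) \<nu> m) \<and>
    char (iterated_convolution convolution (return borel c) \<nu> m) t = iexp (t * c) * (\<Prod>j=1..m. char (\<nu> j) t)"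
  using assms
proof (induction m)
  case 0
  then show ?case by (simp add: iterated_convolution_0 real_distribution_return char_return)
next
  case (Suc m)
  then have IH: "real_distribution (iterated_convolution convolution (return borel c) \<nu> m)"
    "char (iterated_convolution convolution (return borel c) \<nu> m) t = iexp (t * c) * (\<Prod>j=1..m. char (\<nu> j) t)"
    by auto
  have "real_distribution (\<nu> (Suc m))" using Suc.prems by simp
  from convolution_real_distribution[OF IH(1) this] IH(2) show ?case
    by (simp add: iterated_convolution_Suc mult.assoc)
qed

section \<open>The kernel of the Levy-Khintchine formula\<close>

abbreviation (input) "lk_kernel \<equiv> levy_khintchine_kernel"

lemma lk_kernel_eq:
  assumes "x \<noteq> 0"
  shows "lk_kernel t x
    = (iexp (t * x) - 1 - \<i> * of_real (t * x)) * of_real ((1 + x^2) / x^2) + \<i> * of_real (t * x)"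
proof -
  have p: "1 + x^2 \<noteq> 0" by (metis add_pos_nonneg less_irrefl zero_le_power2 zero_less_one)
  have "(t * x) / (1 + x^2) = t * x - (t * x) * (x^2 / (1 + x^2))" using p by (simp add: field_simps)
  then have "\<i> * of_real (t * x) / of_real (1 + x^2)
     = \<i> * complex_of_real (t * x) - \<i> * of_real (t * x) * of_real (x^2 / (1 + x^2))"
    by (metis of_real_diff of_real_divide of_real_mult mult.assoc right_diff_distrib times_divide_eq_right)
  moreover have "complex_of_real (x^2 / (1 + x^2)) * of_real ((1 + x^2) / x^2) = 1"
    unfolding of_real_mult[symmetric] using p assms by simp
  moreover have "q * P = 1 ==> (A - (u - u * q)) * P = (A - u) * P + u" for A u q P :: complex
    by algebra
  ultimately show ?thesis using assms by (simp only: levy_khintchine_kernel_def if_False)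
qed

lemma lk_kernel_bound: "cmod (lk_kernel t x) \<le> 4 + \<bar>t\<bar> + t^2"
proof (cases "x = 0")
  case True
  have "cmod (lk_kernel t x) = t^2 / 2"
    using True by (simp add: levy_khintchine_kernel_def norm_divide norm_power)
  then show ?thesis by (simp add: add_nonneg_nonneg) (smt (verit) abs_ge_zero zero_le_power2)
next
  case False
  have x2: "x^2 > 0" using False by simp
  show ?thesis
  proof (cases "\<bar>x\<bar> \<le> 1")
    case True
    have "(1 + x^2) / x^2 \<le> 2 / x^2" using True x2 by (intro divide_right_mono) (auto simp: abs_square_le_1)
    moreover have "cmod (iexp (t * x) - 1 - \<i> * of_real (t * x)) \<le> (t * x)^2 / 2"
      using iexp_approx1[of "t * x" 1] by (simp add: numeral_2_eq_2 algebra_simps)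
    ultimately have "cmod (iexp (t * x) - 1 - \<i> * of_real (t * x)) * ((1 + x^2) / x^2) \<le> (t * x)^2 / 2 * (2 / x^2)"
      using x2 by (intro mult_mono) auto
    also have "... = t^2" using x2 by (simp add: power_mult_distrib)
    finally have 1: "cmod ((iexp (t * x) - 1 - \<i> * of_real (t * x)) * of_real ((1 + x^2) / x^2)) \<le> t^2"
      unfolding norm_mult norm_of_real using x2 by (simp add: abs_of_pos)
    have "\<bar>t\<bar> * \<bar>x\<bar> \<le> \<bar>t\<bar> * 1" using True by (intro mult_left_mono) auto
    then have 2: "cmod (\<i> * of_real (t * x)) \<le> \<bar>t\<bar>" by (simp add: norm_mult abs_mult)
    show ?thesis unfolding lk_kernel_eq[OF False]
      using norm_triangle_mono[OF 1 2] by linarith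
  next
    case big: False
    then have x1: "x^2 \<ge> 1" using abs_le_square_iff[of 1 x] by simp
    have r: "(1 + x^2) / x^2 \<le> 2" using x1 x2 by (simp add: pos_divide_le_eq)
    have "\<bar>t * x\<bar> / (1 + x^2) * ((1 + x^2) / x^2) = \<bar>t\<bar> * (\<bar>x\<bar> / x^2)"
    proof -
      have "1 + x^2 \<noteq> 0" using x2 by linarith
      then show ?thesis by (simp add: abs_mult)
    qed
    also have "... \<le> \<bar>t\<bar> * 1"
    proof (rule mult_left_mono)
      have "\<bar>x\<bar> * 1 \<le> \<bar>x\<bar> * \<bar>x\<bar>" using big by (intro mult_left_mono) auto
      then show "\<bar>x\<bar> / x^2 \<le> 1" using x2 by (simp add: pos_divide_le_eq power2_eq_square)
    qed simp
    finally have a: "\<bar>t * x\<bar> / (1 + x^2) * ((1 + x^2) / x^2) \<le> \<bar>t\<bar>"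
      unfolding mult_1_right .
    have "cmod (lk_kernel t x)
      = cmod ((iexp (t * x) - 1) - \<i> * of_real (t * x) / of_real (1 + x^2)) * ((1 + x^2) / x^2)"
      using False x2 by (simp add: levy_khintchine_kernel_def norm_mult abs_of_pos del: of_real_divide)
    also have "... \<le> (cmod (iexp (t * x) - 1) + cmod (\<i> * of_real (t * x) / of_real (1 + x^2))) * ((1 + x^2) / x^2)"
      using x2 by (intro mult_right_mono norm_triangle_ineq4) auto
    also have "... \<le> 2 * ((1 + x^2) / x^2) + \<bar>t * x\<bar> / (1 + x^2) * ((1 + x^2) / x^2)"
    proof -
      have i: "cmod (iexp (t * x) - 1) \<le> 2" using norm_triangle_ineq4[of "iexp (t * x)" 1] by simp
      have j: "cmod (\<i> * of_real (t * x) / of_real (1 + x^2)) = \<bar>t * x\<bar> / (1 + x^2)"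
        unfolding norm_divide norm_mult norm_of_real using x2 by simp
      show ?thesis unfolding j distrib_right[symmetric] using i x2 by (intro mult_right_mono add_right_mono) auto
    qed
    also have "... \<le> 2 * 2 + \<bar>t\<bar>" by (rule add_mono[OF mult_left_mono[OF r] a]) simp
    finally show ?thesis using zero_le_power2[of t] by linarith
  qed
qed

text \<open>At \<open>x = 0\<close> the third order Taylor estimate of the exponential compensates the factor \<open>1/x\<^sup>2\<close>.\<close>
lemma lk_kernel_continuous: "continuous_on UNIV (lk_kernel t)"
proof -
  have "isCont (lk_kernel t) x" for x
  proof (cases "x = 0")
    case False
    let ?f = "\<lambda>x. (iexp (t * x) - 1 - \<i> * of_real (t * x) / of_real (1 + x^2)) * complex_of_real ((1 + x^2) / x^2)"
    have "complex_of_real (1 + x^2) \<noteq> 0" unfolding of_real_eq_0_iff by (metis add_pos_nonneg less_irrefl zero_le_power2 zero_less_one)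
    then have c: "isCont ?f x" using False by (intro continuous_intros) auto
    have ev: "eventually (\<lambda>y. lk_kernel t y = ?f y) (nhds x)"
      using t1_space_nhds[OF False] by eventually_elim (simp add: levy_khintchine_kernel_def)
    show ?thesis by (rule isCont_cong[OF ev, THEN iffD2, OF c])
  next
    case True
    define b where "b x = \<bar>t\<bar> ^ 3 * \<bar>x\<bar> / 6 * (1 + x^2) + t^2 * x^2 / 2 + \<bar>t\<bar> * \<bar>x\<bar>" for x
    have bd: "norm (lk_kernel t x - (- (of_real t)\<^sup>2 / 2)) \<le> b x" if x: "x \<noteq> 0" for x
    proof -
      have x2: "x^2 > 0" using x by simp
      let ?r = "iexp (t * x) - 1 - \<i> * of_real (t * x) + of_real ((t * x)^2 / 2)"
      have r: "cmod ?r \<le> \<bar>t * x\<bar> ^ 3 / 6"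
      proof -
        have S: "(\<Sum>k\<le>2. (\<i> * complex_of_real (t * x)) ^ k / fact k) = 1 + \<i> * of_real (t * x) - of_real ((t * x)^2 / 2)"
          by (simp add: numeral_2_eq_2 power2_eq_square algebra_simps)
        have f: "Suc 2 = 3" "fact 3 = (6::real)" by (simp_all add: fact_numeral)
        have "cmod (iexp (t * x) - (1 + \<i> * of_real (t * x) - of_real ((t * x)^2 / 2))) \<le> \<bar>t * x\<bar> ^ 3 / 6"
          using iexp_approx1[of "t * x" 2] unfolding S f .
        moreover have "?r = iexp (t * x) - (1 + \<i> * of_real (t * x) - of_real ((t * x)^2 / 2))" by algebra
        ultimately show ?thesis by (simp only:)
      qed
      have e1: "complex_of_real ((t * x)^2 / 2) * of_real ((1 + x^2) / x^2) = of_real (t^2 / 2) + of_real (t^2 * x^2 / 2)"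
      proof -
        have "(t * x)^2 / 2 * ((1 + x^2) / x^2) = t^2 / 2 + t^2 * x^2 / 2"
          using x by (simp add: field_simps power_mult_distrib)
        then show ?thesis by (simp only: of_real_mult[symmetric] of_real_add[symmetric])
      qed
      have "lk_kernel t x - (- (of_real t)\<^sup>2 / 2)
        = ?r * of_real ((1 + x^2) / x^2) - of_real (t^2 * x^2 / 2) + \<i> * of_real (t * x)"
        unfolding lk_kernel_eq[OF x] distrib_right[of _ "of_real ((t * x)^2 / 2)"] e1 by simp
      also have "norm ... \<le> norm (?r * of_real ((1 + x^2) / x^2)) + norm (complex_of_real (t^2 * x^2 / 2)) + norm (\<i> * of_real (t * x))"
        by (intro order_trans[OF norm_triangle_ineq] add_right_mono norm_triangle_ineq4)
      also have "norm (?r * of_real ((1 + x^2) / x^2)) \<le> \<bar>t\<bar> ^ 3 * \<bar>x\<bar> / 6 * (1 + x^2)"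
      proof -
        have "norm (?r * of_real ((1 + x^2) / x^2)) = norm ?r * ((1 + x^2) / x^2)"
          unfolding norm_mult norm_of_real using x2 by simp
        also have "... \<le> \<bar>t * x\<bar> ^ 3 / 6 * ((1 + x^2) / x^2)" using r x2 by (intro mult_right_mono) auto
        also have "... = \<bar>t\<bar> ^ 3 * \<bar>x\<bar> / 6 * (1 + x^2)"
        proof -
          have "\<bar>x\<bar> ^ 3 = \<bar>x\<bar> * x^2" by (simp add: power3_eq_cube power2_eq_square)
          then show ?thesis using x2 by (simp add: abs_mult power_mult_distrib)
        qed
        finally show ?thesis .
      qed
      finally show ?thesis by (simp add: b_def norm_mult norm_power abs_mult)
    qed
    have "((\<lambda>x. b x) \<longlongrightarrow> b 0) (at 0)"
      unfolding b_def by (intro tendsto_intros) auto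
    moreover have "b 0 = 0" by (simp add: b_def)
    ultimately have b0: "(b \<longlongrightarrow> 0) (at 0)" by (simp only:)
    have "eventually (\<lambda>x. norm (lk_kernel t x - (- (of_real t)\<^sup>2 / 2)) \<le> b x) (at 0)"
      unfolding eventually_at_filter using bd by (intro always_eventually allI impI) 
    from Lim_null_comparison[OF this b0]
    have "(lk_kernel t \<longlongrightarrow> - (of_real t)\<^sup>2 / 2) (at 0)" by (rule LIM_zero_cancel)
    then show ?thesis using True by (simp add: isCont_def levy_khintchine_kernel_def)
  qed
  then show ?thesis by (simp add: continuous_on_eq_continuous_at)
qed

lemma lk_kernel_measurable: "lk_kernel t \<in> borel_measurable borel"
  by (rule borel_measurable_continuous_onI[OF lk_kernel_continuous])

lemma lk_kernel_integrable:
  "finite_borel \<sigma> ==> integrable \<sigma> (lk_kernel t)"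
  by (rule integrable_bounded_borel[OF _ lk_kernel_measurable lk_kernel_bound])

definition lk_exponent :: "real \<Rightarrow> real measure \<Rightarrow> real \<Rightarrow> complex" where
  "lk_exponent \<gamma> \<sigma> t = \<i> * of_real (\<gamma> * t) + (\<integral>x. lk_kernel t x \<partial>\<sigma>)"

lemma lk_exponent_0: "lk_exponent \<gamma> \<sigma> 0 = 0"
proof -
  have "lk_kernel 0 x = 0" for x by (simp add: levy_khintchine_kernel_def)
  then show ?thesis by (simp add: lk_exponent_def)
qed

lemma lk_exponent_continuous:
  assumes s: "finite_borel \<sigma>"
  shows "continuous_on UNIV (lk_exponent \<gamma> \<sigma>)"
  unfolding continuous_on_sequentially
proof (intro allI ballI impI, elim conjE)
  fix f :: "nat \<Rightarrow> real" and t assume f: "f \<longlonglongrightarrow> t"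
  interpret finite_borel_measure \<sigma> by fact
  obtain R where R: "\<And>n. norm (f n) \<le> R"
    using convergent_imp_Bseq[of f] f by (auto simp: convergent_def Bseq_def)
  have "(\<lambda>n. \<integral>x. lk_kernel (f n) x \<partial>\<sigma>) \<longlonglongrightarrow> (\<integral>x. lk_kernel t x \<partial>\<sigma>)"
  proof (rule integral_dominated_convergence[where w="\<lambda>_. 4 + R + R^2"])
    show "lk_kernel (f n) \<in> borel_measurable \<sigma>" "lk_kernel t \<in> borel_measurable \<sigma>" for n
      by (rule finite_borelD(4)[OF s lk_kernel_measurable])+
    show "AE x in \<sigma>. norm (lk_kernel (f n) x) \<le> 4 + R + R^2" for n
    proof (rule AE_I2)
      fix x
      have "\<bar>f n\<bar> \<le> R" "(f n)^2 \<le> R^2" using R[of n] power_mono[of "\<bar>f n\<bar>" R 2] by auto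
      then show "norm (lk_kernel (f n) x) \<le> 4 + R + R^2"
        using lk_kernel_bound[of "f n" x] by linarith
    qed
    show "AE x in \<sigma>. (\<lambda>n. lk_kernel (f n) x) \<longlonglongrightarrow> lk_kernel t x"
    proof (rule AE_I2)
      fix x :: real
      show "(\<lambda>n. lk_kernel (f n) x) \<longlonglongrightarrow> lk_kernel t x"
      proof (cases "x = 0")
        case True
        have "(\<lambda>n. - (complex_of_real (f n))\<^sup>2 / 2) \<longlonglongrightarrow> - (complex_of_real t)\<^sup>2 / 2" by (intro tendsto_intros f) auto
        then show ?thesis using True by (simp add: levy_khintchine_kernel_def)
      next
        case False
        have "complex_of_real (1 + x^2) \<noteq> 0" unfolding of_real_eq_0_iff by (metis add_pos_nonneg less_irrefl zero_le_power2 zero_less_one)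
        then have "(\<lambda>n. (iexp (f n * x) - 1 - \<i> * of_real (f n * x) / of_real (1 + x^2)) * complex_of_real ((1 + x^2) / x^2))
          \<longlonglongrightarrow> (iexp (t * x) - 1 - \<i> * of_real (t * x) / of_real (1 + x^2)) * complex_of_real ((1 + x^2) / x^2)"
          by (intro tendsto_intros f)
        then show ?thesis using False by (simp add: levy_khintchine_kernel_def)
      qed
    qed
  qed auto
  then have "(\<lambda>n. lk_exponent \<gamma> \<sigma> (f n)) \<longlonglongrightarrow> lk_exponent \<gamma> \<sigma> t"
    unfolding lk_exponent_def by (intro tendsto_intros f)
  then show "(lk_exponent \<gamma> \<sigma> \<circ> f) \<longlonglongrightarrow> lk_exponent \<gamma> \<sigma> t" by (simp add: o_def)
qed

lemma lk_exponent_converges: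
  assumes W: "weakly_converges X \<sigma>" and X: "\<And>n. finite_borel (X n)" "finite_borel \<sigma>"
    and g: "g \<longlonglongrightarrow> \<gamma>"
  shows "(\<lambda>n. lk_exponent (g n) (X n) t) \<longlonglongrightarrow> lk_exponent \<gamma> \<sigma> t"
  unfolding lk_exponent_def
  by (intro tendsto_intros g weakly_converges_complex[OF W X lk_kernel_continuous lk_kernel_bound])

section \<open>Uniqueness in the Levy-Khintchine formula\<close>

lemma equal_exp_equal:
  fixes D :: "real \<Rightarrow> complex"
  assumes c: "continuous_on UNIV D" and e: "\<And>t. exp (D t) = 1" and 0: "D 0 = 0"
  shows "D t = 0"
proof -
  have per: "\<exists>n::int. D t = of_real (of_int (2 * n) * pi) * \<i>" for t
  proof -
    have "Re (D t) = 0 \<and> (\<exists>n::int. Im (D t) = of_int (2 * n) * pi)" using e[of t] by (simp only: exp_eq_1)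
    then show ?thesis by (auto simp: complex_eq_iff)
  qed
  have "D constant_on UNIV"
  proof (rule continuous_discrete_range_constant[OF connected_UNIV c])
    fix x :: real
    show "\<exists>e>0. \<forall>y. y \<in> UNIV \<and> D y \<noteq> D x \<longrightarrow> e \<le> norm (D y - D x)"
    proof (intro exI[of _ 1] conjI allI impI)
      fix y assume ne: "y \<in> UNIV \<and> D y \<noteq> D x"
      obtain n m :: int where nm: "D y = of_real (of_int (2 * n) * pi) * \<i>" "D x = of_real (of_int (2 * m) * pi) * \<i>"
        using per by metis
      have "n \<noteq> m" using ne nm by auto
      then have "\<bar>real_of_int (n - m)\<bar> \<ge> 1" by linarith
      have "D y - D x = of_real (2 * real_of_int (n - m) * pi) * \<i>" unfolding nm by (simp add: algebra_simps)
      then have "norm (D y - D x) = 2 * \<bar>real_of_int (n - m)\<bar> * pi"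
        by (simp only: norm_mult norm_of_real norm_ii abs_mult) simp
      also have "... \<ge> 2 * 1 * pi" using \<open>\<bar>real_of_int (n - m)\<bar> \<ge> 1\<close> by (intro mult_right_mono mult_left_mono) auto
      finally show "1 \<le> norm (D y - D x)" using pi_gt3 by linarith
    qed simp
  qed
  then show ?thesis using 0 by (auto simp: constant_on_def)
qed

text \<open>The factor of \<open>exp (i t x)\<close> in a second difference of the Levy-Khintchine kernel in \<open>t\<close>. Unlike the
kernel it is nonnegative.\<close>
definition second_difference :: "real \<Rightarrow> real \<Rightarrow> real" where
  "second_difference h x = (if x = 0 then h\<^sup>2 else 2 * (1 - cos (h * x)) * ((1 + x^2) / x^2))"

lemma one_minus_cos_bound: "2 * (1 - cos u) \<le> (u::real)^2"
proof -
  have "2 * (1 - cos u) = 4 * (sin (u / 2))^2"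
    using cos_double_sin[of "u / 2"] by simp
  also have "(sin (u / 2))^2 \<le> (u / 2)^2"
    by (rule abs_le_square_iff[THEN iffD1, OF abs_sin_x_le_abs_x])
  finally show ?thesis by (simp add: power_divide)
qed

lemma second_difference_bound: "0 \<le> second_difference h x" "second_difference h x \<le> h^2 * (1 + x^2)"
  "second_difference h x \<le> 8 + 2 * h^2"
proof -
  have c: "0 \<le> 1 - cos (h * x)" "1 - cos (h * x) \<le> 2" using cos_le_one[of "h * x"] cos_ge_minus_one[of "h * x"] by linarith+
  show "0 \<le> second_difference h x" using c(1) by (simp add: second_difference_def)
  show 1: "second_difference h x \<le> h^2 * (1 + x^2)"
  proof (cases "x = 0")
    case False
    have "2 * (1 - cos (h * x)) * ((1 + x^2) / x^2) \<le> (h * x)^2 * ((1 + x^2) / x^2)"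
      by (intro mult_right_mono one_minus_cos_bound) simp
    then show ?thesis using False by (simp add: second_difference_def power_mult_distrib)
  qed (simp add: second_difference_def)
  show "second_difference h x \<le> 8 + 2 * h^2"
  proof (cases "\<bar>x\<bar> \<le> 1")
    case True
    then have "x^2 \<le> 1" by (simp add: abs_square_le_1)
    then have "h^2 * (1 + x^2) \<le> h^2 * 2" by (intro mult_left_mono) auto
    then show ?thesis using 1 by linarith
  next
    case False
    then have x1: "x^2 \<ge> 1" using abs_le_square_iff[of 1 x] by simp
    then have x0: "x^2 > 0" by linarith
    have r: "(1 + x^2) / x^2 \<le> 2" unfolding pos_divide_le_eq[OF x0] using x1 by simp
    have "2 * (1 - cos (h * x)) * ((1 + x^2) / x^2) \<le> (2 * 2) * 2"
      using c r by (intro mult_mono) auto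
    moreover have "x \<noteq> 0" using x1 by auto
    ultimately have "second_difference h x \<le> 8" by (simp add: second_difference_def)
    then show ?thesis using zero_le_power2[of h] by linarith
  qed
qed

lemma second_difference_measurable [measurable]: "second_difference h \<in> borel_measurable borel"
  unfolding second_difference_def by measurable

lemma lk_kernel_second_difference:
  "2 * lk_kernel t x - lk_kernel (t + h) x - lk_kernel (t - h) x
    = of_real (second_difference h x) * iexp (t * x)"
proof (cases "x = 0")
  case True
  then show ?thesis
    by (simp add: levy_khintchine_kernel_def second_difference_def field_simps power2_eq_square)
next
  case False
  let ?P = "complex_of_real ((1 + x^2) / x^2)" and ?q = "complex_of_real (1 + x^2)"
  have q: "?q \<noteq> 0" unfolding of_real_eq_0_iff by (metis add_pos_nonneg less_irrefl zero_le_power2 zero_less_one)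
  have ip: "iexp ((t + h) * x) = iexp (t * x) * iexp (h * x)" "iexp ((t - h) * x) = iexp (t * x) * iexp (- (h * x))"
    unfolding mult_exp_exp by (simp_all add: algebra_simps)
  have s: "iexp (h * x) + iexp (- (h * x)) = of_real (2 * cos (h * x))"
    by (simp add: complex_eq_iff Re_exp Im_exp)
  have lin: "2 * (\<i> * of_real (t * x) / ?q) - \<i> * of_real ((t + h) * x) / ?q - \<i> * of_real ((t - h) * x) / ?q = 0"
  proof -
    have "2 * (\<i> * a / q) - \<i> * (a + b) / q - \<i> * (a - b) / q = 0" for a b q :: complex
      by (simp add: algebra_simps add_divide_distrib diff_divide_distrib)
    moreover have "complex_of_real ((t + h) * x) = of_real (t * x) + of_real (h * x)"
      "complex_of_real ((t - h) * x) = of_real (t * x) - of_real (h * x)" by (simp_all add: algebra_simps)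
    ultimately show ?thesis by (simp only:)
  qed
  have gen: "2 * ((E - 1 - l0) * P) - (E * a - 1 - l1) * P - (E * b - 1 - l2) * P
     = E * (2 - (a + b)) * P - (2 * l0 - l1 - l2) * P" for E l0 l1 l2 a b P :: complex by algebra
  have "2 * lk_kernel t x - lk_kernel (t + h) x - lk_kernel (t - h) x
    = 2 * ((iexp (t * x) - 1 - \<i> * of_real (t * x) / ?q) * ?P)
      - (iexp (t * x) * iexp (h * x) - 1 - \<i> * of_real ((t + h) * x) / ?q) * ?P
      - (iexp (t * x) * iexp (- (h * x)) - 1 - \<i> * of_real ((t - h) * x) / ?q) * ?P"
    using False unfolding levy_khintchine_kernel_def ip[symmetric] by simp
  also have "... = iexp (t * x) * (2 - of_real (2 * cos (h * x))) * ?P"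
    unfolding gen s lin by simp
  also have "2 - of_real (2 * cos (h * x)) = complex_of_real (2 * (1 - cos (h * x)))" by simp
  also have "iexp (t * x) * complex_of_real (2 * (1 - cos (h * x))) * ?P
      = complex_of_real (2 * (1 - cos (h * x)) * ((1 + x^2) / x^2)) * iexp (t * x)"
    by (simp only: of_real_mult mult_ac)
  finally show ?thesis using False by (simp add: second_difference_def)
qed

text \<open>Normalise to probability measures with density \<open>w\<close> and apply the uniqueness theorem of Levy.\<close>
lemma finite_char_determines:
  assumes s: "finite_borel \<sigma>" "finite_borel \<tau>"
    and w: "w \<in> borel_measurable borel" "\<And>x. 0 \<le> w x" "\<And>x. w x \<le> B"
    and eq: "\<And>t. (\<integral>x. of_real (w x) * iexp (t * x) \<partial>\<sigma>) = (\<integral>x. of_real (w x) * iexp (t * x) \<partial>\<tau>)"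
    and f: "f \<in> borel_measurable borel" "\<And>x. \<bar>f x\<bar> \<le> C"
  shows "(\<integral>x. w x * f x \<partial>\<sigma>) = (\<integral>x. w x * f x \<partial>\<tau>)"
proof -
  have wn: "norm (w x) \<le> B" for x using w by simp
  have wi: "integrable M w" if "finite_borel M" for M
    by (rule integrable_bounded_borel[OF that w(1) wn])
  define A where "A = (\<integral>x. w x \<partial>\<sigma>)"
  have "(\<integral>x. complex_of_real (w x) \<partial>\<sigma>) = (\<integral>x. complex_of_real (w x) \<partial>\<tau>)" using eq[of 0] by simp
  then have A': "A = (\<integral>x. w x \<partial>\<tau>)" by (simp add: A_def integral_complex_of_real)
  have A0: "A \<ge> 0" unfolding A_def using w(2) by simp
  show ?thesis
  proof (cases "A = 0")
    case True
    have "(\<integral>x. w x * f x \<partial>M) = 0" if M: "finite_borel M" and z: "(\<integral>x. w x \<partial>M) = 0" for M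
    proof -
      have "AE x in M. w x = 0" using z integral_nonneg_eq_0_iff_AE[OF wi[OF M]] w(2) by simp
      then have "AE x in M. w x * f x = 0" by eventually_elim simp
      then show ?thesis by (rule integral_eq_zero_AE)
    qed
    then show ?thesis using s True A' A_def by metis
  next
    case False
    then have Ap: "A > 0" using A0 by simp
    define P where "P M = density M (\<lambda>x. ennreal (w x / A))" for M :: "real measure"
    have intP: "(\<integral>x. g x \<partial>P M) = (\<integral>x. (w x / A) *\<^sub>R g x \<partial>M)"
      if M: "finite_borel M" and g: "g \<in> borel_measurable borel" for M and g :: "real \<Rightarrow> 'b::{banach, second_countable_topology}"
    proof -
      have wm: "(\<lambda>x. w x / A) \<in> borel_measurable borel" using w(1) by measurable
      have ae: "AE x in M. 0 \<le> w x / A" using w(2) Ap by (intro AE_I2) auto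
      show ?thesis unfolding P_def
        by (rule integral_density[OF finite_borelD(4)[OF M g] finite_borelD(4)[OF M wm] ae])
    qed
    have rd: "real_distribution (P M)" if M: "finite_borel M" and z: "(\<integral>x. w x \<partial>M) = A" for M
    proof -
      have wm: "(\<lambda>x. ennreal (w x / A)) \<in> borel_measurable M"
        by (rule finite_borelD(4)[OF M]) (use w(1) in measurable)
      have "emeasure (P M) (space (P M)) = (\<integral>\<^sup>+x. ennreal (w x / A) \<partial>M)"
        unfolding P_def using emeasure_density[OF wm sets.top] by (simp cong: nn_integral_cong)
      also have "... = ennreal (\<integral>x. w x / A \<partial>M)"
        using wi[OF M] w(2) Ap by (intro nn_integral_eq_integral) auto
      also have "... = 1" using z Ap by simp
      finally show ?thesis
        using finite_borelD(2)[OF M]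
        by (auto simp: real_distribution_def real_distribution_axioms_def P_def intro!: prob_spaceI)
    qed
    have ch: "char (P M) t = (\<integral>x. of_real (w x) * iexp (t * x) \<partial>M) / of_real A" if M: "finite_borel M" for M t
    proof -
      have "char (P M) t = (\<integral>x. (w x / A) *\<^sub>R iexp (t * x) \<partial>M)"
        unfolding char_def by (rule intP[OF M iexp_measurable])
      also have "... = (\<integral>x. (of_real (w x) * iexp (t * x)) / of_real A \<partial>M)"
        by (simp add: scaleR_conv_of_real)
      finally show ?thesis by simp
    qed
    have PP: "P \<sigma> = P \<tau>"
      using rd s A_def A' ch eq by (intro Levy_uniqueness ext) auto
    have "(\<integral>x. w x * f x \<partial>M) = A * (\<integral>x. f x \<partial>P M)" if M: "finite_borel M" for M
    proof -
      have "(\<integral>x. f x \<partial>P M) = (\<integral>x. w x * f x / A \<partial>M)" using intP[OF M f(1)] by simp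
      then show ?thesis unfolding integral_divide_zero using False by simp
    qed
    then show ?thesis using PP s by metis
  qed
qed

text \<open>A continuous logarithm vanishing at 0 is unique, so the exponents agree. Their second
differences in \<open>t\<close> are the Fourier transforms of \<open>\<sigma>\<close> weighted by \<open>second_difference h\<close>, which
therefore determine \<open>\<sigma>\<close> as \<open>h\<close> tends to 0.\<close>
lemma lk_exponent_unique:
  assumes s: "finite_borel \<sigma>" "finite_borel \<tau>"
    and eq: "\<And>t. exp (lk_exponent \<gamma> \<sigma> t) = exp (lk_exponent \<delta> \<tau> t)"
  shows "\<gamma> = \<delta>" "\<sigma> = \<tau>"
proof -
  have "lk_exponent \<gamma> \<sigma> t - lk_exponent \<delta> \<tau> t = 0" for t
    by (rule equal_exp_equal) (auto intro!: continuous_on_diff lk_exponent_continuous s simp: lk_exponent_0 exp_diff eq)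
  then have L: "lk_exponent \<gamma> \<sigma> t = lk_exponent \<delta> \<tau> t" for t by simp
  have sd: "(\<integral>x. of_real (second_difference h x) * iexp (t * x) \<partial>M)
     = 2 * lk_exponent g M t - lk_exponent g M (t + h) - lk_exponent g M (t - h)"
    if M: "finite_borel M" for M g h t
  proof -
    note i = lk_kernel_integrable[OF M]
    have "(\<integral>x. of_real (second_difference h x) * iexp (t * x) \<partial>M)
      = (\<integral>x. 2 * lk_kernel t x - lk_kernel (t + h) x - lk_kernel (t - h) x \<partial>M)"
      by (simp only: lk_kernel_second_difference)
    also have "... = (\<integral>x. 2 * lk_kernel t x \<partial>M) - (\<integral>x. lk_kernel (t + h) x \<partial>M)
        - (\<integral>x. lk_kernel (t - h) x \<partial>M)"
      using i by (simp add: Bochner_Integration.integral_diff integrable_mult_right)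
    also have "... = 2 * lk_exponent g M t - lk_exponent g M (t + h) - lk_exponent g M (t - h)"
      unfolding integral_mult_right_zero lk_exponent_def by (simp add: algebra_simps)
    finally show ?thesis .
  qed
  have weighted: "(\<integral>x. second_difference h x * f x \<partial>\<sigma>) = (\<integral>x. second_difference h x * f x \<partial>\<tau>)"
    if "f \<in> borel_measurable borel" "\<And>x. \<bar>f x\<bar> \<le> C" for h f C
  proof (rule finite_char_determines[OF s second_difference_measurable second_difference_bound(1,3) _ that])
    show "(\<integral>x. of_real (second_difference h x) * iexp (t * x) \<partial>\<sigma>) = (\<integral>x. of_real (second_difference h x) * iexp (t * x) \<partial>\<tau>)" for t
      unfolding sd[OF s(1), where g=\<gamma>] sd[OF s(2), where g=\<delta>] L ..
  qed
  show st: "\<sigma> = \<tau>"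
  proof (rule measure_eqI_continuous[OF s])
    fix g :: "real \<Rightarrow> real"
    assume gc: "continuous_on UNIV g" and g: "\<And>x. 0 \<le> g x" "\<And>x. g x \<le> 1"
    have gm: "g \<in> borel_measurable borel" using gc by (rule borel_measurable_continuous_onI)
    define h where "h n = inverse (real (Suc n))" for n
    have h0: "h n \<noteq> 0" "h n > 0" for n by (simp_all add: h_def)
    have hl: "h \<longlonglongrightarrow> 0" unfolding h_def by (rule LIMSEQ_inverse_real_of_nat)
    define u where "u n x = second_difference (h n) x * (g x / (1 + x^2)) / (h n)^2" for n x
    have pos: "1 + x^2 > 0" for x :: real by (simp add: add_pos_nonneg)
    have um: "u n \<in> borel_measurable borel" for n unfolding u_def using gm by measurable
    have ub: "norm (u n x) \<le> 1" for n x
    proof -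
      have "second_difference (h n) x * (g x / (1 + x^2)) \<le> ((h n)^2 * (1 + x^2)) * (1 / (1 + x^2))"
        using second_difference_bound(1,2)[of "h n" x] g[of x] pos[of x]
        by (intro mult_mono divide_right_mono) auto
      also have "... = (h n)^2" using pos[of x] by simp
      finally have "u n x \<le> (h n)^2 / (h n)^2" unfolding u_def by (rule divide_right_mono) simp
      then have "u n x \<le> 1" using h0[of n] by simp
      moreover have "0 \<le> u n x" unfolding u_def using second_difference_bound(1)[of "h n" x] g(1)[of x] pos[of x] by simp
      ultimately show ?thesis by simp
    qed
    have ul: "(\<lambda>n. u n x) \<longlonglongrightarrow> g x" for x
    proof (cases "x = 0")
      case True
      then show ?thesis using h0 by (simp add: u_def second_difference_def)
    next
      case False
      have "((\<lambda>v. 2 * (1 - cos v) / v^2) \<longlongrightarrow> 1) (at (0::real))" by real_asymp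
      moreover have "filterlim (\<lambda>n. h n * x) (at 0) sequentially"
        using hl h0 False by (intro filterlim_atI tendsto_mult_left_zero) (auto intro!: always_eventually tendsto_mult_left_zero)
      ultimately have "(\<lambda>n. 2 * (1 - cos (h n * x)) / (h n * x)^2) \<longlonglongrightarrow> 1" by (rule filterlim_compose)
      then have "(\<lambda>n. 2 * (1 - cos (h n * x)) / (h n * x)^2 * g x) \<longlonglongrightarrow> 1 * g x" by (intro tendsto_intros)
      moreover have "u n x = 2 * (1 - cos (h n * x)) / (h n * x)^2 * g x" for n
        using False h0[of n] pos[of x] by (simp add: u_def second_difference_def power_mult_distrib)
      ultimately show ?thesis by simp
    qed
    have conv: "(\<lambda>n. \<integral>x. u n x \<partial>M) \<longlonglongrightarrow> (\<integral>x. g x \<partial>M)" if M: "finite_borel M" for M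
    proof -
      interpret finite_borel_measure M by fact
      show ?thesis
        by (rule integral_dominated_convergence[where w="\<lambda>_. 1"])
           (use finite_borelD(4)[OF M gm] finite_borelD(4)[OF M um] ub ul in \<open>auto simp del: real_norm_def\<close>)
    qed
    have gb: "\<bar>g x / (1 + x^2)\<bar> \<le> 1" for x
    proof -
      have "g x / (1 + x^2) \<le> 1 / 1" using g[of x] by (intro frac_le) auto
      moreover have "0 \<le> g x / (1 + x^2)" using g(1)[of x] pos[of x] by simp
      ultimately show ?thesis by simp
    qed
    have gqm: "(\<lambda>x. g x / (1 + x^2)) \<in> borel_measurable borel" using gm by measurable
    have "(\<integral>x. u n x \<partial>\<sigma>) = (\<integral>x. u n x \<partial>\<tau>)" for n
      unfolding u_def integral_divide_zero by (simp only: weighted[OF gqm gb])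
    then show "(\<integral>x. g x \<partial>\<sigma>) = (\<integral>x. g x \<partial>\<tau>)"
      using LIMSEQ_unique[OF conv[OF s(1)]] conv[OF s(2)] by simp
  qed
  have "\<i> * complex_of_real (\<gamma> * 1) = \<i> * of_real (\<delta> * 1)" using L[of 1] unfolding st lk_exponent_def by (simp only: add_right_cancel)
  then show "\<gamma> = \<delta>" by simp
qed

section \<open>Tightness from characteristic functions\<close>

lemma char_scaled_measurable:
  assumes "real_distribution M"
  shows "(\<lambda>z. char M (s * z)) \<in> borel_measurable borel"
proof -
  interpret real_distribution M by fact
  show ?thesis
    by (intro borel_measurable_continuous_onI) (simp add: continuous_on_eq_continuous_at isCont_char continuous_at_compose[unfolded o_def])
qed

text \<open>Fubini, because the characteristic function of a Gaussian is again Gaussian. It replaces the usual average of the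
characteristic function over an interval around 0.\<close>
lemma gaussian_average:
  assumes M: "real_distribution M"
  shows "(\<integral>x. 1 - exp (- ((s * x)^2) / 2) \<partial>M) = (\<integral>z. 1 - Re (char M (s * z)) \<partial>std_normal_distribution)"
proof -
  interpret M: real_distribution M by fact
  interpret N: real_distribution std_normal_distribution by (rule real_dist_normal_dist)
  interpret P: pair_prob_space std_normal_distribution M ..
  have fN: "finite_borel std_normal_distribution" by (rule real_distributionD(2)[OF real_dist_normal_dist])
  note fM = real_distributionD(2)[OF M]
  have meas: "(\<lambda>p. iexp (s * fst p * snd p)) \<in> borel_measurable (std_normal_distribution \<Otimes>\<^sub>M M)"
    by measurable
  have int: "integrable (std_normal_distribution \<Otimes>\<^sub>M M) (\<lambda>(z, x). iexp (s * z * x))"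
    unfolding case_prod_beta by (rule P.integrable_const_bound[of _ 1, OF _ meas]) simp
  have "(\<integral>x. (\<integral>z. iexp (s * z * x) \<partial>std_normal_distribution) \<partial>M) = (\<integral>z. (\<integral>x. iexp (s * z * x) \<partial>M) \<partial>std_normal_distribution)"
    by (rule P.Fubini_integral[OF int])
  moreover have "(\<integral>z. iexp (s * z * x) \<partial>std_normal_distribution) = of_real (exp (- ((s * x)^2) / 2))" for x
    using fun_cong[OF char_std_normal_distribution, of "s * x"] by (simp add: char_def mult_ac)
  moreover have "(\<integral>x. iexp (s * z * x) \<partial>M) = char M (s * z)" for z by (simp add: char_def)
  ultimately have e: "(\<integral>x. complex_of_real (exp (- ((s * x)^2) / 2)) \<partial>M) = (\<integral>z. char M (s * z) \<partial>std_normal_distribution)"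
    by simp
  have cm: "(\<lambda>z. char M (s * z)) \<in> borel_measurable borel"
    by (rule char_scaled_measurable[OF M])
  have ci: "integrable std_normal_distribution (\<lambda>z. char M (s * z))"
    by (rule integrable_bounded_borel[OF fN cm M.cmod_char_le_1])
  have "(\<integral>x. exp (- ((s * x)^2) / 2) \<partial>M) = Re (\<integral>z. char M (s * z) \<partial>std_normal_distribution)"
    unfolding e[symmetric] integral_complex_of_real by simp
  also have "... = (\<integral>z. Re (char M (s * z)) \<partial>std_normal_distribution)"
    by (rule integral_Re[OF ci, symmetric])
  finally have e2: "(\<integral>x. exp (- ((s * x)^2) / 2) \<partial>M) = (\<integral>z. Re (char M (s * z)) \<partial>std_normal_distribution)" .
  have i1: "integrable M (\<lambda>x. exp (- ((s * x)^2) / 2))"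
    by (intro integrable_bounded_borel[OF fM, where B=1]) auto
  have i2: "integrable std_normal_distribution (\<lambda>z. Re (char M (s * z)))" using ci by (rule integrable_Re)
  have "(\<integral>x. 1 - exp (- ((s * x)^2) / 2) \<partial>M) = 1 - (\<integral>x. exp (- ((s * x)^2) / 2) \<partial>M)"
    using i1 by (simp add: real_distributionD(5)[OF M])
  also have "... = 1 - (\<integral>z. Re (char M (s * z)) \<partial>std_normal_distribution)" by (simp only: e2)
  also have "... = (\<integral>z. 1 - Re (char M (s * z)) \<partial>std_normal_distribution)"
    using i2 by (simp add: real_distributionD(5)[OF real_dist_normal_dist])
  finally show ?thesis .
qed

lemma gaussian_tail_kernel:
  fixes s x :: real
  assumes "s > 0"
  shows "x^2 / (x^2 + (1 / s)^2) \<le> 2 * (1 - exp (- ((s * x)^2) / 2))"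
proof -
  define v where "v = (s * x)^2 / 2"
  have v: "v \<ge> 0" by (simp add: v_def)
  have "exp (- v) \<le> 1 / (1 + v)"
  proof -
    have "1 + v \<le> exp v" by (rule exp_ge_add_one_self)
    then have "1 / exp v \<le> 1 / (1 + v)" using v by (intro divide_left_mono) auto
    then show ?thesis by (simp add: exp_minus divide_inverse)
  qed
  then have "v / (1 + v) \<le> 1 - exp (- v)" using v by (simp add: field_simps)
  moreover have "x^2 / (x^2 + (1 / s)^2) = 2 * v / (1 + 2 * v)"
  proof -
    have "x^2 + (1 / s)^2 = (1 + (s * x)^2) / s^2" using assms by (simp add: field_simps)
    then have "x^2 / (x^2 + (1 / s)^2) = (s * x)^2 / (1 + (s * x)^2)"
      using assms by (simp add: power_mult_distrib mult.commute)
    then show ?thesis by (simp add: v_def)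
  qed
  moreover have "2 * v / (1 + 2 * v) \<le> 2 * (v / (1 + v))"
    using v by (simp add: frac_le)
  ultimately show ?thesis by (simp add: v_def)
qed

lemma gaussian_tail:
  assumes M: "real_distribution M" and s: "s > 0"
  shows "(\<integral>x. x^2 / (x^2 + (1 / s)^2) \<partial>M) \<le> 2 * (\<integral>z. 1 - Re (char M (s * z)) \<partial>std_normal_distribution)"
proof -
  note fM = real_distributionD(2)[OF M]
  have "(\<integral>x. x^2 / (x^2 + (1 / s)^2) \<partial>M) \<le> (\<integral>x. 2 * (1 - exp (- ((s * x)^2) / 2)) \<partial>M)"
  proof (intro integral_mono gaussian_tail_kernel[OF s] tail_kernel_integrable[OF fM])
    show "integrable M (\<lambda>x. 2 * (1 - exp (- ((s * x)^2) / 2)))"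
      by (intro integrable_bounded_borel[OF fM, where B=2]) auto
  qed (use s in simp)
  then show ?thesis unfolding integral_mult_right_zero gaussian_average[OF M] .
qed

lemma tight_of_char_converges:
  assumes X: "\<And>n. real_distribution (X n)" and lim: "\<And>t. (\<lambda>n. char (X n) t) \<longlonglongrightarrow> u t"
    and c: "isCont u 0"
  shows "tight_seq X"
proof -
  let ?N = "std_normal_distribution"
  interpret N: real_distribution ?N by (rule real_dist_normal_dist)
  note fX = real_distributionD(2)[OF X]
  have u0: "u 0 = 1"
  proof -
    have "char (X n) 0 = 1" for n
    proof -
      interpret real_distribution "X n" by (rule X)
      show ?thesis by (rule char_zero)
    qed
    then show ?thesis using lim[of 0] by (simp add: LIMSEQ_const_iff)
  qed
  note cm = char_scaled_measurable[OF X]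
  have um: "(\<lambda>z. u (s * z)) \<in> borel_measurable borel" for s
    by (rule borel_measurable_LIMSEQ_metric[OF cm lim])
  have cb: "cmod (char (X n) t) \<le> 1" for n t
  proof -
    interpret real_distribution "X n" by (rule X)
    show ?thesis by (rule cmod_char_le_1)
  qed
  have ub: "cmod (u t) \<le> 1" for t
    by (rule LIMSEQ_le_const2[OF tendsto_norm[OF lim]]) (use cb in auto)
  have rb: "norm (1 - Re z) \<le> 2" if "cmod z \<le> 1" for z :: complex
    using abs_Re_le_cmod[of z] that by (simp add: abs_le_iff)
  define J where "J s = (\<integral>z. 1 - Re (u (s * z)) \<partial>?N)" for s
  have J1: "(\<lambda>n. \<integral>z. 1 - Re (char (X n) (s * z)) \<partial>?N) \<longlonglongrightarrow> J s" for s
    unfolding J_def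
  proof (rule integral_dominated_convergence[where w="\<lambda>_. 2"])
    show "(\<lambda>z. 1 - Re (u (s * z))) \<in> borel_measurable ?N" using um by measurable
    show "(\<lambda>z. 1 - Re (char (X n) (s * z))) \<in> borel_measurable ?N" for n using cm by measurable
    show "AE z in ?N. (\<lambda>n. 1 - Re (char (X n) (s * z))) \<longlonglongrightarrow> 1 - Re (u (s * z))"
      by (intro AE_I2 tendsto_intros lim)
    show "AE z in ?N. norm (1 - Re (char (X n) (s * z))) \<le> 2" for n
      by (intro AE_I2 rb cb)
  qed simp
  have "(\<lambda>m. J (inverse (real (Suc m)))) \<longlonglongrightarrow> (\<integral>z. 0 \<partial>?N)"
    unfolding J_def
  proof (rule integral_dominated_convergence[where w="\<lambda>_. 2"])
    show "(\<lambda>z. 1 - Re (u (inverse (real (Suc m)) * z))) \<in> borel_measurable ?N" for m using um by measurable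
    show "AE z in ?N. norm (1 - Re (u (inverse (real (Suc m)) * z))) \<le> 2" for m
      by (intro AE_I2 rb ub)
    show "AE z in ?N. (\<lambda>m. 1 - Re (u (inverse (real (Suc m)) * z))) \<longlonglongrightarrow> 0"
    proof (rule AE_I2)
      fix z :: real
      have "(\<lambda>m. inverse (real (Suc m)) * z) \<longlonglongrightarrow> 0 * z" by (intro tendsto_intros LIMSEQ_inverse_real_of_nat)
      then have "(\<lambda>m. inverse (real (Suc m)) * z) \<longlonglongrightarrow> 0" by simp
      then have "(\<lambda>m. u (inverse (real (Suc m)) * z)) \<longlonglongrightarrow> u 0" by (rule isCont_tendsto_compose[OF c])
      then have "(\<lambda>m. 1 - Re (u (inverse (real (Suc m)) * z))) \<longlonglongrightarrow> 1 - Re (u 0)" by (intro tendsto_intros)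
      then show "(\<lambda>m. 1 - Re (u (inverse (real (Suc m)) * z))) \<longlonglongrightarrow> 0" by (simp add: u0)
    qed
  qed auto
  then have J2: "(\<lambda>m. J (inverse (real (Suc m)))) \<longlonglongrightarrow> 0" by simp
  show ?thesis
  proof (rule tight_seqI_kernel[OF fX])
    fix e :: real assume e: "e > 0"
    have "eventually (\<lambda>m. J (inverse (real (Suc m))) < e / 2) sequentially"
      using order_tendstoD(2)[OF J2, of "e / 2"] e by simp
    then obtain m where m: "J (inverse (real (Suc m))) < e / 2" by (auto simp: eventually_sequentially)
    define s where "s = inverse (real (Suc m))"
    have s: "s > 0" "J s < e / 2" using m by (auto simp: s_def)
    have ev: "eventually (\<lambda>n. (\<integral>z. 1 - Re (char (X n) (s * z)) \<partial>?N) < e / 2) sequentially"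
      by (rule order_tendstoD(2)[OF J1 s(2)])
    have "(\<integral>t. t^2 / (t^2 + (1 / s)^2) \<partial>X n) \<le> e" if "(\<integral>z. 1 - Re (char (X n) (s * z)) \<partial>?N) < e / 2" for n
    proof -
      have "(\<integral>t. t^2 / (t^2 + (1 / s)^2) \<partial>X n) \<le> 2 * (\<integral>z. 1 - Re (char (X n) (s * z)) \<partial>?N)"
        by (rule gaussian_tail[OF X s(1)])
      then show ?thesis using that by simp
    qed
    then have "eventually (\<lambda>n. (\<integral>t. t^2 / (t^2 + (1 / s)^2) \<partial>X n) \<le> e) sequentially"
      by (rule eventually_mono[OF ev])
    then show "\<exists>y>0. eventually (\<lambda>n. (\<integral>t. t^2 / (t^2 + y^2) \<partial>X n) \<le> e) sequentially"
      using s(1) by (intro exI[of _ "1 / s"] conjI) auto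
  qed
qed

lemma weakly_converges_char:
  assumes W: "weakly_converges X M" and X: "\<And>n. finite_borel (X n)" "finite_borel M"
  shows "(\<lambda>n. char (X n) t) \<longlonglongrightarrow> char M t"
  unfolding char_def
  by (rule weakly_converges_complex[OF W X, where B=1]) (auto intro!: continuous_intros)

lemma levy_limit_exists:
  assumes X: "\<And>n. real_distribution (X n)" and lim: "\<And>t. (\<lambda>n. char (X n) t) \<longlonglongrightarrow> u t"
    and c: "isCont u 0"
  shows "\<exists>M. real_distribution M \<and> char M = u"
proof -
  note fX = real_distributionD(2)[OF X]
  have B: "measure (X n) UNIV \<le> 1" for n using real_distributionD(5)[OF X] by simp
  obtain r M where r: "strict_mono (r :: nat \<Rightarrow> nat)" "finite_borel M" "weakly_converges (X \<circ> r) M"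
    using tight_seq_compact[OF fX B tight_of_char_converges[OF X lim c]] by blast
  have "(\<lambda>n. measure ((X \<circ> r) n) UNIV) \<longlonglongrightarrow> measure M UNIV"
    by (rule weakly_converges_mass[OF r(3) _ r(2)]) (simp add: fX)
  then have "measure M UNIV = 1" using real_distributionD(5)[OF X] by (simp add: LIMSEQ_const_iff)
  then have M: "real_distribution M" by (rule real_distributionI_mass[OF r(2)])
  have "char M t = u t" for t
  proof (rule LIMSEQ_unique)
    show "(\<lambda>n. char ((X \<circ> r) n) t) \<longlonglongrightarrow> char M t"
      by (rule weakly_converges_char[OF r(3) _ r(2)]) (simp add: fX)
    show "(\<lambda>n. char ((X \<circ> r) n) t) \<longlonglongrightarrow> u t"
      using LIMSEQ_subseq_LIMSEQ[OF lim r(1)] by (simp add: o_def)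
  qed
  then show ?thesis using M by blast
qed

section \<open>Characteristic functions of centred measures\<close>

lemma sin_multiple_bound: "\<bar>sin (real n * v)\<bar> \<le> real n * \<bar>sin v\<bar>"
proof (induction n)
  case (Suc n)
  have "sin (real (Suc n) * v) = sin (real n * v) * cos v + cos (real n * v) * sin v"
    by (simp add: distrib_right sin_add add.commute)
  also have "\<bar>...\<bar> \<le> \<bar>sin (real n * v)\<bar> * \<bar>cos v\<bar> + \<bar>cos (real n * v)\<bar> * \<bar>sin v\<bar>"
    by (rule order_trans[OF abs_triangle_ineq]) (simp add: abs_mult)
  also have "... \<le> \<bar>sin (real n * v)\<bar> * 1 + 1 * \<bar>sin v\<bar>"
    by (intro add_mono mult_left_mono mult_right_mono) auto
  also have "... \<le> real (Suc n) * \<bar>sin v\<bar>" using Suc.IH by (simp add: algebra_simps)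
  finally show ?case .
qed simp

lemma one_minus_cos_multiple: "1 - cos (real n * u) \<le> (real n)^2 * (1 - cos u)"
proof -
  have c: "1 - cos w = 2 * (sin (w / 2))^2" for w :: real
    using cos_double_sin[of "w / 2"] by simp
  have "\<bar>sin (real n * (u / 2))\<bar>\<^sup>2 \<le> (real n * \<bar>sin (u / 2)\<bar>)^2"
    by (intro power_mono sin_multiple_bound) simp
  then show ?thesis unfolding c by (simp add: power_mult_distrib)
qed

lemma one_minus_Re_char:
  assumes M: "real_distribution M"
  shows "1 - Re (char M t) = (\<integral>x. 1 - cos (t * x) \<partial>M)" "integrable M (\<lambda>x. 1 - cos (t * x))"
    "0 \<le> 1 - Re (char M t)" "1 - Re (char M t) \<le> 2"
proof -
  interpret real_distribution M by fact
  note fM = real_distributionD(2)[OF M]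
  have i: "integrable M (\<lambda>x. cos (t * x))"
    by (rule integrable_bounded_borel[OF fM, where B=1]) auto
  then show "integrable M (\<lambda>x. 1 - cos (t * x))" by simp
  have "Re (char M t) = (\<integral>x. Re (iexp (t * x)) \<partial>M)"
    unfolding char_def by (rule integral_Re[symmetric, OF integrable_bounded_borel[OF fM iexp_measurable, where B=1]]) simp
  also have "... = (\<integral>x. cos (t * x) \<partial>M)" by (simp add: Re_exp)
  finally show "1 - Re (char M t) = (\<integral>x. 1 - cos (t * x) \<partial>M)" using i by (simp add: real_distributionD(5)[OF M])
  have "\<bar>Re (char M t)\<bar> \<le> 1" using abs_Re_le_cmod[of "char M t"] cmod_char_le_1[of t] by linarith
  then show "0 \<le> 1 - Re (char M t)" "1 - Re (char M t) \<le> 2" by linarith+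
qed

lemma one_minus_Re_char_multiple:
  assumes M: "real_distribution M"
  shows "1 - Re (char M (real n * t)) \<le> (real n)^2 * (1 - Re (char M t))"
proof -
  have "(\<integral>x. 1 - cos (real n * t * x) \<partial>M) \<le> (\<integral>x. (real n)^2 * (1 - cos (t * x)) \<partial>M)"
  proof (rule integral_mono[OF one_minus_Re_char(2)[OF M]])
    show "integrable M (\<lambda>x. (real n)^2 * (1 - cos (t * x)))"
      by (rule integrable_mult_right[OF one_minus_Re_char(2)[OF M]])
    show "1 - cos (real n * t * x) \<le> (real n)^2 * (1 - cos (t * x))" for x
      using one_minus_cos_multiple[of n "t * x"] by (simp add: mult.assoc)
  qed
  then show ?thesis unfolding one_minus_Re_char(1)[OF M] integral_mult_right_zero .
qed

lemma one_minus_char_bound: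
  assumes M: "real_distribution M" and b: "\<beta> > 0" and t: "\<bar>t\<bar> \<le> 1 / \<beta>"
  shows "cmod (1 - char M t) \<le> 2 * kappa M \<beta>"
proof -
  interpret real_distribution M by fact
  note fM = real_distributionD(2)[OF M]
  have i: "integrable M (\<lambda>x. iexp (t * x))"
    by (rule integrable_bounded_borel[OF fM iexp_measurable, where B=1]) simp
  have i1: "integrable M (\<lambda>x. 1 - iexp (t * x))" using i by simp
  have "1 - char M t = (\<integral>x. 1 - iexp (t * x) \<partial>M)"
    unfolding char_def using i by (simp add: real_distributionD(5)[OF M])
  also have "cmod ... \<le> (\<integral>x. cmod (1 - iexp (t * x)) \<partial>M)" by (rule integral_norm_bound)
  also have "... \<le> (\<integral>x. 2 * min 1 (\<bar>x\<bar> / \<beta>) \<partial>M)"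
  proof (rule integral_mono)
    show "integrable M (\<lambda>x. cmod (1 - iexp (t * x)))" using i1 by (rule integrable_norm)
    show "integrable M (\<lambda>x. 2 * min 1 (\<bar>x\<bar> / \<beta>))" by (intro integrable_mult_right kappa_integrable fM b)
    show "cmod (1 - iexp (t * x)) \<le> 2 * min 1 (\<bar>x\<bar> / \<beta>)" for x
    proof -
      have "cmod (1 - iexp (t * x)) \<le> 2" using norm_triangle_ineq4[of 1 "iexp (t * x)"] by simp
      moreover have "cmod (iexp (t * x) - 1) \<le> \<bar>t * x\<bar>" using iexp_approx1[of "t * x" 0] by simp
      moreover have "\<bar>t * x\<bar> \<le> \<bar>x\<bar> / \<beta>" using mult_right_mono[OF t, of "\<bar>x\<bar>"] by (simp add: abs_mult)
      moreover have "0 \<le> \<bar>x\<bar> / \<beta>" using b by simp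
      ultimately show ?thesis by (simp add: norm_minus_commute min_def)
    qed
  qed
  also have "... = 2 * kappa M \<beta>" by (simp add: kappa_def)
  finally show ?thesis .
qed

text \<open>A bound near 0 extends to all frequencies with quadratic growth, which the Gaussian
integrates.\<close>
lemma gaussian_average_multiple:
  fixes h :: "real \<Rightarrow> real"
  assumes b: "\<And>t. \<bar>h t\<bar> \<le> B" and m: "(\<lambda>z. h (s * z)) \<in> borel_measurable borel" and s: "s > 0"
    and le: "\<And>t. \<bar>t\<bar> \<le> s ==> h t \<le> \<eta>" and mult: "\<And>n t. h (real n * t) \<le> (real n)^2 * h t"
  shows "(\<integral>z. h (s * z) \<partial>std_normal_distribution) \<le> 4 * \<eta>"
proof -
  let ?N = "std_normal_distribution"
  interpret N: real_distribution ?N by (rule real_dist_normal_dist)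
  have fN: "finite_borel ?N" by (rule real_distributionD(2)[OF real_dist_normal_dist])
  have "0 \<le> h 0" using mult[of 2 0] by simp
  then have eta: "0 \<le> \<eta>" using le[of 0] s by simp
  have bd: "h (s * z) \<le> \<eta> * (2 * z^2 + 2)" for z
  proof -
    define n where "n = nat \<lfloor>\<bar>z\<bar>\<rfloor> + 1"
    have n: "\<bar>z\<bar> \<le> real n" "1 \<le> real n" "real n \<le> \<bar>z\<bar> + 1" unfolding n_def by linarith+
    have "s * z = real n * (s * z / real n)" using n(2) by simp
    then have "h (s * z) \<le> (real n)^2 * h (s * z / real n)" using mult[of n "s * z / real n"] by simp
    also have "... \<le> (real n)^2 * \<eta>"
    proof (rule mult_left_mono[OF le])
      have "s * \<bar>z\<bar> \<le> s * real n" using n(1) s by (intro mult_left_mono) auto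
      then show "\<bar>s * z / real n\<bar> \<le> s" using n(2) s by (simp add: abs_mult pos_divide_le_eq)
    qed simp
    also have "(real n)^2 * \<eta> \<le> (\<bar>z\<bar> + 1)^2 * \<eta>" using n eta by (intro mult_right_mono power_mono) auto
    also have "... \<le> (2 * z^2 + 2) * \<eta>"
    proof (rule mult_right_mono[OF _ eta])
      have "0 \<le> (\<bar>z\<bar> - 1)^2" by simp
      then show "(\<bar>z\<bar> + 1)^2 \<le> 2 * z^2 + 2" by (simp add: power2_eq_square algebra_simps)
    qed
    finally show ?thesis by (simp only: mult.commute)
  qed
  have mom: "(\<integral>z. z^2 \<partial>?N) = 1" "integrable ?N (\<lambda>z. z^2)"
    using std_normal_distribution_even_moments[of 1] by simp_all
  have "(\<integral>z. h (s * z) \<partial>?N) \<le> (\<integral>z. \<eta> * (2 * z^2 + 2) \<partial>?N)"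
  proof (rule integral_mono[OF _ _ bd])
    show "integrable ?N (\<lambda>z. h (s * z))" by (rule integrable_bounded_borel[OF fN m, where B=B]) (use b in simp)
    show "integrable ?N (\<lambda>z. \<eta> * (2 * z^2 + 2))" using mom by simp
  qed
  also have "... = \<eta> * (2 * 1 + 2)"
    using mom(2) by (simp add: mom(1) real_distributionD(5)[OF real_dist_normal_dist])
  finally show ?thesis by simp
qed

lemma second_order_exp:
  assumes "cmod w \<le> 2"
  shows "cmod (exp w - (1 + w)) \<le> exp 2 * (cmod w)^2"
proof -
  have "cmod (exp w - (1 + w)) \<le> exp \<bar>Re w\<bar> * (cmod w)^2"
    using Taylor_exp[of w 1] by (simp add: power2_eq_square)
  also have "... \<le> exp 2 * (cmod w)^2"
    using abs_Re_le_cmod[of w] assms by (intro mult_right_mono) auto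
  finally show ?thesis .
qed

definition levy_symbol :: "real measure \<Rightarrow> real \<Rightarrow> complex" where
  "levy_symbol \<mu> t = char (centered \<mu>) t - 1"

lemma char_centered:
  assumes m: "real_distribution \<mu>"
  shows "char \<mu> t = iexp (t * truncated_mean \<mu>) * (1 + levy_symbol \<mu> t)"
proof -
  have "char (centered \<mu>) t = (\<integral>x. iexp (t * (x - truncated_mean \<mu>)) \<partial>\<mu>)"
    unfolding char_def by (rule integral_centered[OF m iexp_measurable])
  also have "... = (\<integral>x. iexp (- (t * truncated_mean \<mu>)) * iexp (t * x) \<partial>\<mu>)"
    unfolding mult_exp_exp by (simp add: algebra_simps)
  also have "... = iexp (- (t * truncated_mean \<mu>)) * char \<mu> t"
    unfolding char_def by (rule integral_mult_right_zero)
  finally have "iexp (t * truncated_mean \<mu>) * (1 + levy_symbol \<mu> t)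
      = (iexp (t * truncated_mean \<mu>) * iexp (- (t * truncated_mean \<mu>))) * char \<mu> t"
    by (simp add: levy_symbol_def)
  also have "iexp (t * truncated_mean \<mu>) * iexp (- (t * truncated_mean \<mu>)) = 1"
    unfolding mult_exp_exp by simp
  finally show ?thesis by simp
qed

lemma levy_symbol_eq:
  assumes m: "real_distribution \<mu>"
  shows "levy_symbol \<mu> t = \<i> * of_real (t * levy_drift \<mu>) + (\<integral>x. lk_kernel t x \<partial>levy_part \<mu>)"
proof -
  note C = real_distribution_centered[OF m]
  note fC = real_distributionD(2)[OF C]
  have e: "(x^2 / (1 + x^2)) *\<^sub>R lk_kernel t x
     = iexp (t * x) - 1 - \<i> * of_real t * of_real (x / (1 + x^2))" for x
  proof (cases "x = 0")
    case False
    have cancel: "A * (B * P) = B" if "A * P = 1" for A B P :: complex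
      using that by (simp add: mult.left_commute)
    have p: "1 + x^2 \<noteq> 0" by (metis add_pos_nonneg less_irrefl zero_le_power2 zero_less_one)
    have "complex_of_real (x^2 / (1 + x^2)) * of_real ((1 + x^2) / x^2) = 1"
      unfolding of_real_mult[symmetric] using p False by simp
    then have "(x^2 / (1 + x^2)) *\<^sub>R lk_kernel t x = iexp (t * x) - 1 - \<i> * of_real (t * x) / of_real (1 + x^2)"
      using False by (simp only: levy_khintchine_kernel_def scaleR_conv_of_real if_False cancel)
    also have "\<i> * complex_of_real (t * x) / of_real (1 + x^2) = \<i> * of_real t * of_real (x / (1 + x^2))"
      by (simp only: of_real_mult of_real_divide times_divide_eq_right mult.assoc)
    finally show ?thesis .
  qed simp
  have i1: "integrable (centered \<mu>) (\<lambda>x. iexp (t * x))"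
    by (rule integrable_bounded_borel[OF fC iexp_measurable, where B=1]) simp
  have i2: "integrable (centered \<mu>) (\<lambda>x. \<i> * of_real t * complex_of_real (x / (1 + x^2)))"
    by (intro integrable_mult_right integrable_of_real drift_integrable fC)
  have i3: "integrable (centered \<mu>) (\<lambda>x. 1 :: complex)"
    by (rule integrable_bounded_borel[OF fC, where B=1]) auto
  have "(\<integral>x. lk_kernel t x \<partial>levy_part \<mu>)
     = (\<integral>x. iexp (t * x) - 1 - \<i> * of_real t * of_real (x / (1 + x^2)) \<partial>centered \<mu>)"
    unfolding integral_levy_part[OF m lk_kernel_measurable] e ..
  also have "... = (\<integral>x. iexp (t * x) \<partial>centered \<mu>) - (\<integral>x. 1 \<partial>centered \<mu>)
      - (\<integral>x. \<i> * of_real t * of_real (x / (1 + x^2)) \<partial>centered \<mu>)"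
    by (simp only: Bochner_Integration.integral_diff[OF Bochner_Integration.integrable_diff[OF i1 i3] i2]
      Bochner_Integration.integral_diff[OF i1 i3])
  also have "(\<integral>x. \<i> * of_real t * complex_of_real (x / (1 + x^2)) \<partial>centered \<mu>) = \<i> * of_real t * of_real (levy_drift \<mu>)"
    unfolding integral_mult_right_zero integral_complex_of_real levy_drift_def ..
  also have "(\<integral>x. (1::complex) \<partial>centered \<mu>) = 1" using real_distributionD(4,5)[OF C] by simp
  finally show ?thesis by (simp add: levy_symbol_def char_def)
qed

lemma levy_symbol_le_2:
  assumes m: "real_distribution \<mu>"
  shows "cmod (levy_symbol \<mu> t) \<le> 2"
proof -
  interpret real_distribution "centered \<mu>" by (rule real_distribution_centered[OF m])
  show ?thesis unfolding levy_symbol_def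
    using norm_triangle_ineq4[of "char (centered \<mu>) t" 1] cmod_char_le_1[of t] by simp
qed

lemma levy_symbol_bound:
  assumes m: "real_distribution \<mu>" and a: "\<bar>truncated_mean \<mu>\<bar> \<le> 1 / 2"
  shows "cmod (levy_symbol \<mu> t) \<le> (4 + 7 * \<bar>t\<bar> + t^2) * levy_mass \<mu>"
proof -
  note f = emeasure_levy_part[OF m]
  have "cmod (levy_symbol \<mu> t) \<le> \<bar>t * levy_drift \<mu>\<bar> + cmod (\<integral>x. lk_kernel t x \<partial>levy_part \<mu>)"
    unfolding levy_symbol_eq[OF m] by (rule order_trans[OF norm_triangle_ineq]) (simp add: norm_mult abs_mult)
  also have "cmod (\<integral>x. lk_kernel t x \<partial>levy_part \<mu>) \<le> (4 + \<bar>t\<bar> + t^2) * levy_mass \<mu>"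
    unfolding f(2)[symmetric] by (rule norm_integral_bound[OF f(1) lk_kernel_measurable lk_kernel_bound])
  also have "\<bar>t * levy_drift \<mu>\<bar> \<le> \<bar>t\<bar> * (6 * levy_mass \<mu>)"
    unfolding abs_mult by (intro mult_left_mono levy_drift_bound[OF m a]) simp
  finally show ?thesis by (simp add: algebra_simps)
qed

lemma lk_exponent_row:
  assumes m: "\<And>j. 1 \<le> j ==> j \<le> m ==> real_distribution (\<nu> j)"
  shows "lk_exponent (gamma_row c \<nu> m) (sigma_row \<nu> m) t
    = \<i> * of_real (t * c) + (\<Sum>j=1..m. \<i> * of_real (t * truncated_mean (\<nu> j)) + levy_symbol (\<nu> j) t)"
proof -
  have "(\<integral>x. lk_kernel t x \<partial>sigma_row \<nu> m) = (\<Sum>j=1..m. \<integral>x. lk_kernel t x \<partial>levy_part (\<nu> j))"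
    by (rule integral_sigma_row[OF m lk_kernel_measurable lk_kernel_bound])
  moreover have "(\<Sum>j=1..m. \<i> * of_real (t * truncated_mean (\<nu> j)) + levy_symbol (\<nu> j) t)
     = (\<Sum>j=1..m. \<i> * of_real (t * truncated_mean (\<nu> j)) + (\<i> * of_real (t * levy_drift (\<nu> j))
         + (\<integral>x. lk_kernel t x \<partial>levy_part (\<nu> j))))"
    by (intro sum.cong refl) (simp add: levy_symbol_eq m)
  ultimately show ?thesis
    unfolding lk_exponent_def gamma_row_def levy_drift_def[symmetric]
    by (simp add: sum.distrib distrib_right distrib_left sum_distrib_left sum_distrib_right mult_ac)
qed

text \<open>Along a subsequence \<open>X \<circ> r\<close> converging to \<open>N\<close>, the factors \<open>exp (i t g)\<close> are
characteristic functions of point masses that converge to a continuous function, hence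
tight; so \<open>g\<close> is bounded there, and uniqueness identifies both limits.\<close>
lemma lk_converges_imp:
  assumes X: "\<And>n. finite_borel (X n)" and s: "finite_borel \<sigma>"
    and B: "\<And>n. measure (X n) UNIV \<le> B" and t: "tight_seq X"
    and lim: "\<And>t. (\<lambda>n. exp (lk_exponent (g n) (X n) t)) \<longlonglongrightarrow> exp (lk_exponent \<gamma> \<sigma> t)"
  shows "weakly_converges X \<sigma>" "g \<longlonglongrightarrow> \<gamma>"
proof -
  have core: "N = \<sigma> \<and> (\<exists>q. strict_mono q \<and> (\<lambda>n. g (r (q n))) \<longlonglongrightarrow> \<gamma>)"
    if r: "strict_mono (r :: nat \<Rightarrow> nat)" and N: "finite_borel N" and W: "weakly_converges (X \<circ> r) N" for r N
  proof -
    have lx: "(\<lambda>n. lk_exponent 0 (X (r n)) t) \<longlonglongrightarrow> lk_exponent 0 N t" for t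
      using lk_exponent_converges[OF W _ N, of "\<lambda>_. 0" 0 t] X by (simp add: o_def)
    define u where "u t = exp (lk_exponent \<gamma> \<sigma> t - lk_exponent 0 N t)" for t
    have "char (return borel (g n)) t = exp (lk_exponent (g n) (X n) t) / exp (lk_exponent 0 (X n) t)" for n t
      unfolding char_return exp_diff[symmetric] by (simp add: lk_exponent_def mult.commute)
    then have cu: "(\<lambda>n. char (return borel (g (r n))) t) \<longlonglongrightarrow> u t" for t
      unfolding u_def exp_diff
      using tendsto_divide[OF LIMSEQ_subseq_LIMSEQ[OF lim r] tendsto_exp[OF lx], of t] by (simp add: o_def)
    have "continuous_on UNIV u" unfolding u_def
      by (intro continuous_on_exp continuous_on_diff lk_exponent_continuous s N)
    then have uc: "isCont u 0" by (simp add: continuous_on_eq_continuous_at)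
    have "tight_seq (\<lambda>n. return borel (g (r n)))"
      by (rule tight_of_char_converges[OF real_distribution_return cu uc])
    then have "\<exists>R>0. \<forall>n. measure (return borel (g (r n))) {x. \<bar>x\<bar> > R} \<le> 1 / 2"
      by (intro tight_seq_uniform) (auto intro: real_distributionD(2) real_distribution_return)
    then obtain R where R: "R > 0" "\<And>n. measure (return borel (g (r n))) {x. \<bar>x\<bar> > R} \<le> 1 / 2" by metis
    have "\<bar>g (r n)\<bar> \<le> R" for n
    proof (rule ccontr)
      assume "\<not> \<bar>g (r n)\<bar> \<le> R"
      moreover have "{x::real. \<bar>x\<bar> > R} \<in> sets borel" by measurable
      ultimately have "measure (return borel (g (r n))) {x. \<bar>x\<bar> > R} = 1" by (simp add: measure_return)
      then show False using R(2)[of n] by simp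
    qed
    then have "bounded (range (\<lambda>n. g (r n)))" by (intro boundedI[of _ R]) auto
    then obtain l q where q: "strict_mono q" "((\<lambda>n. g (r n)) \<circ> q) \<longlonglongrightarrow> l"
      using bounded_imp_convergent_subsequence by metis
    have "(\<lambda>n. exp (lk_exponent (g (r (q n))) (X (r (q n))) t)) \<longlonglongrightarrow> exp (lk_exponent l N t)" for t
      using tendsto_exp[OF lk_exponent_converges[OF weakly_converges_subseq[OF W q(1)] _ N q(2)]] X by (simp add: o_def)
    moreover have "(\<lambda>n. exp (lk_exponent (g (r (q n))) (X (r (q n))) t)) \<longlonglongrightarrow> exp (lk_exponent \<gamma> \<sigma> t)" for t
      using LIMSEQ_subseq_LIMSEQ[OF LIMSEQ_subseq_LIMSEQ[OF lim r] q(1)] by (simp add: o_def)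
    ultimately have eq: "exp (lk_exponent l N t) = exp (lk_exponent \<gamma> \<sigma> t)" for t
      using LIMSEQ_unique by blast
    have "l = \<gamma>" "N = \<sigma>" by (rule lk_exponent_unique[OF N s eq])+
    then show ?thesis using q by (auto simp: o_def)
  qed
  show W: "weakly_converges X \<sigma>"
    by (rule weakly_convergesI_tight[OF X B t]) (use core in blast)
  show "g \<longlonglongrightarrow> \<gamma>"
  proof (rule tendsto_subsubseqI)
    fix r :: "nat \<Rightarrow> nat" assume r: "strict_mono r"
    show "\<exists>s. strict_mono s \<and> (\<lambda>n. g (r (s n))) \<longlonglongrightarrow> \<gamma>"
      using core[OF r s weakly_converges_subseq[OF W r]] by blast
  qed
qed

lemma exp_le_of_prod_ge:
  fixes y :: "'i \<Rightarrow> real"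
  assumes "finite I" and y: "\<And>i. i \<in> I ==> y i \<le> 1" and p: "(\<Prod>i\<in>I. 1 - y i) \<ge> 1 - 2 * \<eta>"
    and eta: "0 \<le> \<eta>" "\<eta> \<le> 1 / 4"
  shows "(\<Sum>i\<in>I. y i) \<le> 4 * \<eta>"
proof (rule ccontr)
  assume n: "\<not> ?thesis"
  have "(\<Prod>i\<in>I. 1 - y i) \<le> (\<Prod>i\<in>I. exp (- y i))"
  proof (rule prod_mono)
    fix i assume "i \<in> I"
    then show "0 \<le> 1 - y i \<and> 1 - y i \<le> exp (- y i)" using y[of i] exp_ge_add_one_self[of "- y i"] by simp
  qed
  also have "... = exp (- (\<Sum>i\<in>I. y i))" using assms(1) by (simp add: exp_sum sum_negf[symmetric])
  also have "... < exp (- (4 * \<eta>))" using n by simp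
  also have "... \<le> 1 - 2 * \<eta>"
  proof -
    have "(1 - 2 * \<eta>) * (1 + 4 * \<eta>) = 1 + 2 * \<eta> * (1 - 4 * \<eta>)" by (simp add: algebra_simps)
    also have "... \<ge> 1" using eta by simp
    finally have "1 \<le> (1 - 2 * \<eta>) * exp (4 * \<eta>)"
      using mult_left_mono[OF exp_ge_add_one_self[of "4 * \<eta>"], of "1 - 2 * \<eta>"] eta by linarith
    then show ?thesis by (simp add: exp_minus pos_divide_le_eq[symmetric] inverse_eq_divide)
  qed
  finally show False using p by simp
qed

section \<open>The classical limit theorem\<close>

context infinitesimal_rows
begin

abbreviation (input) "classical_row n \<equiv> iterated_convolution convolution (return borel (c n)) (\<nu> n) (k n)"

lemma classical_row_distribution: "real_distribution (classical_row n)"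
  and char_classical_row: "char (classical_row n) t = iexp (t * c n) * (\<Prod>j=1..k n. char (\<nu> n j) t)"
  using iterated_classical_convolution[where \<nu>="\<nu> n" and m="k n" and c="c n" and t=t, OF m] by blast+

lemma row_mass: "row_mass n = (\<Sum>j=1..k n. levy_mass (\<nu> n j))"
  by (rule sigma_row_finite(2)[OF m])

lemma truncated_mean_small:
  assumes "e n \<le> 1 / 2" "1 \<le> j" "j \<le> k n"
  shows "\<bar>truncated_mean (\<nu> n j)\<bar> \<le> 1 / 2"
  using truncated_mean_kappa[OF m] ke assms by (meson order_trans)

lemma symbol_square_sum:
  assumes en: "e n \<le> 1 / 2"
  shows "(\<Sum>j=1..k n. (cmod (levy_symbol (\<nu> n j) t))^2)
    \<le> 2 * (4 + 7 * \<bar>t\<bar> + t^2)^2 * (e n * row_mass n)"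
proof -
  define C where "C = 4 + 7 * \<bar>t\<bar> + t^2"
  have C: "C \<ge> 0" by (simp add: C_def)
  have "(\<Sum>j=1..k n. (cmod (levy_symbol (\<nu> n j) t))^2) \<le> (\<Sum>j=1..k n. 2 * C^2 * e n * levy_mass (\<nu> n j))"
  proof (rule sum_mono)
    fix j assume "j \<in> {1..k n}"
    then have j: "1 \<le> j" "j \<le> k n" by auto
    have b: "cmod (levy_symbol (\<nu> n j) t) \<le> C * levy_mass (\<nu> n j)"
      unfolding C_def by (rule levy_symbol_bound[OF m[OF j] truncated_mean_small[OF en j]])
    have k2: "levy_mass (\<nu> n j) \<le> 2 * e n" using levy_mass_kappa[OF m[OF j]] ke[OF j] by linarith
    have "(cmod (levy_symbol (\<nu> n j) t))^2 \<le> (C * levy_mass (\<nu> n j))^2" by (intro power_mono b) simp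
    also have "... = C^2 * (levy_mass (\<nu> n j) * levy_mass (\<nu> n j))" by (simp add: power_mult_distrib power2_eq_square)
    also have "... \<le> C^2 * (2 * e n * levy_mass (\<nu> n j))"
      using k2 levy_mass_nonneg by (intro mult_left_mono mult_right_mono) auto
    finally show "(cmod (levy_symbol (\<nu> n j) t))^2 \<le> 2 * C^2 * e n * levy_mass (\<nu> n j)" by simp
  qed
  also have "... = 2 * C^2 * (e n * row_mass n)"
    unfolding row_mass by (simp only: sum_distrib_left mult.assoc)
  finally show ?thesis by (simp add: C_def)
qed

text \<open>The factors of both products have modulus at most 1, so the difference of the products is at most
the sum of the differences, which are quadratic in the symbol.\<close>
lemma classical_row_char:
  assumes en: "e n \<le> 1 / 2"
  shows "cmod (char (classical_row n) t - exp (lk_exponent (row_drift n) (row_measure n) t))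
    \<le> exp 2 * (2 * (4 + 7 * \<bar>t\<bar> + t^2)^2 * (e n * row_mass n))"
proof -
  define a where "a j = iexp (t * truncated_mean (\<nu> n j))" for j
  define w where "w j = levy_symbol (\<nu> n j) t" for j
  have "char (classical_row n) t = iexp (t * c n) * (\<Prod>j=1..k n. char (\<nu> n j) t)"
    by (rule char_classical_row)
  also have "(\<Prod>j=1..k n. char (\<nu> n j) t) = (\<Prod>j=1..k n. a j * (1 + w j))"
    unfolding a_def w_def by (intro prod.cong refl char_centered m) auto
  finally have 1: "char (classical_row n) t = iexp (t * c n) * (\<Prod>j=1..k n. a j * (1 + w j))" .
  have 2: "exp (lk_exponent (row_drift n) (row_measure n) t)
      = iexp (t * c n) * (\<Prod>j=1..k n. a j * exp (w j))"
  proof -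
    have "lk_exponent (row_drift n) (row_measure n) t
      = \<i> * of_real (t * c n) + (\<Sum>j=1..k n. \<i> * of_real (t * truncated_mean (\<nu> n j)) + levy_symbol (\<nu> n j) t)"
      by (rule lk_exponent_row[OF m])
    then show ?thesis by (simp only: a_def w_def exp_add exp_sum[OF finite_atLeastAtMost])
  qed
  have na: "cmod (a j) = 1" for j unfolding a_def by (rule norm_iexp)
  have b1: "cmod (a j * (1 + w j)) \<le> 1" and b2: "cmod (a j * exp (w j)) \<le> 1" if "j \<in> {1..k n}" for j
  proof -
    interpret real_distribution "centered (\<nu> n j)" using that by (intro real_distribution_centered m) auto
    have e: "1 + w j = char (centered (\<nu> n j)) t" by (simp add: w_def levy_symbol_def)
    show "cmod (a j * (1 + w j)) \<le> 1" unfolding norm_mult na e using cmod_char_le_1 by simp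
    have "Re (1 + w j) \<le> 1" using complex_Re_le_cmod[of "1 + w j"] cmod_char_le_1[of t] unfolding e by linarith
    then show "cmod (a j * exp (w j)) \<le> 1" unfolding norm_mult na by simp
  qed
  have "cmod (char (classical_row n) t - exp (lk_exponent (row_drift n) (row_measure n) t))
     = cmod ((\<Prod>j=1..k n. a j * (1 + w j)) - (\<Prod>j=1..k n. a j * exp (w j)))"
    unfolding 1 2 right_diff_distrib[symmetric] norm_mult norm_iexp by simp
  also have "... \<le> (\<Sum>j=1..k n. cmod (a j * (1 + w j) - a j * exp (w j)))"
    by (rule norm_prod_diff[OF b1 b2])
  also have "... \<le> (\<Sum>j=1..k n. exp 2 * (cmod (w j))^2)"
  proof (rule sum_mono)
    fix j assume "j \<in> {1..k n}"
    then have "cmod (w j) \<le> 2" unfolding w_def by (intro levy_symbol_le_2 m) auto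
    then show "cmod (a j * (1 + w j) - a j * exp (w j)) \<le> exp 2 * (cmod (w j))^2"
      unfolding right_diff_distrib[symmetric] norm_mult na using second_order_exp[of "w j"]
      by (simp add: norm_minus_commute)
  qed
  also have "... = exp 2 * (\<Sum>j=1..k n. (cmod (w j))^2)" by (simp add: sum_distrib_left)
  also have "... \<le> exp 2 * (2 * (4 + 7 * \<bar>t\<bar> + t^2)^2 * (e n * row_mass n))"
    unfolding w_def by (intro mult_left_mono symbol_square_sum en) simp
  finally show ?thesis .
qed

lemma classical_row_comparison:
  assumes B: "\<And>n. row_mass n \<le> B"
  shows "(\<lambda>n. char (classical_row n) t - exp (lk_exponent (row_drift n) (row_measure n) t)) \<longlonglongrightarrow> 0"
proof (rule Lim_null_comparison)
  have B0: "B \<ge> 0" using B[of 0] measure_nonneg order_trans by blast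
  define C where "C = exp 2 * (2 * (4 + 7 * \<bar>t\<bar> + t^2)^2)"
  have C: "C \<ge> 0" by (simp add: C_def)
  have "eventually (\<lambda>n. e n < 1 / 2) sequentially" by (rule e_small) simp
  then show "eventually (\<lambda>n. cmod (char (classical_row n) t
      - exp (lk_exponent (row_drift n) (row_measure n) t)) \<le> C * (\<bar>e n\<bar> * B)) sequentially"
  proof eventually_elim
    case (elim n)
    have "e n * row_mass n \<le> \<bar>e n\<bar> * B" by (intro mult_mono B) auto
    then have "C * (e n * row_mass n) \<le> C * (\<bar>e n\<bar> * B)" by (rule mult_left_mono[OF _ C])
    moreover have "cmod (char (classical_row n) t - exp (lk_exponent (row_drift n) (row_measure n) t))
        \<le> C * (e n * row_mass n)"
      using classical_row_char[of n t] elim unfolding C_def mult.assoc by linarith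
    ultimately show ?case by linarith
  qed
  have "(\<lambda>n. C * (\<bar>e n\<bar> * B)) \<longlonglongrightarrow> C * (\<bar>0\<bar> * B)" by (intro tendsto_intros e)
  then show "(\<lambda>n. C * (\<bar>e n\<bar> * B)) \<longlonglongrightarrow> 0" by simp
qed

lemma classical_row_char_limit:
  assumes W: "weakly_converges row_measure \<sigma>" and g: "row_drift \<longlonglongrightarrow> \<gamma>"
  shows "(\<lambda>n. char (classical_row n) t) \<longlonglongrightarrow> exp (lk_exponent \<gamma> \<sigma> t)"
proof -
  have "convergent (\<lambda>n. row_mass n)"
    using weakly_converges_mass[OF W row_finite s] by (rule convergentI)
  from convergent_imp_Bseq[OF this] obtain B where "\<forall>n. norm (row_mass n) \<le> B"
    by (rule BseqE)
  then have B: "row_mass n \<le> B" for n by simp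
  have "(\<lambda>n. exp (lk_exponent (row_drift n) (row_measure n) t)) \<longlonglongrightarrow> exp (lk_exponent \<gamma> \<sigma> t)"
    by (rule tendsto_exp[OF lk_exponent_converges[OF W row_finite s g]])
  from tendsto_add[OF classical_row_comparison[OF B, of t] this] show ?thesis by simp
qed

text \<open>\<open>1 - |1 + w|\<^sup>2 = - 2 Re w - |w|\<^sup>2\<close>, and a product of numbers in \<open>[0,1]\<close> close to 1 bounds the sum of their
defects. In this way the translations drop out.\<close>
lemma row_symmetrized:
  assumes en: "e n \<le> 1 / 2" and t: "\<bar>t\<bar> \<le> 1"
    and ch: "cmod (1 - char (classical_row n) t) \<le> \<eta>" and eta: "\<eta> \<le> 1 / 4"
  shows "(\<Sum>j=1..k n. 1 - Re (char (centered (\<nu> n j)) t)) \<le> 2 * \<eta> + 144 * (e n * row_mass n)"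
proof -
  define w where "w j = levy_symbol (\<nu> n j) t" for j
  define y where "y j = 1 - (cmod (1 + w j))^2" for j
  have e0: "0 \<le> \<eta>" using ch norm_ge_zero order_trans by blast
  have "char (classical_row n) t = iexp (t * c n) * (\<Prod>j=1..k n. char (\<nu> n j) t)"
    by (rule char_classical_row)
  then have "cmod (char (classical_row n) t) = (\<Prod>j=1..k n. cmod (char (\<nu> n j) t))"
    by (simp only: norm_mult norm_iexp prod_norm[symmetric] mult_1_left)
  also have "... = (\<Prod>j=1..k n. cmod (1 + w j))"
    by (intro prod.cong refl) (simp add: char_centered m norm_mult w_def)
  finally have cc: "cmod (char (classical_row n) t) = (\<Prod>j=1..k n. cmod (1 + w j))" .
  have "1 - \<eta> \<le> cmod (char (classical_row n) t)" using ch norm_triangle_ineq2[of 1 "char (classical_row n) t"] by simp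
  then have "(1 - \<eta>)^2 \<le> (\<Prod>j=1..k n. cmod (1 + w j))^2" unfolding cc using eta by (intro power_mono) auto
  also have "... = (\<Prod>j=1..k n. 1 - y j)" unfolding y_def by (simp add: prod_power_distrib)
  finally have "1 - 2 * \<eta> \<le> (\<Prod>j=1..k n. 1 - y j)" by (simp add: power2_diff) (use zero_le_power2[of \<eta>] in linarith)
  then have ys: "(\<Sum>j=1..k n. y j) \<le> 4 * \<eta>"
    by (intro exp_le_of_prod_ge e0 eta) (auto simp: y_def)
  have "1 - Re (char (centered (\<nu> n j)) t) = (y j + (cmod (w j))^2) / 2" for j
    unfolding y_def w_def levy_symbol_def by (simp add: cmod_power2 power2_diff)
  then have "(\<Sum>j=1..k n. 1 - Re (char (centered (\<nu> n j)) t)) = ((\<Sum>j=1..k n. y j) + (\<Sum>j=1..k n. (cmod (w j))^2)) / 2"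
    by (simp only: sum.distrib sum_divide_distrib[symmetric])
  also have "... \<le> (4 * \<eta> + 288 * (e n * row_mass n)) / 2"
  proof (intro divide_right_mono add_mono ys)
    show "(\<Sum>j=1..k n. (cmod (w j))^2) \<le> 288 * (e n * row_mass n)"
    proof (cases "k n = 0")
      case False
      then have "0 \<le> e n" using ke[of 1 n] kappa_nonneg[of 1 "\<nu> n 1"] by simp
      then have em: "0 \<le> e n * row_mass n" by simp
      have "t^2 \<le> 1" using t by (simp add: abs_square_le_1)
      then have "(4 + 7 * \<bar>t\<bar> + t^2)^2 \<le> 12\<^sup>2" using t by (intro power_mono) auto
      then have "2 * (4 + 7 * \<bar>t\<bar> + t^2)^2 * (e n * row_mass n)
          \<le> 288 * (e n * row_mass n)" by (intro mult_right_mono em) simp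
      then show ?thesis using symbol_square_sum[OF en, of t] unfolding w_def by linarith
    qed (use row_mass[of n] in simp)
  qed simp
  finally show ?thesis by simp
qed

lemma row_tail:
  assumes en: "e n \<le> 1 / 2" and s1: "0 < s" "s \<le> 1" and eta: "\<eta> \<le> 1 / 4"
    and ch: "\<And>t. \<bar>t\<bar> \<le> s ==> cmod (1 - char (classical_row n) t) \<le> \<eta>"
  shows "(\<Sum>j=1..k n. \<integral>x. x^2 / (x^2 + (1 / s)^2) \<partial>centered (\<nu> n j))
    \<le> 16 * \<eta> + 1152 * (e n * row_mass n)"
proof -
  let ?N = "std_normal_distribution" and ?em = "e n * row_mass n"
  define h where "h t = (\<Sum>j=1..k n. 1 - Re (char (centered (\<nu> n j)) t))" for t
  have C: "real_distribution (centered (\<nu> n j))" if "j \<in> {1..k n}" for j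
    using that by (intro real_distribution_centered m) auto
  have cm: "(\<lambda>z. 1 - Re (char (centered (\<nu> n j)) (s * z))) \<in> borel_measurable borel" if "j \<in> {1..k n}" for j
    using char_scaled_measurable[OF C[OF that]] by measurable
  have fN: "finite_borel ?N" by (rule real_distributionD(2)[OF real_dist_normal_dist])
  have "(\<Sum>j=1..k n. \<integral>x. x^2 / (x^2 + (1 / s)^2) \<partial>centered (\<nu> n j))
     \<le> (\<Sum>j=1..k n. 2 * (\<integral>z. 1 - Re (char (centered (\<nu> n j)) (s * z)) \<partial>?N))"
  by (intro sum_mono gaussian_tail C s1(1))
  also have "... = 2 * (\<integral>z. h (s * z) \<partial>?N)"
    unfolding h_def sum_distrib_left[symmetric]
  proof (subst Bochner_Integration.integral_sum)
    show "integrable ?N (\<lambda>z. 1 - Re (char (centered (\<nu> n j)) (s * z)))" if "j \<in> {1..k n}" for j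
      by (rule integrable_bounded_borel[OF fN cm[OF that], where B=2])
         (use one_minus_Re_char(3,4)[OF C[OF that]] in simp)
  qed simp
  also have "(\<integral>z. h (s * z) \<partial>?N) \<le> 4 * (2 * \<eta> + 144 * ?em)"
  proof (rule gaussian_average_multiple[where B="\<Sum>j=1..k n. 2"])
    show "\<bar>h t\<bar> \<le> (\<Sum>j=1..k n. 2)" for t
      unfolding h_def by (rule order_trans[OF sum_abs sum_mono]) (use one_minus_Re_char(3,4)[OF C] in simp)
    show "(\<lambda>z. h (s * z)) \<in> borel_measurable borel"
      unfolding h_def by (intro borel_measurable_sum cm)
    show "h t \<le> 2 * \<eta> + 144 * ?em" if "\<bar>t\<bar> \<le> s" for t
      unfolding h_def using that s1 by (intro row_symmetrized en ch eta) auto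
    show "h (real l * t) \<le> (real l)^2 * h t" for l t
      unfolding h_def sum_distrib_left by (intro sum_mono one_minus_Re_char_multiple C)
  qed (rule s1(1))
  finally show ?thesis by simp
qed

lemma row_tail_sigma:
  assumes s1: "0 < s" "s \<le> 1"
  shows "s^2 * row_mass n \<le> (\<Sum>j=1..k n. \<integral>x. x^2 / (x^2 + (1 / s)^2) \<partial>centered (\<nu> n j))"
    "(\<integral>x. x^2 / (x^2 + (1 / s)^2) \<partial>row_measure n) \<le> (\<Sum>j=1..k n. \<integral>x. x^2 / (x^2 + (1 / s)^2) \<partial>centered (\<nu> n j))"
proof -
  have y: "1 / s > 0" using s1 by simp
  have C: "finite_borel (centered (\<nu> n j))" if "j \<in> {1..k n}" for j
    using that by (intro real_distributionD(2) real_distribution_centered m) auto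
  show "s^2 * row_mass n \<le> (\<Sum>j=1..k n. \<integral>x. x^2 / (x^2 + (1 / s)^2) \<partial>centered (\<nu> n j))"
    unfolding row_mass sum_distrib_left
  proof (rule sum_mono)
    fix j assume j: "j \<in> {1..k n}"
    have "s^2 * levy_mass (\<nu> n j) = (\<integral>x. s^2 * (x^2 / (1 + x^2)) \<partial>centered (\<nu> n j))"
      unfolding levy_mass_def integral_mult_right_zero ..
    also have "... \<le> (\<integral>x. x^2 / (x^2 + (1 / s)^2) \<partial>centered (\<nu> n j))"
    proof (intro integral_mono integrable_mult_right sq_ratio_integrable tail_kernel_integrable C j y)
      fix x :: real
      have s2: "0 < s^2" "s^2 \<le> 1" using s1 by (auto simp: power_le_one)
      have p: "1 + x^2 > 0" "x^2 + (1 / s)^2 > 0" using y by (auto intro: add_pos_nonneg add_nonneg_pos)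
      have "s^2 * (x^2 + (1 / s)^2) \<le> 1 + x^2"
        using s1 s2 mult_right_mono[OF s2(2), of "x^2"] by (simp add: distrib_left power_divide)
      then have "x^2 * (s^2 * (x^2 + (1 / s)^2)) \<le> x^2 * (1 + x^2)" by (intro mult_left_mono) auto
      then show "s^2 * (x^2 / (1 + x^2)) \<le> x^2 / (x^2 + (1 / s)^2)"
        unfolding times_divide_eq_right using p by (simp add: frac_le_eq divide_le_eq pos_le_divide_eq mult_ac)
    qed
    finally show "s^2 * levy_mass (\<nu> n j) \<le> (\<integral>x. x^2 / (x^2 + (1 / s)^2) \<partial>centered (\<nu> n j))" .
  qed
  have kb: "\<bar>x\<^sup>2 / (x^2 + (1 / s)^2)\<bar> \<le> 1" for x
    using tail_kernel_bounds[OF y, of x] by (intro abs_leI) linarith+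
  have km: "(\<lambda>x. x^2 / (x^2 + (1 / s)^2)) \<in> borel_measurable borel" by measurable
  have "(\<integral>x. x^2 / (x^2 + (1 / s)^2) \<partial>row_measure n) = (\<Sum>j=1..k n. \<integral>x. x^2 / (x^2 + (1 / s)^2) \<partial>levy_part (\<nu> n j))"
    by (rule integral_sigma_row_real[OF m km kb])
  also have "... \<le> (\<Sum>j=1..k n. \<integral>x. x^2 / (x^2 + (1 / s)^2) \<partial>centered (\<nu> n j))"
  proof (rule sum_mono)
    fix j assume j: "j \<in> {1..k n}"
    have mj: "real_distribution (\<nu> n j)" using j by (intro m) auto
    have i: "integrable (centered (\<nu> n j)) (\<lambda>x. (x^2 / (1 + x^2)) *\<^sub>R (x^2 / (x^2 + (1 / s)^2)))"
    proof (rule integrable_bounded_borel[OF C[OF j], where B=1])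
      show "norm ((x^2 / (1 + x^2)) *\<^sub>R (x^2 / (x^2 + (1 / s)^2))) \<le> 1" for x
        using mult_mono[OF sq_ratio_bounds(2)[of x] tail_kernel_bounds(2)[OF y, of x]] sq_ratio_bounds(1)[of x] tail_kernel_bounds(1)[OF y, of x]
        by (simp only: norm_scaleR real_norm_def abs_of_nonneg mult_1_left) simp
    qed measurable
    show "(\<integral>x. x^2 / (x^2 + (1 / s)^2) \<partial>levy_part (\<nu> n j)) \<le> (\<integral>x. x^2 / (x^2 + (1 / s)^2) \<partial>centered (\<nu> n j))"
      unfolding integral_levy_part[OF mj km]
    proof (intro integral_mono[OF i] tail_kernel_integrable C j y)
      show "(x^2 / (1 + x^2)) *\<^sub>R (x^2 / (x^2 + (1 / s)^2)) \<le> x^2 / (x^2 + (1 / s)^2)" for x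
        using mult_right_mono[OF sq_ratio_bounds(2)[of x] tail_kernel_bounds(1)[OF y, of x]] by simp
    qed
  qed
  finally show "(\<integral>x. x^2 / (x^2 + (1 / s)^2) \<partial>row_measure n) \<le> (\<Sum>j=1..k n. \<integral>x. x^2 / (x^2 + (1 / s)^2) \<partial>centered (\<nu> n j))" .
qed

lemma char_uniformly_near_1:
  assumes X: "\<And>n. real_distribution (X n)" and M: "real_distribution M" and W: "weakly_converges X M"
    and eta: "\<eta> > 0"
  shows "\<exists>s>0. s \<le> 1 \<and> eventually (\<lambda>n. \<forall>t. \<bar>t\<bar> \<le> s \<longrightarrow> cmod (1 - char (X n) t) \<le> \<eta>) sequentially"
proof -
  have "\<eta> / 2 > 0" using eta by simp
  then obtain \<beta>0 where b0: "\<beta>0 > 0" "kappa M \<beta>0 < \<eta> / 2" using kappa_small[OF real_distributionD(2)[OF M]] by blast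
  define \<beta> where "\<beta> = max 1 \<beta>0"
  have b: "\<beta> \<ge> 1" "\<beta> \<ge> \<beta>0" "\<beta> > 0" by (auto simp: \<beta>_def)
  have "kappa M \<beta> < \<eta> / 2" using kappa_mono[OF real_distributionD(2)[OF M] b0(1) b(2)] b0(2) by linarith
  then have "eventually (\<lambda>n. kappa (X n) \<beta> < \<eta> / 2) sequentially"
    by (rule order_tendstoD(2)[OF weakly_converges_kappa[OF W b(3)]])
  then have "eventually (\<lambda>n. \<forall>t. \<bar>t\<bar> \<le> 1 / \<beta> \<longrightarrow> cmod (1 - char (X n) t) \<le> \<eta>) sequentially"
  proof (rule eventually_mono, intro allI impI)
    fix n t assume k: "kappa (X n) \<beta> < \<eta> / 2" and t: "\<bar>t\<bar> \<le> 1 / \<beta>"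
    show "cmod (1 - char (X n) t) \<le> \<eta>" using one_minus_char_bound[OF X b(3) t, of n] k by linarith
  qed
  then show ?thesis using b by (intro exI[of _ "1 / \<beta>"] conjI) auto
qed

text \<open>In \<open>row_tail\<close> the error \<open>1152 e\<^sub>n\<close> times the mass is absorbed by the left-hand side
once \<open>e\<^sub>n\<close> is small compared with \<open>s\<^sup>2\<close>; this bounds the mass, and a second pass with small \<open>\<eta>\<close> gives
tightness.\<close>
lemma classical_row_tight:
  assumes M: "real_distribution M" and W: "weakly_converges classical_row M"
  shows "\<exists>B. \<forall>n. row_mass n \<le> B" "tight_seq row_measure"
proof -
  let ?m = "\<lambda>n. row_mass n"
  note near = char_uniformly_near_1[OF classical_row_distribution M W]
  have q: "(1::real) / 4 > 0" by simp
  obtain s where s: "s > 0" "s \<le> 1"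
    "eventually (\<lambda>n. \<forall>t. \<bar>t\<bar> \<le> s \<longrightarrow> cmod (1 - char (classical_row n) t) \<le> 1 / 4) sequentially"
    using near[OF q] by blast
  have ev1: "eventually (\<lambda>n. e n < s^2 / 2304) sequentially" using s(1) by (intro e_small) simp
  have ev2: "eventually (\<lambda>n. e n < 1 / 2) sequentially" by (intro e_small) simp
  have "eventually (\<lambda>n. ?m n \<le> 8 / s^2) sequentially"
    using s(3) ev1 ev2
  proof eventually_elim
    case (elim n)
    have "e n \<le> 1 / 2" using elim(3) by simp
    then have "s^2 * ?m n \<le> 16 * (1 / 4) + 1152 * (e n * ?m n)"
      using row_tail_sigma(1)[OF s(1,2), of n] row_tail[OF _ s(1,2), of n "1 / 4"] elim(1) by fastforce
    also have "e n * ?m n \<le> s^2 / 2304 * ?m n" using elim(2) by (intro mult_right_mono) auto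
    finally have "s^2 * ?m n \<le> 8" by simp
    then show ?case using s(1) by (simp add: pos_le_divide_eq mult.commute)
  qed
  from eventually_le_imp_bounded[OF this] obtain B where B: "\<And>n. ?m n \<le> B" by blast
  then show "\<exists>B. \<forall>n. ?m n \<le> B" by blast
  have B0: "0 \<le> B" using B[of 0] measure_nonneg order_trans by blast
  show "tight_seq row_measure"
  proof (rule tight_seqI_kernel[OF row_finite])
    fix \<epsilon> :: real assume eps: "\<epsilon> > 0"
    define \<eta> where "\<eta> = min (1 / 4) (\<epsilon> / 32)"
    have eta: "\<eta> > 0" "\<eta> \<le> 1 / 4" "16 * \<eta> \<le> \<epsilon> / 2" using eps by (auto simp: \<eta>_def)
    obtain s where s: "s > 0" "s \<le> 1"
      "eventually (\<lambda>n. \<forall>t. \<bar>t\<bar> \<le> s \<longrightarrow> cmod (1 - char (classical_row n) t) \<le> \<eta>) sequentially"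
      using near[OF eta(1)] by blast
    have ev1: "eventually (\<lambda>n. e n < \<epsilon> / (2304 * (B + 1))) sequentially" using eps B0 by (intro e_small) simp
    have "eventually (\<lambda>n. (\<integral>t. t^2 / (t^2 + (1 / s)^2) \<partial>row_measure n) \<le> \<epsilon>) sequentially"
      using s(3) ev1 ev2
    proof eventually_elim
      case (elim n)
      have "e n \<le> 1 / 2" using elim(3) by simp
      then have "(\<integral>t. t^2 / (t^2 + (1 / s)^2) \<partial>row_measure n) \<le> 16 * \<eta> + 1152 * (e n * ?m n)"
        using row_tail_sigma(2)[OF s(1,2), of n] row_tail[OF _ s(1,2) eta(2), of n] elim(1) by fastforce
      moreover have "e n * ?m n \<le> \<epsilon> / (2304 * (B + 1)) * (B + 1)"
        using elim(2) B[of n] B0 eps by (intro mult_mono) auto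
      moreover have "\<epsilon> / (2304 * (B + 1)) * (B + 1) = \<epsilon> / 2304"
        unfolding times_divide_eq_left by (rule mult_divide_mult_cancel_right) (use B0 in linarith)
      ultimately show ?case using eta(3) by linarith
    qed
    then show "\<exists>y>0. eventually (\<lambda>n. (\<integral>t. t^2 / (t^2 + y^2) \<partial>row_measure n) \<le> \<epsilon>) sequentially"
      using s(1) by (intro exI[of _ "1 / s"] conjI) auto
  qed
qed

lemma classical_limit_of_char:
  assumes M: "real_distribution M" and char: "\<And>t. char M t = exp (lk_exponent \<gamma> \<sigma> t)"
  shows "weakly_converges classical_row M
   \<longleftrightarrow> weakly_converges row_measure \<sigma> \<and> row_drift \<longlonglongrightarrow> \<gamma>"
proof
  assume W: "weakly_converges classical_row M"
  obtain B where B: "\<And>n. row_mass n \<le> B" using classical_row_tight(1)[OF M W] by blast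
  have "(\<lambda>n. exp (lk_exponent (row_drift n) (row_measure n) t)) \<longlonglongrightarrow> exp (lk_exponent \<gamma> \<sigma> t)" for t
  proof -
    have "(\<lambda>n. char (classical_row n) t) \<longlonglongrightarrow> char M t"
      by (rule weakly_converges_char[OF W real_distributionD(2)[OF classical_row_distribution] real_distributionD(2)[OF M]])
    from tendsto_diff[OF this classical_row_comparison[OF B, of t]] show ?thesis by (simp add: char)
  qed
  from lk_converges_imp[OF row_finite s B classical_row_tight(2)[OF M W] this]
  show "weakly_converges row_measure \<sigma> \<and> row_drift \<longlonglongrightarrow> \<gamma>" by blast
next
  assume *: "weakly_converges row_measure \<sigma> \<and> row_drift \<longlonglongrightarrow> \<gamma>"
  have "(\<lambda>n. char (classical_row n) t) \<longlonglongrightarrow> char M t" for t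
    unfolding char by (rule classical_row_char_limit[OF conjunct1[OF *] conjunct2[OF *]])
  then have "weak_conv_m classical_row M" by (rule levy_continuity[OF classical_row_distribution M])
  then show "weakly_converges classical_row M"
    unfolding weakly_converges_iff_weak_conv_m[OF classical_row_distribution M] .
qed

end

lemma pick_class_divide:
  assumes E: "pick_class E" and r: "r \<ge> (1::real)"
  shows "pick_class (\<lambda>z. E z / of_real r)"
  unfolding pick_class_def
proof (intro conjI ballI allI impI)
  have div: "cmod (w / of_real r) \<le> cmod w" for w
    using r mult_left_mono[OF r norm_ge_zero[of w]] by (simp add: norm_divide pos_divide_le_eq)
  show "(\<lambda>z. E z / of_real r) holomorphic_on uhp" using E r unfolding pick_class_def by (intro holomorphic_intros) auto
  show "Im (E z / of_real r) \<le> 0" if "z \<in> uhp" for z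
    using E that r unfolding pick_class_def by (simp add: divide_nonpos_pos)
  fix \<epsilon> :: real assume "\<epsilon> > 0"
  then obtain \<beta> where b: "\<beta> > 0" "cone_small E \<beta> \<epsilon>" using E unfolding pick_class_def by blast
  have "cone_small (\<lambda>z. E z / of_real r) \<beta> \<epsilon>"
    using b(2) unfolding cone_small_def diff_divide_distrib[symmetric] by (meson div order_trans)
  then show "\<exists>\<beta>>0. cone_small (\<lambda>z. E z / of_real r) \<beta> \<epsilon>" using b(1) by blast
qed

text \<open>Take \<open>n + 1\<close> copies of the Boolean root with \<open>E = N/(n + 1)\<close>. Their Boolean convolution is the Boolean
law for every \<open>n\<close>, so by the Boolean limit theorem the Levy data of the rows converge to
\<open>(\<gamma>, \<sigma>)\<close>, and the classical rows have convergent characteristic functions.\<close>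
lemma classical_inf_div_exists:
  assumes s: "finite_borel \<sigma>"
  shows "\<exists>M. real_distribution M \<and> char M = (\<lambda>t. exp (lk_exponent \<gamma> \<sigma> t))"
proof -
  let ?E = "nevanlinna \<gamma> \<sigma>"
  have "\<exists>P. real_distribution P \<and> (\<forall>z. Im z > 0 \<longrightarrow> E_transform P z = ?E z / of_real (real (Suc n)))" for n
    by (rule ex1_implies_ex[OF pick_class_E_transform_ex1[OF pick_class_divide[OF nevanlinna_pick_class[OF s]]]]) simp
  then obtain P where P: "\<And>n. real_distribution (P n)"
    "\<And>n z. Im z > 0 ==> E_transform (P n) z = ?E z / of_real (real (Suc n))" by metis
  have cz: "Im z > 0" if "z \<in> tcone 1 1" for z using that by (simp add: truncated_cone_def)
  have PE: "(\<lambda>n. E_transform (P n) z) \<longlonglongrightarrow> E_transform (return borel 0) z" if "z \<in> tcone 1 1" for z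
  proof -
    have "(\<lambda>n. ?E z * of_real (inverse (real (Suc n)))) \<longlonglongrightarrow> ?E z * of_real 0"
      by (intro tendsto_intros LIMSEQ_inverse_real_of_nat)
    then show ?thesis unfolding P(2)[OF cz[OF that]] E_transform_return
      by (simp add: divide_inverse)
  qed
  have "weakly_converges P (return borel 0)"
    by (rule weakly_converges_of_E_cone[OF P(1) real_distribution_return _ _ PE]) simp_all
  then have "(\<lambda>n. kappa (P n) 1) \<longlonglongrightarrow> kappa (return borel 0) 1" by (rule weakly_converges_kappa) simp
  moreover have "kappa (return borel 0) 1 = 0" unfolding kappa_def by (subst integral_return) auto
  ultimately have e: "(\<lambda>n. kappa (P n) 1) \<longlonglongrightarrow> 0" by simp
  interpret infinitesimal_rows Suc "\<lambda>n j. P n" \<gamma> \<sigma> "\<lambda>_. 0" "\<lambda>n. kappa (P n) 1"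
    by (rule infinitesimal_rows.intro[OF P(1) s e order_refl])
  have "weakly_converges (\<lambda>n. iterated_convolution boolean_convolution (return borel 0) (\<lambda>j. P n) (Suc n)) (boolean_inf_div \<gamma> \<sigma>)"
  proof (rule weakly_converges_of_E_cone[where \<alpha>=1 and \<beta>=1])
    note I = iterated_boolean_convolution[where \<nu>="\<lambda>j. P n" and m="Suc n" and c=0 for n, OF P(1)]
    show "real_distribution (iterated_convolution boolean_convolution (return borel 0) (\<lambda>j. P n) (Suc n))" for n
      using I by blast
    fix z assume z: "z \<in> tcone 1 1"
    then have zu: "z \<in> uhp" by (simp add: uhp_iff cz)
    have "E_transform (iterated_convolution boolean_convolution (return borel 0) (\<lambda>j. P n) (Suc n)) z = ?E z" for n
    proof -
      have "E_transform (iterated_convolution boolean_convolution (return borel 0) (\<lambda>j. P n) (Suc n)) z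
        = of_real 0 + (\<Sum>j=1..Suc n. E_transform (P n) z)"
        by (rule conjunct2[OF I, rule_format, OF zu])
      also have "... = of_nat (Suc n) * (?E z / of_nat (Suc n))" unfolding P(2)[OF cz[OF z]] by simp
      also have "... = ?E z" using of_nat_neq_0[of n, where 'a=complex] by (simp del: of_nat_Suc)
      finally show ?thesis .
    qed
    then show "(\<lambda>n. E_transform (iterated_convolution boolean_convolution (return borel 0) (\<lambda>j. P n) (Suc n)) z)
        \<longlonglongrightarrow> E_transform (boolean_inf_div \<gamma> \<sigma>) z"
      unfolding boolean_inf_div(2)[OF s zu] by (simp only: tendsto_const)
  qed (auto intro: boolean_inf_div(1) s)
  note W = this[unfolded boolean_limit_theorem]
  have "isCont (\<lambda>t. exp (lk_exponent \<gamma> \<sigma> t)) 0"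
    using continuous_on_exp[OF lk_exponent_continuous[OF s]] by (simp add: continuous_on_eq_continuous_at)
  from levy_limit_exists[OF classical_row_distribution classical_row_char_limit[OF conjunct1[OF W] conjunct2[OF W]] this]
  show ?thesis .
qed

lemma classical_inf_div:
  assumes s: "finite_borel \<sigma>"
  shows "real_distribution (classical_inf_div \<gamma> \<sigma>)" "char (classical_inf_div \<gamma> \<sigma>) t = exp (lk_exponent \<gamma> \<sigma> t)"
proof -
  have ex: "\<exists>!M. real_distribution M \<and> (\<forall>t. char M t = exp (lk_exponent \<gamma> \<sigma> t))"
  proof (rule ex_ex1I)
    show "\<exists>M. real_distribution M \<and> (\<forall>t. char M t = exp (lk_exponent \<gamma> \<sigma> t))"
      using classical_inf_div_exists[OF s, of \<gamma>] by (metis (no_types))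
    show "M = M'" if "real_distribution M \<and> (\<forall>t. char M t = exp (lk_exponent \<gamma> \<sigma> t))"
      "real_distribution M' \<and> (\<forall>t. char M' t = exp (lk_exponent \<gamma> \<sigma> t))" for M M'
      using that by (intro Levy_uniqueness ext) auto
  qed
  show "real_distribution (classical_inf_div \<gamma> \<sigma>)" "char (classical_inf_div \<gamma> \<sigma>) t = exp (lk_exponent \<gamma> \<sigma> t)"
    using theI'[OF ex] unfolding classical_inf_div_def lk_exponent_def by blast+
qed

lemma (in infinitesimal_rows) classical_limit_theorem:
  "weakly_converges classical_row (classical_inf_div \<gamma> \<sigma>)
   \<longleftrightarrow> weakly_converges row_measure \<sigma> \<and> row_drift \<longlonglongrightarrow> \<gamma>"
  by (rule classical_limit_of_char[OF classical_inf_div(1)[OF s] classical_inf_div(2)[OF s]])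

theorem theorem5p3:
  fixes k :: "nat \<Rightarrow> nat"
    and \<nu> :: "nat \<Rightarrow> nat \<Rightarrow> real measure"
    and \<gamma> :: real
    and \<sigma> :: "real measure"
    and c :: "nat \<Rightarrow> real"
  assumes "\<And>n. 1 \<le> k n"
    and "\<And>n j. 1 \<le> j \<Longrightarrow> j \<le> k n \<Longrightarrow> real_distribution (\<nu> n j)"
    and "infinitesimal_array k \<nu>"
    and "finite_borel_measure \<sigma>"
  shows "((weakly_converges
            (\<lambda>n. iterated_convolution convolution (return borel (c n)) (\<nu> n) (k n))
            (classical_inf_div \<gamma> \<sigma>))
         \<longleftrightarrow>
         (weakly_converges
            (\<lambda>n. iterated_convolution free_convolution (return borel (c n)) (\<nu> n) (k n))
            (free_inf_div \<gamma> \<sigma>))) \<and>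
        ((weakly_converges
            (\<lambda>n. iterated_convolution free_convolution (return borel (c n)) (\<nu> n) (k n))
            (free_inf_div \<gamma> \<sigma>))
         \<longleftrightarrow>
         (weakly_converges
            (\<lambda>n. iterated_convolution boolean_convolution (return borel (c n)) (\<nu> n) (k n))
            (boolean_inf_div \<gamma> \<sigma>))) \<and>
        ((weakly_converges
            (\<lambda>n. iterated_convolution boolean_convolution (return borel (c n)) (\<nu> n) (k n))
            (boolean_inf_div \<gamma> \<sigma>))
         \<longleftrightarrow>
         (weakly_converges (\<lambda>n. sigma_row (\<nu> n) (k n)) \<sigma> \<and>
          (\<lambda>n. gamma_row (c n) (\<nu> n) (k n)) \<longlonglongrightarrow> \<gamma>))"
proof -
  obtain e where e: "e \<longlonglongrightarrow> 0" "\<And>n j. 1 \<le> j \<Longrightarrow> j \<le> k n \<Longrightarrow> kappa (\<nu> n j) 1 \<le> e n"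
    using infinitesimal_kappa[OF assms(3,1,2)] by blast
  interpret infinitesimal_rows k \<nu> \<gamma> \<sigma> c e
    by (rule infinitesimal_rows.intro[OF assms(2,4) e])
  show ?thesis
    using classical_limit_theorem free_limit_theorem boolean_limit_theorem by blast
qed

end
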